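(* Let $X$ solve the SDE of the context, where $\mathbb S=\mathbb R^{d\times d}_{>0}$ and the diffusion coefficient $\sigma$ is given by either Form 1 or Form 2 of the context, and let $\hat\varsigma^\varepsilon$ be the corresponding estimator defined there, based on the observations $X(\tilde t_i)$, $\tilde t_i=i\tilde\Delta(\varepsilon)$, $0\le i\le m$, $\tilde t_m=\varepsilon^{-1}$. Assume: (A) There is a Lyapunov function $V:\mathbb R^d\to[1,\infty)$ such that for every $\theta=(\mu,\varsigma)\in\Theta$: $-\limsup_{\|x\|\to\infty}\mathcal L_\theta V(x)>0$; $\ \nabla^TV(x)a(\varsigma,x)\nabla V(x)/(V(x)|\mathcal L_\theta V(x)|)\to0$ as $\|x\|\to\infty$; and, for some exponent $q_{V,0}\ge 0$ and constant $J_{V,0}>0$, $\max\{\|\nabla V(x)\|,\|D^2V(x)\|\}\le J_{V,0}V(x)^{q_{V,0}}$ for all $x$. Moreover, for some locally bounded functions $J_{b,0}:\mathbb M\to[0,\infty)$, $J_{\sigma,0},J_{\sigma,1}:\mathbb S\to[0,\infty)$, exponents $q_{b,0},q_{\sigma,0},q_{\sigma,1}\ge0$ and $0<\alpha_\sigma\le1$ (not depending on the parameters), for all $\mu\in\mathbb M,\varsigma\in\mathbb S,x,x'\in\mathbb R^d$: $\|b(\mu,x)\|\le J_{b,0}(\mu)V(x)^{q_{b,0}}$; $\|\sigma(\varsigma,x)\|\le J_{\sigma,0}(\varsigma)V(x)^{q_{\sigma,0}}$; $\|\sigma(\varsigma,x)-\sigma(\varsigma,x')\|\le J_{\sigma,1}(\varsigma)(V(x)^{q_{\sigma,1}}+V(x')^{q_{\sigma,1}})\|x-x'\|^{\alpha_\sigma}$.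 (B) $\tilde\Delta(\varepsilon)\to0$ as $\varepsilon\to0$. Then for each $\theta_0=(\mu_0,\varsigma_0)\in\Theta$, $\hat\varsigma^\varepsilon\to\varsigma_0$ in $\mathbb P_{\theta_0}$-probability as $\varepsilon\to0$.
   Context: Setup. $\mathbb R^{d\times d}_{>0}$ is the set of symmetric positive definite matrices. $\Theta=\mathbb M\times\mathbb S$ with $\mathbb M\subset\mathbb R^{n_0}$, $\mathbb S=\mathbb R^{d\times d}_{>0}$; $b(\mu,\cdot):\mathbb R^d\to\mathbb R^d$ and $\sigma(\varsigma,\cdot):\mathbb R^d\to\mathbb R^{d\times d}$ are measurable; $a(\varsigma,x)=\sigma(\varsigma,x)\sigma(\varsigma,x)^T$ is positive definite for all $\varsigma\in\mathbb S$, $x$. On $(\Omega,\mathcal F)$ there are probability measures $\mathbb P_\theta$, $\theta=(\mu,\varsigma)\in\Theta$, such that under $\mathbb P_\theta$ $$X(t)=x_0+\int_0^tb(\mu,X(s))ds+\int_0^t\sigma(\varsigma,X(s))dW(s),\quad x_0\in\mathbb R^d,$$ with $W$ a $d$-dimensional Brownian motion. For each $\theta$, $X$ is ergodic with unique stationary distribution $\pi^{st}_\theta$. The generator is $\mathcal L_\theta f(x)=\langle b(\mu,x),\nabla f(x)\rangle+\frac12\mathrm{tr}(a(\varsigma,x)D^2f(x))$. A Lyapunov function is a $C^2$ function $V:\mathbb R^d\to[1,\infty)$ with compact sublevel sets. A function is locally bounded if it is bounded on compact subsets of its domain. Forms of $\sigma$. Form 1: $\sigma(\varsigma,x)=(a_0(x)\varsigma)^{1/2}$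 (the unique positive definite square root; it is understood that $a_0(x)\varsigma$ is positive definite), so $a(\varsigma,x)=a_0(x)\varsigma$, where $a_0:\mathbb R^d\to\mathbb R^{d\times d}_{>0}$ is known. Form 2: $\sigma(\varsigma,x)=\sigma_0(x)\kappa$ where $\kappa\in\mathbb R^{d\times d}$ is a matrix with $\kappa\kappa^T=\varsigma$ and $\sigma_0:\mathbb R^d\to\mathbb R^{d\times d}_{>0}$ is known, so $a(\varsigma,x)=\sigma_0(x)\varsigma\sigma_0(x)^T$. Estimators. $m=(\varepsilon\tilde\Delta(\varepsilon))^{-1}$ is assumed to be an integer. Put $Q^\varepsilon=\sum_{i=0}^{m-1}(X(\tilde t_{i+1})-X(\tilde t_i))(X(\tilde t_{i+1})-X(\tilde t_i))^T$, and $\tilde\varrho_\varepsilon(s)=\tilde t_i$ for $\tilde t_i\le s<\tilde t_{i+1}$. Form 1: $\hat\varsigma^\varepsilon=\left(\int_0^{\varepsilon^{-1}}a_0(X(\tilde\varrho_\varepsilon(s)))ds\right)^{-1}Q^\varepsilon$. Form 2: $\mathrm{vec}(\hat\varsigma^\varepsilon)=\left(\int_0^{\varepsilon^{-1}}\sigma_0(X(\tilde\varrho_\varepsilon(s)))\otimes\sigma_0(X(\tilde\varrho_\varepsilon(s)))ds\right)^{-1}\mathrm{vec}(Q^\varepsilon)$, with $\mathrm{vec}$ the column-stacking vectorization $\mathbb R^{d\times d}\to\mathbb R^{d^2}$ and $\otimes$ the Kronecker product. *)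

theory Defs
  imports "HOL-Probability.Probability"
begin

section \<open>Matrices\<close>

definition spd :: "(real ^ 'd ^ 'd) set" where
  "spd = {A. transpose A = A \<and> (\<forall>x. x \<noteq> 0 \<longrightarrow> x \<bullet> (A *v x) > 0)}"

definition spd_sqrt :: "real ^ 'd ^ 'd \<Rightarrow> real ^ 'd ^ 'd" where
  "spd_sqrt A = (THE B. B \<in> spd \<and> B ** B = A)"

definition outer_square :: "real ^ 'd \<Rightarrow> real ^ 'd ^ 'd" where
  "outer_square v = (\<chi> i j. v $ i * v $ j)"

text \<open>Column-stacking vectorization and Kronecker product.  The index set of \<open>\<real>\<close>-vectors of
  length \<open>d\<^sup>2\<close> is \<open>'d \<times> 'd\<close>; the first component of an index selects the block (for a vectorized
  matrix: the column), the second one the position inside the block (the row).\<close>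

definition vec_mat :: "real ^ 'd ^ 'd \<Rightarrow> real ^ ('d \<times> 'd)" where
  "vec_mat A = (\<chi> p. A $ snd p $ fst p)"

definition unvec_mat :: "real ^ ('d \<times> 'd) \<Rightarrow> real ^ 'd ^ 'd" where
  "unvec_mat v = (\<chi> i j. v $ (j, i))"

definition kronecker :: "real ^ 'd ^ 'd \<Rightarrow> real ^ 'd ^ 'd \<Rightarrow> real ^ ('d \<times> 'd) ^ ('d \<times> 'd)" where
  "kronecker A B = (\<chi> p q. A $ fst p $ fst q * B $ snd p $ snd q)"

lemma vec_mat_unvec_mat [simp]: "vec_mat (unvec_mat v) = v"
  by (simp add: vec_mat_def unvec_mat_def vec_eq_iff)

lemma unvec_mat_vec_mat [simp]: "unvec_mat (vec_mat A) = A"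
  by (simp add: vec_mat_def unvec_mat_def vec_eq_iff)

lemma kronecker_mult_vec_mat:
  "kronecker A B *v vec_mat M = vec_mat (B ** M ** transpose A)"
proof -
  have "(\<Sum>q\<in>UNIV. A $ a $ fst q * B $ b $ snd q * M $ snd q $ fst q)
      = (\<Sum>j\<in>UNIV. (\<Sum>l\<in>UNIV. B $ b $ l * M $ l $ j) * A $ a $ j)" for a b
    by (simp add: sum.cartesian_product UNIV_Times_UNIV[symmetric] split_def sum_distrib_left
        sum_distrib_right mult_ac del: UNIV_Times_UNIV)
  then show ?thesis
    by (simp add: kronecker_def vec_mat_def vec_eq_iff matrix_vector_mult_def
        matrix_matrix_mult_def transpose_def)
qed


section \<open>Twice differentiable functions, generator, Lyapunov functions\<close>

definition grad :: "(real ^ 'd \<Rightarrow> real) \<Rightarrow> real ^ 'd \<Rightarrow> real ^ 'd" where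
  "grad f x = (\<chi> i. frechet_derivative f (at x) (axis i 1))"

definition hessian :: "(real ^ 'd \<Rightarrow> real) \<Rightarrow> real ^ 'd \<Rightarrow> real ^ 'd ^ 'd" where
  "hessian f x = jacobian (grad f) (at x)"

definition C2 :: "(real ^ 'd \<Rightarrow> real) \<Rightarrow> bool" where
  "C2 f \<longleftrightarrow> (\<forall>x. f differentiable (at x)) \<and> (\<forall>x. grad f differentiable (at x)) \<and>
     continuous_on UNIV (hessian f)"

definition diffusion_matrix ::
  "('s \<Rightarrow> real ^ 'd \<Rightarrow> real ^ 'd ^ 'd) \<Rightarrow> 's \<Rightarrow> real ^ 'd \<Rightarrow> real ^ 'd ^ 'd" where
  "diffusion_matrix \<sigma> \<zeta> x = \<sigma> \<zeta> x ** transpose (\<sigma> \<zeta> x)"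

definition generator ::
  "('m \<Rightarrow> real ^ 'd \<Rightarrow> real ^ 'd) \<Rightarrow> ('s \<Rightarrow> real ^ 'd \<Rightarrow> real ^ 'd ^ 'd) \<Rightarrow>
   'm \<Rightarrow> 's \<Rightarrow> (real ^ 'd \<Rightarrow> real) \<Rightarrow> real ^ 'd \<Rightarrow> real" where
  "generator b \<sigma> \<mu> \<zeta> f x =
     b \<mu> x \<bullet> grad f x + 1 / 2 * trace (diffusion_matrix \<sigma> \<zeta> x ** hessian f x)"

definition lyapunov_function :: "(real ^ 'd \<Rightarrow> real) \<Rightarrow> bool" where
  "lyapunov_function V \<longleftrightarrow> C2 V \<and> (\<forall>x. V x \<ge> 1) \<and> (\<forall>c. compact {x. V x \<le> c})"

definition locally_bounded_on ::
  "'a::topological_space set \<Rightarrow> ('a \<Rightarrow> 'b::metric_space) \<Rightarrow> bool" where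
  "locally_bounded_on D J \<longleftrightarrow> (\<forall>K. K \<subseteq> D \<longrightarrow> compact K \<longrightarrow> bounded (J ` K))"


section \<open>Stochastic differential equations\<close>

text \<open>Measurability is part of the definition, so that the probabilities below are not those of
  non-measurable sets (which would be \<open>0\<close> by convention).\<close>

definition tendsto_in_prob ::
  "'w measure \<Rightarrow> ('i \<Rightarrow> 'w \<Rightarrow> 'b::metric_space) \<Rightarrow> ('w \<Rightarrow> 'b) \<Rightarrow> 'i filter \<Rightarrow> bool" where
  "tendsto_in_prob M Z z F \<longleftrightarrow>
     (\<forall>\<^sub>F i in F. Z i \<in> borel_measurable M) \<and> z \<in> borel_measurable M \<and>
     (\<forall>\<eta>>0. ((\<lambda>i. measure M {\<omega> \<in> space M. dist (Z i \<omega>) (z \<omega>) > \<eta>}) \<longlongrightarrow> 0) F)"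

text \<open>Processes and filtrations are indexed by \<open>real\<close>, but only times \<open>t \<ge> 0\<close> matter.\<close>

definition filtration_of :: "'w measure \<Rightarrow> (real \<Rightarrow> 'w measure) \<Rightarrow> bool" where
  "filtration_of M G \<longleftrightarrow> filtration (space M) G \<and> (\<forall>t. sets (G t) \<subseteq> sets M)"

definition continuous_adapted ::
  "'w measure \<Rightarrow> (real \<Rightarrow> 'w measure) \<Rightarrow> (real \<Rightarrow> 'w \<Rightarrow> 'b::topological_space) \<Rightarrow> bool" where
  "continuous_adapted M G Y \<longleftrightarrow> (\<forall>t\<ge>0. Y t \<in> borel_measurable (G t)) \<and>
     (\<forall>\<omega>\<in>space M. continuous_on {0..} (\<lambda>t. Y t \<omega>))"

definition brownian_motion ::
  "'w measure \<Rightarrow> (real \<Rightarrow> 'w measure) \<Rightarrow> (real \<Rightarrow> 'w \<Rightarrow> real ^ 'd) \<Rightarrow> bool" where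
  "brownian_motion M G W \<longleftrightarrow>
     continuous_adapted M G W \<and> (AE \<omega> in M. W 0 \<omega> = 0) \<and>
     (\<forall>s t. 0 \<le> s \<and> s < t \<longrightarrow>
        prob_space.indep_set M (sets (G s))
          (sets (vimage_algebra (space M) (\<lambda>\<omega>. W t \<omega> - W s \<omega>) borel)) \<and>
        distributed M lborel (\<lambda>\<omega>. W t \<omega> - W s \<omega>)
          (\<lambda>x. ennreal (\<Prod>i\<in>UNIV. normal_density 0 (sqrt (t - s)) (x $ i))))"

text \<open>A simple integrand is \<open>\<Sum>i<n. \<xi> i * 1_(\<tau> i, \<tau> (i+1)]\<close> with bounded coefficients \<open>\<xi> i\<close> known at
  time \<open>\<tau> i\<close>.\<close>

definition simple_integrand ::
  "'w measure \<Rightarrow> (real \<Rightarrow> 'w measure) \<Rightarrow> nat \<Rightarrow> (nat \<Rightarrow> real) \<Rightarrow> (nat \<Rightarrow> 'w \<Rightarrow> real ^ 'd ^ 'd) \<Rightarrow> bool"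
  where
  "simple_integrand M G n \<tau> \<xi> \<longleftrightarrow> 0 \<le> \<tau> 0 \<and> (\<forall>i<n. \<tau> i \<le> \<tau> (Suc i)) \<and>
     (\<forall>i<n. \<xi> i \<in> borel_measurable (G (\<tau> i)) \<and> bounded (\<xi> i ` space M))"

definition simple_value ::
  "nat \<Rightarrow> (nat \<Rightarrow> real) \<Rightarrow> (nat \<Rightarrow> 'w \<Rightarrow> real ^ 'd ^ 'd) \<Rightarrow> real \<Rightarrow> 'w \<Rightarrow> real ^ 'd ^ 'd" where
  "simple_value n \<tau> \<xi> s \<omega> = (\<Sum>i<n. indicator {\<tau> i<..\<tau> (Suc i)} s *\<^sub>R \<xi> i \<omega>)"

definition simple_ito ::
  "nat \<Rightarrow> (nat \<Rightarrow> real) \<Rightarrow> (nat \<Rightarrow> 'w \<Rightarrow> real ^ 'd ^ 'd) \<Rightarrow> (real \<Rightarrow> 'w \<Rightarrow> real ^ 'd) \<Rightarrow>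
   real \<Rightarrow> 'w \<Rightarrow> real ^ 'd" where
  "simple_ito n \<tau> \<xi> W t \<omega> =
     (\<Sum>i<n. \<xi> i \<omega> *v (W (min t (\<tau> (Suc i))) \<omega> - W (min t (\<tau> i)) \<omega>))"

definition progressive ::
  "(real \<Rightarrow> 'w measure) \<Rightarrow> (real \<Rightarrow> 'w \<Rightarrow> 'b::topological_space) \<Rightarrow> bool" where
  "progressive G H \<longleftrightarrow> (\<forall>t\<ge>0.
     (\<lambda>(s, \<omega>). H s \<omega>) \<in> borel_measurable (restrict_space borel {0..t} \<Otimes>\<^sub>M G t))"

text \<open>\<open>I\<close> is (a continuous version of) the Ito integral process of \<open>H\<close> against \<open>W\<close>: the limit in
  probability of the integrals of simple integrands that approximate \<open>H\<close> in
  \<open>L\<^sup>2([0,t])\<close> in probability, for every \<open>t\<close>.  Such an approximation exists iff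
  \<open>\<integral>\<^sub>0\<^sup>t \<parallel>H s\<parallel>\<^sup>2 ds\<close> is almost surely finite for every \<open>t\<close>, and the limit does not depend on its
  choice.\<close>

definition has_ito_integral ::
  "'w measure \<Rightarrow> (real \<Rightarrow> 'w measure) \<Rightarrow> (real \<Rightarrow> 'w \<Rightarrow> real ^ 'd) \<Rightarrow>
   (real \<Rightarrow> 'w \<Rightarrow> real ^ 'd ^ 'd) \<Rightarrow> (real \<Rightarrow> 'w \<Rightarrow> real ^ 'd) \<Rightarrow> bool" where
  "has_ito_integral M G W H I \<longleftrightarrow>
     progressive G H \<and> continuous_adapted M G I \<and>
     (\<exists>n \<tau> \<xi>. (\<forall>k::nat. simple_integrand M G (n k) (\<tau> k) (\<xi> k)) \<and>
       (\<forall>t\<ge>0.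
          (\<forall>\<eta>>0. (\<lambda>k. measure M {\<omega> \<in> space M.
             (\<integral>\<^sup>+ s\<in>{0..t}. ennreal ((norm (simple_value (n k) (\<tau> k) (\<xi> k) s \<omega> - H s \<omega>))\<^sup>2) \<partial>lborel)
               > ennreal \<eta>}) \<longlonglongrightarrow> 0) \<and>
          tendsto_in_prob M (\<lambda>k. simple_ito (n k) (\<tau> k) (\<xi> k) W t) (I t) sequentially))"

text \<open>Solution of \<open>dX = b(X) dt + \<sigma>(X) dW\<close> on the filtered probability space \<open>(M, G)\<close>; the
  initial value is left open.\<close>

definition sde_solution ::
  "'w measure \<Rightarrow> (real \<Rightarrow> 'w measure) \<Rightarrow> (real \<Rightarrow> 'w \<Rightarrow> real ^ 'd) \<Rightarrow>
   (real ^ 'd \<Rightarrow> real ^ 'd) \<Rightarrow> (real ^ 'd \<Rightarrow> real ^ 'd ^ 'd) \<Rightarrow> (real \<Rightarrow> 'w \<Rightarrow> real ^ 'd) \<Rightarrow> bool" where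
  "sde_solution M G W b \<sigma> X \<longleftrightarrow>
     prob_space M \<and> filtration_of M G \<and> brownian_motion M G W \<and> continuous_adapted M G X \<and>
     (\<exists>I. has_ito_integral M G W (\<lambda>s \<omega>. \<sigma> (X s \<omega>)) I \<and>
       (AE \<omega> in M. \<forall>t\<ge>0. set_integrable lborel {0..t} (\<lambda>s. b (X s \<omega>)) \<and>
          X t \<omega> = X 0 \<omega> + (LINT s:{0..t}|lborel. b (X s \<omega>)) + I t \<omega>))"

text \<open>\<open>\<nu>\<close> is stationary if some solution of the equation has law \<open>\<nu>\<close> at all times.  Choosing the
  sample space inside \<open>real \<Rightarrow> real ^ 'd \<times> real ^ 'd\<close> loses no generality: it is large enough to
  carry the path of the pair (solution, Brownian motion).\<close>

definition stationary_distribution ::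
  "(real ^ 'd \<Rightarrow> real ^ 'd) \<Rightarrow> (real ^ 'd \<Rightarrow> real ^ 'd ^ 'd) \<Rightarrow> (real ^ 'd) measure \<Rightarrow> bool" where
  "stationary_distribution b \<sigma> \<nu> \<longleftrightarrow>
     (\<exists>(M :: (real \<Rightarrow> real ^ 'd \<times> real ^ 'd) measure) G W Y.
        sde_solution M G W b \<sigma> Y \<and> (\<forall>t\<ge>0. distr M borel (Y t) = \<nu>))"

text \<open>Ergodicity is the law of large numbers for time averages.  Test functions are bounded: from a
  fixed initial point the time integral of an unbounded \<open>\<nu>\<close>-integrable function may diverge.\<close>

definition ergodic_process ::
  "'w measure \<Rightarrow> (real \<Rightarrow> 'w \<Rightarrow> real ^ 'd) \<Rightarrow> (real ^ 'd) measure \<Rightarrow> bool" where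
  "ergodic_process M X \<nu> \<longleftrightarrow>
     (\<forall>f :: real ^ 'd \<Rightarrow> real. f \<in> borel_measurable borel \<longrightarrow> bounded (range f) \<longrightarrow>
        (AE \<omega> in M. ((\<lambda>T. (LINT s:{0..T}|lborel. f (X s \<omega>)) / T) \<longlongrightarrow> (\<integral>x. f x \<partial>\<nu>)) at_top))"


section \<open>Forms of the diffusion coefficient and estimators\<close>

definition sigma_form1 ::
  "(real ^ 'd ^ 'd \<Rightarrow> real ^ 'd \<Rightarrow> real ^ 'd ^ 'd) \<Rightarrow> (real ^ 'd \<Rightarrow> real ^ 'd ^ 'd) \<Rightarrow> bool" where
  "sigma_form1 \<sigma> a\<^sub>0 \<longleftrightarrow> (\<forall>x. a\<^sub>0 x \<in> spd) \<and>
     (\<forall>\<zeta>\<in>spd. \<forall>x. a\<^sub>0 x ** \<zeta> \<in> spd \<and> \<sigma> \<zeta> x = spd_sqrt (a\<^sub>0 x ** \<zeta>))"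

definition sigma_form2 ::
  "(real ^ 'd ^ 'd \<Rightarrow> real ^ 'd \<Rightarrow> real ^ 'd ^ 'd) \<Rightarrow> (real ^ 'd \<Rightarrow> real ^ 'd ^ 'd) \<Rightarrow>
   (real ^ 'd ^ 'd \<Rightarrow> real ^ 'd ^ 'd) \<Rightarrow> bool" where
  "sigma_form2 \<sigma> \<sigma>\<^sub>0 \<kappa> \<longleftrightarrow> (\<forall>x. \<sigma>\<^sub>0 x \<in> spd) \<and>
     (\<forall>\<zeta>\<in>spd. \<kappa> \<zeta> ** transpose (\<kappa> \<zeta>) = \<zeta> \<and> (\<forall>x. \<sigma> \<zeta> x = \<sigma>\<^sub>0 x ** \<kappa> \<zeta>))"

text \<open>In the following, \<open>\<delta>\<close> is the sampling step, \<open>m\<close> the number of increments and \<open>T\<close> the length of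
  the observation interval.\<close>

definition grid_floor :: "real \<Rightarrow> real \<Rightarrow> real" where
  "grid_floor \<delta> s = of_int \<lfloor>s / \<delta>\<rfloor> * \<delta>"

definition quad_stat :: "(real \<Rightarrow> 'w \<Rightarrow> real ^ 'd) \<Rightarrow> real \<Rightarrow> nat \<Rightarrow> 'w \<Rightarrow> real ^ 'd ^ 'd" where
  "quad_stat X \<delta> m \<omega> = (\<Sum>i<m. outer_square (X (real (Suc i) * \<delta>) \<omega> - X (real i * \<delta>) \<omega>))"

definition estimator1 ::
  "(real ^ 'd \<Rightarrow> real ^ 'd ^ 'd) \<Rightarrow> (real \<Rightarrow> 'w \<Rightarrow> real ^ 'd) \<Rightarrow> real \<Rightarrow> nat \<Rightarrow> real \<Rightarrow> 'w \<Rightarrow>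
   real ^ 'd ^ 'd" where
  "estimator1 a\<^sub>0 X \<delta> m T \<omega> =
     matrix_inv (LINT s:{0..T}|lborel. a\<^sub>0 (X (grid_floor \<delta> s) \<omega>)) ** quad_stat X \<delta> m \<omega>"

definition estimator2 ::
  "(real ^ 'd \<Rightarrow> real ^ 'd ^ 'd) \<Rightarrow> (real \<Rightarrow> 'w \<Rightarrow> real ^ 'd) \<Rightarrow> real \<Rightarrow> nat \<Rightarrow> real \<Rightarrow> 'w \<Rightarrow>
   real ^ 'd ^ 'd" where
  "estimator2 \<sigma>\<^sub>0 X \<delta> m T \<omega> = unvec_mat
     (matrix_inv (LINT s:{0..T}|lborel.
        kronecker (\<sigma>\<^sub>0 (X (grid_floor \<delta> s) \<omega>)) (\<sigma>\<^sub>0 (X (grid_floor \<delta> s) \<omega>)))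
      *v vec_mat (quad_stat X \<delta> m \<omega>))"

end

theory Submission
  imports Defs
begin

text \<open>The Lyapunov condition alone controls the time averages that occur; no ergodic theorem is used.
  Let \<open>\<delta>\<close> be the sampling step, \<open>T = m \<delta>\<close>, \<open>X\<^sub>i = X(i \<delta>)\<close> and \<open>Q\<close> the sum of the squared increments.
  A Dynkin inequality for \<open>\<phi>(V)\<close> with \<open>\<phi>'(v) = v\<^sup>k max(0, 1 - v/N)\<^sup>2\<close>, whose drift is at most
  \<open>C - c \<phi>'(V)\<close> uniformly in \<open>N\<close>, bounds the expectation of \<open>\<Sum> \<delta> V(X\<^sub>i)\<^sup>k\<close> by \<open>C(1 + T)\<close> for every \<open>k\<close>.
  With these moments the increments of \<open>X\<close> are \<open>\<sigma>(X\<^sub>i) \<Delta>W\<^sub>i + r\<^sub>i\<close> where \<open>\<Sum> E\<parallel>r\<^sub>i\<parallel>\<^sup>2 = o(T)\<close>, and the sum of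
  \<open>(\<sigma>(X\<^sub>i) \<Delta>W\<^sub>i)(\<sigma>(X\<^sub>i) \<Delta>W\<^sub>i)\<^sup>T - \<delta> a(X\<^sub>i)\<close> is a martingale with second moment \<open>O(\<delta> T)\<close>; hence
  \<open>E\<parallel>Q - \<Sum> \<delta> a(X\<^sub>i)\<parallel> = o(T)\<close>.  In both forms \<open>\<Sum> \<delta> a(X\<^sub>i)\<close> is \<open>D = \<Sum> \<delta> F(X\<^sub>i)\<close> applied to the
  parameter, with \<open>F\<close> continuous and positive definite.  By Markov's inequality most \<open>X\<^sub>i\<close> lie in a compact set
  \<open>{V \<le> R}\<close>, so \<open>D \<ge> l T\<close> with large probability, and the error of the estimator is \<open>D\<^sup>-\<^sup>1\<close> applied to \<open>o(T)\<close>.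

  Since stochastic integrals are given only as limits in probability of simple integrals, the \<open>L\<^sup>2\<close> estimates
  are obtained from a truncated isometry, and the Dynkin inequality from an Euler scheme instead of
  Ito's formula.\<close>

text \<open>A stochastic integral is available only as a limit in probability, so no square
  integrability is known in advance. Every second-moment estimate is first proved on the event that
  the accumulated quadratic variation stays below a level, carried to the limit by Fatou's lemma,
  and only then freed of the level. Localization follows the same pattern: instead of stopping times
  there is the event that the path has remained in a sublevel set of \<open>V\<close> up to a
  deterministic time. It is adapted, so it may multiply a coefficient; since the test functions are
  non-negative, discarding the other paths costs only equality in Dynkin's formula, and the
  surviving inequality points the way moment bounds need.

  The ratio condition on \<open>V\<close> makes every power available: it absorbs the second-order
  term of \<phi>(V) into half of the negative drift, whatever \<open>k\<close> is. No moment bound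
  uniform in time is derived; time averages are bounded instead, and values on the grid are compared
  with averages over the preceding cell. All errors are measured against 1 + T, which is at most 2 T
  once \<epsilon> < 1.\<close>

abbreviation sqnorm :: "'a::real_normed_vector \<Rightarrow> ennreal" where
  "sqnorm x \<equiv> ennreal ((norm x)\<^sup>2)"

section \<open>Positive definite matrices\<close>

lemma norm_matrix_squared:
  fixes A :: "real ^ 'n ^ 'm"
  shows "(norm A)\<^sup>2 = (\<Sum>i\<in>UNIV. \<Sum>j\<in>UNIV. (A $ i $ j)\<^sup>2)"
  by (simp add: norm_vec_def L2_set_def sum_nonneg)

lemma norm_matrix_squared_columns:
  fixes A :: "real ^ 'n ^ 'm"
  shows "(norm A)\<^sup>2 = (\<Sum>j\<in>UNIV. (norm (column j A))\<^sup>2)"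
  unfolding norm_matrix_squared by (subst sum.swap) (simp add: norm_vec_def L2_set_def sum_nonneg column_def)

lemma norm_transpose [simp]:
  fixes A :: "real ^ 'n ^ 'm"
  shows "norm (transpose A) = norm A"
proof -
  have "(norm (transpose A))\<^sup>2 = (norm A)\<^sup>2"
    unfolding norm_matrix_squared by (subst sum.swap) (simp add: transpose_def)
  then show ?thesis by simp
qed

lemma norm_matrix_vector_mult_le:
  fixes A :: "real ^ 'n ^ 'm"
  shows "norm (A *v x) \<le> norm A * norm x"
proof -
  have "(norm (A *v x))\<^sup>2 = (\<Sum>i\<in>UNIV. (A $ i \<bullet> x)\<^sup>2)"
    by (simp add: norm_vec_def L2_set_def sum_nonneg matrix_vector_mul_component)
  also have "\<dots> \<le> (\<Sum>i\<in>UNIV. (norm (A $ i))\<^sup>2 * (norm x)\<^sup>2)"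
    by (intro sum_mono) (metis Cauchy_Schwarz_ineq2 abs_le_square_iff abs_mult abs_norm_cancel power_mult_distrib)
  also have "\<dots> = (norm A * norm x)\<^sup>2"
    by (simp add: norm_vec_def[of A] L2_set_def sum_nonneg power_mult_distrib sum_distrib_right)
  finally show ?thesis by (rule power2_le_imp_le) simp
qed

lemma column_matrix_matrix_mult:
  fixes A :: "real ^ 'n ^ 'm" and B :: "real ^ 'k ^ 'n"
  shows "column j (A ** B) = A *v column j B"
  by (simp add: column_def matrix_matrix_mult_def matrix_vector_mult_def vec_eq_iff)

text \<open>\<open>A\<close> acts on \<open>B\<close> column by column, and the squared Frobenius
  norm is the sum of the squared column norms. Only an operator bound of \<open>A\<close> enters,
  which is what allows a contraction constant below 1 and the bound 1/l for inverses.\<close>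

lemma norm_matrix_matrix_mult_le_op:
  fixes A :: "real ^ 'n ^ 'm" and B :: "real ^ 'k ^ 'n"
  assumes "\<And>x. norm (A *v x) \<le> r * norm x" "0 \<le> r"
  shows "norm (A ** B) \<le> r * norm B"
proof -
  have "(norm (A ** B))\<^sup>2 \<le> (\<Sum>j\<in>UNIV. (r * norm (column j B))\<^sup>2)"
    unfolding norm_matrix_squared_columns column_matrix_matrix_mult
    by (intro sum_mono power_mono assms) auto
  also have "\<dots> = (r * norm B)\<^sup>2"
    by (simp add: norm_matrix_squared_columns power_mult_distrib sum_distrib_left)
  finally show ?thesis by (rule power2_le_imp_le) (use assms in simp)
qed

lemma norm_matrix_matrix_mult_le:
  fixes A :: "real ^ 'n ^ 'm" and B :: "real ^ 'k ^ 'n"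
  shows "norm (A ** B) \<le> norm A * norm B"
  by (rule norm_matrix_matrix_mult_le_op) (auto simp: norm_matrix_vector_mult_le)

lemma matrix_diff_ldistrib: 
  fixes A :: "real ^ 'n ^ 'm" and B C :: "real ^ 'k ^ 'n"
  shows "A ** (B - C) = A ** B - A ** C"
  by (simp add: matrix_matrix_mult_def vec_eq_iff right_diff_distrib sum_subtractf)

lemma matrix_diff_rdistrib: 
  fixes A B :: "real ^ 'n ^ 'm" and C :: "real ^ 'k ^ 'n"
  shows "(A - B) ** C = A ** C - B ** C"
  by (simp add: matrix_matrix_mult_def vec_eq_iff left_diff_distrib sum_subtractf)

lemma matrix_mult_scaleR:
  fixes A :: "real ^ 'n ^ 'm" and B :: "real ^ 'k ^ 'n"
  shows "(a *\<^sub>R A) ** (b *\<^sub>R B) = (a * b) *\<^sub>R (A ** B)"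
  by (simp add: matrix_matrix_mult_def vec_eq_iff sum_distrib_left mult_ac)

lemma transpose_diff: 
  fixes A B :: "real ^ 'n ^ 'm"
  shows "transpose (A - B) = transpose A - transpose B"
  by (simp add: transpose_def vec_eq_iff)

lemma transpose_add: 
  fixes A B :: "real ^ 'n ^ 'm"
  shows "transpose (A + B) = transpose A + transpose B"
  by (simp add: transpose_def vec_eq_iff)

lemma transpose_scaleR: 
  fixes A :: "real ^ 'n ^ 'm"
  shows "transpose (c *\<^sub>R A) = c *\<^sub>R transpose A"
  by (simp add: transpose_def vec_eq_iff)

text \<open>The quadratic form is continuous and positive on the compact set of pairs of a point of
  \<open>K\<close> and a unit vector, so it has a positive minimum there; homogeneity extends the
  bound to all vectors.\<close>

lemma uniformly_posdef_on_compact: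
  fixes F :: "'a::{metric_space} \<Rightarrow> real ^ 'k ^ 'k"
  assumes "compact K" "continuous_on K F" "\<And>x v. x \<in> K \<Longrightarrow> v \<noteq> 0 \<Longrightarrow> v \<bullet> (F x *v v) > 0"
  obtains l where "l > 0" "\<And>x v. x \<in> K \<Longrightarrow> l * (norm v)\<^sup>2 \<le> v \<bullet> (F x *v v)"
proof (cases "K = {}")
  case True
  then show ?thesis using that[of 1] by auto
next
  case False
  let ?g = "\<lambda>(x, v). v \<bullet> (F x *v v)"
  let ?D = "K \<times> sphere (0 :: real ^ 'k) 1"
  have "continuous_on ?D ?g"
    unfolding split_def inner_vec_def matrix_vector_mult_def
    by (auto intro!: continuous_intros continuous_on_compose2[OF assms(2)])
  moreover have "compact ?D" using assms(1) by (intro compact_Times) auto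
  moreover have "?D \<noteq> {}" using False by auto
  ultimately obtain z where z: "z \<in> ?D" "\<And>y. y \<in> ?D \<Longrightarrow> ?g z \<le> ?g y"
    using continuous_attains_inf[of ?D ?g] by blast
  show ?thesis
  proof (rule that[of "?g z"])
    show "?g z > 0" using z(1) by (auto intro!: assms(3))
    fix x v assume x: "x \<in> K"
    show "?g z * (norm v)\<^sup>2 \<le> v \<bullet> (F x *v v)"
    proof (cases "v = 0")
      case False
      define u where "u = v /\<^sub>R norm v"
      have "?g z \<le> u \<bullet> (F x *v u)" using z(2)[of "(x, u)"] x False by (simp add: u_def)
      moreover have "v \<bullet> (F x *v v) = (norm v)\<^sup>2 * (u \<bullet> (F x *v u))"
        using False by (simp add: u_def matrix_vector_mult_scaleR power2_eq_square field_simps)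
      ultimately show ?thesis by (simp only: mult.commute[of _ "(norm v)\<^sup>2"]) (intro mult_left_mono, auto)
    qed simp
  qed
qed

lemma spd_coercive:
  assumes "A \<in> spd"
  obtains l where "l > 0" "\<And>v. l * (norm v)\<^sup>2 \<le> v \<bullet> (A *v v)"
proof (rule uniformly_posdef_on_compact[of "{0 :: real}" "\<lambda>_. A"])
  show "v \<bullet> (A *v v) > 0" if "v \<noteq> 0" for v using assms that by (auto simp: spd_def)
  fix l assume "l > 0" "\<And>x v. x \<in> {0 :: real} \<Longrightarrow> l * (norm v)\<^sup>2 \<le> v \<bullet> (A *v v)"
  then show thesis using that[of l] by simp
qed auto

section \<open>Existence and uniqueness of the positive definite square root\<close>

lemma norm_diff_squared:
  fixes x y :: "'a::real_inner"
  shows "(norm (x - y))\<^sup>2 = (norm x)\<^sup>2 - 2 * (x \<bullet> y) + (norm y)\<^sup>2"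
  by (simp add: power2_norm_eq_inner inner_diff inner_commute algebra_simps)

text \<open>Banach's fixed point theorem instead of diagonalization. Writing the root as
  \<open>sqrt c\<close> times \<open>mat 1 - Y\<close> turns \<open>B ** B = A\<close> into the
  fixed point equation 2 Y = C + Y ** Y, and the scale \<open>c\<close> is chosen so that
  \<open>C\<close> has operator norm below 1.\<close>

lemma spd_sqrt_existence:
  fixes A :: "real ^ 'd ^ 'd"
  assumes A: "A \<in> spd"
  shows "\<exists>B\<in>spd. B ** B = A"
proof -
  obtain l where l: "l > 0" "\<And>v. l * (norm v)\<^sup>2 \<le> v \<bullet> (A *v v)" using spd_coercive[OF A] by blast
  have [simp]: "transpose A = A" using A by (simp add: spd_def)
  define L where "L = norm A + l"
  have L: "L \<ge> l" "L > 0" using l(1) norm_ge_zero[of A] by (auto simp: L_def simp del: norm_ge_zero intro: add_nonneg_pos)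
  \<comment> \<open>This value minimizes \<open>1 - 2 * l / c + L\<^sup>2 / c\<^sup>2\<close>, a
    bound for the squared operator norm of \<open>C\<close>; the minimum is
    \<open>1 - l\<^sup>2 / L\<^sup>2\<close>. The summand \<open>l\<close> in \<open>L\<close>
    guarantees \<open>l \<le> L\<close>.\<close>
  define c where "c = L\<^sup>2 / l"
  have c: "c > 0" using L l by (simp add: c_def)
  define r where "r = sqrt (1 - l\<^sup>2 / L\<^sup>2)"
  have r: "0 \<le> r" "r < 1" using l L by (auto simp: r_def power_mono)
  define C where "C = mat 1 - A /\<^sub>R c"
  have C_op: "norm (C *v x) \<le> r * norm x" for x
  proof -
    have "(norm (C *v x))\<^sup>2 = (norm (x - (A *v x) /\<^sub>R c))\<^sup>2"
      by (simp add: C_def matrix_vector_mult_diff_rdistrib scaleR_matrix_vector_assoc)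
    also have "\<dots> = (norm x)\<^sup>2 - 2 * (x \<bullet> (A *v x)) / c + (norm (A *v x))\<^sup>2 / c\<^sup>2"
      using c by (subst norm_diff_squared) (simp add: divide_inverse power_mult_distrib power_inverse)
    also have "\<dots> \<le> (norm x)\<^sup>2 - 2 * (l * (norm x)\<^sup>2) / c + (L * norm x)\<^sup>2 / c\<^sup>2"
    proof -
      have "norm (A *v x) \<le> L * norm x"
        using norm_matrix_vector_mult_le[of A x] l(1) by (simp add: L_def distrib_right add_increasing2)
      then show ?thesis using c l(2)[of x]
        by (intro add_mono diff_mono divide_right_mono power_mono) auto
    qed
    also have "\<dots> = (1 - l\<^sup>2 / L\<^sup>2) * (norm x)\<^sup>2"
      using l L unfolding c_def by (simp add: field_simps power2_eq_square)
    also have "\<dots> = (r * norm x)\<^sup>2"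
      using l L by (simp add: r_def power_mult_distrib power_mono)
    finally show ?thesis by (rule power2_le_imp_le) (use r in simp)
  qed
  \<comment> \<open>\<open>T\<close> maps this set into itself because (r + r^2)/2 is at most r. The
    set is cut out by operator bounds but is closed in the Frobenius norm, in which \<open>T\<close>
    contracts by \<open>r\<close>.\<close>
  define U where "U = {Y :: real ^ 'd ^ 'd. transpose Y = Y \<and> (\<forall>x. norm (Y *v x) \<le> r * norm x)}"
  define T where "T Y = (1/2) *\<^sub>R (C + Y ** Y)" for Y
  have "closed U"
  proof -
    have "U = {Y. transpose Y = Y} \<inter> (\<Inter>x. {Y. norm (Y *v x) \<le> r * norm x})" by (auto simp: U_def)
    moreover have "closed {Y :: real ^ 'd ^ 'd. transpose Y = Y}"
      unfolding transpose_def by (intro closed_Collect_eq continuous_intros)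
    moreover have "closed {Y :: real ^ 'd ^ 'd. norm (Y *v x) \<le> r * norm x}" for x
      unfolding matrix_vector_mult_def by (intro closed_Collect_le continuous_intros)
    ultimately show ?thesis by auto
  qed
  note iffD2[OF complete_eq_closed this]
  moreover have "U \<noteq> {}" using r by (auto simp: U_def transpose_def vec_eq_iff intro!: exI[of _ 0])
  moreover have "T ` U \<subseteq> U"
  proof (clarsimp simp: U_def, intro conjI allI)
    fix Y :: "real ^ 'd ^ 'd" and x assume Y: "transpose Y = Y" "\<forall>x. norm (Y *v x) \<le> r * norm x"
    show "transpose (T Y) = T Y" using Y
      by (simp add: T_def C_def transpose_scaleR transpose_add transpose_diff transpose_mat matrix_transpose_mul)
    have "norm (Y *v (Y *v x)) \<le> r * (r * norm x)"
      using Y(2) r by (meson mult_left_mono order_trans)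
    also have "\<dots> \<le> r * norm x"
      using r by (intro mult_left_mono) (auto intro: mult_left_le_one_le)
    finally have "norm (C *v x + Y *v (Y *v x)) \<le> 2 * (r * norm x)"
      using C_op[of x] norm_triangle_ineq[of "C *v x" "Y *v (Y *v x)"] by linarith
    then show "norm (T Y *v x) \<le> r * norm x"
      by (simp add: T_def matrix_vector_mult_add_rdistrib matrix_vector_mul_assoc scaleR_matrix_vector_assoc[symmetric])
  qed
  moreover have "\<forall>Y\<in>U. \<forall>Z\<in>U. dist (T Y) (T Z) \<le> r * dist Y Z"
  proof safe
    fix Y Z assume that: "Y \<in> U" "Z \<in> U"
    have "norm (Y ** (Y - Z)) \<le> r * norm (Y - Z)"
      using that r by (intro norm_matrix_matrix_mult_le_op) (auto simp: U_def)
    moreover have "norm ((Y - Z) ** Z) \<le> r * norm (Y - Z)"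
    proof -
      have "norm (Z ** (Y - Z)) \<le> r * norm (Y - Z)"
        using that r by (intro norm_matrix_matrix_mult_le_op) (auto simp: U_def)
      moreover have "transpose ((Y - Z) ** Z) = Z ** (Y - Z)"
        using that by (simp add: matrix_transpose_mul transpose_diff U_def)
      ultimately show ?thesis by (metis norm_transpose)
    qed
    \<comment> \<open>\<open>Y\<close> and \<open>Z\<close> need not commute, so the difference of
      squares is split with one factor on each side; the term with \<open>Z\<close> on the right was
      bounded after a transposition.\<close>
    moreover have "T Y - T Z = (1/2) *\<^sub>R (Y ** (Y - Z) + (Y - Z) ** Z)"
      by (simp add: T_def matrix_diff_ldistrib matrix_diff_rdistrib scaleR_diff_right[symmetric])
    ultimately show "dist (T Y) (T Z) \<le> r * dist Y Z"
      using norm_triangle_ineq[of "Y ** (Y - Z)" "(Y - Z) ** Z"] by (simp add: dist_norm)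
  qed
  ultimately obtain Y where Y: "Y \<in> U" "T Y = Y"
    using Banach_fix[of U r T] r by blast
  define B where "B = mat 1 - Y"
  have "2 *\<^sub>R T Y = C + Y ** Y" by (simp add: T_def)
  then have "2 *\<^sub>R Y = C + Y ** Y" by (simp only: Y(2))
  then have "B ** B = A /\<^sub>R c"
    by (simp add: B_def C_def matrix_diff_ldistrib matrix_diff_rdistrib scaleR_2 algebra_simps)
  then have "(sqrt c *\<^sub>R B) ** (sqrt c *\<^sub>R B) = A"
    using c by (simp add: matrix_mult_scaleR)
  moreover have "sqrt c *\<^sub>R B \<in> spd"
    unfolding spd_def mem_Collect_eq
  proof (intro conjI allI impI)
    show "transpose (sqrt c *\<^sub>R B) = sqrt c *\<^sub>R B"
      using Y(1) by (simp add: B_def U_def transpose_scaleR transpose_diff transpose_mat)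
    fix x :: "real ^ 'd" assume "x \<noteq> 0"
    have "x \<bullet> (Y *v x) \<le> norm x * norm (Y *v x)" by (rule norm_cauchy_schwarz)
    also have "\<dots> \<le> norm x * (r * norm x)" using Y(1) by (intro mult_left_mono) (auto simp: U_def)
    also have "\<dots> < x \<bullet> x" using r \<open>x \<noteq> 0\<close>
      by (simp add: power2_norm_eq_inner[symmetric] power2_eq_square)
    finally show "x \<bullet> ((sqrt c *\<^sub>R B) *v x) > 0"
      using c by (simp add: B_def scaleR_matrix_vector_assoc[symmetric] matrix_vector_mult_diff_rdistrib inner_diff_right)
  qed
  ultimately show ?thesis by blast
qed

text \<open>The trace is the sum of the quadratic form of \<open>B\<close> over the columns of
  \<open>D\<close>, so it vanishes only if all columns do.\<close>

lemma trace_congruence_nonneg: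
  fixes B D :: "real ^ 'd ^ 'd"
  assumes "B \<in> spd"
  shows "trace (transpose D ** B ** D) \<ge> 0"
    and "trace (transpose D ** B ** D) = 0 \<Longrightarrow> D = 0"
proof -
  have *: "trace (transpose D ** B ** D) = (\<Sum>j\<in>UNIV. column j D \<bullet> (B *v column j D))"
    unfolding trace_def
    by (intro sum.cong refl)
      (simp add: matrix_mul_assoc[symmetric] column_matrix_matrix_mult[symmetric], simp add: matrix_matrix_mult_def transpose_def column_def inner_vec_def)
  have nn: "column j D \<bullet> (B *v column j D) \<ge> 0" for j
    using assms by (cases "column j D = 0") (auto simp: spd_def less_imp_le)
  show "trace (transpose D ** B ** D) \<ge> 0"
    unfolding * by (intro sum_nonneg nn)
  assume "trace (transpose D ** B ** D) = 0"
  then have "\<forall>j. column j D \<bullet> (B *v column j D) = 0"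
    unfolding * by (subst (asm) sum_nonneg_eq_0_iff) (auto simp: nn)
  then have "column j D = 0" for j
    using assms unfolding spd_def by (metis (mono_tags, lifting) less_irrefl mem_Collect_eq)
  then show "D = 0" by (simp add: column_def vec_eq_iff)
qed

text \<open>For the difference \<open>D\<close> of the two roots, \<open>D ** B + C ** D\<close>
  equals \<open>B ** B - C ** C\<close>, which is 0. Multiplying by \<open>D\<close> and taking
  traces gives a vanishing sum of two traces of congruences, both non-negative.\<close>

lemma spd_sqrt_unique:
  fixes B C :: "real ^ 'd ^ 'd"
  assumes "B \<in> spd" "C \<in> spd" "B ** B = C ** C"
  shows "B = C"
proof -
  define D where "D = B - C"
  have [simp]: "transpose D = D" using assms by (simp add: D_def spd_def transpose_diff)
  have "D ** B + C ** D = 0"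
    using assms(3) by (simp add: D_def matrix_diff_ldistrib matrix_diff_rdistrib)
  then have "trace ((D ** B + C ** D) ** D) = 0" by (simp add: trace_def)
  then have "trace (D ** B ** D) + trace (C ** D ** D) = 0"
    by (simp add: matrix_matrix_mult_def trace_def distrib_right sum.distrib)
  moreover have "trace (C ** D ** D) = trace (D ** C ** D)"
    by (metis matrix_mul_assoc trace_mul_sym)
  ultimately have "trace (transpose D ** B ** D) + trace (transpose D ** C ** D) = 0" by simp
  then have "trace (transpose D ** B ** D) = 0"
    using trace_congruence_nonneg(1)[OF assms(1), of D] trace_congruence_nonneg(1)[OF assms(2), of D]
    by linarith
  from trace_congruence_nonneg(2)[OF assms(1) this] show ?thesis by (simp add: D_def)
qed

lemma spd_sqrt:
  assumes "A \<in> spd"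
  shows "spd_sqrt A \<in> spd" "spd_sqrt A ** spd_sqrt A = A"
proof -
  have "\<exists>!B. B \<in> spd \<and> B ** B = A"
    using spd_sqrt_existence[OF assms] spd_sqrt_unique by metis
  from theI'[OF this] show "spd_sqrt A \<in> spd" "spd_sqrt A ** spd_sqrt A = A"
    by (auto simp: spd_sqrt_def)
qed

section \<open>Inverses of positive definite and coercive matrices\<close>

lemma posdef_invertible:
  fixes A :: "real ^ 'k ^ 'k"
  assumes "\<And>v. v \<noteq> 0 \<Longrightarrow> v \<bullet> (A *v v) > 0"
  shows "invertible A"
proof -
  have "\<forall>x. A *v x = 0 \<longrightarrow> x = 0" using assms by (metis inner_zero_right less_irrefl)
  then show ?thesis
    by (simp add: invertible_left_inverse matrix_left_invertible_ker)
qed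

lemma matrix_inv_mult:
  fixes A :: "real ^ 'k ^ 'k"
  assumes "invertible A"
  shows "A ** matrix_inv A = mat 1" "matrix_inv A ** A = mat 1"
  using assms someI_ex[OF assms[unfolded invertible_def]] by (auto simp: matrix_inv_def)

lemma coercive_matrix_inv:
  fixes A :: "real ^ 'k ^ 'k"
  assumes "l > 0" "\<And>v. l * (norm v)\<^sup>2 \<le> v \<bullet> (A *v v)"
  shows "invertible A" "norm (matrix_inv A *v v) \<le> norm v / l"
proof -
  show inv: "invertible A"
    by (intro posdef_invertible less_le_trans[OF _ assms(2)]) (use assms(1) in simp)
  define u where "u = matrix_inv A *v v"
  have v: "A *v u = v" by (simp add: u_def matrix_vector_mul_assoc matrix_inv_mult[OF inv])
  have "l * (norm u)\<^sup>2 \<le> norm u * norm v"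
    using assms(2)[of u] norm_cauchy_schwarz[of u v] by (simp add: v)
  then have "l * norm u \<le> norm v" by (cases "u = 0") (auto simp: power2_eq_square)
  then show "norm (matrix_inv A *v v) \<le> norm v / l"
    using assms(1) by (simp add: u_def[symmetric] field_simps)
qed

lemma coercive_matrix_inv_mult:
  fixes A B :: "real ^ 'k ^ 'k"
  assumes "l > 0" "\<And>v. l * (norm v)\<^sup>2 \<le> v \<bullet> (A *v v)"
  shows "norm (matrix_inv A ** B) \<le> norm B / l"
  using norm_matrix_matrix_mult_le_op[of "matrix_inv A" "1 / l" B] coercive_matrix_inv(2)[OF assms] assms(1)
  by simp

text \<open>Cramer's rule replaces the inverse, which is defined by choice, by quotients of
  polynomials in the entries; this is how the inverse becomes measurable.\<close>

lemma matrix_inv_cramer: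
  fixes A :: "real ^ 'k ^ 'k"
  assumes "invertible A"
  shows "matrix_inv A $ k $ j = det (\<chi> i l. if l = k then axis j 1 $ i else A $ i $ l) / det A"
proof -
  have "det A \<noteq> 0" using assms by (simp add: invertible_det_nz)
  moreover have "A *v (matrix_inv A *v axis j 1) = axis j 1"
    by (simp add: matrix_vector_mul_assoc matrix_inv_mult[OF assms])
  ultimately have "(matrix_inv A *v axis j 1) = (\<chi> k. det (\<chi> i l. if l = k then axis j 1 $ i else A $ i $ l) / det A)"
    by (subst (asm) cramer) auto
  then show ?thesis by (simp add: matrix_vector_mul_component vec_eq_iff cart_eq_inner_axis[symmetric])
qed

section \<open>Measurability of matrix-valued maps\<close>

lemma borel_measurable_matrixI:
  fixes A :: "'a \<Rightarrow> real ^ 'n ^ 'm"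
  assumes "\<And>i j. (\<lambda>x. A x $ i $ j) \<in> borel_measurable M"
  shows "A \<in> borel_measurable M"
proof -
  have "A = (\<lambda>x. \<chi> i j. A x $ i $ j)" by (simp add: vec_eq_iff fun_eq_iff)
  also have "\<dots> \<in> borel_measurable M"
    by (subst borel_measurable_euclidean_space)
      (auto simp: Basis_vec_def inner_axis assms cart_eq_inner_axis[symmetric])
  finally show ?thesis .
qed

lemma borel_measurable_vecI:
  fixes A :: "'a \<Rightarrow> real ^ 'n"
  assumes "\<And>i. (\<lambda>x. A x $ i) \<in> borel_measurable M"
  shows "A \<in> borel_measurable M"
  by (subst borel_measurable_euclidean_space)
      (auto simp: Basis_vec_def inner_axis assms cart_eq_inner_axis[symmetric])

lemma measurable_vec_nth' [measurable (raw)]: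
  fixes A :: "'a \<Rightarrow> 'b::{second_countable_topology, t2_space} ^ 'n"
  assumes "A \<in> borel_measurable M"
  shows "(\<lambda>x. A x $ i) \<in> borel_measurable M"
  by (rule measurable_compose[OF assms borel_measurable_continuous_onI]) (intro continuous_intros)

lemma borel_measurable_matrix_vector_mult [measurable (raw)]:
  fixes A :: "'a \<Rightarrow> real ^ 'n ^ 'm"
  assumes [measurable]: "A \<in> borel_measurable M" "v \<in> borel_measurable M"
  shows "(\<lambda>x. A x *v v x) \<in> borel_measurable M"
  unfolding matrix_vector_mult_def by (rule borel_measurable_vecI) simp

lemma borel_measurable_matrix_matrix_mult [measurable (raw)]:
  fixes A :: "'a \<Rightarrow> real ^ 'n ^ 'm" and B :: "'a \<Rightarrow> real ^ 'k ^ 'n"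
  assumes [measurable]: "A \<in> borel_measurable M" "B \<in> borel_measurable M"
  shows "(\<lambda>x. A x ** B x) \<in> borel_measurable M"
  unfolding matrix_matrix_mult_def by (rule borel_measurable_matrixI) simp

lemma borel_measurable_transpose [measurable (raw)]:
  fixes A :: "'a \<Rightarrow> real ^ 'n ^ 'm"
  assumes [measurable]: "A \<in> borel_measurable M"
  shows "(\<lambda>x. transpose (A x)) \<in> borel_measurable M"
  unfolding transpose_def by (rule borel_measurable_matrixI) simp

lemma borel_measurable_outer_square [measurable (raw)]:
  assumes [measurable]: "v \<in> borel_measurable M"
  shows "(\<lambda>x. outer_square (v x)) \<in> borel_measurable M"
  unfolding outer_square_def by (rule borel_measurable_matrixI) simp

lemma borel_measurable_matrix_inv:
  fixes A :: "'a \<Rightarrow> real ^ 'n ^ 'n"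
  assumes [measurable]: "A \<in> borel_measurable M" and inv: "\<And>x. x \<in> space M \<Longrightarrow> invertible (A x)"
  shows "(\<lambda>x. matrix_inv (A x)) \<in> borel_measurable M"
proof (rule borel_measurable_matrixI)
  fix k j
  have "(\<lambda>x. det (\<chi> i l. if l = k then axis j 1 $ i else A x $ i $ l) / det (A x)) \<in> borel_measurable M"
    unfolding det_def by simp
  then show "(\<lambda>x. matrix_inv (A x) $ k $ j) \<in> borel_measurable M"
    by (rule measurable_cong[THEN iffD1, rotated]) (simp add: matrix_inv_cramer inv)
qed

lemma norm_outer_square: "norm (outer_square v) = (norm v)\<^sup>2"
proof -
  have "(norm (outer_square v))\<^sup>2 = (\<Sum>i\<in>UNIV. (v $ i)\<^sup>2) * (\<Sum>i\<in>UNIV. (v $ i)\<^sup>2)"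
    by (simp add: norm_matrix_squared outer_square_def power_mult_distrib sum_product)
  also have "\<dots> = ((norm v)\<^sup>2)\<^sup>2"
    by (simp add: norm_vec_def L2_set_def sum_nonneg power2_eq_square)
  finally show ?thesis by (subst (asm) power2_eq_iff_nonneg) auto
qed

lemma norm_outer_square_add_diff_le:
  fixes v w :: "real ^ 'd"
  shows "norm (outer_square (v + w) - outer_square v) \<le> 2 * norm v * norm w + (norm w)\<^sup>2"
proof -
  define P where "P v w = (\<chi> i j. v $ i * w $ j)" for v w :: "real ^ 'd"
  have P: "norm (P v w) \<le> norm v * norm w" for v w
  proof -
    have "(norm (P v w))\<^sup>2 = (\<Sum>i\<in>UNIV. (v $ i)\<^sup>2) * (\<Sum>i\<in>UNIV. (w $ i)\<^sup>2)"
      by (simp add: norm_matrix_squared P_def power_mult_distrib sum_product)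
    also have "\<dots> = (norm v * norm w)\<^sup>2"
      by (simp add: norm_vec_def L2_set_def sum_nonneg power_mult_distrib)
    finally show ?thesis by simp
  qed
  have "outer_square (v + w) - outer_square v = P v w + P w v + P w w"
    by (simp add: outer_square_def P_def vec_eq_iff algebra_simps)
  also have "norm \<dots> \<le> norm v * norm w + norm w * norm v + norm w * norm w"
    by (intro norm_triangle_mono P)
  finally show ?thesis by (simp add: power2_eq_square)
qed

text \<open>On \<open>vec_mat N\<close> the form of the Kronecker square equals tr(N^T A N A). With
  the root \<open>T\<close> of \<open>A\<close> and cyclicity of the trace this is the trace of a
  congruence by \<open>N ** T\<close>, which is positive because \<open>T\<close> is
  invertible.\<close>

lemma kronecker_posdef:
  assumes "A \<in> spd" "v \<noteq> 0"
  shows "v \<bullet> (kronecker A A *v v) > 0"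
proof -
  define N where "N = unvec_mat v"
  have v: "v = vec_mat N" by (simp add: N_def)
  have "N \<noteq> 0" using assms(2) by (auto simp: v vec_mat_def vec_eq_iff)
  have inner_vec_mat: "vec_mat P \<bullet> vec_mat Q = trace (transpose P ** Q)" for P Q :: "real ^ 'a ^ 'a"
    by (simp add: vec_mat_def inner_vec_def trace_def transpose_def matrix_matrix_mult_def
        sum.cartesian_product UNIV_Times_UNIV[symmetric] split_def del: UNIV_Times_UNIV)
  define T where "T = spd_sqrt A"
  have T: "T \<in> spd" "T ** T = A" "transpose T = T"
    using spd_sqrt[OF assms(1)] by (auto simp: T_def spd_def)
  have "v \<bullet> (kronecker A A *v v) = trace (transpose N ** (A ** N ** transpose A))"
    by (simp add: v kronecker_mult_vec_mat inner_vec_mat)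
  also have "\<dots> = trace (transpose N ** A ** N ** T ** T)"
    using assms(1) by (simp add: spd_def) (simp only: matrix_mul_assoc[symmetric] T(2))
  also have "\<dots> = trace (transpose (N ** T) ** A ** (N ** T))"
    by (subst trace_mul_sym) (simp only: matrix_transpose_mul T(3) matrix_mul_assoc)
  also have "\<dots> > 0"
  proof -
    have "N ** T \<noteq> 0"
    proof
      assume "N ** T = 0"
      moreover have "invertible T" using T(1) by (intro posdef_invertible) (auto simp: spd_def)
      then have "N ** T ** matrix_inv T = N"
        by (simp add: matrix_mul_assoc[symmetric] matrix_inv_mult)
      ultimately have "N = 0" by (simp add: matrix_matrix_mult_def vec_eq_iff)
      with \<open>N \<noteq> 0\<close> show False by simp
    qed
    then show ?thesis using trace_congruence_nonneg[OF assms(1), of "N ** T"] by linarith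
  qed
  finally show ?thesis .
qed

section \<open>Moments of Brownian increments\<close>

lemma axis_nth_eq: "axis j (x :: real) $ i = (if i = j then x else 0)"
  by (simp add: axis_def)

text \<open>Lebesgue measure on vectors is the image of a product measure indexed by the basis
  vectors, so Fubini's theorem for products applies; \<open>idx\<close> translates a basis vector
  back into its coordinate. This reduces Gaussian moments of an increment to one-dimensional
  integrals.\<close>

lemma
  fixes F :: "'d::finite \<Rightarrow> real \<Rightarrow> real"
  assumes "\<And>i. integrable lborel (F i)"
  shows integrable_lborel_prod_components: "integrable lborel (\<lambda>x :: real ^ 'd. \<Prod>i\<in>UNIV. F i (x $ i))"
    and integral_lborel_prod_components: "(\<integral>x. (\<Prod>i\<in>UNIV. F i ((x :: real ^ 'd) $ i)) \<partial>lborel) = (\<Prod>i\<in>UNIV. \<integral>x. F i x \<partial>lborel)"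
proof -
  interpret product_sigma_finite "\<lambda>b :: real ^ 'd. lborel :: real measure" by standard
  define idx :: "real ^ 'd \<Rightarrow> 'd" where "idx = inv (\<lambda>i. axis i 1)"
  have inj: "inj (\<lambda>i :: 'd. axis i (1 :: real))" by (auto simp: inj_def axis_eq_axis)
  then have idx [simp]: "idx (axis i 1) = i" for i unfolding idx_def by (rule inv_f_f)
  have Basis: "(Basis :: (real ^ 'd) set) = (\<lambda>i. axis i 1) ` UNIV" by (auto simp: Basis_vec_def)
  have prod_Basis: "(\<Prod>b\<in>Basis. H (idx b) b) = (\<Prod>i\<in>UNIV. H i (axis i 1))" for H :: "'d \<Rightarrow> real ^ 'd \<Rightarrow> real"
    unfolding Basis by (subst prod.reindex[OF inj]) simp
  have comp: "(\<Sum>b\<in>Basis. f b *\<^sub>R b) $ i = f (axis i 1)" for f :: "real ^ 'd \<Rightarrow> real" and i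
  proof -
    have "(\<Sum>b\<in>Basis. f b *\<^sub>R b) $ i = (\<Sum>j\<in>UNIV. f (axis j 1) * axis j 1 $ i)"
      unfolding Basis by (subst sum.reindex[OF inj]) simp
    also have "\<dots> = (\<Sum>j\<in>UNIV. if j = i then f (axis i 1) else 0)"
      by (intro sum.cong refl) (auto simp: axis_nth_eq)
    finally show ?thesis by simp
  qed
  have [measurable]: "F i \<in> borel_measurable borel" for i
    using borel_measurable_integrable[OF assms[of i]] by simp
  have int: "integrable (Pi\<^sub>M Basis (\<lambda>_. lborel)) (\<lambda>f. \<Prod>b\<in>Basis. F (idx b) (f b))"
    by (intro product_integrable_prod assms) simp
  have meas: "(\<lambda>f. \<Sum>b\<in>Basis. f b *\<^sub>R b) \<in> Pi\<^sub>M Basis (\<lambda>_ :: real ^ 'd. lborel) \<rightarrow>\<^sub>M (borel :: (real ^ 'd) measure)"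
    by measurable
  have eq: "(\<Prod>i\<in>UNIV. F i ((\<Sum>b\<in>Basis. f b *\<^sub>R b) $ i)) = (\<Prod>b\<in>Basis. F (idx b) (f b))" for f :: "real ^ 'd \<Rightarrow> real"
    unfolding comp using prod_Basis[of "\<lambda>i b. F i (f b)"] by simp
  have bm: "(\<lambda>x :: real ^ 'd. \<Prod>i\<in>UNIV. F i (x $ i)) \<in> borel_measurable borel" by measurable
  show "integrable lborel (\<lambda>x :: real ^ 'd. \<Prod>i\<in>UNIV. F i (x $ i))"
    unfolding lborel_eq[where 'a = "real ^ 'd"] integrable_distr_eq[OF meas bm] eq by (rule int)
  have "(\<integral>x. (\<Prod>i\<in>UNIV. F i ((x :: real ^ 'd) $ i)) \<partial>lborel)
      = (\<integral>f. (\<Prod>b\<in>Basis. F (idx b) (f b)) \<partial>Pi\<^sub>M Basis (\<lambda>_. lborel))"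
    unfolding lborel_eq[where 'a = "real ^ 'd"] integral_distr[OF meas bm] eq ..
  also have "\<dots> = (\<Prod>i\<in>UNIV. \<integral>x. F i x \<partial>lborel)"
    using prod_Basis[of "\<lambda>i _. integral\<^sup>L lborel (F i)"]
    by (subst product_integral_prod) (auto intro!: assms)
  finally show "(\<integral>x. (\<Prod>i\<in>UNIV. F i ((x :: real ^ 'd) $ i)) \<partial>lborel) = (\<Prod>i\<in>UNIV. \<integral>x. F i x \<partial>lborel)" .
qed

section \<open>Increments of Brownian motion relative to the filtration\<close>

locale brownian_setting = prob_space M for M :: "'w measure" +
  fixes G :: "real \<Rightarrow> 'w measure" and W :: "real \<Rightarrow> 'w \<Rightarrow> real ^ 'd"
  assumes filtration_of: "filtration_of M G" and brownian: "brownian_motion M G W"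
begin

lemma space_G [simp]: "space (G t) = space M"
  using filtration_of by (simp add: filtration_of_def filtration_def)

lemma sets_G_mono: "s \<le> t \<Longrightarrow> sets (G s) \<subseteq> sets (G t)"
  using filtration_of by (simp add: filtration_of_def filtration_def)

lemma sets_G_subset: "sets (G t) \<subseteq> sets M"
  using filtration_of by (simp add: filtration_of_def)

lemma measurable_G_mono: "f \<in> measurable (G s) N \<Longrightarrow> s \<le> t \<Longrightarrow> f \<in> measurable (G t) N"
  by (erule measurable_from_subalg[rotated]) (simp add: subalgebra_def sets_G_mono)

lemma measurable_G: "f \<in> measurable (G s) N \<Longrightarrow> f \<in> measurable M N"
  by (erule measurable_from_subalg[rotated]) (simp add: subalgebra_def sets_G_subset)

lemma W_measurable_G: "0 \<le> t \<Longrightarrow> W t \<in> borel_measurable (G t)"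
  using brownian by (simp add: brownian_motion_def continuous_adapted_def)

lemma W_measurable [measurable]: "0 \<le> t \<Longrightarrow> W t \<in> borel_measurable M"
  using W_measurable_G measurable_G by blast

lemma indep_increment:
  assumes "0 \<le> s" "s < t" "Y \<in> borel_measurable (G s)" "g \<in> borel_measurable borel"
  shows "indep_var borel Y borel (\<lambda>w. g (W t w - W s w))"
proof -
  let ?Z = "\<lambda>w. W t w - W s w"
  have Z: "?Z \<in> borel_measurable M" using assms by simp
  have "indep_set (sets (G s)) (sets (vimage_algebra (space M) ?Z borel))"
    using brownian assms by (auto simp: brownian_motion_def)
  moreover have "sigma_sets (space M) {Y -` A \<inter> space M | A. A \<in> sets borel} \<subseteq> sets (G s)"
    using measurable_sets[OF assms(3)] by (intro sets.sigma_sets_subset[of _ "G s", simplified]) auto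
  moreover have "sigma_sets (space M) {(\<lambda>w. g (?Z w)) -` A \<inter> space M | A. A \<in> sets borel}
      \<subseteq> sets (vimage_algebra (space M) ?Z borel)"
  proof -
    have "(\<lambda>w. g (?Z w)) -` A \<inter> space M \<in> sets (vimage_algebra (space M) ?Z borel)" if "A \<in> sets borel" for A
    proof -
      have "g -` A \<in> sets borel" using measurable_sets[OF assms(4) that] by simp
      then have "?Z -` (g -` A) \<inter> space M \<in> sets (vimage_algebra (space M) ?Z borel)"
        by (rule in_vimage_algebra)
      then show ?thesis by (simp add: vimage_def)
    qed
    then show ?thesis
      by (intro sets.sigma_sets_subset[of _ "vimage_algebra (space M) ?Z borel", simplified]) auto
  qed
  ultimately have "indep_set (sigma_sets (space M) {Y -` A \<inter> space M | A. A \<in> sets borel})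
      (sigma_sets (space M) {(\<lambda>w. g (?Z w)) -` A \<inter> space M | A. A \<in> sets borel})"
    unfolding indep_set_def by (elim indep_sets_mono_sets) (auto split: bool.split)
  then show ?thesis using Z assms measurable_G[OF assms(3)] by (simp add: indep_var_eq)
qed

lemma
  fixes Y :: "'w \<Rightarrow> real" and g :: "real ^ 'd \<Rightarrow> real"
  assumes "0 \<le> s" "s < t" "Y \<in> borel_measurable (G s)" "integrable M Y"
    "g \<in> borel_measurable borel" "integrable M (\<lambda>w. g (W t w - W s w))"
  shows integrable_increment_mult: "integrable M (\<lambda>w. Y w * g (W t w - W s w))"
    and expectation_increment_mult:
      "expectation (\<lambda>w. Y w * g (W t w - W s w)) = expectation Y * expectation (\<lambda>w. g (W t w - W s w))"
  using indep_var_integrable[OF indep_increment[OF assms(1-3,5)] assms(4,6)]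
    indep_var_lebesgue_integral[OF indep_increment[OF assms(1-3,5)] assms(4,6)] by auto

lemma
  fixes g :: "'d \<Rightarrow> real \<Rightarrow> real"
  assumes "0 \<le> s" "s < t" and [measurable]: "\<And>i. g i \<in> borel_measurable borel"
    and "\<And>i. integrable lborel (\<lambda>x. normal_density 0 (sqrt (t - s)) x * g i x)"
  shows integrable_increment_prod: "integrable M (\<lambda>w. \<Prod>i\<in>UNIV. g i ((W t w - W s w) $ i))"
    and expectation_increment_prod: "expectation (\<lambda>w. \<Prod>i\<in>UNIV. g i ((W t w - W s w) $ i))
      = (\<Prod>i\<in>UNIV. \<integral>x. normal_density 0 (sqrt (t - s)) x * g i x \<partial>lborel)"
proof -
  let ?p = "\<lambda>x :: real ^ 'd. \<Prod>i\<in>UNIV. normal_density 0 (sqrt (t - s)) (x $ i)"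
  have d: "distributed M lborel (\<lambda>w. W t w - W s w) (\<lambda>x. ennreal (?p x))"
    using brownian assms(1,2) by (auto simp: brownian_motion_def)
  have eq: "?p x * (\<Prod>i\<in>UNIV. g i (x $ i)) = (\<Prod>i\<in>UNIV. normal_density 0 (sqrt (t - s)) (x $ i) * g i (x $ i))" for x
    by (simp add: prod.distrib)
  have p: "0 \<le> ?p x" for x by (intro prod_nonneg) simp
  show "integrable M (\<lambda>w. \<Prod>i\<in>UNIV. g i ((W t w - W s w) $ i))"
    using distributed_integrable[OF d, of "\<lambda>x. \<Prod>i\<in>UNIV. g i (x $ i)"] p
      integrable_lborel_prod_components[of "\<lambda>i x. normal_density 0 (sqrt (t - s)) x * g i x"] assms(4)
    unfolding eq by simp
  show "expectation (\<lambda>w. \<Prod>i\<in>UNIV. g i ((W t w - W s w) $ i))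
      = (\<Prod>i\<in>UNIV. \<integral>x. normal_density 0 (sqrt (t - s)) x * g i x \<partial>lborel)"
    using distributed_integral[OF d, of "\<lambda>x. \<Prod>i\<in>UNIV. g i (x $ i)"] p
      integral_lborel_prod_components[of "\<lambda>i x. normal_density 0 (sqrt (t - s)) x * g i x"] assms(4)
    unfolding eq by simp
qed

lemma
  assumes "0 \<le> s" "s < t"
  shows integrable_increment_nth: "integrable M (\<lambda>w. (W t w - W s w) $ i)"
    and expectation_increment_nth: "expectation (\<lambda>w. (W t w - W s w) $ i) = 0"
    and integrable_increment_nth2: "integrable M (\<lambda>w. (W t w - W s w) $ i * (W t w - W s w) $ j)"
    and expectation_increment_nth2:
      "expectation (\<lambda>w. (W t w - W s w) $ i * (W t w - W s w) $ j) = (if i = j then t - s else 0)"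
    and integrable_increment_nth4: "integrable M (\<lambda>w. ((W t w - W s w) $ i) ^ 4)"
    and expectation_increment_nth4: "expectation (\<lambda>w. ((W t w - W s w) $ i) ^ 4) = 3 * (t - s)\<^sup>2"
proof -
  let ?n = "normal_density 0 (sqrt (t - s))"
  have h: "t - s > 0" using assms by simp
  have n0: "integrable lborel ?n" "integral\<^sup>L lborel ?n = 1" using h by auto
  have mom: "integrable lborel (\<lambda>x. ?n x * x ^ k)" for k
    using integrable_normal_moment[of "sqrt (t - s)" 0 k] h by simp
  have m1: "(\<integral>x. ?n x * x \<partial>lborel) = 0"
    using integral_normal_moment_odd[of "sqrt (t - s)" 0 0] h by simp
  have m2: "(\<integral>x. ?n x * x ^ 2 \<partial>lborel) = t - s"
    using integral_normal_moment_even[of "sqrt (t - s)" 0 1] h by simp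
  have m4: "(\<integral>x. ?n x * x ^ 4 \<partial>lborel) = 3 * (t - s)\<^sup>2"
    using integral_normal_moment_even[of "sqrt (t - s)" 0 2] h by (simp add: fact_numeral field_simps)
  have single: "(\<Prod>k\<in>UNIV. if k = i then x $ k ^ r else 1) = (x $ i) ^ r" for x :: "real ^ 'd" and r
    by (simp add: prod.delta)
  have I: "integrable lborel (\<lambda>x. ?n x * (if k = i then x ^ r else 1))" for k r
    using mom[of r] n0 by (cases "k = i") auto
  have *: "integrable M (\<lambda>w. ((W t w - W s w) $ i) ^ r)"
    "expectation (\<lambda>w. ((W t w - W s w) $ i) ^ r) = (\<integral>x. ?n x * x ^ r \<partial>lborel)" for r
  proof -
    show "integrable M (\<lambda>w. ((W t w - W s w) $ i) ^ r)"
      using integrable_increment_prod[OF assms, of "\<lambda>k x. if k = i then x ^ r else 1"] I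
      unfolding single by simp
    have "expectation (\<lambda>w. ((W t w - W s w) $ i) ^ r) = (\<Prod>k\<in>UNIV. \<integral>x. ?n x * (if k = i then x ^ r else 1) \<partial>lborel)"
      using expectation_increment_prod[OF assms, of "\<lambda>k x. if k = i then x ^ r else 1"] I
      unfolding single by simp
    also have "\<dots> = (\<Prod>k\<in>UNIV. if k = i then \<integral>x. ?n x * x ^ r \<partial>lborel else 1)"
      by (intro prod.cong refl) (simp add: n0)
    finally show "expectation (\<lambda>w. ((W t w - W s w) $ i) ^ r) = (\<integral>x. ?n x * x ^ r \<partial>lborel)" by (simp add: prod.delta)
  qed
  show "integrable M (\<lambda>w. (W t w - W s w) $ i)" "expectation (\<lambda>w. (W t w - W s w) $ i) = 0"
    using *[of 1] m1 by auto
  show "integrable M (\<lambda>w. ((W t w - W s w) $ i) ^ 4)" "expectation (\<lambda>w. ((W t w - W s w) $ i) ^ 4) = 3 * (t - s)\<^sup>2"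
    using *[of 4] m4 by auto
  show "integrable M (\<lambda>w. (W t w - W s w) $ i * (W t w - W s w) $ j)"
    "expectation (\<lambda>w. (W t w - W s w) $ i * (W t w - W s w) $ j) = (if i = j then t - s else 0)"
  proof (atomize(full), cases "i = j")
    case True
    then show "integrable M (\<lambda>w. (W t w - W s w) $ i * (W t w - W s w) $ j) \<and>
      expectation (\<lambda>w. (W t w - W s w) $ i * (W t w - W s w) $ j) = (if i = j then t - s else 0)"
      using *[of 2] m2 by (auto simp: power2_eq_square)
  next
    case False
    \<comment> \<open>Identity on the two coordinates and 1 elsewhere: since \<open>i\<close> and
      \<open>j\<close> differ, the product of integrals contains the vanishing mean of coordinate
      \<open>i\<close> as a factor.\<close>
    let ?g = "\<lambda>k x :: real. if k \<in> {i, j} then x else 1"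
    have pr: "(\<Prod>k\<in>UNIV. ?g k (x $ k)) = x $ i * x $ j" for x :: "real ^ 'd"
    proof -
      have "(\<Prod>k\<in>UNIV. ?g k (x $ k)) = (\<Prod>k\<in>{i, j}. x $ k)"
        by (rule prod.mono_neutral_cong_right) auto
      then show ?thesis using False by simp
    qed
    have I: "integrable lborel (\<lambda>x. ?n x * ?g k x)" for k
      using mom[of 1] n0 by (cases "k \<in> {i, j}") auto
    have "(\<Prod>k\<in>UNIV. \<integral>x. ?n x * ?g k x \<partial>lborel) = 0"
      using m1 by (intro prod_zero bexI[of _ i]) auto
    then show "integrable M (\<lambda>w. (W t w - W s w) $ i * (W t w - W s w) $ j) \<and>
      expectation (\<lambda>w. (W t w - W s w) $ i * (W t w - W s w) $ j) = (if i = j then t - s else 0)"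
      using integrable_increment_prod[OF assms, of ?g] expectation_increment_prod[OF assms, of ?g] I False
      unfolding pr by simp
  qed
qed

lemma
  fixes Y :: "'w \<Rightarrow> real ^ 'd"
  assumes st: "0 \<le> s" "s < t" and Y: "Y \<in> borel_measurable (G s)" "integrable M Y"
  shows integrable_inner_increment: "integrable M (\<lambda>w. Y w \<bullet> (W t w - W s w))"
    and expectation_inner_increment: "expectation (\<lambda>w. Y w \<bullet> (W t w - W s w)) = 0"
proof -
  have [measurable]: "(\<lambda>w. Y w $ i) \<in> borel_measurable (G s)" for i using Y(1) by measurable
  have I: "integrable M (\<lambda>w. Y w $ i)" for i
    using Bochner_Integration.integrable_inner_left[of "axis i 1" M Y] Y(2) by (simp add: inner_axis)
  have J: "integrable M (\<lambda>w. Y w $ i * (W t w - W s w) $ i)" for i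
    by (rule integrable_increment_mult[where g = "\<lambda>z. z $ i", OF st _ I])
      (use integrable_increment_nth[OF st] in simp_all)
  have E: "expectation (\<lambda>w. Y w $ i * (W t w - W s w) $ i) = 0" for i
    by (subst expectation_increment_mult[where g = "\<lambda>z. z $ i", OF st _ I])
      (use integrable_increment_nth[OF st] expectation_increment_nth[OF st] in simp_all)
  show "integrable M (\<lambda>w. Y w \<bullet> (W t w - W s w))"
    unfolding inner_vec_def using J by simp
  show "expectation (\<lambda>w. Y w \<bullet> (W t w - W s w)) = 0"
    unfolding inner_vec_def using J E by (simp add: Bochner_Integration.integral_sum)
qed

text \<open>\<open>A\<close> is known at time \<open>s\<close> and independent of the increment, so
  each entry factors out; the off-diagonal products have mean 0 and the diagonal ones mean
  \<open>t - s\<close>, which leaves the trace.\<close>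

lemma
  fixes A :: "'w \<Rightarrow> real ^ 'd ^ 'd"
  assumes st: "0 \<le> s" "s < t" and A: "A \<in> borel_measurable (G s)" "integrable M A"
  shows integrable_quadratic_increment: "integrable M (\<lambda>w. (W t w - W s w) \<bullet> (A w *v (W t w - W s w)))"
    and expectation_quadratic_increment:
      "expectation (\<lambda>w. (W t w - W s w) \<bullet> (A w *v (W t w - W s w))) = (t - s) * expectation (\<lambda>w. trace (A w))"
proof -
  let ?Z = "\<lambda>w. W t w - W s w"
  have [measurable]: "(\<lambda>w. A w $ i $ j) \<in> borel_measurable (G s)" for i j using A(1) by measurable
  have I: "integrable M (\<lambda>w. A w $ i $ j)" for i j
    using Bochner_Integration.integrable_inner_left[of "axis i (axis j 1)" M A] A(2) by (simp add: inner_axis)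
  have J: "integrable M (\<lambda>w. A w $ i $ j * (?Z w $ i * ?Z w $ j))" for i j
    by (rule integrable_increment_mult[where g = "\<lambda>z. z $ i * z $ j", OF st _ I])
      (use integrable_increment_nth2[OF st] in simp_all)
  have E: "expectation (\<lambda>w. A w $ i $ j * (?Z w $ i * ?Z w $ j)) = expectation (\<lambda>w. A w $ i $ j) * (if i = j then t - s else 0)" for i j
    by (subst expectation_increment_mult[where g = "\<lambda>z. z $ i * z $ j", OF st _ I])
      (use integrable_increment_nth2[OF st] expectation_increment_nth2[OF st] in simp_all)
  have eq: "?Z w \<bullet> (A w *v ?Z w) = (\<Sum>i\<in>UNIV. \<Sum>j\<in>UNIV. A w $ i $ j * (?Z w $ i * ?Z w $ j))" for w
    by (simp only: inner_vec_def matrix_vector_mult_def vec_lambda_beta inner_real_def sum_distrib_left mult_ac)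
  show "integrable M (\<lambda>w. ?Z w \<bullet> (A w *v ?Z w))"
    unfolding eq using J by (intro Bochner_Integration.integrable_sum) auto
  show "expectation (\<lambda>w. ?Z w \<bullet> (A w *v ?Z w)) = (t - s) * expectation (\<lambda>w. trace (A w))"
    unfolding eq trace_def
    apply (subst Bochner_Integration.integral_sum, intro Bochner_Integration.integrable_sum J)
    apply (subst Bochner_Integration.integral_sum, rule J)
    apply (subst Bochner_Integration.integral_sum, rule I)
    apply (simp only: E)
    apply (simp add: sum_distrib_left if_distrib mult.commute cong: if_cong)
    done
qed

lemma
  fixes Y :: "'w \<Rightarrow> real"
  assumes st: "0 \<le> s" "s < t" and Y: "Y \<in> borel_measurable (G s)" "integrable M Y" "\<And>w. w \<in> space M \<Longrightarrow> Y w \<ge> 0"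
  shows integrable_increment_power4: "integrable M (\<lambda>w. Y w * norm (W t w - W s w) ^ 4)"
    and expectation_increment_power4:
      "expectation (\<lambda>w. Y w * norm (W t w - W s w) ^ 4) \<le> 3 * (real CARD('d))\<^sup>2 * (t - s)\<^sup>2 * expectation Y"
proof -
  let ?Z = "\<lambda>w. W t w - W s w"
  \<comment> \<open>Cauchy-Schwarz over the coordinates costs one factor \<open>CARD('d)\<close>;
    summing the coordinatewise fourth moments \<open>3 * (t - s)\<^sup>2\<close> gives the second
    one.\<close>
  have le: "norm x ^ 4 \<le> real CARD('d) * (\<Sum>i\<in>UNIV. (x $ i) ^ 4)" for x :: "real ^ 'd"
  proof -
    have "norm x ^ 4 = (\<Sum>i\<in>UNIV. (x $ i)\<^sup>2)\<^sup>2"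
      by (simp add: norm_vec_def L2_set_def sum_nonneg power_even_abs flip: power_mult)
        (metis (no_types, lifting) mult_2_right numeral_Bit0 power_add real_sqrt_pow2 sum_nonneg zero_le_power2 power2_eq_square)
    also have "\<dots> \<le> real CARD('d) * (\<Sum>i\<in>UNIV. ((x $ i)\<^sup>2)\<^sup>2)"
      using sum_squared_le_sum_of_squares[of "\<lambda>i. (x $ i)\<^sup>2" UNIV] by (simp add: mult.commute)
    finally show ?thesis by simp
  qed
  have E: "integrable M (\<lambda>w. real CARD('d) * (\<Sum>i\<in>UNIV. (?Z w $ i) ^ 4))"
    "expectation (\<lambda>w. real CARD('d) * (\<Sum>i\<in>UNIV. (?Z w $ i) ^ 4)) = 3 * (real CARD('d))\<^sup>2 * (t - s)\<^sup>2"
    using integrable_increment_nth4[OF st] expectation_increment_nth4[OF st]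
    by (auto simp: power2_eq_square)
  have [measurable]: "W t \<in> borel_measurable M" "W s \<in> borel_measurable M" using st by auto
  have I: "integrable M (\<lambda>w. norm (?Z w) ^ 4)"
    using le by (intro Bochner_Integration.integrable_bound[OF E(1)]) (auto intro!: AE_I2 order_trans[OF le] abs_ge_self)
  show "integrable M (\<lambda>w. Y w * norm (?Z w) ^ 4)"
    by (rule integrable_increment_mult[where g = "\<lambda>z. norm z ^ 4", OF st Y(1,2) _ I]) simp
  have "expectation (\<lambda>w. Y w * norm (?Z w) ^ 4) = expectation Y * expectation (\<lambda>w. norm (?Z w) ^ 4)"
    by (rule expectation_increment_mult[where g = "\<lambda>z. norm z ^ 4", OF st Y(1,2) _ I]) simp
  also have "\<dots> \<le> expectation Y * (3 * (real CARD('d))\<^sup>2 * (t - s)\<^sup>2)"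
  proof (intro mult_left_mono)
    show "expectation (\<lambda>w. norm (?Z w) ^ 4) \<le> 3 * (real CARD('d))\<^sup>2 * (t - s)\<^sup>2"
      unfolding E(2)[symmetric] by (intro integral_mono I E(1) le)
    show "0 \<le> expectation Y" by (intro integral_nonneg_AE AE_I2 Y)
  qed
  finally show "expectation (\<lambda>w. Y w * norm (?Z w) ^ 4) \<le> 3 * (real CARD('d))\<^sup>2 * (t - s)\<^sup>2 * expectation Y"
    by (simp add: mult.commute)
qed

end

section \<open>Isometries for the stochastic integral\<close>

lemma simple_value_diff:
  "simple_value n \<tau> (\<lambda>i w. \<xi> i w - \<eta> i w) s w = simple_value n \<tau> \<xi> s w - simple_value n \<tau> \<eta> s w"
  by (simp add: simple_value_def scaleR_diff_right sum_subtractf)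

lemma simple_ito_diff:
  "simple_ito n \<tau> (\<lambda>i w. \<xi> i w - \<eta> i w) W t w = simple_ito n \<tau> \<xi> W t w - simple_ito n \<tau> \<eta> W t w"
  by (simp add: simple_ito_def matrix_vector_mult_diff_rdistrib sum_subtractf)

text \<open>Telescoping over the cells between \<open>x\<close> and \<open>y\<close>. Selecting the
  cells by an indicator evaluated at the right end point yields exactly the coefficients that appear
  in \<open>simple_value\<close>, so the same identity refines both integrands and
  integrals.\<close>

lemma telescope_refinement:
  fixes F :: "real \<Rightarrow> 'v::real_vector"
  assumes P: "sorted_wrt (<) ps" and N: "length ps = Suc N"
    and xy: "x \<in> set ps" "y \<in> set ps" "x \<le> y"
  shows "F y - F x = (\<Sum>j<N. indicator {x<..y} (ps ! Suc j) *\<^sub>R (F (ps ! Suc j) - F (ps ! j)))"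
proof -
  obtain a b where ab: "x = ps ! a" "y = ps ! b" "a \<le> N" "b \<le> N"
    using xy(1,2) N by (metis in_set_conv_nth less_Suc_eq_le)
  have less: "ps ! i < ps ! j \<longleftrightarrow> i < j" if "i \<le> N" "j \<le> N" for i j
    using sorted_wrt_nth_less[OF P, of i j] sorted_wrt_nth_less[OF P, of j i] that N
    by (cases i j rule: linorder_cases) (auto simp: less_Suc_eq_le)
  have "a \<le> b" using less[of b a] ab xy(3) by (meson linorder_not_less)
  have "indicator {x<..y} (ps ! Suc j) = (if a \<le> j \<and> j < b then 1 else 0 :: real)" if "j < N" for j
    using less[of a "Suc j"] less[of b "Suc j"] that ab by (auto simp: indicator_def not_less[symmetric])
  then have "(\<Sum>j<N. indicator {x<..y} (ps ! Suc j) *\<^sub>R (F (ps ! Suc j) - F (ps ! j)))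
    = (\<Sum>j<N. if a \<le> j \<and> j < b then F (ps ! Suc j) - F (ps ! j) else 0)"
    by (intro sum.cong refl) auto
  also have "\<dots> = (\<Sum>j\<in>{a..<b}. F (ps ! Suc j) - F (ps ! j))"
    using ab by (intro sum.mono_neutral_cong_right) auto
  also have "\<dots> = F y - F x" using \<open>a \<le> b\<close> ab sum_Suc_diff'[of a b "\<lambda>j. F (ps ! j)"] by simp
  finally show ?thesis ..
qed

context brownian_setting
begin

lemma simple_integrand_mono:
  assumes "simple_integrand M G n \<tau> \<xi>" "i \<le> j" "j \<le> n"
  shows "\<tau> i \<le> \<tau> j"
  using assms(2,3)
proof (induction rule: dec_induct)
  case (step m)
  moreover have "\<tau> m \<le> \<tau> (Suc m)" using assms(1) step by (simp add: simple_integrand_def)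
  ultimately show ?case by simp
qed simp

text \<open>A simple integrand is constant on each left-open, right-closed cell of a finer grid, so
  its value at the right end point of the cell serves as the new coefficient.\<close>

lemma simple_integrand_refine:
  assumes S: "simple_integrand M G n \<tau> \<xi>"
    and P: "sorted_wrt (<) ps" "length ps = Suc N" "\<tau> ` {..n} \<subseteq> set ps" "\<And>p. p \<in> set ps \<Longrightarrow> 0 \<le> p"
  defines "\<eta> \<equiv> \<lambda>j w. simple_value n \<tau> \<xi> (ps ! Suc j) w"
  shows "simple_integrand M G N (\<lambda>j. ps ! j) \<eta>"
    and "simple_value N (\<lambda>j. ps ! j) \<eta> s w = simple_value n \<tau> \<xi> s w"
    and "simple_ito N (\<lambda>j. ps ! j) \<eta> W t w = simple_ito n \<tau> \<xi> W t w"
proof -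
  have mono: "\<tau> i \<le> \<tau> (Suc i)" if "i < n" for i using S that by (simp add: simple_integrand_def)
  have mem: "\<tau> i \<in> set ps" if "i \<le> n" for i using P(3) that by auto
  have less: "ps ! i < ps ! j" if "i < j" "j \<le> N" for i j
    using sorted_wrt_nth_less[OF P(1), of i j] that P(2) by auto
  have term_meas: "(\<lambda>w. indicator {\<tau> i<..\<tau> (Suc i)} (ps ! Suc j) *\<^sub>R \<xi> i w) \<in> borel_measurable (G (ps ! j))"
    if ij: "i < n" "j < N" for i j
  proof (cases "ps ! Suc j \<in> {\<tau> i<..\<tau> (Suc i)}")
    case True
    have "\<exists>a. a \<le> N \<and> ps ! a = \<tau> i"
      using mem[of i] ij P(2) by (auto simp: in_set_conv_nth less_Suc_eq_le)
    then obtain a where a: "a \<le> N" "\<tau> i = ps ! a" by force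
    \<comment> \<open>The coefficient of cell \<open>j\<close> must be known at the left end of the
      cell although it is read off at the right end: \<open>\<tau> i\<close> is itself a grid point
      below \<open>ps ! Suc j\<close>, hence at most \<open>ps ! j\<close>.\<close>
    have "\<tau> i \<le> ps ! j"
    proof (rule ccontr)
      assume "\<not> \<tau> i \<le> ps ! j"
      then have "a > j" using a less[of a j] that by (cases a j rule: linorder_cases) auto
      then have "ps ! Suc j \<le> ps ! a" using less[of "Suc j" a] a by (cases "Suc j = a") auto
      with True a show False by auto
    qed
    moreover have "\<xi> i \<in> borel_measurable (G (\<tau> i))" using S that by (simp add: simple_integrand_def)
    ultimately have "\<xi> i \<in> borel_measurable (G (ps ! j))" by (rule measurable_G_mono[rotated])
    then show ?thesis by (intro borel_measurable_scaleR borel_measurable_const)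
  next
    case False
    then have "indicator {\<tau> i<..\<tau> (Suc i)} (ps ! Suc j) = (0 :: real)" by simp
    then show ?thesis by simp
  qed
  show "simple_integrand M G N (\<lambda>j. ps ! j) \<eta>"
    unfolding simple_integrand_def
  proof (intro conjI allI impI)
    show "0 \<le> ps ! 0" using P(2,4) by simp
    show "ps ! j \<le> ps ! Suc j" if "j < N" for j using less[of j "Suc j"] that by simp
    show "\<eta> j \<in> borel_measurable (G (ps ! j))" if "j < N" for j
      unfolding \<eta>_def simple_value_def using that by (intro borel_measurable_sum term_meas) auto
    show "bounded (\<eta> j ` space M)" if "j < N" for j
    proof -
      have "\<exists>b. \<forall>w\<in>space M. norm (\<xi> i w) \<le> b" if "i < n" for i
        using S that unfolding simple_integrand_def bounded_iff by auto
      then obtain b where b: "\<And>i w. i < n \<Longrightarrow> w \<in> space M \<Longrightarrow> norm (\<xi> i w) \<le> b i" by metis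
      have "norm (\<eta> j w) \<le> (\<Sum>i<n. b i)" if "w \<in> space M" for w
        unfolding \<eta>_def simple_value_def
      proof (intro order_trans[OF norm_sum] sum_mono)
        fix i assume "i \<in> {..<n}"
        then have "norm (\<xi> i w) \<le> b i" using b that by simp
        then show "norm (indicator {\<tau> i<..\<tau> (Suc i)} (ps ! Suc j) *\<^sub>R \<xi> i w) \<le> b i"
          using norm_ge_zero[of "\<xi> i w"] by (simp add: indicator_def del: norm_ge_zero)
      qed
      then show ?thesis unfolding bounded_iff by auto
    qed
  qed
  \<comment> \<open>The indicator of \<open>{\<tau> i<..\<tau> (Suc i)}\<close> at \<open>s\<close>
    is written as an increment of \<open>indicator {..<s}\<close>; in this form the telescoping
    identity applies to the integrand as well.\<close>
  have "simple_value n \<tau> \<xi> s w = (\<Sum>i<n. (indicator {..<s} (\<tau> i) - indicator {..<s} (\<tau> (Suc i))) *\<^sub>R \<xi> i w)"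
    unfolding simple_value_def using mono by (intro sum.cong refl) (force simp: indicator_def)
  also have "\<dots> = (\<Sum>i<n. (\<Sum>j<N. indicator {\<tau> i<..\<tau> (Suc i)} (ps ! Suc j) *\<^sub>R
      (indicator {..<s} (ps ! j) - indicator {..<s} (ps ! Suc j))) *\<^sub>R \<xi> i w)"
  proof (intro sum.cong refl)
    fix i assume "i \<in> {..<n}"
    then show "(indicator {..<s} (\<tau> i) - indicator {..<s} (\<tau> (Suc i))) *\<^sub>R \<xi> i w =
      (\<Sum>j<N. indicator {\<tau> i<..\<tau> (Suc i)} (ps ! Suc j) *\<^sub>R
      (indicator {..<s} (ps ! j) - indicator {..<s} (ps ! Suc j))) *\<^sub>R \<xi> i w"
      using telescope_refinement[OF P(1,2) mem[of i] mem[of "Suc i"] mono, of "\<lambda>x. - indicator {..<s} x :: real"]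
      by simp
  qed
  also have "\<dots> = simple_value N (\<lambda>j. ps ! j) \<eta> s w"
  proof -
    have *: "indicator {..<s} (ps ! j) - indicator {..<s} (ps ! Suc j) = (indicator {ps ! j<..ps ! Suc j} s :: real)"
      if "j < N" for j using less[of j "Suc j"] that by (force simp: indicator_def)
    have swap: "(\<Sum>i<n. (\<Sum>j<N. a i j * b j) *\<^sub>R x i) = (\<Sum>j<N. b j *\<^sub>R (\<Sum>i<n. a i j *\<^sub>R x i))"
      for a :: "nat \<Rightarrow> nat \<Rightarrow> real" and b and x :: "nat \<Rightarrow> real ^ 'd ^ 'd"
      unfolding scaleR_sum_left scaleR_sum_right by (subst sum.swap) (simp add: mult.commute)
    show ?thesis unfolding simple_value_def \<eta>_def real_scaleR_def swap
      by (intro sum.cong refl arg_cong2[where f = scaleR] *) simp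
  qed
  finally show "simple_value N (\<lambda>j. ps ! j) \<eta> s w = simple_value n \<tau> \<xi> s w" ..
  have "simple_ito n \<tau> \<xi> W t w = (\<Sum>i<n. \<xi> i w *v (\<Sum>j<N. indicator {\<tau> i<..\<tau> (Suc i)} (ps ! Suc j) *\<^sub>R
      (W (min t (ps ! Suc j)) w - W (min t (ps ! j)) w)))"
    unfolding simple_ito_def
  proof (intro sum.cong refl)
    fix i assume "i \<in> {..<n}"
    then show "\<xi> i w *v (W (min t (\<tau> (Suc i))) w - W (min t (\<tau> i)) w) =
      \<xi> i w *v (\<Sum>j<N. indicator {\<tau> i<..\<tau> (Suc i)} (ps ! Suc j) *\<^sub>R
      (W (min t (ps ! Suc j)) w - W (min t (ps ! j)) w))"
      using telescope_refinement[OF P(1,2) mem[of i] mem[of "Suc i"] mono, of "\<lambda>x. W (min t x) w"]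
      by simp
  qed
  also have "\<dots> = simple_ito N (\<lambda>j. ps ! j) \<eta> W t w"
  proof -
    have lin1: "\<xi> *v (\<Sum>j<N. c j *\<^sub>R v j) = (\<Sum>j<N. (c j *\<^sub>R \<xi>) *v v j)" for \<xi> :: "real ^ 'd ^ 'd" and c :: "nat \<Rightarrow> real" and v
      by (induction N) (simp_all add: matrix_vector_right_distrib matrix_vector_mult_scaleR scaleR_matrix_vector_assoc)
    have lin2: "(\<Sum>i<n. A i) *v v = (\<Sum>i<n. A i *v v)" for A :: "nat \<Rightarrow> real ^ 'd ^ 'd" and v
      by (induction n) (simp_all add: matrix_vector_mult_add_rdistrib)
    show ?thesis unfolding simple_ito_def \<eta>_def simple_value_def lin1 lin2
      by (rule sum.swap)
  qed
  finally show "simple_ito N (\<lambda>j. ps ! j) \<eta> W t w = simple_ito n \<tau> \<xi> W t w" ..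
qed

lemma simple_integrand_nonneg:
  assumes "simple_integrand M G n \<tau> \<xi>" "i \<le> n"
  shows "0 \<le> \<tau> i"
  using simple_integrand_mono[OF assms(1) _ assms(2), of 0] assms(1) by (auto simp: simple_integrand_def)

text \<open>On the union of the two grids both integrands have the same partition, so their
  difference is taken coefficientwise. It lets the isometry for simple integrals compare two
  approximations.\<close>

lemma simple_integrand_diff:
  assumes 1: "simple_integrand M G n\<^sub>1 \<tau>\<^sub>1 \<xi>\<^sub>1" and 2: "simple_integrand M G n\<^sub>2 \<tau>\<^sub>2 \<xi>\<^sub>2"
  obtains n \<tau> \<xi> where "simple_integrand M G n \<tau> \<xi>"
    "\<And>s w. simple_value n \<tau> \<xi> s w = simple_value n\<^sub>1 \<tau>\<^sub>1 \<xi>\<^sub>1 s w - simple_value n\<^sub>2 \<tau>\<^sub>2 \<xi>\<^sub>2 s w"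
    "\<And>t w. simple_ito n \<tau> \<xi> W t w = simple_ito n\<^sub>1 \<tau>\<^sub>1 \<xi>\<^sub>1 W t w - simple_ito n\<^sub>2 \<tau>\<^sub>2 \<xi>\<^sub>2 W t w"
proof -
  define P where "P = \<tau>\<^sub>1 ` {..n\<^sub>1} \<union> \<tau>\<^sub>2 ` {..n\<^sub>2}"
  define ps where "ps = sorted_list_of_set P"
  have ps: "sorted_wrt (<) ps" "set ps = P" by (simp_all add: ps_def P_def)
  have "P \<noteq> {}" by (auto simp: P_def)
  with ps have "ps \<noteq> []" by auto
  then obtain N where N: "length ps = Suc N" by (metis length_Suc_conv list.exhaust)
  have nn: "0 \<le> p" if "p \<in> set ps" for p
    using that simple_integrand_nonneg[OF 1] simple_integrand_nonneg[OF 2] by (auto simp: ps P_def)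
  have sub: "\<tau>\<^sub>1 ` {..n\<^sub>1} \<subseteq> set ps" "\<tau>\<^sub>2 ` {..n\<^sub>2} \<subseteq> set ps" by (auto simp: ps P_def)
  note r1 = simple_integrand_refine[OF 1 ps(1) N sub(1) nn]
  note r2 = simple_integrand_refine[OF 2 ps(1) N sub(2) nn]
  show thesis
  proof (rule that)
    show "simple_integrand M G N (\<lambda>j. ps ! j) (\<lambda>j w. simple_value n\<^sub>1 \<tau>\<^sub>1 \<xi>\<^sub>1 (ps ! Suc j) w - simple_value n\<^sub>2 \<tau>\<^sub>2 \<xi>\<^sub>2 (ps ! Suc j) w)"
      using r1(1) r2(1) unfolding simple_integrand_def 
      by (auto intro!: bounded_minus_comp borel_measurable_diff simp del: borel_measurable_diff)
  qed (simp_all only: simple_value_diff simple_ito_diff r1 r2)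
qed

text \<open>In the expansion of the square the cross term has mean 0 because \<open>S\<close> and
  \<open>\<xi>\<close> are known at \<open>u\<close>, and the quadratic term has mean
  \<open>v - u\<close> times the expected trace of \<open>transpose \<xi> ** \<xi>\<close>, which is
  the squared Frobenius norm.\<close>

lemma increment_isometry_step:
  fixes S :: "'w \<Rightarrow> real ^ 'd" and \<xi> :: "'w \<Rightarrow> real ^ 'd ^ 'd"
  assumes uv: "0 \<le> u" "u < v"
    and S: "S \<in> borel_measurable (G u)" "integrable M (\<lambda>w. (norm (S w))\<^sup>2)"
    and \<xi>: "\<xi> \<in> borel_measurable (G u)" "bounded (\<xi> ` space M)"
  defines "R \<equiv> \<lambda>w. S w + \<xi> w *v (W v w - W u w)"
  shows "integrable M (\<lambda>w. (norm (R w))\<^sup>2)"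
    and "expectation (\<lambda>w. (norm (R w))\<^sup>2)
      = expectation (\<lambda>w. (norm (S w))\<^sup>2) + (v - u) * expectation (\<lambda>w. (norm (\<xi> w))\<^sup>2)"
proof -
  note [measurable] = S(1) \<xi>(1)
  have [measurable]: "S \<in> borel_measurable M" "\<xi> \<in> borel_measurable M"
    by (rule measurable_G[OF S(1)], rule measurable_G[OF \<xi>(1)])
  obtain C where C: "\<And>w. w \<in> space M \<Longrightarrow> norm (\<xi> w) \<le> C" using \<xi>(2) by (auto simp: bounded_iff)
  let ?Z = "\<lambda>w. W v w - W u w"
  let ?Y = "\<lambda>w. transpose (\<xi> w) *v S w" and ?A = "\<lambda>w. transpose (\<xi> w) ** \<xi> w"
  have Y: "?Y \<in> borel_measurable (G u)" by measurable
  have Yi: "integrable M ?Y"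
  proof (rule Bochner_Integration.integrable_bound[of M "\<lambda>w. C * (1 + (norm (S w))\<^sup>2)"])
    show "AE w in M. norm (?Y w) \<le> norm (C * (1 + (norm (S w))\<^sup>2))"
    proof (rule AE_I2)
      fix w assume w: "w \<in> space M"
      have "0 \<le> (norm (S w) - 1)\<^sup>2 + 1" by simp
      then have "norm (S w) \<le> 1 + (norm (S w))\<^sup>2"
        using zero_le_power2[of "norm (S w)"] by (simp add: power2_diff) (smt (verit) power2_eq_square zero_le_power2 norm_ge_zero)
      then have "norm (\<xi> w) * norm (S w) \<le> C * (1 + (norm (S w))\<^sup>2)"
        using C[OF w] order_trans[OF norm_ge_zero C[OF w]] by (intro mult_mono) auto
      then show "norm (?Y w) \<le> norm (C * (1 + (norm (S w))\<^sup>2))"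
        using norm_matrix_vector_mult_le[of "transpose (\<xi> w)" "S w"] by simp
    qed
  qed (use S(2) measurable_G[OF Y] in simp_all)
  have A: "?A \<in> borel_measurable (G u)" by measurable
  have Ai: "integrable M ?A"
  proof (rule Bochner_Integration.integrable_bound[of M "\<lambda>w. C * C"])
    show "AE w in M. norm (?A w) \<le> norm (C * C)"
    proof (rule AE_I2)
      fix w assume w: "w \<in> space M"
      have "norm (\<xi> w) * norm (\<xi> w) \<le> C * C"
        using C[OF w] order_trans[OF norm_ge_zero C[OF w]] by (intro mult_mono) auto
      then show "norm (?A w) \<le> norm (C * C)"
        using norm_matrix_matrix_mult_le[of "transpose (\<xi> w)" "\<xi> w"] by simp
    qed
  qed auto
  have eq: "(norm (R w))\<^sup>2 = (norm (S w))\<^sup>2 + 2 * (?Y w \<bullet> ?Z w) + ?Z w \<bullet> (?A w *v ?Z w)" for w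
    unfolding R_def power2_norm_eq_inner
    by (simp add: inner_add_left inner_add_right inner_commute dot_lmul_matrix[symmetric] matrix_vector_mul_assoc[symmetric]
        vector_transpose_matrix transpose_matrix_vector) 
  have tr: "trace (?A w) = (norm (\<xi> w))\<^sup>2" for w
    unfolding norm_matrix_squared trace_def matrix_matrix_mult_def transpose_def
    by (subst sum.swap) (simp add: power2_eq_square)
  note I = integrable_inner_increment[OF uv Y Yi] integrable_quadratic_increment[OF uv A Ai]
  show "integrable M (\<lambda>w. (norm (R w))\<^sup>2)"
    unfolding eq using S(2) I by auto
  show "expectation (\<lambda>w. (norm (R w))\<^sup>2)
      = expectation (\<lambda>w. (norm (S w))\<^sup>2) + (v - u) * expectation (\<lambda>w. (norm (\<xi> w))\<^sup>2)"
    unfolding eq using S(2) I expectation_inner_increment[OF uv Y Yi] expectation_quadratic_increment[OF uv A Ai]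
    by (simp add: tr)
qed

end

text \<open>Discrete stopping with non-negative increments: if the full sum is at most
  \<open>K\<close>, the selected terms are bounded by it; otherwise the last term is dropped and the
  induction hypothesis applies.\<close>

lemma sum_stopped_le:
  fixes q :: "nat \<Rightarrow> real"
  assumes "\<And>i. q i \<ge> 0" "0 \<le> K"
  shows "(\<Sum>i<n. if (\<Sum>j<Suc i. q j) \<le> K then q i else 0) \<le> min K (\<Sum>i<n. q i)"
proof (induction n)
  case (Suc n)
  have "(\<Sum>i<n. if (\<Sum>j<Suc i. q j) \<le> K then q i else 0) \<le> (\<Sum>i<n. q i)"
    by (intro sum_mono) (use assms in auto)
  then show ?case using Suc assms(1)[of n] by auto
qed (use assms in auto)

text \<open>The cells are disjoint, so the square of the sum is the sum of the squares, and each
  cell contributes the length of its part inside \<open>{s..t}\<close>, written as a difference of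
  clipped end points.\<close>

lemma nn_integral_simple_value:
  fixes \<xi> :: "nat \<Rightarrow> 'w \<Rightarrow> real ^ 'd ^ 'd"
  assumes mono: "\<And>i j. i \<le> j \<Longrightarrow> j \<le> n \<Longrightarrow> \<tau> i \<le> \<tau> j" and st: "s \<le> t"
  shows "(\<integral>\<^sup>+ u\<in>{s..t}. sqnorm (simple_value n \<tau> \<xi> u w) \<partial>lborel)
    = ennreal (\<Sum>i<n. (norm (\<xi> i w))\<^sup>2 * (max s (min t (\<tau> (Suc i))) - max s (min t (\<tau> i))))"
proof -
  have sq: "(norm (simple_value n \<tau> \<xi> u w))\<^sup>2 = (\<Sum>i<n. indicator {\<tau> i<..\<tau> (Suc i)} u * (norm (\<xi> i w))\<^sup>2)" for u
  proof (cases "\<exists>i<n. u \<in> {\<tau> i<..\<tau> (Suc i)}")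
    case True
    then obtain i where i: "i < n" "u \<in> {\<tau> i<..\<tau> (Suc i)}" by blast
    have ne: "u \<notin> {\<tau> j<..\<tau> (Suc j)}" if "j < n" "j \<noteq> i" for j
      using i that mono[of "Suc j" i] mono[of "Suc i" j] by (cases i j rule: linorder_cases) auto
    have "simple_value n \<tau> \<xi> u w = (\<Sum>j<n. if j = i then \<xi> i w else 0)"
      unfolding simple_value_def by (intro sum.cong refl) (use ne i in auto)
    moreover have "(\<Sum>j<n. indicator {\<tau> j<..\<tau> (Suc j)} u * (norm (\<xi> j w))\<^sup>2) = (\<Sum>j<n. if j = i then (norm (\<xi> i w))\<^sup>2 else 0)"
      by (intro sum.cong refl) (use ne i in auto)
    ultimately show ?thesis using i(1) by simp
  next
    case False
    then have "indicator {\<tau> i<..\<tau> (Suc i)} u = (0 :: real)" if "i < n" for i using that by auto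
    then show ?thesis by (simp add: simple_value_def)
  qed
  have "(\<integral>\<^sup>+ u\<in>{s..t}. sqnorm (simple_value n \<tau> \<xi> u w) \<partial>lborel)
      = (\<integral>\<^sup>+ u. (\<Sum>i<n. sqnorm (\<xi> i w) * indicator ({\<tau> i<..\<tau> (Suc i)} \<inter> {s..t}) u) \<partial>lborel)"
    by (intro nn_integral_cong) (auto simp: sq indicator_def sum_nonneg simp flip: sum_ennreal intro!: sum.cong)
  also have "\<dots> = (\<Sum>i<n. sqnorm (\<xi> i w) * emeasure lborel ({\<tau> i<..\<tau> (Suc i)} \<inter> {s..t}))"
    by (subst nn_integral_sum) (auto simp: nn_integral_cmult_indicator)
  also have "\<dots> = (\<Sum>i<n. ennreal ((norm (\<xi> i w))\<^sup>2 * (max s (min t (\<tau> (Suc i))) - max s (min t (\<tau> i)))))"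
  proof (intro sum.cong refl)
    fix i assume "i \<in> {..<n}"
    then have le: "\<tau> i \<le> \<tau> (Suc i)" using mono[of i "Suc i"] by simp
    let ?c = "\<lambda>x. max s (min t x)"
    have le': "?c (\<tau> i) \<le> ?c (\<tau> (Suc i))" using le by auto
    have "emeasure lborel ({\<tau> i<..\<tau> (Suc i)} \<inter> {s..t}) = ennreal (?c (\<tau> (Suc i)) - ?c (\<tau> i))"
    proof (rule antisym)
      have "{\<tau> i<..\<tau> (Suc i)} \<inter> {s..t} \<subseteq> {?c (\<tau> i)..?c (\<tau> (Suc i))}" using st by auto
      then have "emeasure lborel ({\<tau> i<..\<tau> (Suc i)} \<inter> {s..t}) \<le> emeasure lborel {?c (\<tau> i)..?c (\<tau> (Suc i))}"
        by (intro emeasure_mono) auto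
      then show "emeasure lborel ({\<tau> i<..\<tau> (Suc i)} \<inter> {s..t}) \<le> ennreal (?c (\<tau> (Suc i)) - ?c (\<tau> i))" using le' by simp
      have "{?c (\<tau> i)<..?c (\<tau> (Suc i))} \<subseteq> {\<tau> i<..\<tau> (Suc i)} \<inter> {s..t}" using st le by (auto split: if_splits simp: max_def min_def)
      then have "emeasure lborel {?c (\<tau> i)<..?c (\<tau> (Suc i))} \<le> emeasure lborel ({\<tau> i<..\<tau> (Suc i)} \<inter> {s..t})"
        by (intro emeasure_mono) auto
      then show "ennreal (?c (\<tau> (Suc i)) - ?c (\<tau> i)) \<le> emeasure lborel ({\<tau> i<..\<tau> (Suc i)} \<inter> {s..t})" using le' by simp
    qed
    then show "sqnorm (\<xi> i w) * emeasure lborel ({\<tau> i<..\<tau> (Suc i)} \<inter> {s..t})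
        = ennreal ((norm (\<xi> i w))\<^sup>2 * (?c (\<tau> (Suc i)) - ?c (\<tau> i)))"
      using le' by (simp add: ennreal_mult)
  qed
  also have "\<dots> = ennreal (\<Sum>i<n. (norm (\<xi> i w))\<^sup>2 * (max s (min t (\<tau> (Suc i))) - max s (min t (\<tau> i))))"
  proof (rule sum_ennreal)
    fix i assume "i \<in> {..<n}"
    then have "\<tau> i \<le> \<tau> (Suc i)" using mono[of i "Suc i"] by simp
    then have "max s (min t (\<tau> i)) \<le> max s (min t (\<tau> (Suc i)))" by auto
    then show "0 \<le> (norm (\<xi> i w))\<^sup>2 * (max s (min t (\<tau> (Suc i))) - max s (min t (\<tau> i)))" by simp
  qed
  finally show ?thesis .
qed

context brownian_setting
begin

text \<open>Adaptedness is demanded only on cells of positive length. Clipping a grid to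
  \<open>{s..t}\<close> collapses the outer cells to a point, and there \<open>\<xi> i\<close> need
  not be known at the clipped time.\<close>

lemma adapted_sum_isometry:
  fixes \<xi> :: "nat \<Rightarrow> 'w \<Rightarrow> real ^ 'd ^ 'd"
  assumes c: "\<And>i. i < n \<Longrightarrow> 0 \<le> c i \<and> c i \<le> c (Suc i)"
    and \<xi>: "\<And>i. i < n \<Longrightarrow> c i < c (Suc i) \<Longrightarrow> \<xi> i \<in> borel_measurable (G (c i)) \<and> bounded (\<xi> i ` space M)"
    and k: "k \<le> n"
  defines "S \<equiv> \<lambda>k w. \<Sum>i<k. \<xi> i w *v (W (c (Suc i)) w - W (c i) w)"
  shows "S k \<in> borel_measurable (G (c k)) \<and> integrable M (\<lambda>w. (norm (S k w))\<^sup>2) \<and>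
    expectation (\<lambda>w. (norm (S k w))\<^sup>2) = (\<Sum>i<k. (c (Suc i) - c i) * expectation (\<lambda>w. (norm (\<xi> i w))\<^sup>2))"
  using k
proof (induction k)
  case 0
  then show ?case by (simp add: S_def)
next
  case (Suc k)
  then have IH: "S k \<in> borel_measurable (G (c k))" "integrable M (\<lambda>w. (norm (S k w))\<^sup>2)"
    "expectation (\<lambda>w. (norm (S k w))\<^sup>2) = (\<Sum>i<k. (c (Suc i) - c i) * expectation (\<lambda>w. (norm (\<xi> i w))\<^sup>2))"
    by auto
  have ck: "0 \<le> c k" "c k \<le> c (Suc k)" using c Suc(2) by auto
  have S: "S (Suc k) = (\<lambda>w. S k w + \<xi> k w *v (W (c (Suc k)) w - W (c k) w))" by (simp add: S_def)
  show ?case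
  proof (cases "c k < c (Suc k)")
    case False
    then have "c (Suc k) = c k" using ck by simp
    then show ?thesis using IH unfolding S by simp
  next
    case True
    with \<xi> Suc(2) have \<xi>k: "\<xi> k \<in> borel_measurable (G (c k))" "bounded (\<xi> k ` space M)" by auto
    have [measurable]: "S k \<in> borel_measurable (G (c (Suc k)))" "\<xi> k \<in> borel_measurable (G (c (Suc k)))"
      "W (c (Suc k)) \<in> borel_measurable (G (c (Suc k)))" "W (c k) \<in> borel_measurable (G (c (Suc k)))"
      using IH(1) \<xi>k(1) W_measurable_G[of "c k"] W_measurable_G[of "c (Suc k)"] ck
      by (meson measurable_G_mono order_trans)+
    have "S (Suc k) \<in> borel_measurable (G (c (Suc k)))" unfolding S by measurable
    with increment_isometry_step[OF ck(1) True IH(1,2) \<xi>k] IH(3) show ?thesis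
      unfolding S by simp
  qed
qed

lemma simple_ito_increment:
  assumes "s \<le> t"
  shows "simple_ito n \<tau> \<xi> W t w - simple_ito n \<tau> \<xi> W s w
    = (\<Sum>i<n. \<xi> i w *v (W (max s (min t (\<tau> (Suc i)))) w - W (max s (min t (\<tau> i))) w))"
proof -
  have "W (min t x) w - W (min s x) w = W (max s (min t x)) w - W s w" for x
    using assms by (auto simp: min_def max_def)
  moreover have "(W (min t x) w - W (min t y) w) - (W (min s x) w - W (min s y) w)
      = (W (min t x) w - W (min s x) w) - (W (min t y) w - W (min s y) w)" for x y
    by (simp add: algebra_simps)
  ultimately have "(W (min t x) w - W (min t y) w) - (W (min s x) w - W (min s y) w)
      = W (max s (min t x)) w - W (max s (min t y)) w" for x y
    by simp
  then show ?thesis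
    unfolding simple_ito_def sum_subtractf[symmetric] matrix_vector_mult_diff_distrib[symmetric] by simp
qed

lemma simple_ito_measurable:
  assumes "simple_integrand M G n \<tau> \<xi>" "0 \<le> t"
  shows "simple_ito n \<tau> \<xi> W t \<in> borel_measurable M"
proof -
  have [measurable]: "\<xi> i \<in> borel_measurable M" if "i < n" for i
    using assms(1) that measurable_G unfolding simple_integrand_def by blast
  have [measurable]: "W (min t (\<tau> i)) \<in> borel_measurable M" if "i \<le> n" for i
    using simple_integrand_nonneg[OF assms(1) that] assms(2) by simp
  show ?thesis unfolding simple_ito_def
    by (intro borel_measurable_sum borel_measurable_matrix_vector_mult borel_measurable_diff) auto
qed

text \<open>The simple integral is stopped at the first grid index at which the accumulated quadratic variation would
  exceed \<open>K\<close>; the stopped coefficients remain adapted to the grid of \<open>\<xi>\<close>.\<close>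

lemma simple_ito_truncated_isometry:
  assumes S: "simple_integrand M G n \<tau> \<xi>" and st: "0 \<le> s" "s \<le> t" and B: "B \<in> sets (G s)" and K: "0 \<le> K"
  defines "q \<equiv> \<lambda>w. \<integral>\<^sup>+ u\<in>{s..t}. sqnorm (simple_value n \<tau> \<xi> u w) \<partial>lborel"
  shows "(\<integral>\<^sup>+ w. indicator B w * indicator {w. q w \<le> ennreal K} w *
      sqnorm (simple_ito n \<tau> \<xi> W t w - simple_ito n \<tau> \<xi> W s w) \<partial>M)
    \<le> (\<integral>\<^sup>+ w. indicator B w * min (ennreal K) (q w) \<partial>M)"
proof -
  define c where "c i = max s (min t (\<tau> i))" for i
  define p where "p i w = (norm (\<xi> i w))\<^sup>2 * (c (Suc i) - c i)" for i w
  define A where "A k w = (\<Sum>i<k. p i w)" for k w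
  have mono: "\<tau> i \<le> \<tau> j" if "i \<le> j" "j \<le> n" for i j using simple_integrand_mono[OF S that] .
  have c: "0 \<le> c i \<and> c i \<le> c (Suc i)" if "i < n" for i
    using st mono[of i "Suc i"] that by (auto simp: c_def)
  have p: "0 \<le> p i w" if "i < n" for i w using c[OF that] by (simp add: p_def)
  have q: "q w = ennreal (A n w)" for w
    unfolding q_def A_def p_def c_def by (rule nn_integral_simple_value[OF mono st(2)])
  have \<xi>M [measurable]: "\<xi> i \<in> borel_measurable M" if "i < n" for i
    using S that measurable_G unfolding simple_integrand_def by blast
  have \<xi>b: "bounded (\<xi> i ` space M)" if "i < n" for i using S that unfolding simple_integrand_def by blast
  have B' [measurable]: "B \<in> sets M" using B sets_G_subset by blast
  have pM [measurable]: "p i \<in> borel_measurable M" if "i < n" for i unfolding p_def using that by measurable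
  have AM [measurable]: "A k \<in> borel_measurable M" if "k \<le> n" for k
    unfolding A_def using that by (intro borel_measurable_sum pM) auto
  \<comment> \<open>The test involves \<open>A (Suc i)\<close>, which already includes the
    contribution of cell \<open>i\<close>: it is known at the left end of the cell because
    \<open>\<xi> i\<close> is, and it keeps the stopped variation below \<open>K\<close> without
    overshoot.\<close>
  define \<eta> where "\<eta> i w = (if w \<in> B \<and> A (Suc i) w \<le> K then \<xi> i w else 0)" for i w
  have adapted: "\<eta> i \<in> borel_measurable (G (c i))" if i: "i < n" "c i < c (Suc i)" for i
  proof -
    have \<tau>c: "\<tau> i \<le> c i" "s \<le> c i" using i(2) by (auto simp: c_def)
    have m [measurable]: "\<xi> j \<in> borel_measurable (G (c i))" if "j \<le> i" for j
    proof (rule measurable_G_mono)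
      show "\<xi> j \<in> borel_measurable (G (\<tau> j))" using S that i(1) by (simp add: simple_integrand_def)
      show "\<tau> j \<le> c i" using mono[of j i] that i(1) \<tau>c by auto
    qed
    have [measurable]: "B \<in> sets (G (c i))" using B sets_G_mono[OF \<tau>c(2)] by blast
    have [measurable]: "A (Suc i) \<in> borel_measurable (G (c i))"
      unfolding A_def p_def
      by (intro borel_measurable_sum borel_measurable_times borel_measurable_power borel_measurable_const
          measurable_compose[OF m borel_measurable_norm]) auto
    have [measurable]: "\<xi> i \<in> borel_measurable (G (c i))" by (rule m) simp
    show ?thesis unfolding \<eta>_def by measurable
  qed
  have bounded: "bounded (\<eta> i ` space M)" if i: "i < n" for i
  proof -
    obtain b where "\<And>w. w \<in> space M \<Longrightarrow> norm (\<xi> i w) \<le> b" using \<xi>b[OF i] by (auto simp: bounded_iff)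
    moreover have "norm (\<eta> i w) \<le> norm (\<xi> i w)" for w by (simp add: \<eta>_def)
    ultimately show ?thesis unfolding bounded_iff by (auto intro: order_trans)
  qed
  define R where "R w = (\<Sum>i<n. \<eta> i w *v (W (c (Suc i)) w - W (c i) w))" for w
  have iso: "integrable M (\<lambda>w. (norm (R w))\<^sup>2)"
    "expectation (\<lambda>w. (norm (R w))\<^sup>2) = (\<Sum>i<n. (c (Suc i) - c i) * expectation (\<lambda>w. (norm (\<eta> i w))\<^sup>2))"
    using adapted_sum_isometry[of n c \<eta> n] c adapted bounded unfolding R_def by auto
  have \<eta>M [measurable]: "\<eta> i \<in> borel_measurable M" if "i < n" for i
  proof -
    have [measurable]: "A (Suc i) \<in> borel_measurable M" by (rule AM) (use that in simp)
    show ?thesis unfolding \<eta>_def using that by measurable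
  qed
  have \<eta>i: "integrable M (\<lambda>w. (norm (\<eta> i w))\<^sup>2)" if i: "i < n" for i
  proof -
    obtain b where b: "\<And>w. w \<in> space M \<Longrightarrow> norm (\<eta> i w) \<le> b" using bounded[OF i] by (auto simp: bounded_iff)
    show ?thesis using i b
      by (intro integrable_const_bound[where B = "b\<^sup>2"] AE_I2) (auto intro: power_mono)
  qed
  have "(\<integral>\<^sup>+ w. indicator B w * indicator {w. q w \<le> ennreal K} w *
      sqnorm (simple_ito n \<tau> \<xi> W t w - simple_ito n \<tau> \<xi> W s w) \<partial>M) \<le> (\<integral>\<^sup>+ w. sqnorm (R w) \<partial>M)"
  proof (intro nn_integral_mono)
    fix w
    show "indicator B w * indicator {w. q w \<le> ennreal K} w *
      sqnorm (simple_ito n \<tau> \<xi> W t w - simple_ito n \<tau> \<xi> W s w) \<le> sqnorm (R w)"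
    proof (cases "w \<in> B \<and> A n w \<le> K")
      case True
      \<comment> \<open>On this event the total variation is at most \<open>K\<close>, so no
        coefficient has been stopped.\<close>
      have "A (Suc i) w \<le> K" if "i < n" for i
      proof -
        have "A (Suc i) w \<le> A n w" unfolding A_def using that by (intro sum_mono2) (auto intro: p)
        with True show ?thesis by simp
      qed
      then have "\<eta> i w = \<xi> i w" if "i < n" for i using True that by (simp add: \<eta>_def)
      then have "R w = simple_ito n \<tau> \<xi> W t w - simple_ito n \<tau> \<xi> W s w"
        unfolding simple_ito_increment[OF st(2)] R_def c_def by simp
      then show ?thesis by (simp add: indicator_def)
    next
      case False
      then show ?thesis using K by (auto simp: indicator_def q)
    qed
  qed
  also have "\<dots> = ennreal (expectation (\<lambda>w. (norm (R w))\<^sup>2))"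
    by (rule nn_integral_eq_integral[OF iso(1)]) simp
  also have "expectation (\<lambda>w. (norm (R w))\<^sup>2) = expectation (\<lambda>w. \<Sum>i<n. (c (Suc i) - c i) * (norm (\<eta> i w))\<^sup>2)"
    unfolding iso(2) by (subst Bochner_Integration.integral_sum) (auto intro!: \<eta>i)
  also have "ennreal \<dots> = (\<integral>\<^sup>+ w. ennreal (\<Sum>i<n. (c (Suc i) - c i) * (norm (\<eta> i w))\<^sup>2) \<partial>M)"
    by (subst nn_integral_eq_integral) (use c in \<open>auto intro!: \<eta>i sum_nonneg\<close>)
  also have "\<dots> \<le> (\<integral>\<^sup>+ w. indicator B w * min (ennreal K) (q w) \<partial>M)"
  proof (intro nn_integral_mono)
    fix w
    have "(\<Sum>i<n. (c (Suc i) - c i) * (norm (\<eta> i w))\<^sup>2) = indicator B w * (\<Sum>i<n. if A (Suc i) w \<le> K then p i w else 0)"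
      unfolding sum_distrib_left by (intro sum.cong refl) (auto simp: \<eta>_def p_def indicator_def)
    also have "(\<Sum>i<n. if A (Suc i) w \<le> K then p i w else 0)
        = (\<Sum>i<n. if (\<Sum>j<Suc i. (if j < n then p j w else 0)) \<le> K then (if i < n then p i w else 0) else 0)"
      unfolding A_def by (intro sum.cong refl if_cong arg_cong2[where f = "(\<le>)"]) auto
    also have "\<dots> \<le> min K (\<Sum>i<n. if i < n then p i w else 0)"
      by (rule sum_stopped_le) (use p K in auto)
    also have "\<dots> = min K (A n w)" unfolding A_def by (intro arg_cong2[where f = min] sum.cong) auto
    finally have "(\<Sum>i<n. (c (Suc i) - c i) * (norm (\<eta> i w))\<^sup>2) \<le> indicator B w * min K (A n w)"
      by (simp add: mult_left_mono)
    then have "ennreal (\<Sum>i<n. (c (Suc i) - c i) * (norm (\<eta> i w))\<^sup>2) \<le> ennreal (indicator B w * min K (A n w))"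
      by (rule ennreal_leI)
    also have "\<dots> = indicator B w * min (ennreal K) (q w)"
    proof -
      have "0 \<le> A n w" unfolding A_def by (intro sum_nonneg p) auto
      then show ?thesis by (simp add: q min_def ennreal_le_iff indicator_def)
    qed
    finally show "ennreal (\<Sum>i<n. (c (Suc i) - c i) * (norm (\<eta> i w))\<^sup>2) \<le> indicator B w * min (ennreal K) (q w)" .
  qed
  finally show ?thesis .
qed

end

text \<open>The process is evaluated at the last multiple of 1/(k + 1) before \<open>u\<close>. Only
  countably many times occur, which gives joint measurability, and path continuity gives
  convergence.\<close>

lemma borel_measurable_continuous_path:
  fixes Y :: "real \<Rightarrow> 'w \<Rightarrow> 'b::metric_space"
  assumes meas: "\<And>u. Y u \<in> borel_measurable N" and cont: "\<And>w. w \<in> space N \<Longrightarrow> continuous_on UNIV (\<lambda>u. Y u w)"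
  shows "(\<lambda>(u, w). Y u w) \<in> borel_measurable (borel \<Otimes>\<^sub>M N)"
proof (rule borel_measurable_LIMSEQ_metric)
  define p where "p k u = real_of_int \<lfloor>u * real (Suc k)\<rfloor> / real (Suc k)" for k u
  show "(\<lambda>(u, w). Y (p k u) w) \<in> borel_measurable (borel \<Otimes>\<^sub>M N)" for k
  proof -
    have "(\<lambda>x. Y (real_of_int \<lfloor>fst x * real (Suc k)\<rfloor> / real (Suc k)) (snd x)) \<in> borel_measurable (borel \<Otimes>\<^sub>M N)"
      by (rule measurable_compose_countable[where f = "\<lambda>i x. Y (real_of_int i / real (Suc k)) (snd x)"
            and g = "\<lambda>x. \<lfloor>fst x * real (Suc k)\<rfloor>"]) (use meas in measurable)
    then show ?thesis by (simp add: p_def split_def)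
  qed
  have p: "(\<lambda>k. p k u) \<longlonglongrightarrow> u" for u
  proof (rule tendsto_sandwich)
    have "u - 1 / real (Suc k) \<le> p k u \<and> p k u \<le> u" for k
    proof -
      let ?n = "real (Suc k)"
      have "u - 1 / ?n = (u * ?n - 1) / ?n" "u = (u * ?n) / ?n" by (simp_all add: field_simps)
      moreover have "u * ?n - 1 \<le> \<lfloor>u * ?n\<rfloor>" "\<lfloor>u * ?n\<rfloor> \<le> u * ?n" by linarith+
      ultimately show ?thesis unfolding p_def by (metis divide_right_mono of_nat_0_le_iff)
    qed
    then show "\<forall>\<^sub>F k in sequentially. u - 1 / real (Suc k) \<le> p k u" "\<forall>\<^sub>F k in sequentially. p k u \<le> u" by auto
    show "(\<lambda>k. u - 1 / real (Suc k)) \<longlonglongrightarrow> u"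
      using tendsto_diff[OF tendsto_const LIMSEQ_inverse_real_of_nat, of u] by (simp add: inverse_eq_divide)
  qed simp
  fix x assume "x \<in> space (borel \<Otimes>\<^sub>M N :: (real \<times> 'w) measure)"
  then obtain u w where x: "x = (u, w)" "w \<in> space N" by (auto simp: space_pair_measure)
  have "isCont (\<lambda>u. Y u w) u" using cont[OF x(2)] by (simp add: continuous_on_eq_continuous_at)
  then have "(\<lambda>k. Y (p k u) w) \<longlonglongrightarrow> Y u w" using p by (rule isCont_tendsto_compose)
  then show "(\<lambda>k. (\<lambda>(u, w). Y (p k u) w) x) \<longlonglongrightarrow> (\<lambda>(u, w). Y u w) x" by (simp add: x)
qed

lemma enn2real_min_1_tendsto_0D:
  fixes y :: "nat \<Rightarrow> ennreal"
  assumes "(\<lambda>k. enn2real (min 1 (y k))) \<longlonglongrightarrow> 0"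
  shows "y \<longlonglongrightarrow> 0"
proof (rule order_tendstoI)
  have "(\<lambda>k. ennreal (enn2real (min 1 (y k)))) \<longlonglongrightarrow> ennreal 0" by (intro tendsto_ennrealI assms)
  moreover have "ennreal (enn2real (min 1 (y k))) = min 1 (y k)" for k
    by (rule ennreal_enn2real) (simp add: min_less_iff_disj)
  ultimately have lim: "(\<lambda>k. min 1 (y k)) \<longlonglongrightarrow> 0" by simp
  fix a :: ennreal assume "0 < a"
  then have "\<forall>\<^sub>F k in sequentially. min 1 (y k) < min 1 a" by (intro order_tendstoD(2)[OF lim]) simp
  then show "\<forall>\<^sub>F k in sequentially. y k < a" by eventually_elim (auto simp: min_def split: if_splits)
qed simp

text \<open>Convergence in probability is expressed as convergence in mean of the variables capped
  at 1; in this form an almost surely convergent subsequence can be extracted.\<close>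

lemma (in prob_space) expectation_min_1_tendsto_0:
  fixes Y :: "nat \<Rightarrow> 'a \<Rightarrow> ennreal"
  assumes [measurable]: "\<And>k. Y k \<in> borel_measurable M"
    and lim: "\<And>\<eta>. \<eta> > 0 \<Longrightarrow> (\<lambda>k. measure M {w \<in> space M. Y k w > ennreal \<eta>}) \<longlonglongrightarrow> 0"
  shows "(\<lambda>k. expectation (\<lambda>w. enn2real (min 1 (Y k w)))) \<longlonglongrightarrow> 0"
proof (rule LIMSEQ_I)
  fix e :: real assume e: "0 < e"
  have le1: "enn2real (min 1 y) \<le> 1" for y :: ennreal using enn2real_mono[of "min 1 y" 1] by simp
  have *: "expectation (\<lambda>w. enn2real (min 1 (Y k w))) \<le> e / 2 + prob {w \<in> space M. Y k w > ennreal (e / 2)}" for k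
  proof -
    have "expectation (\<lambda>w. enn2real (min 1 (Y k w))) \<le> expectation (\<lambda>w. e / 2 + indicator {w \<in> space M. Y k w > ennreal (e / 2)} w)"
    proof (intro integral_mono)
      show "integrable M (\<lambda>w. enn2real (min 1 (Y k w)))"
        by (intro integrable_const_bound[where B = 1] AE_I2) (auto simp: le1)
      fix w assume "w \<in> space M"
      show "enn2real (min 1 (Y k w)) \<le> e / 2 + indicator {w \<in> space M. Y k w > ennreal (e / 2)} w"
      proof (cases "Y k w > ennreal (e / 2)")
        case True
        then show ?thesis using le1[of "Y k w"] e \<open>w \<in> space M\<close> by simp
      next
        case False
        then have "min 1 (Y k w) \<le> ennreal (e / 2)" by (simp add: min.coboundedI2)
        from enn2real_mono[OF this] False e show ?thesis by simp
      qed
    qed (auto intro!: integrable_real_indicator simp: emeasure_eq_measure)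
    then show ?thesis by (simp add: emeasure_eq_measure prob_space)
  qed
  have "\<forall>\<^sub>F k in sequentially. prob {w \<in> space M. Y k w > ennreal (e / 2)} < e / 2"
    using order_tendstoD(2)[OF lim[of "e / 2"], of "e / 2"] e by simp
  then obtain K where "\<And>k. k \<ge> K \<Longrightarrow> prob {w \<in> space M. Y k w > ennreal (e / 2)} < e / 2"
    by (auto simp: eventually_sequentially)
  then show "\<exists>K. \<forall>k\<ge>K. norm (expectation (\<lambda>w. enn2real (min 1 (Y k w))) - 0) < e"
    using * by (intro exI[of _ K] allI impI) (smt (verit) field_sum_of_halves integral_nonneg_AE AE_I2 enn2real_nonneg real_norm_def)
qed

text \<open>Young's inequality with a free weight: the factor of the first term can be brought
  arbitrarily near 1, so a passage to the limit loses no constant. With \<open>\<theta> = 1\<close>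
  it is the usual factor 2.\<close>

lemma norm_add_squared_le:
  fixes x y :: "'a::real_inner"
  assumes "\<theta> > 0"
  shows "(norm (x + y))\<^sup>2 \<le> (1 + \<theta>) * (norm x)\<^sup>2 + (1 + 1 / \<theta>) * (norm y)\<^sup>2"
proof -
  have "0 \<le> (sqrt \<theta> * norm x - norm y / sqrt \<theta>)\<^sup>2" by simp
  also have "\<dots> = \<theta> * (norm x)\<^sup>2 + (norm y)\<^sup>2 / \<theta> - 2 * (norm x * norm y)"
    using assms by (simp add: power2_diff power_mult_distrib power_divide)
  finally have "2 * (norm x * norm y) \<le> \<theta> * (norm x)\<^sup>2 + (norm y)\<^sup>2 / \<theta>" by simp
  moreover have "(norm (x + y))\<^sup>2 \<le> (norm x + norm y)\<^sup>2" by (intro power_mono norm_triangle_ineq) simp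
  ultimately show ?thesis by (simp add: power2_sum algebra_simps)
qed

section \<open>The stochastic integral of the diffusion coefficient\<close>

locale ito_diffusion = brownian_setting M G W
  for M :: "'w measure" and G :: "real \<Rightarrow> 'w measure" and W :: "real \<Rightarrow> 'w \<Rightarrow> real ^ 'd" +
  fixes X :: "real \<Rightarrow> 'w \<Rightarrow> real ^ 'd" and \<beta> :: "real ^ 'd \<Rightarrow> real ^ 'd"
    and S :: "real ^ 'd \<Rightarrow> real ^ 'd ^ 'd" and I :: "real \<Rightarrow> 'w \<Rightarrow> real ^ 'd"
  assumes X_adapted: "continuous_adapted M G X"
    and \<beta>_measurable [measurable]: "\<beta> \<in> borel_measurable borel"
    and S_measurable [measurable]: "S \<in> borel_measurable borel"
    and ito: "has_ito_integral M G W (\<lambda>s w. S (X s w)) I"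
    and X_eq: "AE w in M. \<forall>t\<ge>0. set_integrable lborel {0..t} (\<lambda>s. \<beta> (X s w)) \<and>
      X t w = X 0 w + (LINT s:{0..t}|lborel. \<beta> (X s w)) + I t w"
begin

text \<open>Extending the process constantly to negative times makes its paths continuous on the
  whole line, so that joint measurability can be stated without restricting the time domain.\<close>

definition path :: "real \<Rightarrow> 'w \<Rightarrow> real ^ 'd" where
  "path u w = X (max 0 u) w"

lemma path_nonneg [simp]: "0 \<le> u \<Longrightarrow> path u = X u"
  by (simp add: path_def fun_eq_iff)

lemma continuous_path:
  assumes "w \<in> space M"
  shows "continuous_on UNIV (\<lambda>u. path u w)"
proof -
  have "continuous_on {0..} (\<lambda>t. X t w)" using X_adapted assms unfolding continuous_adapted_def by blast
  moreover have "continuous_on UNIV (\<lambda>u :: real. max 0 u)" by (intro continuous_intros)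
  ultimately show ?thesis unfolding path_def by (rule continuous_on_compose2) auto
qed

lemma X_measurable_G: "0 \<le> u \<Longrightarrow> X u \<in> borel_measurable (G u)"
  using X_adapted unfolding continuous_adapted_def by blast

lemma path_measurable_G: "u \<le> t \<Longrightarrow> 0 \<le> t \<Longrightarrow> path u \<in> borel_measurable (G t)"
  using measurable_G_mono[OF X_measurable_G[of "max 0 u"], of t] by (simp add: path_def[abs_def])

lemma path_joint_measurable [measurable (raw)]:
  assumes [measurable]: "f \<in> borel_measurable N" "g \<in> measurable N M"
  shows "(\<lambda>x. path (f x) (g x)) \<in> borel_measurable N"
proof -
  have "(\<lambda>(u, w). path u w) \<in> borel_measurable (borel \<Otimes>\<^sub>M M)"
  proof (rule borel_measurable_continuous_path)
    show "path u \<in> borel_measurable M" for u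
      by (rule measurable_G[OF path_measurable_G[of u "max 0 u"]]) auto
  qed (rule continuous_path)
  from measurable_compose[OF measurable_Pair[OF assms(1,2)] this] show ?thesis unfolding prod.case .
qed

lemma path_joint_measurable_G:
  assumes [measurable]: "f \<in> borel_measurable N" "g \<in> measurable N (G t)" and t: "0 \<le> t"
  shows "(\<lambda>x. path (min (f x) t) (g x)) \<in> borel_measurable N"
proof -
  have "(\<lambda>(u, w). path (min u t) w) \<in> borel_measurable (borel \<Otimes>\<^sub>M G t)"
  proof (rule borel_measurable_continuous_path)
    show "path (min u t) \<in> borel_measurable (G t)" for u by (rule path_measurable_G) (use t in auto)
    show "continuous_on UNIV (\<lambda>u. path (min u t) w)" if "w \<in> space (G t)" for w
      by (rule continuous_on_compose2[OF continuous_path]) (use that in \<open>auto intro!: continuous_intros\<close>)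
  qed
  from measurable_compose[OF measurable_Pair[OF assms(1,2)] this] show ?thesis unfolding prod.case .
qed

lemma I_measurable: "0 \<le> t \<Longrightarrow> I t \<in> borel_measurable M"
  using ito measurable_G[of "I t" t] by (auto simp: has_ito_integral_def continuous_adapted_def)

lemma simple_value_joint_measurable:
  assumes "simple_integrand M G n \<tau> \<xi>" and [measurable]: "f \<in> borel_measurable N" "g \<in> measurable N M"
  shows "(\<lambda>x. simple_value n \<tau> \<xi> (f x) (g x)) \<in> borel_measurable N"
proof -
  have [measurable]: "\<xi> i \<in> borel_measurable M" if "i < n" for i
    using assms(1) that measurable_G unfolding simple_integrand_def by blast
  show ?thesis unfolding simple_value_def
    by (intro borel_measurable_sum borel_measurable_scaleR) auto
qed

definition sq_dist :: "nat \<Rightarrow> (nat \<Rightarrow> real) \<Rightarrow> (nat \<Rightarrow> 'w \<Rightarrow> real ^ 'd ^ 'd) \<Rightarrow> real \<Rightarrow> real \<Rightarrow> 'w \<Rightarrow> ennreal" where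
  "sq_dist n \<tau> \<xi> s t w = (\<integral>\<^sup>+ u\<in>{s..t}. sqnorm (S (path u w) - simple_value n \<tau> \<xi> u w) \<partial>lborel)"

lemma sq_dist_measurable [measurable]:
  assumes "simple_integrand M G n \<tau> \<xi>"
  shows "sq_dist n \<tau> \<xi> s t \<in> borel_measurable M"
proof -
  note [measurable (raw)] = simple_value_joint_measurable[OF assms]
  show ?thesis unfolding sq_dist_def[abs_def] by measurable
qed

lemma ito_approximation:
  obtains N :: "nat \<Rightarrow> nat" and T \<Xi> where "\<And>k. simple_integrand M G (N k) (T k) (\<Xi> k)"
    "\<And>t \<eta>. 0 \<le> t \<Longrightarrow> 0 < \<eta> \<Longrightarrow> (\<lambda>k. measure M {w \<in> space M. sq_dist (N k) (T k) (\<Xi> k) 0 t w > ennreal \<eta>}) \<longlonglongrightarrow> 0"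
    "\<And>t \<eta>. 0 \<le> t \<Longrightarrow> 0 < \<eta> \<Longrightarrow>
      (\<lambda>k. measure M {w \<in> space M. ennreal (dist (simple_ito (N k) (T k) (\<Xi> k) W t w) (I t w)) > ennreal \<eta>}) \<longlonglongrightarrow> 0"
proof -
  obtain N T \<Xi> where S: "\<And>k::nat. simple_integrand M G (N k) (T k) (\<Xi> k)"
    and c: "\<And>t. 0 \<le> t \<Longrightarrow> (\<forall>\<eta>>0. (\<lambda>k. measure M {w \<in> space M.
             (\<integral>\<^sup>+ s\<in>{0..t}. sqnorm (simple_value (N k) (T k) (\<Xi> k) s w - S (X s w)) \<partial>lborel)
               > ennreal \<eta>}) \<longlonglongrightarrow> 0) \<and>
          tendsto_in_prob M (\<lambda>k. simple_ito (N k) (T k) (\<Xi> k) W t) (I t) sequentially"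
    using ito unfolding has_ito_integral_def by blast
  have "sq_dist (N k) (T k) (\<Xi> k) 0 t w
      = (\<integral>\<^sup>+ s\<in>{0..t}. sqnorm (simple_value (N k) (T k) (\<Xi> k) s w - S (X s w)) \<partial>lborel)" for k t w
    unfolding sq_dist_def by (intro nn_integral_cong) (simp add: norm_minus_commute indicator_def)
  moreover have "(ennreal (dist a b) > ennreal \<eta>) = (dist a b > \<eta>)" if "\<eta> > 0" for a b :: "real ^ 'd" and \<eta>
    using that by (simp add: ennreal_less_iff)
  ultimately show thesis using S c
    by (intro that[of N T \<Xi>]) (auto simp: tendsto_in_prob_def)
qed

text \<open>The truncated isometry is applied to the difference of an approximating simple integrand
  and the given one, along an almost surely convergent subsequence. The strict inequality
  \<open>q w < ennreal L\<close> leaves room: eventually the approximate variations are below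
  \<open>L\<close> as well, so Fatou's lemma applies. On the right, the approximate variation is at
  most 1 + \<theta> times \<open>q\<close> plus a multiple of a vanishing error, and finally
  \<theta> tends to 0.\<close>

lemma ito_truncated_isometry:
  assumes K: "simple_integrand M G n \<tau> \<xi>" and st: "0 \<le> s" "s \<le> t" and B: "B \<in> sets (G s)" and L: "0 \<le> L"
  defines "D \<equiv> \<lambda>w. (I t w - I s w) - (simple_ito n \<tau> \<xi> W t w - simple_ito n \<tau> \<xi> W s w)"
  defines "q \<equiv> sq_dist n \<tau> \<xi> s t"
  shows "(\<integral>\<^sup>+ w. indicator B w * indicator {w. q w < ennreal L} w * sqnorm (D w) \<partial>M)
    \<le> (\<integral>\<^sup>+ w. indicator B w * min (ennreal L) (q w) \<partial>M)"
proof -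
  have BM [measurable]: "B \<in> sets M" using B sets_G_subset by blast
  have t: "0 \<le> t" using st by simp
  obtain N :: "nat \<Rightarrow> nat" and T \<Xi> where H: "\<And>k. simple_integrand M G (N k) (T k) (\<Xi> k)"
    and c1: "\<And>t \<eta>. 0 \<le> t \<Longrightarrow> 0 < \<eta> \<Longrightarrow> (\<lambda>k. measure M {w \<in> space M. sq_dist (N k) (T k) (\<Xi> k) 0 t w > ennreal \<eta>}) \<longlonglongrightarrow> 0"
    and c2: "\<And>t \<eta>. 0 \<le> t \<Longrightarrow> 0 < \<eta> \<Longrightarrow>
      (\<lambda>k. measure M {w \<in> space M. ennreal (dist (simple_ito (N k) (T k) (\<Xi> k) W t w) (I t w)) > ennreal \<eta>}) \<longlonglongrightarrow> 0"
    using ito_approximation by blast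
  note [measurable (raw)] = simple_value_joint_measurable[OF K] simple_value_joint_measurable[OF H]
  note [measurable] = sq_dist_measurable[OF K] sq_dist_measurable[OF H] I_measurable[OF st(1)] I_measurable[OF t]
    simple_ito_measurable[OF H st(1)] simple_ito_measurable[OF H t] simple_ito_measurable[OF K st(1)] simple_ito_measurable[OF K t]
  have "\<forall>k. \<exists>n' \<tau>' \<xi>'. simple_integrand M G n' \<tau>' \<xi>' \<and>
      (\<forall>s w. simple_value n' \<tau>' \<xi>' s w = simple_value (N k) (T k) (\<Xi> k) s w - simple_value n \<tau> \<xi> s w) \<and>
      (\<forall>t w. simple_ito n' \<tau>' \<xi>' W t w = simple_ito (N k) (T k) (\<Xi> k) W t w - simple_ito n \<tau> \<xi> W t w)"
    by (intro allI) (rule simple_integrand_diff[OF H K], blast)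
  then obtain n' \<tau>' \<xi>' where d: "\<And>k. simple_integrand M G (n' k) (\<tau>' k) (\<xi>' k)"
    "\<And>k s w. simple_value (n' k) (\<tau>' k) (\<xi>' k) s w = simple_value (N k) (T k) (\<Xi> k) s w - simple_value n \<tau> \<xi> s w"
    "\<And>k t w. simple_ito (n' k) (\<tau>' k) (\<xi>' k) W t w = simple_ito (N k) (T k) (\<Xi> k) W t w - simple_ito n \<tau> \<xi> W t w"
    by metis
  note [measurable (raw)] = simple_value_joint_measurable[OF d(1)]
  note [measurable] = simple_ito_measurable[OF d(1) st(1)] simple_ito_measurable[OF d(1) t]
  define D' where "D' k w = simple_ito (n' k) (\<tau>' k) (\<xi>' k) W t w - simple_ito (n' k) (\<tau>' k) (\<xi>' k) W s w" for k w
  define q' where "q' k w = (\<integral>\<^sup>+ u\<in>{s..t}. sqnorm (simple_value (n' k) (\<tau>' k) (\<xi>' k) u w) \<partial>lborel)" for k w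
  define r where "r k = sq_dist (N k) (T k) (\<Xi> k) 0 t" for k
  define dt where "dt k w = ennreal (dist (simple_ito (N k) (T k) (\<Xi> k) W t w) (I t w))" for k w
  define ds where "ds k w = ennreal (dist (simple_ito (N k) (T k) (\<Xi> k) W s w) (I s w))" for k w
  have [measurable]: "D' k \<in> borel_measurable M" "q' k \<in> borel_measurable M" "r k \<in> borel_measurable M"
    "dt k \<in> borel_measurable M" "ds k \<in> borel_measurable M" "D \<in> borel_measurable M" "q \<in> borel_measurable M" for k
    unfolding D'_def q'_def r_def dt_def ds_def D_def q_def by measurable
  \<comment> \<open>The sum of the three capped errors, so that one subsequence serves the variation
    and the integrals at both times.\<close>
  define F where "F k w = enn2real (min 1 (r k w)) + enn2real (min 1 (dt k w)) + enn2real (min 1 (ds k w))" for k w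
  have le1: "enn2real (min 1 y) \<le> 1" for y :: ennreal using enn2real_mono[of "min 1 y" 1] by simp
  have int1: "integrable M (\<lambda>w. enn2real (min 1 (Y w)))" if [measurable]: "Y \<in> borel_measurable M" for Y
    by (intro integrable_const_bound[where B = 1] AE_I2) (auto simp: le1)
  have "(\<lambda>k. expectation (F k)) \<longlonglongrightarrow> 0 + 0 + 0"
    unfolding F_def
    by (subst Bochner_Integration.integral_add, (intro int1 Bochner_Integration.integrable_add; measurable)+)+
      (intro tendsto_add expectation_min_1_tendsto_0;
        use c1[OF t] c2[OF t] c2[OF st(1)] in \<open>simp add: r_def dt_def ds_def\<close>)
  moreover have "norm (F k w) = F k w" for k w by (simp add: F_def)
  moreover have "integrable M (F k)" for k
    unfolding F_def by (intro int1 Bochner_Integration.integrable_add) measurable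
  ultimately obtain \<rho> where \<rho>: "strict_mono \<rho>" and AE: "AE w in M. (\<lambda>k. F (\<rho> k) w) \<longlonglongrightarrow> 0"
    using tendsto_L1_AE_subseq[of M F] by auto
  have conv: "AE w in M. (\<lambda>k. r (\<rho> k) w) \<longlonglongrightarrow> 0 \<and> (\<lambda>k. D' (\<rho> k) w) \<longlonglongrightarrow> D w"
    using AE
  proof eventually_elim
    case (elim w)
    have F0: "(\<lambda>k. enn2real (min 1 (Y k))) \<longlonglongrightarrow> 0" if "\<And>k. enn2real (min 1 (Y k)) \<le> F (\<rho> k) w" for Y
      by (rule tendsto_sandwich[OF _ _ tendsto_const elim]) (use that in auto)
    have r0: "(\<lambda>k. r (\<rho> k) w) \<longlonglongrightarrow> 0" by (intro enn2real_min_1_tendsto_0D F0) (simp add: F_def)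
    have dt0: "(\<lambda>k. dt (\<rho> k) w) \<longlonglongrightarrow> 0" by (intro enn2real_min_1_tendsto_0D F0) (simp add: F_def)
    have ds0: "(\<lambda>k. ds (\<rho> k) w) \<longlonglongrightarrow> 0" by (intro enn2real_min_1_tendsto_0D F0) (simp add: F_def)
    have "(\<lambda>k. simple_ito (N (\<rho> k)) (T (\<rho> k)) (\<Xi> (\<rho> k)) W t w) \<longlonglongrightarrow> I t w"
      "(\<lambda>k. simple_ito (N (\<rho> k)) (T (\<rho> k)) (\<Xi> (\<rho> k)) W s w) \<longlonglongrightarrow> I s w"
      using dt0 ds0 unfolding dt_def ds_def ennreal_0[symmetric]
      by (subst (asm) (1 2) tendsto_ennreal_iff; simp add: tendsto_dist_iff[symmetric])+
    then have "(\<lambda>k. D' (\<rho> k) w) \<longlonglongrightarrow> (I t w - simple_ito n \<tau> \<xi> W t w) - (I s w - simple_ito n \<tau> \<xi> W s w)"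
      unfolding D'_def d by (intro tendsto_intros)
    with r0 show ?case by (simp add: D_def algebra_simps)
  qed
  have q'_le: "q' k w \<le> ennreal (1 + \<theta>) * q w + ennreal (1 + 1 / \<theta>) * r k w" if \<theta>: "\<theta> > 0" and w: "w \<in> space M" for k w \<theta>
  proof -
    note [measurable] = w
    have "q' k w \<le> (\<integral>\<^sup>+ u. ennreal (1 + \<theta>) * (sqnorm (S (path u w) - simple_value n \<tau> \<xi> u w) * indicator {s..t} u)
        + ennreal (1 + 1 / \<theta>) * (sqnorm (S (path u w) - simple_value (N k) (T k) (\<Xi> k) u w) * indicator {0..t} u) \<partial>lborel)"
      unfolding q'_def
    proof (intro nn_integral_mono)
      fix u :: real
      let ?a = "S (path u w) - simple_value n \<tau> \<xi> u w"
      let ?b = "S (path u w) - simple_value (N k) (T k) (\<Xi> k) u w"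
      have "(norm (simple_value (n' k) (\<tau>' k) (\<xi>' k) u w))\<^sup>2 \<le> (1 + \<theta>) * (norm ?a)\<^sup>2 + (1 + 1 / \<theta>) * (norm ?b)\<^sup>2"
        using norm_add_squared_le[OF \<theta>, of ?a "- ?b"] by (simp add: d algebra_simps norm_minus_commute)
      then show "sqnorm (simple_value (n' k) (\<tau>' k) (\<xi>' k) u w) * indicator {s..t} u
        \<le> ennreal (1 + \<theta>) * (sqnorm ?a * indicator {s..t} u)
        + ennreal (1 + 1 / \<theta>) * (sqnorm ?b * indicator {0..t} u)"
        using \<theta> st by (auto simp: indicator_def simp flip: ennreal_mult ennreal_plus intro!: ennreal_leI)
    qed
    also have "\<dots> = ennreal (1 + \<theta>) * q w + ennreal (1 + 1 / \<theta>) * r k w"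
      unfolding q_def r_def sq_dist_def
      by (subst nn_integral_add, measurable, subst nn_integral_cmult, measurable, subst nn_integral_cmult, measurable)
    finally show ?thesis .
  qed
  define R where "R = (\<integral>\<^sup>+ w. indicator B w * min (ennreal L) (q w) \<partial>M)"
  have R: "R \<le> ennreal L"
  proof -
    have "R \<le> (\<integral>\<^sup>+ w. ennreal L \<partial>M)" unfolding R_def by (intro nn_integral_mono) (auto simp: indicator_def)
    then show ?thesis by (simp add: emeasure_space_1)
  qed
  define E where "E = (\<integral>\<^sup>+ w. indicator B w * indicator {w. q w < ennreal L} w * sqnorm (D w) \<partial>M)"
  have "E \<le> (\<integral>\<^sup>+ w. liminf (\<lambda>k. indicator B w * indicator {w. q' (\<rho> k) w \<le> ennreal L} w * sqnorm (D' (\<rho> k) w)) \<partial>M)"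
    unfolding E_def
  proof (rule nn_integral_mono_AE)
    show "AE w in M. indicator B w * indicator {w. q w < ennreal L} w * sqnorm (D w)
      \<le> liminf (\<lambda>k. indicator B w * indicator {w. q' (\<rho> k) w \<le> ennreal L} w * sqnorm (D' (\<rho> k) w))"
      using conv AE_space
    proof eventually_elim
      case (elim w)
      show ?case
      proof (cases "w \<in> B \<and> q w < ennreal L")
        case True
        then obtain x where x: "q w = ennreal x" "0 \<le> x" "x < L"
          using L by (cases "q w" rule: ennreal_cases) (auto simp: ennreal_less_iff)
        \<comment> \<open>Half of the gap between \<open>x\<close> and \<open>L\<close>, divided by
          1 + x: then \<open>(1 + \<theta>) * x\<close> stays below \<open>L\<close>, also for
          \<open>x = 0\<close>.\<close>
        define \<theta> where "\<theta> = (L - x) / (2 * (1 + x))"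
        have \<theta>: "\<theta> > 0" using x by (simp add: \<theta>_def)
        have "(1 + \<theta>) * x \<le> x + (L - x) / 2"
        proof -
          have "\<theta> * x \<le> \<theta> * (1 + x)" using \<theta> by simp
          also have "\<dots> = (L - x) / 2" using x by (simp add: \<theta>_def field_simps)
          finally show ?thesis by (simp add: algebra_simps)
        qed
        also have "x + (L - x) / 2 < L" using x by (simp add: field_simps)
        finally have lt: "(1 + \<theta>) * x < L" .
        have "(\<lambda>k. ennreal (1 + \<theta>) * q w + ennreal (1 + 1 / \<theta>) * r (\<rho> k) w) \<longlonglongrightarrow> ennreal (1 + \<theta>) * q w + ennreal (1 + 1 / \<theta>) * 0"
          using elim by (intro tendsto_add tendsto_const ennreal_tendsto_cmult) auto
        moreover have "ennreal (1 + \<theta>) * q w + ennreal (1 + 1 / \<theta>) * 0 < ennreal L"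
        proof -
          have eq: "ennreal (1 + \<theta>) * q w = ennreal ((1 + \<theta>) * x)"
            unfolding x(1) by (rule ennreal_mult[symmetric]) (use \<theta> x in auto)
          show ?thesis unfolding eq using lt \<theta> x by (simp add: ennreal_less_iff)
        qed
        ultimately have "\<forall>\<^sub>F k in sequentially. ennreal (1 + \<theta>) * q w + ennreal (1 + 1 / \<theta>) * r (\<rho> k) w < ennreal L"
          by (rule order_tendstoD)
        then have "\<forall>\<^sub>F k in sequentially. sqnorm (D' (\<rho> k) w)
          = indicator B w * indicator {w. q' (\<rho> k) w \<le> ennreal L} w * sqnorm (D' (\<rho> k) w)"
        proof eventually_elim
          case (elim k)
          then have "q' (\<rho> k) w \<le> ennreal L" using q'_le[OF \<theta> \<open>w \<in> space M\<close>, of "\<rho> k"] by simp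
          then show ?case using True by simp
        qed
        moreover have "(\<lambda>k. sqnorm (D' (\<rho> k) w)) \<longlonglongrightarrow> sqnorm (D w)"
          using elim by (intro tendsto_intros) auto
        ultimately have "(\<lambda>k. indicator B w * indicator {w. q' (\<rho> k) w \<le> ennreal L} w * sqnorm (D' (\<rho> k) w))
          \<longlonglongrightarrow> sqnorm (D w)"
          by (rule Lim_transform_eventually[rotated])
        from lim_imp_Liminf[OF _ this] True show ?thesis by simp
      qed (auto simp: indicator_def)
    qed
  qed
  also have "\<dots> \<le> liminf (\<lambda>k. \<integral>\<^sup>+ w. indicator B w * indicator {w. q' (\<rho> k) w \<le> ennreal L} w * sqnorm (D' (\<rho> k) w) \<partial>M)"
    by (intro nn_integral_liminf) measurable
  also have "\<dots> \<le> liminf (\<lambda>k. \<integral>\<^sup>+ w. indicator B w * min (ennreal L) (q' (\<rho> k) w) \<partial>M)"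
    unfolding D'_def q'_def
    by (intro Liminf_mono always_eventually allI simple_ito_truncated_isometry[OF d(1) st B L])
  finally have E_le: "E \<le> liminf (\<lambda>k. \<integral>\<^sup>+ w. indicator B w * min (ennreal L) (q' (\<rho> k) w) \<partial>M)" .
  have E_le': "E \<le> ennreal (1 + \<theta>) * R" if \<theta>: "\<theta> > 0" for \<theta>
  proof -
    \<comment> \<open>The cap \<open>L\<close> is kept on both parts: the first then reproduces the
      right-hand side, the second is dominated by a constant and tends to 0.\<close>
    have min_le: "min (ennreal L) (q' k w) \<le> ennreal (1 + \<theta>) * min (ennreal L) (q w) + min (ennreal L) (ennreal (1 + 1 / \<theta>) * r k w)"
      if "w \<in> space M" for k w
    proof -
      have 1: "1 \<le> ennreal (1 + \<theta>)" using \<theta> by (simp add: ennreal_1[symmetric] del: ennreal_1)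
      have "ennreal L \<le> ennreal (1 + \<theta>) * ennreal L" using mult_right_mono[OF 1, of "ennreal L"] by simp
      then show ?thesis using q'_le[OF \<theta> that, of k]
        by (auto simp: min_def not_le intro: order_trans add_increasing2 add_increasing)
    qed
    let ?e = "\<lambda>k. \<integral>\<^sup>+ w. min (ennreal L) (ennreal (1 + 1 / \<theta>) * r (\<rho> k) w) \<partial>M"
    have "?e \<longlonglongrightarrow> (\<integral>\<^sup>+ w. 0 \<partial>M)"
    proof (rule nn_integral_dominated_convergence[where w = "\<lambda>_. ennreal L"])
      show "AE w in M. (\<lambda>k. min (ennreal L) (ennreal (1 + 1 / \<theta>) * r (\<rho> k) w)) \<longlonglongrightarrow> 0"
        using conv
      proof eventually_elim
        case (elim w)
        then have "(\<lambda>k. min (ennreal L) (ennreal (1 + 1 / \<theta>) * r (\<rho> k) w)) \<longlonglongrightarrow> min (ennreal L) (ennreal (1 + 1 / \<theta>) * 0)"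
          by (intro tendsto_min tendsto_const ennreal_tendsto_cmult) auto
        then show ?case by simp
      qed
    qed (auto simp: emeasure_space_1)
    then have e0: "(\<lambda>k. ennreal (1 + \<theta>) * R + ?e k) \<longlonglongrightarrow> ennreal (1 + \<theta>) * R + 0"
      by (intro tendsto_add tendsto_const) simp
    have "liminf (\<lambda>k. \<integral>\<^sup>+ w. indicator B w * min (ennreal L) (q' (\<rho> k) w) \<partial>M) \<le> liminf (\<lambda>k. ennreal (1 + \<theta>) * R + ?e k)"
    proof (intro Liminf_mono always_eventually allI)
      fix k
      have "(\<integral>\<^sup>+ w. indicator B w * min (ennreal L) (q' (\<rho> k) w) \<partial>M)
        \<le> (\<integral>\<^sup>+ w. ennreal (1 + \<theta>) * (indicator B w * min (ennreal L) (q w)) + min (ennreal L) (ennreal (1 + 1 / \<theta>) * r (\<rho> k) w) \<partial>M)"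
        using min_le by (intro nn_integral_mono) (auto simp: indicator_def)
      also have "\<dots> = ennreal (1 + \<theta>) * R + ?e k"
        unfolding R_def by (subst nn_integral_add, measurable, subst nn_integral_cmult, measurable)
      finally show "(\<integral>\<^sup>+ w. indicator B w * min (ennreal L) (q' (\<rho> k) w) \<partial>M) \<le> ennreal (1 + \<theta>) * R + ?e k" .
    qed
    also have "\<dots> = ennreal (1 + \<theta>) * R" using lim_imp_Liminf[OF _ e0] by simp
    finally show ?thesis using E_le by simp
  qed
  have "E \<le> R"
  proof (rule ennreal_le_epsilon)
    fix e :: real assume e: "0 < e"
    \<comment> \<open>Since \<open>R\<close> is at most \<open>L\<close>, the surplus
      \<open>\<theta> * R\<close> is at most \<open>e\<close>; the 1 in the denominator covers
      \<open>L = 0\<close>.\<close>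
    define \<theta> where "\<theta> = e / (1 + L)"
    have \<theta>: "\<theta> > 0" using e L by (simp add: \<theta>_def)
    have "E \<le> ennreal (1 + \<theta>) * R" by (rule E_le'[OF \<theta>])
    also have "\<dots> = R + ennreal \<theta> * R" using \<theta> by (simp add: distrib_right)
    also have "ennreal \<theta> * R \<le> ennreal \<theta> * ennreal L" using R by (intro mult_left_mono) auto
    also have "\<dots> = ennreal (\<theta> * L)" using \<theta> L by (simp add: ennreal_mult)
    also have "\<dots> \<le> ennreal e" using e L by (intro ennreal_leI) (simp add: \<theta>_def field_simps)
    finally show "E \<le> R + ennreal e" by (simp add: add_left_mono)
  qed
  then show ?thesis by (simp only: E_def R_def)
qed

end

lemma nn_integral_le_liminf:
  assumes [measurable]: "\<And>i :: nat. F i \<in> borel_measurable M"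
    and "AE x in M. f x \<le> liminf (\<lambda>i. F i x)" and "\<And>i. i \<ge> i\<^sub>0 \<Longrightarrow> (\<integral>\<^sup>+ x. F i x \<partial>M) \<le> B"
  shows "(\<integral>\<^sup>+ x. f x \<partial>M) \<le> B"
proof -
  have "(\<integral>\<^sup>+ x. f x \<partial>M) \<le> (\<integral>\<^sup>+ x. liminf (\<lambda>i. F i x) \<partial>M)" by (intro nn_integral_mono_AE assms(2))
  also have "\<dots> \<le> liminf (\<lambda>i. \<integral>\<^sup>+ x. F i x \<partial>M)" by (rule nn_integral_liminf) measurable
  also have "\<dots> \<le> liminf (\<lambda>i :: nat. B)"
    using assms(3) by (intro Liminf_mono eventually_sequentiallyI[of i\<^sub>0])
  finally show ?thesis by (simp add: Liminf_const)
qed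

context ito_diffusion
begin

text \<open>The level \<open>real k\<close> in the truncated isometry tends to infinity. If the
  right-hand side is finite, the variation is almost surely finite on \<open>B\<close>, so every
  such path is eventually below the level.\<close>

lemma ito_isometry_le:
  assumes K: "simple_integrand M G n \<tau> \<xi>" and st: "0 \<le> s" "s \<le> t" and B: "B \<in> sets (G s)"
  shows "(\<integral>\<^sup>+ w. indicator B w * sqnorm ((I t w - I s w) - (simple_ito n \<tau> \<xi> W t w - simple_ito n \<tau> \<xi> W s w)) \<partial>M)
    \<le> (\<integral>\<^sup>+ w. indicator B w * sq_dist n \<tau> \<xi> s t w \<partial>M)"
proof (cases "(\<integral>\<^sup>+ w. indicator B w * sq_dist n \<tau> \<xi> s t w \<partial>M) = \<infinity>")
  case False
  have [measurable]: "B \<in> sets M" using B sets_G_subset by blast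
  have t: "0 \<le> t" using st by simp
  define D where "D w = (I t w - I s w) - (simple_ito n \<tau> \<xi> W t w - simple_ito n \<tau> \<xi> W s w)" for w
  define q where "q = sq_dist n \<tau> \<xi> s t"
  note [measurable] = sq_dist_measurable[OF K] I_measurable[OF st(1)] I_measurable[OF t]
    simple_ito_measurable[OF K st(1)] simple_ito_measurable[OF K t]
  have [measurable]: "D \<in> borel_measurable M" "q \<in> borel_measurable M" unfolding D_def q_def by measurable
  let ?F = "\<lambda>k w. indicator B w * indicator {w. q w < ennreal (real k)} w * sqnorm (D w)"
  have fin: "AE w in M. indicator B w * q w \<noteq> \<infinity>"
    using False unfolding q_def[symmetric] by (intro nn_integral_PInf_AE) auto
  have "(\<integral>\<^sup>+ w. indicator B w * sqnorm (D w) \<partial>M) \<le> (\<integral>\<^sup>+ w. indicator B w * q w \<partial>M)"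
  proof (rule nn_integral_le_liminf[where F = ?F and i\<^sub>0 = 0])
    show "AE w in M. indicator B w * sqnorm (D w) \<le> liminf (\<lambda>k. ?F k w)"
      using fin
    proof eventually_elim
      case (elim w)
      show ?case
      proof (cases "w \<in> B")
        case True
        then obtain x where x: "q w = ennreal x" "0 \<le> x" using elim by (cases "q w" rule: ennreal_cases) auto
        obtain k0 where "x < real k0" using reals_Archimedean2 by blast
        then show ?thesis
          using True x by (intro Liminf_bounded eventually_sequentiallyI[of k0]) (auto simp: ennreal_less_iff)
      qed simp
    qed
    fix k
    have "(\<integral>\<^sup>+ w. ?F k w \<partial>M) \<le> (\<integral>\<^sup>+ w. indicator B w * min (ennreal (real k)) (q w) \<partial>M)"
      unfolding D_def q_def by (rule ito_truncated_isometry[OF K st B]) simp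
    also have "\<dots> \<le> (\<integral>\<^sup>+ w. indicator B w * q w \<partial>M)"
      by (intro nn_integral_mono mult_left_mono) auto
    finally show "(\<integral>\<^sup>+ w. ?F k w \<partial>M) \<le> (\<integral>\<^sup>+ w. indicator B w * q w \<partial>M)" .
  qed measurable
  then show ?thesis unfolding D_def q_def .
qed simp

text \<open>Chebyshev's inequality applied to the truncated isometry: a simple form of Lenglart's
  inequality, which turns a small variation into a small probability of a large integral.\<close>

lemma ito_deviation:
  assumes K: "simple_integrand M G n \<tau> \<xi>" and st: "0 \<le> s" "s \<le> t" and L: "0 \<le> L" and \<eta>: "0 < \<eta>"
  shows "measure M {w \<in> space M. sq_dist n \<tau> \<xi> s t w < ennreal L \<and>
      \<eta> \<le> norm ((I t w - I s w) - (simple_ito n \<tau> \<xi> W t w - simple_ito n \<tau> \<xi> W s w))} \<le> L / \<eta>\<^sup>2"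
proof -
  have t: "0 \<le> t" using st by simp
  define D where "D w = (I t w - I s w) - (simple_ito n \<tau> \<xi> W t w - simple_ito n \<tau> \<xi> W s w)" for w
  define q where "q = sq_dist n \<tau> \<xi> s t"
  note [measurable] = sq_dist_measurable[OF K] I_measurable[OF st(1)] I_measurable[OF t]
    simple_ito_measurable[OF K st(1)] simple_ito_measurable[OF K t]
  have [measurable]: "D \<in> borel_measurable M" "q \<in> borel_measurable M" unfolding D_def q_def by measurable
  define E where "E = {w \<in> space M. q w < ennreal L \<and> \<eta> \<le> norm (D w)}"
  have [measurable]: "E \<in> sets M" unfolding E_def by measurable
  have B: "space M \<in> sets (G s)" using sets.top[of "G s"] by simp
  have "ennreal (\<eta>\<^sup>2) * emeasure M E = (\<integral>\<^sup>+ w. ennreal (\<eta>\<^sup>2) * indicator E w \<partial>M)"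
    by (simp add: nn_integral_cmult_indicator)
  also have "\<dots> \<le> (\<integral>\<^sup>+ w. indicator (space M) w * indicator {w. q w < ennreal L} w * sqnorm (D w) \<partial>M)"
    using \<eta> by (intro nn_integral_mono) (auto simp: E_def indicator_def intro!: ennreal_leI power_mono)
  also have "\<dots> \<le> (\<integral>\<^sup>+ w. indicator (space M) w * min (ennreal L) (q w) \<partial>M)"
    unfolding D_def q_def by (rule ito_truncated_isometry[OF K st B L])
  also have "\<dots> \<le> (\<integral>\<^sup>+ w. ennreal L \<partial>M)" by (intro nn_integral_mono) (auto simp: indicator_def)
  also have "\<dots> = ennreal L" by (simp add: emeasure_space_1)
  finally have "ennreal (\<eta>\<^sup>2 * measure M E) \<le> ennreal L"
    by (simp add: emeasure_eq_measure ennreal_mult)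
  then have "\<eta>\<^sup>2 * measure M E \<le> L" using L by (simp add: ennreal_le_iff)
  then have "measure M E \<le> L / \<eta>\<^sup>2" using \<eta> by (simp add: field_simps)
  then show ?thesis unfolding E_def q_def D_def .
qed

text \<open>A bounded coefficient frozen at time \<open>s\<close> is a simple integrand with one
  cell. An unbounded one is first restricted to the events \<open>B k\<close>, which belong to
  \<open>G s\<close>, and \<open>k\<close> then tends to infinity.\<close>

lemma ito_increment_frozen:
  assumes st: "0 \<le> s" "s \<le> t" and \<zeta>: "\<zeta> \<in> borel_measurable (G s)"
  shows "(\<integral>\<^sup>+ w. sqnorm ((I t w - I s w) - \<zeta> w *v (W t w - W s w)) \<partial>M)
    \<le> (\<integral>\<^sup>+ w. (\<integral>\<^sup>+ u\<in>{s..t}. sqnorm (S (path u w) - \<zeta> w) \<partial>lborel) \<partial>M)"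
proof -
  have t: "0 \<le> t" using st by simp
  note [measurable] = I_measurable[OF st(1)] I_measurable[OF t] W_measurable[OF st(1)] W_measurable[OF t] measurable_G[OF \<zeta>]
  define B where "B k = {w \<in> space M. norm (\<zeta> w) \<le> real k}" for k
  have BG: "B k \<in> sets (G s)" for k
  proof -
    have "{w \<in> space (G s). norm (\<zeta> w) \<le> real k} \<in> sets (G s)" using \<zeta> by measurable
    then show ?thesis by (simp add: B_def)
  qed
  have [measurable]: "B k \<in> sets M" for k using BG sets_G_subset by blast
  define D where "D w = (I t w - I s w) - \<zeta> w *v (W t w - W s w)" for w
  have [measurable]: "D \<in> borel_measurable M" unfolding D_def by measurable
  define q where "q w = (\<integral>\<^sup>+ u\<in>{s..t}. sqnorm (S (path u w) - \<zeta> w) \<partial>lborel)" for w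
  have le: "(\<integral>\<^sup>+ w. indicator (B k) w * sqnorm (D w) \<partial>M) \<le> (\<integral>\<^sup>+ w. q w \<partial>M)" for k
  proof -
    define \<tau> where "\<tau> i = (if i = 0 then s else t)" for i :: nat
    define \<xi> where "\<xi> i w = (if w \<in> B k then \<zeta> w else 0)" for i :: nat and w
    have "\<xi> 0 \<in> borel_measurable (G s)" unfolding \<xi>_def using \<zeta> BG[of k] by measurable
    moreover have "bounded (\<xi> 0 ` space M)" unfolding bounded_iff by (auto simp: \<xi>_def B_def intro!: exI[of _ "real k"])
    ultimately have K: "simple_integrand M G 1 \<tau> \<xi>"
      unfolding simple_integrand_def using st by (simp add: \<tau>_def)
    have ito: "simple_ito 1 \<tau> \<xi> W t w - simple_ito 1 \<tau> \<xi> W s w = \<zeta> w *v (W t w - W s w)" if "w \<in> B k" for w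
      using that st by (simp add: simple_ito_def \<tau>_def \<xi>_def min_def)
    \<comment> \<open>The simple integrand vanishes at the left end point \<open>s\<close> of its
      cell, so the two integrands agree only up to one point.\<close>
    have sq: "sq_dist 1 \<tau> \<xi> s t w = q w" if "w \<in> B k" for w
      unfolding sq_dist_def q_def using that AE_lborel_singleton[of s]
      by (intro nn_integral_cong_AE) (auto elim!: eventually_mono simp: simple_value_def \<tau>_def \<xi>_def indicator_def)
    have "(\<integral>\<^sup>+ w. indicator (B k) w * sqnorm (D w) \<partial>M)
      = (\<integral>\<^sup>+ w. indicator (B k) w * sqnorm ((I t w - I s w) - (simple_ito 1 \<tau> \<xi> W t w - simple_ito 1 \<tau> \<xi> W s w)) \<partial>M)"
      by (intro nn_integral_cong) (auto simp: D_def ito[simplified] indicator_def)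
    also have "\<dots> \<le> (\<integral>\<^sup>+ w. indicator (B k) w * sq_dist 1 \<tau> \<xi> s t w \<partial>M)"
      by (rule ito_isometry_le[OF K st BG])
    also have "\<dots> \<le> (\<integral>\<^sup>+ w. q w \<partial>M)"
      by (intro nn_integral_mono) (auto simp: sq[simplified] indicator_def)
    finally show ?thesis .
  qed
  have "(\<integral>\<^sup>+ w. sqnorm (D w) \<partial>M) \<le> (\<integral>\<^sup>+ w. q w \<partial>M)"
  proof (rule nn_integral_le_liminf[OF _ AE_I2 le])
    fix w assume w: "w \<in> space M"
    obtain k0 where "norm (\<zeta> w) < real k0" using reals_Archimedean2 by blast
    then show "sqnorm (D w) \<le> liminf (\<lambda>k. indicator (B k) w * sqnorm (D w))"
      using w by (intro Liminf_bounded eventually_sequentiallyI[of k0]) (auto simp: B_def)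
  qed measurable
  then show ?thesis unfolding D_def q_def .
qed

end

section \<open>Taylor expansion along a Gaussian step\<close>

locale C2_test_function =
  fixes f :: "real ^ 'd \<Rightarrow> real" and g :: "real ^ 'd \<Rightarrow> real ^ 'd" and H :: "real ^ 'd \<Rightarrow> real ^ 'd ^ 'd" and b :: real
  assumes f_derivative: "\<And>x. (f has_derivative (\<lambda>v. g x \<bullet> v)) (at x)"
    and g_derivative: "\<And>x. (g has_derivative (\<lambda>v. H x *v v)) (at x)"
    and f_bound: "\<And>x. \<bar>f x\<bar> \<le> b" and g_bound: "\<And>x. norm (g x) \<le> b" and H_bound: "\<And>x. norm (H x) \<le> b"
    and H_uniformly_continuous: "uniformly_continuous_on UNIV H"
begin

lemma b_nonneg: "0 \<le> b" using f_bound[of 0] by linarith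

lemma continuous_f: "continuous_on UNIV f"
  using has_derivative_continuous[OF f_derivative] by (auto simp: continuous_on_eq_continuous_at)

lemma continuous_g: "continuous_on UNIV g"
  using has_derivative_continuous[OF g_derivative] by (auto simp: continuous_on_eq_continuous_at)

lemma continuous_H: "continuous_on UNIV H"
  using H_uniformly_continuous by (rule uniformly_continuous_imp_continuous)

lemma measurable_test_function [measurable]:
  "f \<in> borel_measurable borel" "g \<in> borel_measurable borel" "H \<in> borel_measurable borel"
  using continuous_f continuous_g continuous_H by (auto intro: borel_measurable_continuous_onI)

lemma uniformly_continuous_f: "uniformly_continuous_on UNIV f"
proof (intro lipschitz_on_uniformly_continuous[where L = b] lipschitz_onI b_nonneg)
  fix x y :: "real ^ 'd"
  have "norm (f x - f y) \<le> b * norm (x - y)"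
  proof (rule differentiable_bound[of UNIV f "\<lambda>x v. g x \<bullet> v"])
    fix x show "onorm (\<lambda>v. g x \<bullet> v) \<le> b"
      by (rule onorm_bound[OF b_nonneg]) (metis g_bound Cauchy_Schwarz_ineq2 mult_right_mono norm_ge_zero order_trans real_norm_def)
  qed (use f_derivative in \<open>auto simp: has_derivative_at_withinI\<close>)
  then show "dist (f x) (f y) \<le> b * dist x y" by (simp add: dist_norm)
qed

lemma uniformly_continuous_g: "uniformly_continuous_on UNIV g"
proof (intro lipschitz_on_uniformly_continuous[where L = b] lipschitz_onI b_nonneg)
  fix x y :: "real ^ 'd"
  have "norm (g x - g y) \<le> b * norm (x - y)"
  proof (rule differentiable_bound[of UNIV g "\<lambda>x v. H x *v v"])
    fix x show "onorm (\<lambda>v. H x *v v) \<le> b"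
      by (rule onorm_bound[OF b_nonneg]) (metis H_bound norm_matrix_vector_mult_le mult_right_mono norm_ge_zero order_trans)
  qed (use g_derivative in \<open>auto simp: has_derivative_at_withinI\<close>)
  then show "dist (g x) (g y) \<le> b * dist x y" by (simp add: dist_norm)
qed

text \<open>Taylor's formula with the Hessian at an intermediate point. For short \<open>v\<close>
  the modulus of continuity of \<open>H\<close> gives the factor \<open>\<eta>\<close>; for long
  \<open>v\<close> the crude bound \<open>2 * b\<close> is multiplied by
  \<open>(norm v)\<^sup>2 / \<kappa>\<^sup>2\<close>, which is at least 1. A fourth power is welcome
  because fourth moments of an increment are quadratic in its time step.\<close>

lemma taylor_remainder:
  assumes \<eta>: "0 \<le> \<eta>" and \<kappa>: "0 < \<kappa>" "\<And>x y. dist x y < \<kappa> \<Longrightarrow> dist (H x) (H y) \<le> \<eta>"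
  shows "\<bar>f (y + v) - f y - g y \<bullet> v - 1 / 2 * (v \<bullet> (H y *v v))\<bar> \<le> 1 / 2 * \<eta> * (norm v)\<^sup>2 + b / \<kappa>\<^sup>2 * norm v ^ 4"
proof -
  define \<phi> where "\<phi> m r = (if m = 0 then f (y + r *\<^sub>R v) else if m = 1 then g (y + r *\<^sub>R v) \<bullet> v else v \<bullet> (H (y + r *\<^sub>R v) *v v))"
    for m :: nat and r :: real
  have line: "((\<lambda>r. y + r *\<^sub>R v) has_derivative (\<lambda>r. r *\<^sub>R v)) (at r)" for r
    by (auto intro!: derivative_eq_intros)
  have \<phi>_eq: "\<phi> 0 = f \<circ> (\<lambda>r. y + r *\<^sub>R v)" "\<phi> 1 = (\<lambda>r. (g \<circ> (\<lambda>r. y + r *\<^sub>R v)) r \<bullet> v)"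
    "\<phi> 2 = (\<lambda>r. v \<bullet> (H (y + r *\<^sub>R v) *v v))"
    by (auto simp: \<phi>_def fun_eq_iff)
  have d0: "(\<phi> 0 has_real_derivative \<phi> 1 r) (at r)" for r
    unfolding \<phi>_eq has_field_derivative_def
    by (rule has_derivative_eq_rhs[OF diff_chain_at[OF line f_derivative]]) (simp add: fun_eq_iff)
  have d1: "(\<phi> 1 has_real_derivative \<phi> 2 r) (at r)" for r
    unfolding \<phi>_eq has_field_derivative_def
    by (rule has_derivative_eq_rhs[OF has_derivative_inner_left[OF diff_chain_at[OF line g_derivative]]])
      (simp add: fun_eq_iff matrix_vector_mult_scaleR inner_commute)
  have "DERIV (\<phi> m) t :> \<phi> (Suc m) t" if "m < 2" for m t
    using d0[of t] d1[of t] that by (auto simp: less_Suc_eq numeral_2_eq_2)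
  then have "\<exists>t. 0 < t \<and> t < 1 \<and> \<phi> 0 1 = (\<Sum>m<2. \<phi> m 0 / fact m * 1 ^ m) + \<phi> 2 t / fact 2 * 1 ^ 2"
    by (intro Maclaurin) simp_all
  then obtain t where t: "0 < t" "t < 1" "f (y + v) = f y + g y \<bullet> v + 1 / 2 * (v \<bullet> (H (y + t *\<^sub>R v) *v v))"
    by (auto simp: \<phi>_def numeral_2_eq_2)
  define \<Delta> where "\<Delta> = H (y + t *\<^sub>R v) - H y"
  have eq: "f (y + v) - f y - g y \<bullet> v - 1 / 2 * (v \<bullet> (H y *v v)) = 1 / 2 * (v \<bullet> (\<Delta> *v v))"
    by (simp add: t(3) \<Delta>_def matrix_vector_mult_diff_rdistrib inner_diff_right right_diff_distrib)
  have "\<bar>f (y + v) - f y - g y \<bullet> v - 1 / 2 * (v \<bullet> (H y *v v))\<bar> = 1 / 2 * \<bar>v \<bullet> (\<Delta> *v v)\<bar>"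
    unfolding eq abs_mult by simp
  also have "\<bar>v \<bullet> (\<Delta> *v v)\<bar> \<le> norm \<Delta> * (norm v)\<^sup>2"
    using Cauchy_Schwarz_ineq2[of v "\<Delta> *v v"] mult_left_mono[OF norm_matrix_vector_mult_le[of \<Delta> v], of "norm v"]
    by (simp add: power2_eq_square mult_ac)
  also have "norm \<Delta> * (norm v)\<^sup>2 \<le> \<eta> * (norm v)\<^sup>2 + 2 * b / \<kappa>\<^sup>2 * norm v ^ 4"
  proof (cases "norm v < \<kappa>")
    case True
    have "dist (y + t *\<^sub>R v) y = t * norm v" using t by (simp add: dist_norm)
    also have "\<dots> \<le> 1 * norm v" using t by (intro mult_right_mono) auto
    finally have "dist (H (y + t *\<^sub>R v)) (H y) \<le> \<eta>" using True by (intro \<kappa>) auto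
    then have "norm \<Delta> * (norm v)\<^sup>2 \<le> \<eta> * (norm v)\<^sup>2"
      by (intro mult_right_mono) (auto simp: \<Delta>_def dist_norm)
    also have "\<dots> \<le> \<eta> * (norm v)\<^sup>2 + 2 * b / \<kappa>\<^sup>2 * norm v ^ 4" using b_nonneg by simp
    finally show ?thesis .
  next
    case False
    have "norm \<Delta> \<le> 2 * b" unfolding \<Delta>_def
      by (rule order_trans[OF norm_triangle_ineq4]) (use H_bound[of y] H_bound[of "y + t *\<^sub>R v"] in linarith)
    then have "norm \<Delta> * (norm v)\<^sup>2 \<le> 2 * b * (norm v)\<^sup>2 * 1" by (simp add: mult_right_mono)
    also have "\<dots> \<le> 2 * b * (norm v)\<^sup>2 * ((norm v)\<^sup>2 / \<kappa>\<^sup>2)"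
      using False \<kappa>(1) b_nonneg by (intro mult_left_mono) (auto simp: power_mono)
    also have "\<dots> = 2 * b / \<kappa>\<^sup>2 * norm v ^ 4" by (simp add: power_even_abs flip: power_add)
    also have "\<dots> \<le> \<eta> * (norm v)\<^sup>2 + 2 * b / \<kappa>\<^sup>2 * norm v ^ 4" using \<eta> by simp
    finally show ?thesis .
  qed
  finally show ?thesis by (simp add: algebra_simps)
qed

end

context brownian_setting
begin

lemma
  assumes "0 \<le> s" "s < t"
  shows integrable_increment_norm2: "integrable M (\<lambda>w. (norm (W t w - W s w))\<^sup>2)"
    and expectation_increment_norm2: "expectation (\<lambda>w. (norm (W t w - W s w))\<^sup>2) = real CARD('d) * (t - s)"
proof -
  have "integrable M (\<lambda>w. mat 1 :: real ^ 'd ^ 'd)" by (rule integrable_const)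
  note integrable_quadratic_increment[OF assms borel_measurable_const this]
    expectation_quadratic_increment[OF assms borel_measurable_const this]
  then show "integrable M (\<lambda>w. (norm (W t w - W s w))\<^sup>2)"
    "expectation (\<lambda>w. (norm (W t w - W s w))\<^sup>2) = real CARD('d) * (t - s)"
    unfolding power2_norm_eq_inner matrix_vector_mul_lid trace_I lebesgue_integral_const prob_space by auto
qed

lemma
  assumes "0 \<le> s" "s < t"
  shows integrable_increment_norm4: "integrable M (\<lambda>w. norm (W t w - W s w) ^ 4)"
    and expectation_increment_norm4: "expectation (\<lambda>w. norm (W t w - W s w) ^ 4) \<le> 3 * (real CARD('d))\<^sup>2 * (t - s)\<^sup>2"
proof -
  have "integrable M (\<lambda>w. 1 :: real)" by (rule integrable_const)
  note integrable_increment_power4[OF assms borel_measurable_const this]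
    expectation_increment_power4[OF assms borel_measurable_const this]
  then show "integrable M (\<lambda>w. norm (W t w - W s w) ^ 4)"
    "expectation (\<lambda>w. norm (W t w - W s w) ^ 4) \<le> 3 * (real CARD('d))\<^sup>2 * (t - s)\<^sup>2"
    unfolding lebesgue_integral_const prob_space by auto
qed

lemma taylor_step_pointwise:
  fixes Y B Z :: "real ^ 'd" and \<zeta> :: "real ^ 'd ^ 'd"
  assumes "C2_test_function f g H b"
    and \<eta>: "0 \<le> \<eta>" and \<kappa>: "0 < \<kappa>" "\<And>x y. dist x y < \<kappa> \<Longrightarrow> dist (H x) (H y) \<le> \<eta>"
    and h: "0 < h" and C: "0 \<le> C" and B: "norm B \<le> C * h" and \<zeta>: "norm \<zeta> \<le> C"
  shows "f (Y + B + \<zeta> *v Z) \<le> f Y + g Y \<bullet> B + (transpose \<zeta> *v g Y) \<bullet> Z + 1 / 2 * (Z \<bullet> ((transpose \<zeta> ** H Y ** \<zeta>) *v Z))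
    + (\<eta> * C\<^sup>2 * h\<^sup>2 + 8 * b / \<kappa>\<^sup>2 * C ^ 4 * h ^ 4 + 1 / 2 * b * C\<^sup>2 * h * sqrt h + 1 / 2 * b * C\<^sup>2 * h\<^sup>2)
    + (\<eta> * C\<^sup>2 + 1 / 2 * b * sqrt h * C\<^sup>2) * (norm Z)\<^sup>2 + 8 * b / \<kappa>\<^sup>2 * C ^ 4 * norm Z ^ 4"
proof -
  interpret C2_test_function f g H b by fact
  define w where "w = \<zeta> *v Z"
  define v where "v = B + w"
  have w: "norm w \<le> C * norm Z"
    unfolding w_def using norm_matrix_vector_mult_le[of \<zeta> Z] mult_right_mono[OF \<zeta>, of "norm Z"] by simp
  have B2: "(norm B)\<^sup>2 \<le> C\<^sup>2 * h\<^sup>2" using power_mono[OF B, of 2] by (simp add: power_mult_distrib)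
  have B4: "norm B ^ 4 \<le> C ^ 4 * h ^ 4" using power_mono[OF B, of 4] by (simp add: power_mult_distrib)
  have w2: "(norm w)\<^sup>2 \<le> C\<^sup>2 * (norm Z)\<^sup>2" using power_mono[OF w, of 2] by (simp add: power_mult_distrib)
  have w4: "norm w ^ 4 \<le> C ^ 4 * norm Z ^ 4" using power_mono[OF w, of 4] by (simp add: power_mult_distrib)
  have v2: "(norm v)\<^sup>2 \<le> 2 * (norm B)\<^sup>2 + 2 * (norm w)\<^sup>2"
    using norm_add_squared_le[of 1 B w] by (simp add: v_def)
  have v4: "norm v ^ 4 \<le> 8 * norm B ^ 4 + 8 * norm w ^ 4"
  proof -
    have "norm v ^ 4 = ((norm v)\<^sup>2)\<^sup>2" by simp
    also have "\<dots> \<le> (2 * (norm B)\<^sup>2 + 2 * (norm w)\<^sup>2)\<^sup>2" using v2 by (intro power_mono) auto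
    also have "\<dots> \<le> 8 * ((norm B)\<^sup>2)\<^sup>2 + 8 * ((norm w)\<^sup>2)\<^sup>2"
      using sum_squares_bound[of "(norm B)\<^sup>2" "(norm w)\<^sup>2"] by (simp add: power2_sum power_mult_distrib)
    finally show ?thesis by simp
  qed
  have bil: "\<bar>x \<bullet> (H Y *v y)\<bar> \<le> b * norm x * norm y" for x y
  proof -
    have "\<bar>x \<bullet> (H Y *v y)\<bar> \<le> norm x * (norm (H Y) * norm y)"
      by (rule order_trans[OF Cauchy_Schwarz_ineq2]) (intro mult_left_mono norm_matrix_vector_mult_le norm_ge_zero)
    also have "\<dots> \<le> norm x * (b * norm y)" by (intro mult_left_mono mult_right_mono H_bound) auto
    finally show ?thesis by (simp add: mult_ac)
  qed
  \<comment> \<open>The weights \<open>1 / sqrt h\<close> and \<open>sqrt h\<close> balance a drift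
    part of size h against a noise part of size \<open>sqrt h\<close>: both resulting terms have
    order \<open>h * sqrt h\<close> in mean.\<close>
  have cross: "2 * (norm B * norm w) \<le> C\<^sup>2 * h * sqrt h + sqrt h * (norm w)\<^sup>2"
  proof -
    have "0 \<le> (norm B / sqrt (sqrt h) - sqrt (sqrt h) * norm w)\<^sup>2" by simp
    also have "\<dots> = (norm B)\<^sup>2 / sqrt h + sqrt h * (norm w)\<^sup>2 - 2 * (norm B * norm w)"
      using h by (simp add: power2_diff power_divide power_mult_distrib)
    finally have "2 * (norm B * norm w) \<le> (norm B)\<^sup>2 / sqrt h + sqrt h * (norm w)\<^sup>2" by simp
    also have "(norm B)\<^sup>2 / sqrt h \<le> C\<^sup>2 * h\<^sup>2 / sqrt h" using B2 h by (intro divide_right_mono) auto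
    also have "C\<^sup>2 * h\<^sup>2 / sqrt h = C\<^sup>2 * h * sqrt h"
      using h by (simp add: field_simps power2_eq_square)
    finally show ?thesis by simp
  qed
  have "f (Y + v) \<le> f Y + g Y \<bullet> v + 1 / 2 * (v \<bullet> (H Y *v v)) + 1 / 2 * \<eta> * (norm v)\<^sup>2 + b / \<kappa>\<^sup>2 * norm v ^ 4"
    using taylor_remainder[OF \<eta> \<kappa>, of Y v] by linarith
  also have "v \<bullet> (H Y *v v) = w \<bullet> (H Y *v w) + B \<bullet> (H Y *v w) + w \<bullet> (H Y *v B) + B \<bullet> (H Y *v B)"
    by (simp add: v_def matrix_vector_right_distrib inner_add_left inner_add_right)
  also have "\<dots> \<le> w \<bullet> (H Y *v w) + b * (2 * (norm B * norm w)) + b * (norm B)\<^sup>2"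
    using bil[of B w] bil[of w B] bil[of B B] by (simp add: power2_eq_square algebra_simps abs_le_iff)
  also have "\<dots> \<le> w \<bullet> (H Y *v w) + b * (C\<^sup>2 * h * sqrt h + sqrt h * (C\<^sup>2 * (norm Z)\<^sup>2)) + b * (C\<^sup>2 * h\<^sup>2)"
  proof (intro add_mono mult_left_mono order_refl b_nonneg B2)
    have "sqrt h * (norm w)\<^sup>2 \<le> sqrt h * (C\<^sup>2 * (norm Z)\<^sup>2)" using w2 h by (intro mult_left_mono) auto
    then show "2 * (norm B * norm w) \<le> C\<^sup>2 * h * sqrt h + sqrt h * (C\<^sup>2 * (norm Z)\<^sup>2)"
      by (intro order_trans[OF cross] add_left_mono)
  qed
  also have "1 / 2 * \<eta> * (norm v)\<^sup>2 \<le> 1 / 2 * \<eta> * (2 * (C\<^sup>2 * h\<^sup>2) + 2 * (C\<^sup>2 * (norm Z)\<^sup>2))"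
    using v2 B2 w2 \<eta> by (intro mult_left_mono) auto
  also have "b / \<kappa>\<^sup>2 * norm v ^ 4 \<le> b / \<kappa>\<^sup>2 * (8 * (C ^ 4 * h ^ 4) + 8 * (C ^ 4 * norm Z ^ 4))"
    using v4 B4 w4 b_nonneg by (intro mult_left_mono) auto
  finally have main: "f (Y + v) \<le> f Y + g Y \<bullet> v + 1 / 2 * (w \<bullet> (H Y *v w) + b * (C\<^sup>2 * h * sqrt h + sqrt h * (C\<^sup>2 * (norm Z)\<^sup>2)) + b * (C\<^sup>2 * h\<^sup>2))
     + 1 / 2 * \<eta> * (2 * (C\<^sup>2 * h\<^sup>2) + 2 * (C\<^sup>2 * (norm Z)\<^sup>2)) + b / \<kappa>\<^sup>2 * (8 * (C ^ 4 * h ^ 4) + 8 * (C ^ 4 * norm Z ^ 4))"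
    by simp
  have e1: "g Y \<bullet> v = g Y \<bullet> B + (transpose \<zeta> *v g Y) \<bullet> Z"
    by (simp add: v_def w_def inner_add_right dot_lmul_matrix)
  have e2: "w \<bullet> (H Y *v w) = Z \<bullet> ((transpose \<zeta> ** H Y ** \<zeta>) *v Z)"
    unfolding w_def matrix_vector_mul_assoc[symmetric]
    by (metis dot_lmul_matrix inner_commute transpose_matrix_vector)
  show ?thesis using main unfolding e1 e2 unfolding v_def w_def by (simp add: algebra_simps)
qed

text \<open>Ito's formula for one step, with an error uniform over all data bounded by
  \<open>C\<close>. \<open>Y\<close> and \<open>\<zeta>\<close> are known at \<open>u\<close> so
  that the noise terms can be averaged. \<open>B\<close> is either kept inside the expectation or
  bounded pointwise and is merely measurable, which admits a drift integrated along the path during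
  the step.\<close>

lemma taylor_step:
  fixes f :: "real ^ 'd \<Rightarrow> real" and g H
  assumes T: "C2_test_function f g H b" and C: "0 \<le> C" and e: "0 < e"
  obtains h\<^sub>0 where "0 < h\<^sub>0" and "\<And>u v Y B \<zeta>. 0 \<le> u \<Longrightarrow> u < v \<Longrightarrow> v - u \<le> h\<^sub>0 \<Longrightarrow>
    Y \<in> borel_measurable (G u) \<Longrightarrow> B \<in> borel_measurable M \<Longrightarrow> \<zeta> \<in> borel_measurable (G u) \<Longrightarrow>
    (\<And>w. w \<in> space M \<Longrightarrow> norm (B w) \<le> C * (v - u)) \<Longrightarrow> (\<And>w. w \<in> space M \<Longrightarrow> norm (\<zeta> w) \<le> C) \<Longrightarrow>
    expectation (\<lambda>w. f (Y w + B w + \<zeta> w *v (W v w - W u w)))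
    \<le> expectation (\<lambda>w. f (Y w)) +
      expectation (\<lambda>w. g (Y w) \<bullet> B w + (v - u) / 2 * trace (transpose (\<zeta> w) ** H (Y w) ** \<zeta> w)) + e * (v - u)"
proof -
  interpret C2_test_function f g H b by fact
  define d where "d = real CARD('d)"
  have d: "d \<ge> 0" by (simp add: d_def)
  \<comment> \<open>The modulus \<open>\<eta>\<close> causes the part of the error that stays
    proportional to the step length; this choice makes it at most \<open>e / 2\<close> times that
    length.\<close>
  define \<eta> where "\<eta> = e / (2 * (C\<^sup>2 * (1 + d) + 1))"
  have \<eta>: "\<eta> > 0" using e d by (simp add: \<eta>_def add_nonneg_pos)
  have \<eta>_le: "\<eta> * C\<^sup>2 * (1 + d) \<le> e / 2"
  proof -
    have "\<eta> * (C\<^sup>2 * (1 + d)) \<le> \<eta> * (C\<^sup>2 * (1 + d) + 1)" using \<eta> by simp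
    also have "\<dots> = e / 2"
    proof -
      have "C\<^sup>2 * (1 + d) + 1 \<noteq> 0" using d by (smt (verit) mult_nonneg_nonneg zero_le_power2)
      then show ?thesis by (simp add: \<eta>_def field_simps)
    qed
    finally show ?thesis by (simp add: mult.assoc)
  qed
  obtain \<kappa> where \<kappa>: "0 < \<kappa>" "\<And>x y. dist x y < \<kappa> \<Longrightarrow> dist (H x) (H y) \<le> \<eta>"
    using H_uniformly_continuous \<eta> unfolding uniformly_continuous_on_def by (metis UNIV_I less_imp_le dist_commute)
  \<comment> \<open>Collects the factors of all terms of order \<open>h * sqrt h\<close>;
    \<open>h\<^sub>0\<close> is then chosen so that \<open>c * sqrt h\<close> is at most
    \<open>e / 2\<close>.\<close>
  define c where "c = 8 * b / \<kappa>\<^sup>2 * C ^ 4 + b * C\<^sup>2 + 1 / 2 * b * C\<^sup>2 * d + 24 * b / \<kappa>\<^sup>2 * C ^ 4 * d\<^sup>2"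
  have c: "c \<ge> 0" using b_nonneg C d by (simp add: c_def)
  define h\<^sub>0 where "h\<^sub>0 = min 1 ((e / (2 * (c + 1)))\<^sup>2)"
  show thesis
  proof (rule that[of h\<^sub>0])
    show "0 < h\<^sub>0" using e c by (simp add: h\<^sub>0_def)
    fix u v and Y B :: "'w \<Rightarrow> real ^ 'd" and \<zeta> :: "'w \<Rightarrow> real ^ 'd ^ 'd"
    assume uv: "0 \<le> u" "u < v" and vh: "v - u \<le> h\<^sub>0" and Y: "Y \<in> borel_measurable (G u)"
      and Bm [measurable]: "B \<in> borel_measurable M" and \<zeta>: "\<zeta> \<in> borel_measurable (G u)"
      and B: "\<And>w. w \<in> space M \<Longrightarrow> norm (B w) \<le> C * (v - u)" and \<zeta>C: "\<And>w. w \<in> space M \<Longrightarrow> norm (\<zeta> w) \<le> C"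
    define h where "h = v - u"
    have h: "0 < h" "h \<le> 1" "h \<le> (e / (2 * (c + 1)))\<^sup>2" using uv vh by (auto simp: h_def h\<^sub>0_def)
    define Z where "Z w = W v w - W u w" for w
    have [measurable]: "W v \<in> borel_measurable M" "W u \<in> borel_measurable M" using uv by auto
    note [measurable] = measurable_G[OF Y] measurable_G[OF \<zeta>]
    define A where "A w = transpose (\<zeta> w) ** H (Y w) ** \<zeta> w" for w
    define y where "y w = transpose (\<zeta> w) *v g (Y w)" for w
    have AG: "A \<in> borel_measurable (G u)" "y \<in> borel_measurable (G u)"
      unfolding A_def y_def using Y \<zeta> by measurable
    note [measurable] = AG[THEN measurable_G]
    have A_bound: "norm (A w) \<le> C * b * C" if "w \<in> space M" for w
    proof -
      have "norm (A w) \<le> norm (\<zeta> w) * norm (H (Y w)) * norm (\<zeta> w)"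
        unfolding A_def
        by (rule order_trans[OF norm_matrix_matrix_mult_le])
          (intro mult_right_mono order_trans[OF norm_matrix_matrix_mult_le]; simp)
      also have "\<dots> \<le> C * b * C" by (intro mult_mono \<zeta>C that H_bound mult_nonneg_nonneg C b_nonneg) auto
      finally show ?thesis .
    qed
    have y_bound: "norm (y w) \<le> C * b" if "w \<in> space M" for w
      unfolding y_def
      by (rule order_trans[OF norm_matrix_vector_mult_le]) (simp, intro mult_mono \<zeta>C that g_bound C; simp)
    have Ai: "integrable M A" by (rule integrable_const_bound[where B = "C * b * C"]) (auto intro!: AE_I2 A_bound)
    have yi: "integrable M y" by (rule integrable_const_bound[where B = "C * b"]) (auto intro!: AE_I2 y_bound)
    note Zy = integrable_inner_increment[OF uv AG(2) yi] expectation_inner_increment[OF uv AG(2) yi]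
    note ZA = integrable_quadratic_increment[OF uv AG(1) Ai] expectation_quadratic_increment[OF uv AG(1) Ai]
    note Z2 = integrable_increment_norm2[OF uv] expectation_increment_norm2[OF uv]
    note Z4 = integrable_increment_norm4[OF uv] expectation_increment_norm4[OF uv]
    have fi: "integrable M (\<lambda>w. f (Y' w))" if [measurable]: "Y' \<in> borel_measurable M" for Y'
      by (rule integrable_const_bound[where B = b]) (auto intro!: AE_I2 f_bound)
    have gBi: "integrable M (\<lambda>w. g (Y w) \<bullet> B w)"
    proof (rule integrable_const_bound[where B = "b * (C * h)"])
      show "AE w in M. norm (g (Y w) \<bullet> B w) \<le> b * (C * h)"
        using B b_nonneg unfolding h_def real_norm_def
        by (intro AE_I2 order_trans[OF Cauchy_Schwarz_ineq2] mult_mono g_bound) auto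
    qed measurable
    have trA: "integrable M (\<lambda>w. trace (A w))"
      using Ai unfolding trace_def
    proof (intro Bochner_Integration.integrable_sum)
      fix i show "integrable M (\<lambda>w. A w $ i $ i)"
        using Bochner_Integration.integrable_inner_left[of "axis i (axis i 1)" M A] Ai by (simp add: inner_axis)
    qed
    define P where "P = \<eta> * C\<^sup>2 * h\<^sup>2 + 8 * b / \<kappa>\<^sup>2 * C ^ 4 * h ^ 4 + 1 / 2 * b * C\<^sup>2 * h * sqrt h + 1 / 2 * b * C\<^sup>2 * h\<^sup>2"
    define P2 where "P2 = \<eta> * C\<^sup>2 + 1 / 2 * b * sqrt h * C\<^sup>2"
    define P4 where "P4 = 8 * b / \<kappa>\<^sup>2 * C ^ 4"
    let ?R = "\<lambda>w. f (Y w) + g (Y w) \<bullet> B w + y w \<bullet> Z w + 1 / 2 * (Z w \<bullet> (A w *v Z w)) + P + P2 * (norm (Z w))\<^sup>2 + P4 * norm (Z w) ^ 4"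
    have Ri: "integrable M ?R"
      using Zy(1) ZA(1) Z2(1) Z4(1) fi gBi unfolding Z_def
      by (intro Bochner_Integration.integrable_add integrable_const Bochner_Integration.integrable_mult_right) auto
    have "expectation (\<lambda>w. f (Y w + B w + \<zeta> w *v Z w)) \<le> expectation ?R"
    proof (intro integral_mono fi Ri)
      show "(\<lambda>w. Y w + B w + \<zeta> w *v Z w) \<in> borel_measurable M" unfolding Z_def by measurable
      fix w assume w: "w \<in> space M"
      show "f (Y w + B w + \<zeta> w *v Z w) \<le> ?R w"
        unfolding A_def y_def P_def P2_def P4_def
        by (rule taylor_step_pointwise[OF T _ \<kappa> h(1) C]) (use \<eta> B[OF w] \<zeta>C[OF w] in \<open>auto simp: h_def\<close>)
    qed
    also have "expectation ?R = expectation (\<lambda>w. f (Y w)) + expectation (\<lambda>w. g (Y w) \<bullet> B w) + 0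
        + 1 / 2 * (h * expectation (\<lambda>w. trace (A w))) + P + P2 * (d * h) + P4 * expectation (\<lambda>w. norm (Z w) ^ 4)"
      using Zy ZA Z2 Z4(1) fi gBi unfolding Z_def h_def d_def
      by (simp add: prob_space)
    also have "\<dots> \<le> expectation (\<lambda>w. f (Y w)) + expectation (\<lambda>w. g (Y w) \<bullet> B w) + 0
        + 1 / 2 * (h * expectation (\<lambda>w. trace (A w))) + (P + P2 * (d * h) + P4 * (3 * d\<^sup>2 * h\<^sup>2))"
      using mult_left_mono[OF Z4(2), of P4] b_nonneg C unfolding Z_def h_def d_def P4_def by simp
    also have "P + P2 * (d * h) + P4 * (3 * d\<^sup>2 * h\<^sup>2) \<le> e * h"
    proof -
      have sh: "0 < sqrt h" "h = sqrt h * sqrt h" "sqrt h \<le> 1" using h by auto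
      have hs: "h \<le> sqrt h" using mult_left_mono[OF sh(3), of "sqrt h"] sh by simp
      have h2: "h\<^sup>2 \<le> h * sqrt h" using hs h by (simp add: power2_eq_square)
      have h2': "h\<^sup>2 \<le> h" using h by (simp add: power2_eq_square mult_left_le)
      have h4: "h ^ 4 \<le> h * sqrt h"
        using h2 power_decreasing[of 2 4 h] h by linarith
      have "P \<le> \<eta> * C\<^sup>2 * h + 8 * b / \<kappa>\<^sup>2 * C ^ 4 * (h * sqrt h) + 1 / 2 * b * C\<^sup>2 * (h * sqrt h) + 1 / 2 * b * C\<^sup>2 * (h * sqrt h)"
        unfolding P_def mult.assoc[of _ h "sqrt h"] using \<eta> b_nonneg C h2 h2' h4
        by (intro add_mono mult_left_mono order_refl) auto
      moreover have "P4 * (3 * d\<^sup>2 * h\<^sup>2) \<le> P4 * (3 * d\<^sup>2 * (h * sqrt h))"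
        using h2 b_nonneg C by (intro mult_left_mono) (auto simp: P4_def)
      ultimately have "P + P2 * (d * h) + P4 * (3 * d\<^sup>2 * h\<^sup>2) \<le> h * (\<eta> * C\<^sup>2 * (1 + d) + c * sqrt h)"
        unfolding P2_def P4_def c_def by (simp add: algebra_simps)
      also have "\<dots> \<le> h * (e / 2 + e / 2)"
      proof (intro mult_left_mono add_mono \<eta>_le)
        have "sqrt h \<le> e / (2 * (c + 1))" using h(3) e c by (intro real_le_lsqrt) auto
        then have "c * sqrt h \<le> (c + 1) * (e / (2 * (c + 1)))" using c e h by (intro mult_mono) auto
        also have "\<dots> = e / 2" using c by (simp add: field_simps)
        finally show "c * sqrt h \<le> e / 2" .
      qed (use h in auto)
      finally show ?thesis by (simp add: mult.commute)
    qed
    finally have "expectation (\<lambda>w. f (Y w + B w + \<zeta> w *v Z w)) \<le> expectation (\<lambda>w. f (Y w))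
        + (expectation (\<lambda>w. g (Y w) \<bullet> B w) + h / 2 * expectation (\<lambda>w. trace (A w))) + e * h"
      by simp
    also have "expectation (\<lambda>w. g (Y w) \<bullet> B w) + h / 2 * expectation (\<lambda>w. trace (A w))
        = expectation (\<lambda>w. g (Y w) \<bullet> B w + h / 2 * trace (A w))"
      using gBi trA by simp
    finally show "expectation (\<lambda>w. f (Y w + B w + \<zeta> w *v (W v w - W u w)))
      \<le> expectation (\<lambda>w. f (Y w)) +
      expectation (\<lambda>w. g (Y w) \<bullet> B w + (v - u) / 2 * trace (transpose (\<zeta> w) ** H (Y w) ** \<zeta> w)) + e * (v - u)"
      unfolding Z_def A_def h_def .
  qed
qed

end

section \<open>Localization, Euler scheme and Dynkin's inequality\<close>

lemma simple_value_eq: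
  assumes mono: "\<And>i j. i \<le> j \<Longrightarrow> j \<le> n \<Longrightarrow> \<tau> i \<le> \<tau> j" and i: "i < n" "\<tau> i < u" "u \<le> \<tau> (Suc i)"
  shows "simple_value n \<tau> \<xi> u w = \<xi> i w"
proof -
  have "u \<notin> {\<tau> j<..\<tau> (Suc j)}" if "j < n" "j \<noteq> i" for j
    using i that mono[of "Suc j" i] mono[of "Suc i" j] by (cases i j rule: linorder_cases) auto
  then have "simple_value n \<tau> \<xi> u w = (\<Sum>j<n. if j = i then \<xi> i w else 0)"
    unfolding simple_value_def by (intro sum.cong refl) (use i in auto)
  then show ?thesis using i(1) by simp
qed

lemma set_integral_Icc_combine:
  fixes f :: "real \<Rightarrow> 'a::{banach, second_countable_topology}"
  assumes "a \<le> b" "b \<le> c" and f: "set_integrable lborel {a..c} f"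
  shows "(LINT u:{a..c}|lborel. f u) = (LINT u:{a..b}|lborel. f u) + (LINT u:{b..c}|lborel. f u)"
proof -
  have "(LINT u:{a..b} \<union> {b..c}|lborel. f u) = (LINT u:{a..b}|lborel. f u) + (LINT u:{b..c}|lborel. f u)"
  proof (rule set_integral_Un_AE)
    show "AE u in lborel. \<not> (u \<in> {a..b} \<and> u \<in> {b..c})"
      using AE_lborel_singleton[of b] by eventually_elim auto
  qed (use assms in \<open>auto intro: set_integrable_subset[OF f]\<close>)
  moreover have "{a..b} \<union> {b..c} = {a..c}" using assms by auto
  ultimately show ?thesis by simp
qed

section \<open>Localization and the partly frozen Euler scheme\<close>

locale localized_diffusion = ito_diffusion M G W X \<beta> S I
  for M :: "'w measure" and G :: "real \<Rightarrow> 'w measure" and W :: "real \<Rightarrow> 'w \<Rightarrow> real ^ 'd"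
    and X :: "real \<Rightarrow> 'w \<Rightarrow> real ^ 'd" and \<beta> :: "real ^ 'd \<Rightarrow> real ^ 'd"
    and S :: "real ^ 'd \<Rightarrow> real ^ 'd ^ 'd" and I :: "real \<Rightarrow> 'w \<Rightarrow> real ^ 'd" +
  fixes K :: "(real ^ 'd) set" and C s t :: real
  assumes K_closed: "closed K" and s_nonneg: "0 \<le> s" and s_less_t: "s < t" and C_nonneg: "0 \<le> C"
    and \<beta>_bound: "\<And>x. x \<in> K \<Longrightarrow> norm (\<beta> x) \<le> C" and S_bound: "\<And>x. x \<in> K \<Longrightarrow> norm (S x) \<le> C"
    and S_continuous: "continuous_on UNIV S"
begin

text \<open>For continuous paths this means that the path stays in the closed set \<open>K\<close> on \<open>[s, u]\<close>; written as a
  countable condition it is visibly an event of \<open>G u\<close>.\<close>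

definition alive :: "real \<Rightarrow> 'w \<Rightarrow> bool" where
  "alive u w \<longleftrightarrow> (\<forall>k i. i \<le> Suc k \<longrightarrow> path (s + real i / real (Suc k) * (u - s)) w \<in> K)"

text \<open>The times in the definition are dense in \<open>{s..u}\<close>: each \<open>r\<close> is
  a limit of such times, and continuity of the path together with closedness of \<open>K\<close>
  transfers the membership.\<close>

lemma alive_iff:
  assumes w: "w \<in> space M" and u: "s \<le> u"
  shows "alive u w \<longleftrightarrow> (\<forall>r\<in>{s..u}. path r w \<in> K)"
proof
  assume "\<forall>r\<in>{s..u}. path r w \<in> K"
  moreover have "s + real i / real (Suc k) * (u - s) \<in> {s..u}" if "i \<le> Suc k" for i k
  proof -
    have "real i / real (Suc k) \<le> 1" using that by (simp add: field_simps)
    then have "real i / real (Suc k) * (u - s) \<le> 1 * (u - s)" using u by (intro mult_right_mono) auto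
    then show ?thesis using u by simp
  qed
  ultimately show "alive u w" unfolding alive_def by blast
next
  assume a: "alive u w"
  show "\<forall>r\<in>{s..u}. path r w \<in> K"
  proof
    fix r assume r: "r \<in> {s..u}"
    show "path r w \<in> K"
    proof (cases "u = s")
      case True
      then show ?thesis using a r unfolding alive_def by (auto dest!: spec[of _ 0])
    next
      case False
      define \<theta> where "\<theta> = (r - s) / (u - s)"
      have \<theta>: "0 \<le> \<theta>" "\<theta> \<le> 1" "r = s + \<theta> * (u - s)" using r u False by (auto simp: \<theta>_def field_simps)
      define i where "i k = nat \<lfloor>\<theta> * real (Suc k)\<rfloor>" for k
      have i: "\<theta> * real (Suc k) - 1 \<le> real (i k)" "real (i k) \<le> \<theta> * real (Suc k)" for k
      proof -
        have "0 \<le> \<theta> * real (Suc k)" using \<theta> by simp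
        then have "real (i k) = of_int \<lfloor>\<theta> * real (Suc k)\<rfloor>" unfolding i_def by simp
        then show "\<theta> * real (Suc k) - 1 \<le> real (i k)" "real (i k) \<le> \<theta> * real (Suc k)" by linarith+
      qed
      have "i k \<le> Suc k" for k
      proof -
        have "real (i k) \<le> 1 * real (Suc k)" using i(2)[of k] \<theta> by (meson mult_right_mono of_nat_0_le_iff order_trans)
        then show ?thesis by simp
      qed
      then have K: "path (s + real (i k) / real (Suc k) * (u - s)) w \<in> K" for k using a by (simp add: alive_def)
      have "(\<lambda>k. real (i k) / real (Suc k)) \<longlonglongrightarrow> \<theta>"
      proof (rule tendsto_sandwich)
        have "\<theta> - 1 / real (Suc k) \<le> real (i k) / real (Suc k)" "real (i k) / real (Suc k) \<le> \<theta>" for k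
        proof -
          have "\<theta> - 1 / real (Suc k) = (\<theta> * real (Suc k) - 1) / real (Suc k)" by (simp add: field_simps)
          then show "\<theta> - 1 / real (Suc k) \<le> real (i k) / real (Suc k)"
            using i(1)[of k] by (simp add: divide_right_mono del: of_nat_Suc)
          show "real (i k) / real (Suc k) \<le> \<theta>" using i(2)[of k] by (simp add: pos_divide_le_eq del: of_nat_Suc)
        qed
        then show "\<forall>\<^sub>F k in sequentially. \<theta> - 1 / real (Suc k) \<le> real (i k) / real (Suc k)"
          "\<forall>\<^sub>F k in sequentially. real (i k) / real (Suc k) \<le> \<theta>" by auto
        show "(\<lambda>k. \<theta> - 1 / real (Suc k)) \<longlonglongrightarrow> \<theta>"
          using tendsto_diff[OF tendsto_const LIMSEQ_inverse_real_of_nat, of \<theta>] by (simp add: inverse_eq_divide)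
      qed simp
      then have "(\<lambda>k. s + real (i k) / real (Suc k) * (u - s)) \<longlonglongrightarrow> r"
        unfolding \<theta>(3) by (intro tendsto_intros)
      then have "(\<lambda>k. path (s + real (i k) / real (Suc k) * (u - s)) w) \<longlonglongrightarrow> path r w"
        using continuous_path[OF w] by (auto simp: continuous_on_eq_continuous_at intro: isCont_tendsto_compose[of r "\<lambda>u. path u w"])
      then show ?thesis using closed_sequentially[OF K_closed, of "\<lambda>k. path (s + real (i k) / real (Suc k) * (u - s)) w"] K by blast
    qed
  qed
qed

lemma alive_path: "w \<in> space M \<Longrightarrow> s \<le> r \<Longrightarrow> r \<le> u \<Longrightarrow> alive u w \<Longrightarrow> path r w \<in> K"
  using alive_iff[of w u] by auto

lemma alive_mono: "w \<in> space M \<Longrightarrow> s \<le> r \<Longrightarrow> r \<le> u \<Longrightarrow> alive u w \<Longrightarrow> alive r w"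
  using alive_iff[of w u] alive_iff[of w r] by auto

lemma K_sets [measurable]: "K \<in> sets borel"
  using K_closed by (rule borel_closed)

lemma alive_measurable [measurable (raw)]:
  assumes [measurable]: "f \<in> borel_measurable N" "g \<in> measurable N M"
  shows "Measurable.pred N (\<lambda>x. alive (f x) (g x))"
  unfolding alive_def by measurable

lemma alive_measurable_G:
  assumes "s \<le> u"
  shows "Measurable.pred (G u) (alive u)"
proof -
  have [measurable]: "path (s + real i / real (Suc k) * (u - s)) \<in> borel_measurable (G u)" if "i \<le> Suc k" for i k
  proof (rule path_measurable_G)
    have "real i / real (Suc k) \<le> 1" using that by (simp add: field_simps)
    then have "real i / real (Suc k) * (u - s) \<le> 1 * (u - s)" using assms by (intro mult_right_mono) auto
    then show "s + real i / real (Suc k) * (u - s) \<le> u" by simp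
  qed (use assms s_nonneg in simp)
  show ?thesis unfolding alive_def by measurable
qed

definition grid :: "nat \<Rightarrow> nat \<Rightarrow> real" where
  "grid n j = s + real j * ((t - s) / real n)"

text \<open>Cutting off outside \<open>K\<close> makes the drift bounded without changing it along
  paths that are alive.\<close>

definition drift :: "real \<Rightarrow> 'w \<Rightarrow> real ^ 'd" where
  "drift u w = (if path u w \<in> K then \<beta> (path u w) else 0)"

definition drift_increment :: "nat \<Rightarrow> nat \<Rightarrow> 'w \<Rightarrow> real ^ 'd" where
  "drift_increment n j w = (LINT u:{grid n j..grid n (Suc j)}|lborel. drift u w)"

definition frozen :: "nat \<Rightarrow> nat \<Rightarrow> 'w \<Rightarrow> real ^ 'd ^ 'd" where
  "frozen n j w = (if alive (grid n j) w then S (path (grid n j) w) else 0)"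

text \<open>Only the diffusion coefficient is frozen: it is evaluated at the true path at the left
  grid point, and the drift is integrated along the true path. The scheme therefore differs from a
  path that is alive by nothing but a stochastic integral.\<close>

primrec euler :: "nat \<Rightarrow> nat \<Rightarrow> 'w \<Rightarrow> real ^ 'd" where
  "euler n 0 w = path s w"
| "euler n (Suc j) w = euler n j w + (if alive (grid n j) w then drift_increment n j w else 0)
    + frozen n j w *v (W (grid n (Suc j)) w - W (grid n j) w)"

lemma grid_0 [simp]: "grid n 0 = s"
  by (simp add: grid_def)

lemma grid_n: "0 < n \<Longrightarrow> grid n n = t"
  by (simp add: grid_def)

lemma grid_mono: "i \<le> j \<Longrightarrow> grid n i \<le> grid n j"
  using s_less_t by (simp add: grid_def divide_right_mono mult_right_mono)

lemma grid_ge: "s \<le> grid n j"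
  using grid_mono[of 0 j n] by simp

lemma grid_nonneg: "0 \<le> grid n j"
  using grid_ge[of n j] s_nonneg by linarith

lemma grid_step: "grid n (Suc j) - grid n j = (t - s) / real n"
  by (simp only: grid_def of_nat_Suc distrib_right)

lemma grid_less: "0 < n \<Longrightarrow> grid n j < grid n (Suc j)"
proof -
  assume "0 < n"
  then have "0 < (t - s) / real n" using s_less_t by simp
  then show ?thesis using grid_step[of n j] by linarith
qed

lemma drift_norm: "norm (drift u w) \<le> C"
  using \<beta>_bound C_nonneg by (simp add: drift_def)

lemma drift_measurable [measurable (raw)]:
  assumes [measurable]: "f \<in> borel_measurable N" "g \<in> measurable N M"
  shows "(\<lambda>x. drift (f x) (g x)) \<in> borel_measurable N"
  unfolding drift_def by measurable

lemma drift_integrable: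
  assumes "w \<in> space M"
  shows "set_integrable lborel {a..b} (\<lambda>u. drift u w)"
proof -
  note [measurable] = assms
  have "integrable lborel (\<lambda>u. indicator {a..b} u *\<^sub>R C)"
    using borel_integrable_atLeastAtMost'[of a b "\<lambda>_. C"] by (simp add: set_integrable_def)
  then show ?thesis unfolding set_integrable_def
  proof (rule Bochner_Integration.integrable_bound)
    show "AE u in lborel. norm (indicator {a..b} u *\<^sub>R drift u w) \<le> norm (indicator {a..b} u *\<^sub>R C)"
      using drift_norm[of _ w] C_nonneg by (intro AE_I2) (simp add: indicator_def)
  qed measurable
qed

lemma drift_increment_norm:
  assumes "w \<in> space M"
  shows "norm (drift_increment n j w) \<le> C * (grid n (Suc j) - grid n j)"
proof -
  have "norm (drift_increment n j w) \<le> (LINT u:{grid n j..grid n (Suc j)}|lborel. norm (drift u w))"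
    unfolding drift_increment_def by (rule set_integral_norm_bound[OF drift_integrable[OF assms]])
  also have "\<dots> \<le> (LINT u:{grid n j..grid n (Suc j)}|lborel. C)"
    using drift_integrable[OF assms] drift_norm
    by (intro set_integral_mono) (auto simp: set_integrable_norm borel_integrable_atLeastAtMost')
  also have "\<dots> = C * (grid n (Suc j) - grid n j)"
    using grid_mono[of j "Suc j" n] by (simp add: set_lebesgue_integral_def)
  finally show ?thesis .
qed

lemma drift_increment_measurable_G: "drift_increment n j \<in> borel_measurable (G (grid n (Suc j)))"
proof -
  let ?v = "grid n (Suc j)"
  have path: "(\<lambda>x. path (min (snd x) ?v) (fst x)) \<in> borel_measurable (G ?v \<Otimes>\<^sub>M lborel)"
    by (rule path_joint_measurable_G[OF _ _ grid_nonneg]) measurable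
  have "(\<lambda>w. \<integral>u. indicator {grid n j..?v} u *\<^sub>R
      (if path (min u ?v) w \<in> K then \<beta> (path (min u ?v) w) else 0) \<partial>lborel) \<in> borel_measurable (G ?v)"
  proof (rule lborel.borel_measurable_lebesgue_integral)
    note [measurable] = path
    have "(\<lambda>x. indicator {grid n j..?v} (snd x) *\<^sub>R
      (if path (min (snd x) ?v) (fst x) \<in> K then \<beta> (path (min (snd x) ?v) (fst x)) else 0)) \<in> borel_measurable (G ?v \<Otimes>\<^sub>M lborel)"
      by measurable
    then show "(\<lambda>(w, u). indicator {grid n j..?v} u *\<^sub>R
      (if path (min u ?v) w \<in> K then \<beta> (path (min u ?v) w) else 0)) \<in> borel_measurable (G ?v \<Otimes>\<^sub>M lborel)"
      by (simp add: split_def)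
  qed
  moreover have "drift_increment n j = (\<lambda>w. \<integral>u. indicator {grid n j..?v} u *\<^sub>R
      (if path (min u ?v) w \<in> K then \<beta> (path (min u ?v) w) else 0) \<partial>lborel)"
    unfolding drift_increment_def[abs_def] set_lebesgue_integral_def drift_def
    by (intro ext Bochner_Integration.integral_cong) (auto simp: indicator_def min_def)
  ultimately show ?thesis by simp
qed

lemma frozen_norm: "w \<in> space M \<Longrightarrow> norm (frozen n j w) \<le> C"
  using alive_path[of w "grid n j" "grid n j"] S_bound C_nonneg grid_ge by (simp add: frozen_def)

lemma frozen_measurable_G: "frozen n j \<in> borel_measurable (G (grid n j))"
proof -
  note [measurable] = alive_measurable_G[OF grid_ge] path_measurable_G[OF order_refl grid_nonneg]
  show ?thesis unfolding frozen_def[abs_def] by measurable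
qed

lemma euler_measurable_G: "euler n j \<in> borel_measurable (G (grid n j))"
proof (induction j)
  case 0
  have "euler n 0 = path s" by (simp add: fun_eq_iff)
  then show ?case using path_measurable_G[OF order_refl s_nonneg] by simp
next
  case (Suc j)
  let ?G = "G (grid n (Suc j))"
  have le: "grid n j \<le> grid n (Suc j)" by (rule grid_mono) simp
  have [measurable]: "euler n j \<in> borel_measurable ?G" "Measurable.pred ?G (alive (grid n j))"
    "drift_increment n j \<in> borel_measurable ?G" "frozen n j \<in> borel_measurable ?G"
    "W (grid n (Suc j)) \<in> borel_measurable ?G" "W (grid n j) \<in> borel_measurable ?G"
    using measurable_G_mono[OF Suc le] measurable_G_mono[OF alive_measurable_G[OF grid_ge] le] drift_increment_measurable_G
      measurable_G_mono[OF frozen_measurable_G le] W_measurable_G[OF grid_nonneg] measurable_G_mono[OF W_measurable_G[OF grid_nonneg] le]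
    by blast+
  have "euler n (Suc j) = (\<lambda>w. euler n j w + (if alive (grid n j) w then drift_increment n j w else 0)
    + frozen n j w *v (W (grid n (Suc j)) w - W (grid n j) w))" by (simp add: fun_eq_iff)
  also have "\<dots> \<in> borel_measurable ?G" by measurable
  finally show ?case .
qed

lemma frozen_simple: "simple_integrand M G n (grid n) (frozen n)"
  unfolding simple_integrand_def
  using grid_nonneg grid_mono frozen_measurable_G frozen_norm by (auto simp: bounded_iff s_nonneg intro!: exI[of _ C])

lemma frozen_ito:
  assumes "j \<le> n"
  shows "simple_ito n (grid n) (frozen n) W (grid n j) w - simple_ito n (grid n) (frozen n) W s w
    = (\<Sum>i<j. frozen n i w *v (W (grid n (Suc i)) w - W (grid n i) w))"
proof -
  have "simple_ito n (grid n) (frozen n) W (grid n j) w - simple_ito n (grid n) (frozen n) W s w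
    = (\<Sum>i<n. frozen n i w *v (W (max s (min (grid n j) (grid n (Suc i)))) w - W (max s (min (grid n j) (grid n i))) w))"
    by (rule simple_ito_increment[OF grid_ge])
  also have "\<dots> = (\<Sum>i<j. frozen n i w *v (W (grid n (Suc i)) w - W (grid n i) w))"
  proof (rule sum.mono_neutral_cong_right)
    show "\<forall>i\<in>{..<n} - {..<j}. frozen n i w *v (W (max s (min (grid n j) (grid n (Suc i)))) w - W (max s (min (grid n j) (grid n i))) w) = 0"
      using grid_mono[of j _ n] by (auto simp: min_absorb1 le_SucI)
    fix i assume "i \<in> {..<j}"
    then have "max s (min (grid n j) (grid n (Suc i))) = grid n (Suc i)" "max s (min (grid n j) (grid n i)) = grid n i"
      using grid_mono[of "Suc i" j n] grid_mono[of i j n] grid_ge[of n i] grid_ge[of n "Suc i"] by auto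
    then show "frozen n i w *v (W (max s (min (grid n j) (grid n (Suc i)))) w - W (max s (min (grid n j) (grid n i))) w)
      = frozen n i w *v (W (grid n (Suc i)) w - W (grid n i) w)" by simp
  qed (use assms in auto)
  finally show ?thesis .
qed

text \<open>The left end of the grid cell that contains \<open>u\<close>. The cells are left-open
  and right-closed, as for simple integrands; hence a ceiling minus 1 instead of a floor.\<close>

definition left_point :: "nat \<Rightarrow> real \<Rightarrow> real" where
  "left_point n u = s + (t - s) / real n * (of_int \<lceil>(u - s) / ((t - s) / real n)\<rceil> - 1)"

lemma left_point_bounds:
  assumes n: "0 < n" and u: "s < u"
  shows "s \<le> left_point n u" "left_point n u < u" "u - (t - s) / real n \<le> left_point n u"
proof -
  define h where "h = (t - s) / real n"
  have h: "h > 0" using n s_less_t by (simp add: h_def)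
  define x where "x = (u - s) / h"
  have x: "x > 0" "u = s + h * x" using u h by (auto simp: x_def)
  have lp: "left_point n u = s + h * (of_int \<lceil>x\<rceil> - 1)" by (simp add: left_point_def h_def x_def)
  have "1 \<le> \<lceil>x\<rceil>" using x(1) by (simp add: le_ceiling_iff)
  then have "of_int \<lceil>x\<rceil> \<ge> (1 :: real)" by linarith
  then show "s \<le> left_point n u" using h unfolding lp by simp
  have "of_int \<lceil>x\<rceil> - 1 < x" "x \<le> of_int \<lceil>x\<rceil>" by linarith+
  then have "h * (of_int \<lceil>x\<rceil> - 1) < h * x" "h * (x - 1) \<le> h * (of_int \<lceil>x\<rceil> - 1)"
    using h by (intro mult_strict_left_mono mult_left_mono; simp)+
  then show "left_point n u < u" "u - (t - s) / real n \<le> left_point n u"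
    using x(2) unfolding lp h_def[symmetric] by (simp_all add: right_diff_distrib)
qed

lemma left_point_eq:
  assumes n: "0 < n" and u: "grid n i < u" "u \<le> grid n (Suc i)"
  shows "left_point n u = grid n i"
proof -
  define h where "h = (t - s) / real n"
  have h: "h > 0" using n s_less_t by (simp add: h_def)
  have "real i < (u - s) / h" "(u - s) / h \<le> real i + 1"
    using u h by (simp_all add: grid_def h_def[symmetric] field_simps)
  then have "\<lceil>(u - s) / h\<rceil> = int i + 1" by linarith
  then show ?thesis by (simp add: left_point_def grid_def h_def mult.commute)
qed

lemma grid_cover:
  assumes n: "0 < n" and u: "s < u" "u \<le> grid n j"
  obtains i where "i < j" "grid n i < u" "u \<le> grid n (Suc i)"
proof -
  define i where "i = (LEAST i. u \<le> grid n i)"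
  have i: "u \<le> grid n i" "i \<le> j" unfolding i_def using u(2) by (auto intro: LeastI Least_le)
  have "i \<noteq> 0" using i(1) u(1) by (intro notI) simp
  then obtain k where k: "i = Suc k" using not0_implies_Suc by blast
  have "\<not> u \<le> grid n k" using not_less_Least[of k "\<lambda>i. u \<le> grid n i"] k by (simp add: i_def)
  then show thesis using that[of k] i k by simp
qed

lemma left_point_tendsto: "s < u \<Longrightarrow> (\<lambda>n. left_point n u) \<longlonglongrightarrow> u"
proof (rule tendsto_sandwich)
  assume u: "s < u"
  show "\<forall>\<^sub>F n in sequentially. u - (t - s) / real n \<le> left_point n u" "\<forall>\<^sub>F n in sequentially. left_point n u \<le> u"
    using left_point_bounds(2,3)[OF _ u] by (intro eventually_sequentiallyI[of 1]; simp add: less_imp_le)+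
  have "(\<lambda>n. (t - s) / real n) \<longlonglongrightarrow> 0" by (rule lim_const_over_n)
  from tendsto_diff[OF tendsto_const this] show "(\<lambda>n. u - (t - s) / real n) \<longlonglongrightarrow> u" by simp
qed simp

lemma left_point_measurable [measurable]: "left_point n \<in> borel_measurable borel"
  unfolding left_point_def[abs_def] by measurable

lemma path_left_point_tendsto:
  assumes "w \<in> space M" "s < u"
  shows "(\<lambda>n. path (left_point n u) w) \<longlonglongrightarrow> path u w"
  using continuous_path[OF assms(1)] left_point_tendsto[OF assms(2)]
  by (auto simp: continuous_on_eq_continuous_at intro: isCont_tendsto_compose[of u "\<lambda>u. path u w"])

definition freezing_error :: "nat \<Rightarrow> 'w \<Rightarrow> ennreal" where
  "freezing_error n w = (\<integral>\<^sup>+ u\<in>{s<..t}. sqnorm (if alive u w then S (path u w) - S (path (left_point n u) w) else 0) \<partial>lborel)"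

lemma freezing_error_measurable [measurable]: "freezing_error n \<in> borel_measurable M"
  unfolding freezing_error_def[abs_def] by measurable

text \<open>Two dominated convergences, first in \<open>u\<close> and then in \<open>w\<close>:
  paths and \<open>S\<close> are continuous, and as long as the path is alive both values of
  \<open>S\<close> are bounded by \<open>C\<close>.\<close>

lemma freezing_error_tendsto: "(\<lambda>n. \<integral>\<^sup>+ w. freezing_error n w \<partial>M) \<longlonglongrightarrow> 0"
proof -
  let ?F = "\<lambda>n u w. sqnorm (if alive u w then S (path u w) - S (path (left_point n u) w) else 0) * indicator {s<..t} u"
  \<comment> \<open>The index is shifted by one because left points are controlled for a positive
    number of cells only.\<close>
  have bound: "?F (Suc n) u w \<le> ennreal ((2 * C)\<^sup>2) * indicator {s..t} u" if w: "w \<in> space M" for n u w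
  proof (cases "s < u \<and> u \<le> t \<and> alive u w")
    case True
    then have "path u w \<in> K" "path (left_point (Suc n) u) w \<in> K"
      using alive_path[OF w, of u u] alive_path[OF w, of "left_point (Suc n) u" u] left_point_bounds[of "Suc n" u]
      by (simp_all add: less_imp_le del: of_nat_Suc)
    then have "norm (S (path u w) - S (path (left_point (Suc n) u) w)) \<le> 2 * C"
      by (intro order_trans[OF norm_triangle_ineq4]) (use S_bound[of "path u w"] S_bound[of "path (left_point (Suc n) u) w"] in simp)
    then have "sqnorm (S (path u w) - S (path (left_point (Suc n) u) w)) \<le> ennreal ((2 * C)\<^sup>2)"
      by (intro ennreal_leI power_mono) auto
    then show ?thesis using True by simp
  qed (auto simp: indicator_def)
  have inner: "(\<lambda>n. freezing_error (Suc n) w) \<longlonglongrightarrow> 0" if w: "w \<in> space M" for w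
  proof -
    note [measurable] = w
    have "(\<lambda>n. \<integral>\<^sup>+ u. ?F (Suc n) u w \<partial>lborel) \<longlonglongrightarrow> (\<integral>\<^sup>+ (u :: real). 0 \<partial>lborel)"
    proof (rule nn_integral_dominated_convergence[where w = "\<lambda>u. ennreal ((2 * C)\<^sup>2) * indicator {s..t} u"])
      show "(\<integral>\<^sup>+ u. ennreal ((2 * C)\<^sup>2) * indicator {s..t} u \<partial>lborel) < \<infinity>"
        using s_less_t by (simp add: nn_integral_cmult_indicator ennreal_mult_less_top)
      show "AE u in lborel. (\<lambda>n. ?F (Suc n) u w) \<longlonglongrightarrow> 0"
      proof (rule AE_I2)
        fix u
        show "(\<lambda>n. ?F (Suc n) u w) \<longlonglongrightarrow> 0"
        proof (cases "s < u \<and> alive u w")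
          case True
          then have "(\<lambda>n. path (left_point (Suc n) u) w) \<longlonglongrightarrow> path u w"
            by (intro LIMSEQ_Suc path_left_point_tendsto w) auto
          then have "(\<lambda>n. S (path (left_point (Suc n) u) w)) \<longlonglongrightarrow> S (path u w)"
            using S_continuous by (auto simp: continuous_on_eq_continuous_at intro: isCont_tendsto_compose)
          then have "(\<lambda>n. sqnorm (S (path u w) - S (path (left_point (Suc n) u) w))) \<longlonglongrightarrow> sqnorm (S (path u w) - S (path u w))"
            by (intro tendsto_intros)
          then have "(\<lambda>n. sqnorm (S (path u w) - S (path (left_point (Suc n) u) w)) * indicator {s<..t} u) \<longlonglongrightarrow> 0 * indicator {s<..t} u"
            by (cases "u \<le> t") (auto simp: indicator_def)
          then show ?thesis using True by simp
        qed (auto simp: indicator_def)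
      qed
    qed (use bound[OF w] in auto)
    then show ?thesis by (simp add: freezing_error_def)
  qed
  have "(\<lambda>n. \<integral>\<^sup>+ w. freezing_error (Suc n) w \<partial>M) \<longlonglongrightarrow> (\<integral>\<^sup>+ w. 0 \<partial>M)"
  proof (rule nn_integral_dominated_convergence[where w = "\<lambda>w. ennreal ((2 * C)\<^sup>2) * ennreal (t - s)"])
    show "AE w in M. freezing_error (Suc n) w \<le> ennreal ((2 * C)\<^sup>2) * ennreal (t - s)" for n
    proof (rule AE_I2)
      fix w assume w: "w \<in> space M"
      have "freezing_error (Suc n) w \<le> (\<integral>\<^sup>+ u. ennreal ((2 * C)\<^sup>2) * indicator {s..t} u \<partial>lborel)"
        unfolding freezing_error_def by (intro nn_integral_mono bound w)
      then show "freezing_error (Suc n) w \<le> ennreal ((2 * C)\<^sup>2) * ennreal (t - s)"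
        using s_less_t by (simp add: nn_integral_cmult_indicator)
    qed
  qed (use inner in \<open>auto simp: emeasure_space_1 ennreal_mult_less_top\<close>)
  then have "(\<lambda>n. \<integral>\<^sup>+ w. freezing_error (Suc n) w \<partial>M) \<longlonglongrightarrow> 0"
    by (simp only: nn_integral_const mult_zero_left)
  then show ?thesis by (rule LIMSEQ_imp_Suc)
qed

lemma sq_dist_frozen_le:
  assumes w: "w \<in> space M" and n: "0 < n" and j: "j \<le> n" and a: "alive (grid n j) w"
  shows "sq_dist n (grid n) (frozen n) s (grid n j) w \<le> freezing_error n w"
  unfolding sq_dist_def freezing_error_def
proof (rule nn_integral_mono_AE)
  show "AE u in lborel. sqnorm (S (path u w) - simple_value n (grid n) (frozen n) u w) * indicator {s..grid n j} u
    \<le> sqnorm (if alive u w then S (path u w) - S (path (left_point n u) w) else 0) * indicator {s<..t} u"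
    using AE_lborel_singleton[of s]
  proof eventually_elim
    case (elim u)
    show ?case
    proof (cases "s \<le> u \<and> u \<le> grid n j")
      case True
      with elim have u: "s < u" "u \<le> grid n j" by auto
      then obtain i where i: "i < j" "grid n i < u" "u \<le> grid n (Suc i)" using grid_cover[OF n] by blast
      have "alive u w" "alive (grid n i) w"
        using alive_mono[OF w _ _ a] u i grid_mono[of i j n] grid_ge[of n i] by auto
      moreover have "simple_value n (grid n) (frozen n) u w = frozen n i w"
        by (rule simple_value_eq) (use i j grid_mono in auto)
      moreover have "u \<le> t" using u(2) grid_mono[OF j, of n] grid_n[OF n] by simp
      ultimately show ?thesis using u by (simp add: left_point_eq[OF n i(2,3)] frozen_def)
    qed auto
  qed
qed

end

context ito_diffusion
begin

lemma X_increment: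
  "AE w in M. \<forall>u v. 0 \<le> u \<longrightarrow> u \<le> v \<longrightarrow> set_integrable lborel {u..v} (\<lambda>r. \<beta> (path r w)) \<and>
    path v w - path u w = (LINT r:{u..v}|lborel. \<beta> (path r w)) + (I v w - I u w)"
  using X_eq
proof eventually_elim
  case (elim w)
  show ?case
  proof (intro allI impI)
    fix u v :: real assume uv: "0 \<le> u" "u \<le> v"
    have eq: "set_integrable lborel {0..r} (\<lambda>r. \<beta> (path r w)) = set_integrable lborel {0..r} (\<lambda>r. \<beta> (X r w))"
      "(LINT r:{0..r}|lborel. \<beta> (path r w)) = (LINT r:{0..r}|lborel. \<beta> (X r w))" for r
      unfolding set_integrable_def set_lebesgue_integral_def
      by (intro Bochner_Integration.integrable_cong Bochner_Integration.integral_cong; simp add: indicator_def)+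
    have int: "set_integrable lborel {0..v} (\<lambda>r. \<beta> (path r w))" using elim uv by (auto simp: eq)
    have "X v w - X u w = (LINT r:{0..v}|lborel. \<beta> (path r w)) - (LINT r:{0..u}|lborel. \<beta> (path r w)) + (I v w - I u w)"
      using elim[rule_format, of u] elim[rule_format, of v] uv by (simp add: eq)
    then show "set_integrable lborel {u..v} (\<lambda>r. \<beta> (path r w)) \<and>
      path v w - path u w = (LINT r:{u..v}|lborel. \<beta> (path r w)) + (I v w - I u w)"
      using uv set_integral_Icc_combine[OF uv int] by (auto intro: set_integrable_subset[OF int])
  qed
qed

end

lemma abs_trace_congruence_le:
  fixes A D :: "real ^ 'd ^ 'd"
  shows "\<bar>trace (transpose A ** D ** A)\<bar> \<le> norm D * (norm A)\<^sup>2"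
proof -
  have "trace (transpose A ** D ** A) = (\<Sum>j\<in>UNIV. column j A \<bullet> (D *v column j A))"
    unfolding trace_def
    by (intro sum.cong refl)
      (simp add: matrix_mul_assoc[symmetric] column_matrix_matrix_mult[symmetric], simp add: matrix_matrix_mult_def transpose_def column_def inner_vec_def)
  also have "\<bar>\<dots>\<bar> \<le> (\<Sum>j\<in>UNIV. norm D * (norm (column j A))\<^sup>2)"
  proof (intro order_trans[OF sum_abs] sum_mono)
    fix j
    have "\<bar>column j A \<bullet> (D *v column j A)\<bar> \<le> norm (column j A) * (norm D * norm (column j A))"
      by (rule order_trans[OF Cauchy_Schwarz_ineq2]) (intro mult_left_mono norm_matrix_vector_mult_le norm_ge_zero)
    then show "\<bar>column j A \<bullet> (D *v column j A)\<bar> \<le> norm D * (norm (column j A))\<^sup>2" by (simp add: power2_eq_square mult_ac)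
  qed
  also have "\<dots> = norm D * (norm A)\<^sup>2" by (simp add: norm_matrix_squared_columns sum_distrib_left)
  finally show ?thesis .
qed

context localized_diffusion
begin

abbreviation alive_gap :: "(real ^ 'd \<Rightarrow> 'b::real_normed_vector) \<Rightarrow> nat \<Rightarrow> nat \<Rightarrow> 'w \<Rightarrow> real" where
  "alive_gap F n j w \<equiv> indicator {w. alive (grid n j) w} w * norm (F (euler n j w) - F (path (grid n j) w))"

lemma sum_drift_increment:
  assumes "w \<in> space M"
  shows "(\<Sum>i<j. drift_increment n i w) = (LINT u:{s..grid n j}|lborel. drift u w)"
proof (induction j)
  case 0
  have "AE u in lborel. indicator {s..s} u *\<^sub>R drift u w = 0"
    using AE_lborel_singleton[of s] by eventually_elim auto
  then have "(LINT u:{s..s}|lborel. drift u w) = 0"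
    unfolding set_lebesgue_integral_def by (rule integral_eq_zero_AE)
  then show ?case by simp
next
  case (Suc j)
  show ?case
    using set_integral_Icc_combine[OF grid_ge grid_mono drift_integrable[OF assms], of j "Suc j" n] Suc
    by (simp add: drift_increment_def)
qed

lemma euler_sum:
  assumes w: "w \<in> space M"
  shows "alive (grid n j) w \<Longrightarrow> euler n j w = path s w + (\<Sum>i<j. drift_increment n i w)
    + (\<Sum>i<j. frozen n i w *v (W (grid n (Suc i)) w - W (grid n i) w))"
proof (induction j)
  case (Suc j)
  then have "alive (grid n j) w" using alive_mono[OF w grid_ge grid_mono] by (meson le_SucI order_refl)
  with Suc show ?case by simp
qed simp

text \<open>The drift parts of the path and of the scheme agree exactly on these paths, so only the
  stochastic integrals are left to compare.\<close>

lemma euler_error: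
  "AE w in M. \<forall>n j. 0 < n \<longrightarrow> j \<le> n \<longrightarrow> alive (grid n j) w \<longrightarrow>
    path (grid n j) w - euler n j w = (I (grid n j) w - I s w) -
      (simple_ito n (grid n) (frozen n) W (grid n j) w - simple_ito n (grid n) (frozen n) W s w)"
  using X_increment AE_space
proof eventually_elim
  case (elim w)
  show ?case
  proof (intro allI impI)
    fix n j assume n: "0 < n" "j \<le> n" and a: "alive (grid n j) w"
    have "(LINT u:{s..grid n j}|lborel. drift u w) = (LINT u:{s..grid n j}|lborel. \<beta> (path u w))"
      by (intro set_lebesgue_integral_cong) (auto simp: drift_def dest!: alive_path[OF elim(2) _ _ a])
    then have "path (grid n j) w - path s w = (LINT u:{s..grid n j}|lborel. drift u w) + (I (grid n j) w - I s w)"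
      using elim(1) s_nonneg grid_ge[of n j] by metis
    moreover have "euler n j w = path s w + (LINT u:{s..grid n j}|lborel. drift u w)
      + (simple_ito n (grid n) (frozen n) W (grid n j) w - simple_ito n (grid n) (frozen n) W s w)"
      unfolding euler_sum[OF elim(2) a] sum_drift_increment[OF elim(2)] frozen_ito[OF n(2)] ..
    ultimately show "path (grid n j) w - euler n j w = (I (grid n j) w - I s w) -
      (simple_ito n (grid n) (frozen n) W (grid n j) w - simple_ito n (grid n) (frozen n) W s w)"
      by (simp add: algebra_simps)
  qed
qed

lemma euler_measurable [measurable]: "euler n j \<in> borel_measurable M"
  by (rule measurable_G[OF euler_measurable_G])

lemma euler_close:
  assumes \<eta>: "0 < \<eta>" and e: "0 < e"
  obtains N where "0 < N" "\<And>n j. N \<le> n \<Longrightarrow> j \<le> n \<Longrightarrow>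
    prob {w \<in> space M. alive (grid n j) w \<and> \<eta> \<le> norm (path (grid n j) w - euler n j w)} \<le> e"
proof -
  \<comment> \<open>The deviation inequality at level \<open>L\<close> then costs
    \<open>e / 2\<close>, and Markov's inequality for a freezing error above \<open>L\<close> costs
    another \<open>e / 2\<close>.\<close>
  define L where "L = e * \<eta>\<^sup>2 / 2"
  have L: "L > 0" "L / \<eta>\<^sup>2 = e / 2" using \<eta> e by (auto simp: L_def)
  have "\<forall>\<^sub>F n in sequentially. (\<integral>\<^sup>+ w. freezing_error n w \<partial>M) < ennreal (L * (e / 2))"
    using order_tendstoD(2)[OF freezing_error_tendsto] L e by simp
  then obtain N where N: "\<And>n. N \<le> n \<Longrightarrow> (\<integral>\<^sup>+ w. freezing_error n w \<partial>M) < ennreal (L * (e / 2))"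
    by (auto simp: eventually_sequentially)
  show thesis
  proof (rule that[of "Suc N"])
    fix n j assume nN: "Suc N \<le> n" and j: "j \<le> n"
    then have n: "0 < n" by simp
    define D where "D w = (I (grid n j) w - I s w) -
      (simple_ito n (grid n) (frozen n) W (grid n j) w - simple_ito n (grid n) (frozen n) W s w)" for w
    define q where "q = sq_dist n (grid n) (frozen n) s (grid n j)"
    note [measurable] = I_measurable[OF s_nonneg] I_measurable[OF grid_nonneg]
      simple_ito_measurable[OF frozen_simple s_nonneg] simple_ito_measurable[OF frozen_simple grid_nonneg]
    have [measurable]: "D \<in> borel_measurable M" "q \<in> borel_measurable M"
      unfolding D_def q_def using sq_dist_measurable[OF frozen_simple] by measurable
    let ?E = "{w \<in> space M. alive (grid n j) w \<and> \<eta> \<le> norm (path (grid n j) w - euler n j w)}"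
    let ?E1 = "{w \<in> space M. q w < ennreal L \<and> \<eta> \<le> norm (D w)}"
    let ?E2 = "{w \<in> space M. ennreal L \<le> freezing_error n w}"
    have "prob ?E \<le> prob (?E1 \<union> ?E2)"
    proof (rule finite_measure_mono_AE)
      show "AE w in M. w \<in> ?E \<longrightarrow> w \<in> ?E1 \<union> ?E2"
        using euler_error
      proof eventually_elim
        case (elim w)
        show ?case
        proof
          assume w: "w \<in> ?E"
          then have "D w = path (grid n j) w - euler n j w" using elim n j by (simp add: D_def)
          moreover have "q w \<le> freezing_error n w" unfolding q_def using w by (intro sq_dist_frozen_le n j) auto
          ultimately show "w \<in> ?E1 \<union> ?E2" using w by (cases "ennreal L \<le> freezing_error n w") auto
        qed
      qed
    qed measurable
    also have "\<dots> \<le> prob ?E1 + prob ?E2" by (intro measure_Un_le) measurable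
    also have "prob ?E1 \<le> e / 2"
      using ito_deviation[OF frozen_simple s_nonneg grid_ge less_imp_le[OF L(1)] \<eta>, of n n j] L(2) unfolding q_def D_def by simp
    also have "prob ?E2 \<le> e / 2"
    proof -
      have "ennreal L * emeasure M ?E2 = (\<integral>\<^sup>+ w. ennreal L * indicator ?E2 w \<partial>M)"
        by (simp add: nn_integral_cmult_indicator)
      also have "\<dots> \<le> (\<integral>\<^sup>+ w. freezing_error n w \<partial>M)"
        by (intro nn_integral_mono) (auto simp: indicator_def)
      also have "\<dots> \<le> ennreal (L * (e / 2))" using N[of n] nN by simp
      finally have "ennreal (L * prob ?E2) \<le> ennreal (L * (e / 2))"
        using L by (simp add: emeasure_eq_measure ennreal_mult)
      then have "L * prob ?E2 \<le> L * (e / 2)" using L e by (subst (asm) ennreal_le_iff) auto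
      then show ?thesis using L by simp
    qed
    finally show "prob ?E \<le> e" by simp
  qed simp
qed

lemma euler_test_function_close:
  fixes F :: "real ^ 'd \<Rightarrow> 'b::{real_normed_vector, second_countable_topology}"
  assumes F: "uniformly_continuous_on UNIV F" "\<And>x. norm (F x) \<le> b" and e: "0 < e"
  obtains N where "0 < N" "\<And>n j. N \<le> n \<Longrightarrow> j \<le> n \<Longrightarrow>
    expectation (\<lambda>w. alive_gap F n j w) \<le> e"
proof -
  have b: "0 \<le> b" using F(2)[of 0] norm_ge_zero[of "F 0"] by linarith
  have [measurable]: "F \<in> borel_measurable borel"
    using F(1) by (intro borel_measurable_continuous_onI uniformly_continuous_imp_continuous)
  obtain \<eta> where \<eta>: "0 < \<eta>" "\<And>x y. dist x y < \<eta> \<Longrightarrow> dist (F x) (F y) < e / 2"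
    using F(1) e unfolding uniformly_continuous_on_def by (metis UNIV_I half_gt_zero dist_commute)
  \<comment> \<open>On the exceptional event the gap is at most \<open>2 * b\<close>, so its
    contribution to the mean is at most \<open>e / 2\<close>.\<close>
  define e' where "e' = e / (2 * (2 * b + 1))"
  have e': "0 < e'" "2 * b * e' \<le> e / 2"
    using e b by (auto simp: e'_def field_simps add_nonneg_pos)
  obtain N where N: "0 < N" "\<And>n j. N \<le> n \<Longrightarrow> j \<le> n \<Longrightarrow>
    prob {w \<in> space M. alive (grid n j) w \<and> \<eta> \<le> norm (path (grid n j) w - euler n j w)} \<le> e'"
    using euler_close[OF \<eta>(1) e'(1)] by blast
  show thesis
  proof (rule that[OF N(1)])
    fix n j assume nj: "N \<le> n" "j \<le> n"
    let ?E = "{w \<in> space M. alive (grid n j) w \<and> \<eta> \<le> norm (path (grid n j) w - euler n j w)}"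
    let ?f = "alive_gap F n j"
    have le2b: "norm (F x - F y) \<le> 2 * b" for x y
      by (rule order_trans[OF norm_triangle_ineq4]) (use F(2)[of x] F(2)[of y] in linarith)
    have "expectation ?f \<le> expectation (\<lambda>w. e / 2 + 2 * b * indicator ?E w)"
    proof (intro integral_mono)
      show "integrable M ?f"
      proof (rule integrable_const_bound[where B = "2 * b"])
        show "AE w in M. norm (?f w) \<le> 2 * b" using le2b b by (intro AE_I2) (auto simp: indicator_def)
      qed measurable
      fix w assume w: "w \<in> space M"
      show "?f w \<le> e / 2 + 2 * b * indicator ?E w"
      proof (cases "w \<in> ?E")
        case True
        then show ?thesis using le2b[of "euler n j w" "path (grid n j) w"] e by simp
      next
        case False
        then have "alive (grid n j) w \<Longrightarrow> norm (F (euler n j w) - F (path (grid n j) w)) \<le> e / 2"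
          using w \<eta>(2)[of "euler n j w" "path (grid n j) w"] by (auto simp: dist_norm norm_minus_commute not_le intro: less_imp_le)
        then show ?thesis using e b by (auto simp: indicator_def)
      qed
    qed (auto intro!: Bochner_Integration.integrable_add Bochner_Integration.integrable_mult_right integrable_real_indicator simp: emeasure_eq_measure)
    also have "\<dots> = e / 2 + 2 * b * prob ?E"
      by (subst Bochner_Integration.integral_add) (auto simp: prob_space emeasure_eq_measure)
    also have "\<dots> \<le> e / 2 + 2 * b * e'" using N(2)[OF nj] b by (intro add_left_mono mult_left_mono) auto
    also have "\<dots> \<le> e" using e'(2) by simp
    finally show "expectation ?f \<le> e" .
  qed
qed

end

lemma field_le_mult_epsilon:
  fixes x y c :: real
  assumes "0 < c" "\<And>e. 0 < e \<Longrightarrow> x \<le> y + c * e"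
  shows "x \<le> y"
proof (rule field_le_epsilon)
  fix e :: real assume "0 < e"
  then show "x \<le> y + e" using assms(2)[of "e / c"] assms(1) by simp
qed

section \<open>Dynkin's inequality for localized paths\<close>

locale localized_test_function = localized_diffusion M G W X \<beta> S I K C s t + C2_test_function f g H b
  for M :: "'w measure" and G :: "real \<Rightarrow> 'w measure" and W :: "real \<Rightarrow> 'w \<Rightarrow> real ^ 'd"
    and X :: "real \<Rightarrow> 'w \<Rightarrow> real ^ 'd" and \<beta> :: "real ^ 'd \<Rightarrow> real ^ 'd"
    and S :: "real ^ 'd \<Rightarrow> real ^ 'd ^ 'd" and I :: "real \<Rightarrow> 'w \<Rightarrow> real ^ 'd"
    and K :: "(real ^ 'd) set" and C s t :: real
    and f :: "real ^ 'd \<Rightarrow> real" and g :: "real ^ 'd \<Rightarrow> real ^ 'd" and H :: "real ^ 'd \<Rightarrow> real ^ 'd ^ 'd" and b :: real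
begin

text \<open>The second-order part of the generator: by cyclicity the trace is that of
  \<open>S x ** transpose (S x) ** H x\<close>.\<close>

definition second_order :: "real ^ 'd \<Rightarrow> real" where
  "second_order x = 1 / 2 * trace (transpose (S x) ** H x ** S x)"

lemma second_order_measurable [measurable]: "second_order \<in> borel_measurable borel"
  unfolding second_order_def[abs_def] trace_def by measurable

lemma second_order_continuous: "continuous_on UNIV second_order"
  unfolding second_order_def[abs_def] trace_def matrix_matrix_mult_def transpose_def
  by (intro continuous_intros continuous_on_component S_continuous continuous_H; simp)+

lemma second_order_bound: "x \<in> K \<Longrightarrow> \<bar>second_order x\<bar> \<le> 1 / 2 * (b * C\<^sup>2)"
proof -
  assume "x \<in> K"
  then have "norm (H x) * (norm (S x))\<^sup>2 \<le> b * C\<^sup>2"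
    using S_bound by (intro mult_mono H_bound power_mono b_nonneg) auto
  then show ?thesis using abs_trace_congruence_le[of "S x" "H x"] by (simp add: second_order_def)
qed

text \<open>Mixed evaluation as in the scheme: gradient and second-order term at the left point,
  drift at the current time. The condition \<open>s < u\<close> removes one null point, at which the
  left point would lie one step before \<open>s\<close>.\<close>

definition discrete_rate :: "nat \<Rightarrow> real \<Rightarrow> 'w \<Rightarrow> real" where
  "discrete_rate n u w = (if s < u \<and> alive (left_point n u) w
    then g (path (left_point n u) w) \<bullet> drift u w + second_order (path (left_point n u) w) else 0)"

definition rate :: "real \<Rightarrow> 'w \<Rightarrow> real" where
  "rate u w = (if s < u \<and> alive u w then g (path u w) \<bullet> \<beta> (path u w) + second_order (path u w) else 0)"

definition rate_bound :: real where
  "rate_bound = b * C + 1 / 2 * (b * C\<^sup>2)"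

lemma rate_bound_nonneg: "0 \<le> rate_bound"
  using b_nonneg C_nonneg by (simp add: rate_bound_def)

lemma discrete_rate_measurable [measurable (raw)]:
  assumes [measurable]: "p \<in> borel_measurable N" "q \<in> measurable N M"
  shows "(\<lambda>x. discrete_rate n (p x) (q x)) \<in> borel_measurable N"
  unfolding discrete_rate_def by measurable

lemma rate_measurable [measurable (raw)]:
  assumes [measurable]: "p \<in> borel_measurable N" "q \<in> measurable N M"
  shows "(\<lambda>x. rate (p x) (q x)) \<in> borel_measurable N"
  unfolding rate_def by measurable

lemma rate_aux:
  assumes "x \<in> K" "norm v \<le> C"
  shows "\<bar>g x \<bullet> v + second_order x\<bar> \<le> rate_bound"
proof -
  have "\<bar>g x \<bullet> v\<bar> \<le> b * C"
    by (rule order_trans[OF Cauchy_Schwarz_ineq2]) (intro mult_mono g_bound assms b_nonneg norm_ge_zero)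
  then show ?thesis using second_order_bound[OF assms(1)] unfolding rate_bound_def by linarith
qed

lemma discrete_rate_abs_le: "w \<in> space M \<Longrightarrow> 0 < n \<Longrightarrow> \<bar>discrete_rate n u w\<bar> \<le> rate_bound"
  using rate_aux[OF alive_path[of w "left_point n u" "left_point n u"] drift_norm] left_point_bounds[of n u] rate_bound_nonneg
  by (simp add: discrete_rate_def)

lemma rate_abs_le: "w \<in> space M \<Longrightarrow> \<bar>rate u w\<bar> \<le> rate_bound"
  using rate_aux[of "path u w" "\<beta> (path u w)"] alive_path[of w u u] \<beta>_bound[of "path u w"] rate_bound_nonneg
  by (auto simp: rate_def less_imp_le)

lemma bounded_set_integrable:
  fixes F :: "real \<Rightarrow> real"
  assumes [measurable]: "F \<in> borel_measurable borel" and "\<And>u. \<bar>F u\<bar> \<le> B"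
  shows "set_integrable lborel {p..q} F" "\<bar>LINT u:{p..q}|lborel. F u\<bar> \<le> B * max 0 (q - p)"
proof -
  have B: "0 \<le> B" using assms(2)[of 0] by linarith
  have c: "set_integrable lborel {p..q} (\<lambda>_. B)" by (intro borel_integrable_atLeastAtMost' continuous_on_const)
  show int: "set_integrable lborel {p..q} F"
    using c unfolding set_integrable_def
    by (rule Bochner_Integration.integrable_bound) (use assms(2) B in \<open>auto simp: indicator_def\<close>)
  have "\<bar>LINT u:{p..q}|lborel. F u\<bar> \<le> (LINT u:{p..q}|lborel. B)"
    using set_integral_norm_bound[OF int] set_integral_mono[OF set_integrable_abs[OF int] c] assms(2)
    by (auto intro: order_trans)
  also have "\<dots> = B * max 0 (q - p)" by (simp add: set_lebesgue_integral_def max_def)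
  finally show "\<bar>LINT u:{p..q}|lborel. F u\<bar> \<le> B * max 0 (q - p)" .
qed

text \<open>On paths alive at \<open>u\<close> this is continuity. Otherwise the path is outside
  \<open>K\<close> at some time strictly before \<open>u\<close>: if the exit is seen only at
  \<open>u\<close> itself, the complement of \<open>K\<close> is open and already contains the path
  shortly before. Eventually the left points lie beyond that time, and the discrete rate is
  0.\<close>

lemma discrete_rate_tendsto:
  assumes w: "w \<in> space M"
  shows "(\<lambda>n. discrete_rate n u w) \<longlonglongrightarrow> rate u w"
proof (cases "s < u")
  case u: True
  show ?thesis
  proof (cases "alive u w")
    case True
    have al: "alive (left_point n u) w" if "0 < n" for n
      using alive_mono[OF w left_point_bounds(1)[OF that u] less_imp_le[OF left_point_bounds(2)[OF that u]] True] .
    have "drift u w = \<beta> (path u w)" using alive_path[OF w _ _ True, of u] u by (simp add: drift_def)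
    moreover have "(\<lambda>n. g (path (left_point n u) w) \<bullet> drift u w + second_order (path (left_point n u) w))
      \<longlonglongrightarrow> g (path u w) \<bullet> drift u w + second_order (path u w)"
      using path_left_point_tendsto[OF w u] continuous_g second_order_continuous
      by (intro tendsto_intros) (auto simp: continuous_on_eq_continuous_at intro: isCont_tendsto_compose)
    ultimately have "(\<lambda>n. g (path (left_point n u) w) \<bullet> drift u w + second_order (path (left_point n u) w)) \<longlonglongrightarrow> rate u w"
      using True u by (simp add: rate_def)
    moreover have "\<forall>\<^sub>F n in sequentially. g (path (left_point n u) w) \<bullet> drift u w + second_order (path (left_point n u) w) = discrete_rate n u w"
      by (intro eventually_sequentiallyI[of 1]) (simp add: discrete_rate_def u al)
    ultimately show ?thesis by (rule Lim_transform_eventually)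
  next
    case False
    then obtain r where r: "s \<le> r" "r \<le> u" "path r w \<notin> K" using alive_iff[OF w less_imp_le[OF u]] by (metis atLeastAtMost_iff)
    obtain r' where r': "s \<le> r'" "r' < u" "path r' w \<notin> K"
    proof (cases "r < u")
      case False
      with r have "path u w \<notin> K" by simp
      moreover have "(\<lambda>n. path (left_point n u) w) \<longlonglongrightarrow> path u w" by (rule path_left_point_tendsto[OF w u])
      ultimately have "\<forall>\<^sub>F n in sequentially. path (left_point n u) w \<in> - K"
        using K_closed by (intro topological_tendstoD) (auto simp: closed_def)
      then have "\<forall>\<^sub>F n in sequentially. path (left_point n u) w \<in> - K \<and> 0 < n"
        using eventually_gt_at_top[of 0] by eventually_elim auto
      then obtain n where "path (left_point n u) w \<notin> K" "0 < n" using eventually_happens'[OF sequentially_bot] by auto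
      then show thesis using that[of "left_point n u"] left_point_bounds[OF _ u] by auto
    qed (use r that in auto)
    have "\<forall>\<^sub>F n in sequentially. r' < left_point n u" using left_point_tendsto[OF u] r'(2) by (rule order_tendstoD)
    then have ev: "\<forall>\<^sub>F n in sequentially. 0 = discrete_rate n u w"
    proof eventually_elim
      case (elim n)
      then have "\<not> alive (left_point n u) w" using alive_path[OF w r'(1)] r'(3) by (meson less_imp_le)
      then show ?case by (simp add: discrete_rate_def)
    qed
    have "(\<lambda>n. discrete_rate n u w) \<longlonglongrightarrow> 0" by (rule Lim_transform_eventually[OF tendsto_const ev])
    then show ?thesis using False by (simp add: rate_def)
  qed
qed (simp add: discrete_rate_def rate_def)

lemma integral_discrete_rate_tendsto:
  "(\<lambda>n. expectation (\<lambda>w. LINT u:{s..t}|lborel. discrete_rate (Suc n) u w)) \<longlonglongrightarrow> expectation (\<lambda>w. LINT u:{s..t}|lborel. rate u w)"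
proof (rule integral_dominated_convergence[where w = "\<lambda>_. rate_bound * max 0 (t - s)"])
  have inner: "(\<lambda>n. LINT u:{s..t}|lborel. discrete_rate (Suc n) u w) \<longlonglongrightarrow> (LINT u:{s..t}|lborel. rate u w)" if w: "w \<in> space M" for w
  proof -
    note [measurable] = w
    show ?thesis unfolding set_lebesgue_integral_def
  proof (rule integral_dominated_convergence[where w = "\<lambda>u. indicator {s..t} u *\<^sub>R rate_bound"])
    show "integrable lborel (\<lambda>u. indicator {s..t} u *\<^sub>R rate_bound)"
      using borel_integrable_atLeastAtMost'[of s t "\<lambda>_. rate_bound"] by (simp add: set_integrable_def)
    show "AE u in lborel. (\<lambda>n. indicator {s..t} u *\<^sub>R discrete_rate (Suc n) u w) \<longlonglongrightarrow> indicator {s..t} u *\<^sub>R rate u w"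
      by (intro AE_I2 tendsto_scaleR tendsto_const LIMSEQ_Suc discrete_rate_tendsto w)
    show "AE u in lborel. norm (indicator {s..t} u *\<^sub>R discrete_rate (Suc n) u w) \<le> indicator {s..t} u *\<^sub>R rate_bound" for n
      using discrete_rate_abs_le[OF w, of "Suc n"] by (auto simp: indicator_def)
  qed measurable
  qed
  show "AE w in M. (\<lambda>n. LINT u:{s..t}|lborel. discrete_rate (Suc n) u w) \<longlonglongrightarrow> (LINT u:{s..t}|lborel. rate u w)"
    using inner by (rule AE_I2)
  show "AE w in M. norm (LINT u:{s..t}|lborel. discrete_rate (Suc n) u w) \<le> rate_bound * max 0 (t - s)" for n
    unfolding real_norm_def
  proof (intro AE_I2 bounded_set_integrable(2))
    fix w u assume w [measurable]: "w \<in> space M"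
    show "(\<lambda>u. discrete_rate (Suc n) u w) \<in> borel_measurable borel" by measurable
    show "\<bar>discrete_rate (Suc n) u w\<bar> \<le> rate_bound" by (rule discrete_rate_abs_le[OF w]) simp
  qed
qed (simp_all add: set_lebesgue_integral_def)

abbreviation frozen_trace :: "nat \<Rightarrow> nat \<Rightarrow> 'w \<Rightarrow> real" where
  "frozen_trace n j w \<equiv> trace (transpose (frozen n j w) ** H (euler n j w) ** frozen n j w)"

abbreviation step_rate :: "nat \<Rightarrow> nat \<Rightarrow> 'w \<Rightarrow> real" where
  "step_rate n j w \<equiv> LINT u:{grid n j..grid n (Suc j)}|lborel. discrete_rate n u w"

text \<open>The Taylor step produces \<open>g\<close> and \<open>H\<close> at the scheme, whereas
  the rate uses them at the path; the replacement is paid for by the two gap terms. The remaining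
  parts agree because the left point is constant on the cell except at its left end.\<close>

lemma euler_step_rate:
  fixes n j :: nat
  assumes w: "w \<in> space M" and n: "0 < n"
  defines "D \<equiv> (if alive (grid n j) w then drift_increment n j w else 0)"
  defines "h \<equiv> (t - s) / real n"
  shows "g (euler n j w) \<bullet> D + h / 2 * frozen_trace n j w
    \<le> step_rate n j w
      + C * h * alive_gap g n j w
      + 1 / 2 * C\<^sup>2 * h * alive_gap H n j w"
proof -
  have h: "h = grid n (Suc j) - grid n j" "h \<ge> 0" using grid_step[of n j] s_less_t by (auto simp: h_def)
  let ?x = "path (grid n j) w" and ?y = "euler n j w"
  have lp: "AE u in lborel. u \<in> {grid n j..grid n (Suc j)} \<longrightarrow> s < u \<and> left_point n u = grid n j"
    using AE_lborel_singleton[of "grid n j"]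
    by eventually_elim (use left_point_eq[OF n, of j] grid_ge[of n j] in force)
  note [measurable] = w
  show ?thesis
  proof (cases "alive (grid n j) w")
    case False
    have "AE u in lborel. indicator {grid n j..grid n (Suc j)} u *\<^sub>R discrete_rate n u w = 0"
      using lp by eventually_elim (use False in \<open>auto simp: discrete_rate_def indicator_def\<close>)
    then have "step_rate n j w = 0"
      unfolding set_lebesgue_integral_def by (rule integral_eq_zero_AE)
    then show ?thesis using False by (simp add: D_def frozen_def trace_def matrix_matrix_mult_def)
  next
    case True
    have "step_rate n j w
      = (LINT u:{grid n j..grid n (Suc j)}|lborel. g ?x \<bullet> drift u w + second_order ?x)"
      unfolding set_lebesgue_integral_def
    proof (rule integral_cong_AE)
      show "AE u in lborel. indicator {grid n j..grid n (Suc j)} u *\<^sub>R discrete_rate n u w =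
        indicator {grid n j..grid n (Suc j)} u *\<^sub>R (g ?x \<bullet> drift u w + second_order ?x)"
        using lp by eventually_elim (use True in \<open>auto simp: discrete_rate_def indicator_def\<close>)
    qed measurable
    also have "\<dots> = (LINT u:{grid n j..grid n (Suc j)}|lborel. g ?x \<bullet> drift u w) + (LINT u:{grid n j..grid n (Suc j)}|lborel. second_order ?x)"
    proof (rule set_integral_add)
      show "set_integrable lborel {grid n j..grid n (Suc j)} (\<lambda>u. g ?x \<bullet> drift u w)"
        using Bochner_Integration.integrable_inner_right[OF drift_integrable[OF w, unfolded set_integrable_def], of "g ?x"]
        by (simp add: set_integrable_def)
    qed (intro borel_integrable_atLeastAtMost' continuous_on_const)
    also have "(LINT u:{grid n j..grid n (Suc j)}|lborel. g ?x \<bullet> drift u w) = g ?x \<bullet> drift_increment n j w"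
      using Bochner_Integration.integral_inner_right[OF drift_integrable[OF w, unfolded set_integrable_def], of "g ?x"]
      by (simp add: set_lebesgue_integral_def drift_increment_def)
    also have "(LINT u:{grid n j..grid n (Suc j)}|lborel. second_order ?x) = h * second_order ?x"
      using h by (simp add: set_lebesgue_integral_def)
    finally have eq: "step_rate n j w = g ?x \<bullet> drift_increment n j w + h * second_order ?x" .
    have "g ?y \<bullet> drift_increment n j w - g ?x \<bullet> drift_increment n j w \<le> norm (g ?y - g ?x) * norm (drift_increment n j w)"
      using norm_cauchy_schwarz[of "g ?y - g ?x" "drift_increment n j w"] by (simp add: inner_diff_left)
    also have "\<dots> \<le> norm (g ?y - g ?x) * (C * h)"
      using drift_increment_norm[OF w, of n j] unfolding h(1) by (intro mult_left_mono) auto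
    finally have 1: "g ?y \<bullet> drift_increment n j w \<le> g ?x \<bullet> drift_increment n j w + C * h * norm (g ?y - g ?x)"
      by (simp add: mult_ac)
    have tr: "trace (transpose (S ?x) ** H ?y ** S ?x) - trace (transpose (S ?x) ** H ?x ** S ?x)
      = trace (transpose (S ?x) ** (H ?y - H ?x) ** S ?x)"
      by (simp add: matrix_diff_ldistrib matrix_diff_rdistrib trace_sub)
    have "trace (transpose (S ?x) ** (H ?y - H ?x) ** S ?x) \<le> norm (H ?y - H ?x) * C\<^sup>2"
    proof -
      have "norm (S ?x) \<le> C" using frozen_norm[OF w, of n j] True by (simp add: frozen_def)
      then have "norm (H ?y - H ?x) * (norm (S ?x))\<^sup>2 \<le> norm (H ?y - H ?x) * C\<^sup>2"
        by (intro mult_left_mono power_mono) auto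
      then show ?thesis using abs_trace_congruence_le[of "S ?x" "H ?y - H ?x"] by linarith
    qed
    then have "h / 2 * trace (transpose (S ?x) ** H ?y ** S ?x) \<le> h / 2 * (trace (transpose (S ?x) ** H ?x ** S ?x) + norm (H ?y - H ?x) * C\<^sup>2)"
      using tr h(2) by (intro mult_left_mono) auto
    then have 2: "h / 2 * trace (transpose (S ?x) ** H ?y ** S ?x) \<le> h * second_order ?x + 1 / 2 * C\<^sup>2 * h * norm (H ?y - H ?x)"
      by (simp add: second_order_def distrib_left mult_ac)
    show ?thesis using 1 2 True unfolding eq by (simp add: D_def frozen_def)
  qed
qed

lemma bounded_set_integral_integrable:
  fixes F :: "real \<Rightarrow> 'w \<Rightarrow> real"
  assumes meas [measurable]: "(\<lambda>(w, u). F u w) \<in> borel_measurable (M \<Otimes>\<^sub>M lborel)"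
    and B: "\<And>u w. w \<in> space M \<Longrightarrow> \<bar>F u w\<bar> \<le> B"
  shows "integrable M (\<lambda>w. LINT u:{p..q}|lborel. F u w)"
proof (rule integrable_const_bound[where B = "B * max 0 (q - p)"])
  show "AE w in M. norm (LINT u:{p..q}|lborel. F u w) \<le> B * max 0 (q - p)"
    unfolding real_norm_def
  proof (intro AE_I2 bounded_set_integrable(2) B)
    fix w assume "w \<in> space M"
    from measurable_Pair2[OF meas this] show "(\<lambda>u. F u w) \<in> borel_measurable borel" by simp
  qed
  show "(\<lambda>w. LINT u:{p..q}|lborel. F u w) \<in> borel_measurable M"
    unfolding set_lebesgue_integral_def
  proof (rule lborel.borel_measurable_lebesgue_integral)
    have "(\<lambda>x. indicator {p..q} (snd x) *\<^sub>R (\<lambda>(w, u). F u w) x) \<in> borel_measurable (M \<Otimes>\<^sub>M lborel)" by measurable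
    then show "(\<lambda>(w, u). indicator {p..q} u *\<^sub>R F u w) \<in> borel_measurable (M \<Otimes>\<^sub>M lborel)"
      by (simp add: split_def)
  qed
qed

lemma discrete_rate_set_integral_integrable:
  assumes "0 < n"
  shows "integrable M (\<lambda>w. LINT u:{p..q}|lborel. discrete_rate n u w)"
proof (rule bounded_set_integral_integrable)
  have "(\<lambda>x. discrete_rate n (snd x) (fst x)) \<in> borel_measurable (M \<Otimes>\<^sub>M lborel)" by measurable
  then show "(\<lambda>(w, u). discrete_rate n u w) \<in> borel_measurable (M \<Otimes>\<^sub>M lborel)" by (simp add: split_def)
qed (rule discrete_rate_abs_le[OF _ assms])

lemma alive_difference_integrable:
  fixes F :: "real ^ 'd \<Rightarrow> 'b::{real_normed_vector, second_countable_topology}"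
  assumes [measurable]: "F \<in> borel_measurable borel" "Y \<in> borel_measurable M" "Z \<in> borel_measurable M"
    and F: "\<And>x. norm (F x) \<le> b"
  shows "integrable M (\<lambda>w. indicator {w. alive u w} w * norm (F (Y w) - F (Z w)))"
proof (rule integrable_const_bound[where B = "b + b"])
  have "norm (F x - F y) \<le> b + b" for x y
    by (rule order_trans[OF norm_triangle_ineq4]) (intro add_mono F)
  then show "AE w in M. norm (indicator {w. alive u w} w * norm (F (Y w) - F (Z w))) \<le> b + b"
    using b_nonneg by (intro AE_I2) (auto simp: indicator_def)
qed measurable

lemma test_function_integrable:
  assumes [measurable]: "Z \<in> borel_measurable M"
  shows "integrable M (\<lambda>w. f (Z w))"
  by (rule integrable_const_bound[where B = b]) (auto intro!: AE_I2 f_bound)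

text \<open>The three summands of the constant stem from the gradient gap weighted by
  \<open>C\<close>, the Hessian gap weighted by half of \<open>C\<^sup>2\<close>, and the Taylor
  error.\<close>

lemma euler_step_expectation:
  assumes e: "0 < e"
  obtains N where "0 < N" "\<And>n j. N \<le> n \<Longrightarrow> j < n \<Longrightarrow>
    expectation (\<lambda>w. f (euler n (Suc j) w)) \<le> expectation (\<lambda>w. f (euler n j w))
      + expectation (\<lambda>w. step_rate n j w)
      + (C + 1 / 2 * C\<^sup>2 + 1) * e * ((t - s) / real n)"
proof -
  obtain h\<^sub>0 where h\<^sub>0: "0 < h\<^sub>0" and step: "\<And>u v Y B \<zeta>. 0 \<le> u \<Longrightarrow> u < v \<Longrightarrow> v - u \<le> h\<^sub>0 \<Longrightarrow>
    Y \<in> borel_measurable (G u) \<Longrightarrow> B \<in> borel_measurable M \<Longrightarrow> \<zeta> \<in> borel_measurable (G u) \<Longrightarrow>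
    (\<And>w. w \<in> space M \<Longrightarrow> norm (B w) \<le> C * (v - u)) \<Longrightarrow> (\<And>w. w \<in> space M \<Longrightarrow> norm (\<zeta> w) \<le> C) \<Longrightarrow>
    expectation (\<lambda>w. f (Y w + B w + \<zeta> w *v (W v w - W u w)))
    \<le> expectation (\<lambda>w. f (Y w)) +
      expectation (\<lambda>w. g (Y w) \<bullet> B w + (v - u) / 2 * trace (transpose (\<zeta> w) ** H (Y w) ** \<zeta> w)) + e * (v - u)"
    using taylor_step[OF C2_test_function_axioms C_nonneg e] by blast
  obtain N1 where N1: "0 < N1" "\<And>n j. N1 \<le> n \<Longrightarrow> j \<le> n \<Longrightarrow>
    expectation (\<lambda>w. alive_gap g n j w) \<le> e"
    using euler_test_function_close[OF uniformly_continuous_g g_bound e] by blast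
  obtain N2 where N2: "0 < N2" "\<And>n j. N2 \<le> n \<Longrightarrow> j \<le> n \<Longrightarrow>
    expectation (\<lambda>w. alive_gap H n j w) \<le> e"
    using euler_test_function_close[OF H_uniformly_continuous H_bound e] by blast
  obtain N3 where N3: "(t - s) / h\<^sub>0 < real N3" using reals_Archimedean2 by blast
  show thesis
  proof (rule that[of "max N1 (max N2 N3)"])
    fix n j assume n: "max N1 (max N2 N3) \<le> n" and j: "j < n"
    then have n0: "0 < n" by simp
    define h where "h = (t - s) / real n"
    have h: "h = grid n (Suc j) - grid n j" "h \<ge> 0" using grid_step[of n j] s_less_t by (auto simp: h_def)
    have "(t - s) / h\<^sub>0 \<le> real n" using N3 n by linarith
    then have "h \<le> h\<^sub>0" using h\<^sub>0 n0 by (simp add: h_def field_simps)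
    define D where "D w = (if alive (grid n j) w then drift_increment n j w else 0)" for w
    note [measurable] = measurable_G[OF drift_increment_measurable_G] measurable_G[OF frozen_measurable_G]
    have D [measurable]: "D \<in> borel_measurable M" unfolding D_def by measurable
    let ?r = "step_rate n j" and ?a = "alive_gap g n j" and ?c = "alive_gap H n j"
    have r: "integrable M ?r"
      by (rule discrete_rate_set_integral_integrable[OF n0])
    have a: "integrable M ?a"
      by (rule alive_difference_integrable) (measurable, rule g_bound)
    have c: "integrable M ?c"
      by (rule alive_difference_integrable) (measurable, rule H_bound)
    have "norm (D w) \<le> C * (grid n (Suc j) - grid n j)" if "w \<in> space M" for w
      using drift_increment_norm[OF that, of n j] C_nonneg h by (simp add: D_def)
    then have "expectation (\<lambda>w. f (euler n (Suc j) w)) \<le> expectation (\<lambda>w. f (euler n j w)) +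
      expectation (\<lambda>w. g (euler n j w) \<bullet> D w + h / 2 * frozen_trace n j w) + e * h"
      using step[OF grid_nonneg grid_less[OF n0] _ euler_measurable_G D frozen_measurable_G _ frozen_norm, of j] \<open>h \<le> h\<^sub>0\<close>
      unfolding h(1) by (simp add: D_def)
    also have "expectation (\<lambda>w. g (euler n j w) \<bullet> D w + h / 2 * frozen_trace n j w)
      \<le> expectation (\<lambda>w. ?r w + C * h * ?a w + 1 / 2 * C\<^sup>2 * h * ?c w)"
    proof (rule integral_mono)
      show "integrable M (\<lambda>w. ?r w + C * h * ?a w + 1 / 2 * C\<^sup>2 * h * ?c w)"
        by (intro Bochner_Integration.integrable_add Bochner_Integration.integrable_mult_right r a c)
      show "integrable M (\<lambda>w. g (euler n j w) \<bullet> D w + h / 2 * frozen_trace n j w)"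
      proof (rule integrable_const_bound[where B = "b * (C * h) + h / 2 * (b * C\<^sup>2)"])
        show "AE w in M. norm (g (euler n j w) \<bullet> D w + h / 2 * frozen_trace n j w)
          \<le> b * (C * h) + h / 2 * (b * C\<^sup>2)"
          unfolding real_norm_def
        proof (intro AE_I2 order_trans[OF abs_triangle_ineq] add_mono)
          fix w assume w: "w \<in> space M"
          show "\<bar>g (euler n j w) \<bullet> D w\<bar> \<le> b * (C * h)"
            using drift_increment_norm[OF w, of n j] C_nonneg h b_nonneg
            by (intro order_trans[OF Cauchy_Schwarz_ineq2] mult_mono g_bound) (auto simp: D_def)
          have "norm (H (euler n j w)) * (norm (frozen n j w))\<^sup>2 \<le> b * C\<^sup>2"
            by (intro mult_mono H_bound power_mono frozen_norm[OF w] b_nonneg) auto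
          then have "\<bar>frozen_trace n j w\<bar> \<le> b * C\<^sup>2"
            using abs_trace_congruence_le order_trans by blast
          then show "\<bar>h / 2 * frozen_trace n j w\<bar> \<le> h / 2 * (b * C\<^sup>2)"
            using h(2) unfolding abs_mult by (intro mult_mono) auto
        qed
      qed (unfold trace_def, measurable)
    next
      fix w assume "w \<in> space M"
      then show "g (euler n j w) \<bullet> D w + h / 2 * frozen_trace n j w
        \<le> ?r w + C * h * ?a w + 1 / 2 * C\<^sup>2 * h * ?c w"
        unfolding D_def h_def by (rule euler_step_rate[OF _ n0])
    qed
    also have "expectation (\<lambda>w. ?r w + C * h * ?a w + 1 / 2 * C\<^sup>2 * h * ?c w)
      = expectation ?r + C * h * expectation ?a + 1 / 2 * C\<^sup>2 * h * expectation ?c"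
      by (subst Bochner_Integration.integral_add, (intro Bochner_Integration.integrable_add Bochner_Integration.integrable_mult_right r a c)+,
            subst Bochner_Integration.integral_add, (intro Bochner_Integration.integrable_mult_right r a c)+) simp
    also have "\<dots> \<le> expectation ?r + C * h * e + 1 / 2 * C\<^sup>2 * h * e"
      using N1(2)[of n j] N2(2)[of n j] n j C_nonneg h(2) by (intro add_mono mult_left_mono) auto
    finally show "expectation (\<lambda>w. f (euler n (Suc j) w)) \<le> expectation (\<lambda>w. f (euler n j w))
      + expectation (\<lambda>w. step_rate n j w)
      + (C + 1 / 2 * C\<^sup>2 + 1) * e * ((t - s) / real n)"
      unfolding h_def[symmetric] by (simp add: algebra_simps)
  qed (use N1 in simp)
qed

text \<open>The one-step estimates are summed over the grid, and refining the grid turns the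
  discrete rate into the rate. At time \<open>t\<close> the scheme is replaced by the path where it
  is alive; elsewhere the non-negative value of \<open>f\<close> at the scheme is dropped, which is
  why only an inequality remains.\<close>

lemma dynkin_inequality:
  assumes f_nonneg: "\<And>x. 0 \<le> f x"
  shows "expectation (\<lambda>w. indicator {w. alive t w} w * f (path t w))
    \<le> expectation (\<lambda>w. f (path s w)) + expectation (\<lambda>w. LINT u:{s..t}|lborel. rate u w)"
proof (rule field_le_mult_epsilon)
  \<comment> \<open>The one-step errors add up to a multiple of \<open>t - s\<close>; the final 1
    pays for replacing the scheme by the path at time \<open>t\<close>.\<close>
  define c where "c = (t - s) * (C + 1 / 2 * C\<^sup>2 + 1) + 1"
  show "0 < c" using s_less_t C_nonneg by (simp add: c_def add_nonneg_pos)
  fix e :: real assume e: "0 < e"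
  obtain N where N: "0 < N" "\<And>n j. N \<le> n \<Longrightarrow> j < n \<Longrightarrow>
    expectation (\<lambda>w. f (euler n (Suc j) w)) \<le> expectation (\<lambda>w. f (euler n j w))
      + expectation (\<lambda>w. step_rate n j w)
      + (C + 1 / 2 * C\<^sup>2 + 1) * e * ((t - s) / real n)"
    using euler_step_expectation[OF e] by blast
  have f_norm: "norm (f x) \<le> b" for x using f_bound[of x] by simp
  obtain N' where N': "0 < N'" "\<And>n j. N' \<le> n \<Longrightarrow> j \<le> n \<Longrightarrow>
    expectation (\<lambda>w. alive_gap f n j w) \<le> e"
    using euler_test_function_close[OF uniformly_continuous_f f_norm e] by blast
  have le: "expectation (\<lambda>w. indicator {w. alive t w} w * f (path t w))
    \<le> expectation (\<lambda>w. f (path s w)) + expectation (\<lambda>w. LINT u:{s..t}|lborel. discrete_rate n u w) + c * e"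
    if n: "max N N' \<le> n" for n
  proof -
    have n0: "0 < n" using n N(1) by simp
    have "k \<le> n \<Longrightarrow> expectation (\<lambda>w. f (euler n k w)) \<le> expectation (\<lambda>w. f (path s w))
      + expectation (\<lambda>w. LINT u:{s..grid n k}|lborel. discrete_rate n u w)
      + real k * ((C + 1 / 2 * C\<^sup>2 + 1) * e * ((t - s) / real n))" for k
    proof (induction k)
      case 0
      have "expectation (\<lambda>w. LINT u:{s..s}|lborel. discrete_rate n u w) = expectation (\<lambda>w. 0)"
      proof (rule Bochner_Integration.integral_cong[OF refl])
        fix w assume w [measurable]: "w \<in> space M"
        show "(LINT u:{s..s}|lborel. discrete_rate n u w) = 0"
          using bounded_set_integrable(2)[of "\<lambda>u. discrete_rate n u w" rate_bound s s, OF _ discrete_rate_abs_le[OF w n0]]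
          by simp
      qed
      then show ?case by simp
    next
      case (Suc k)
      have add: "expectation (\<lambda>w. LINT u:{s..grid n (Suc k)}|lborel. discrete_rate n u w)
        = expectation (\<lambda>w. LINT u:{s..grid n k}|lborel. discrete_rate n u w)
        + expectation (\<lambda>w. step_rate n k w)"
      proof -
        have int: "integrable M (\<lambda>w. LINT u:{p..q}|lborel. discrete_rate n u w)" for p q
          by (rule discrete_rate_set_integral_integrable[OF n0])
        have "expectation (\<lambda>w. LINT u:{s..grid n (Suc k)}|lborel. discrete_rate n u w)
          = expectation (\<lambda>w. (LINT u:{s..grid n k}|lborel. discrete_rate n u w) + step_rate n k w)"
        proof (intro Bochner_Integration.integral_cong refl set_integral_Icc_combine grid_ge grid_mono)
          fix w assume w [measurable]: "w \<in> space M"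
          show "set_integrable lborel {s..grid n (Suc k)} (\<lambda>u. discrete_rate n u w)"
            by (rule bounded_set_integrable(1)[OF _ discrete_rate_abs_le[OF w n0]]) measurable
        qed simp
        then show ?thesis using int by simp
      qed
      have "expectation (\<lambda>w. f (euler n (Suc k) w)) \<le> expectation (\<lambda>w. f (euler n k w))
        + expectation (\<lambda>w. step_rate n k w)
        + (C + 1 / 2 * C\<^sup>2 + 1) * e * ((t - s) / real n)"
        using N(2)[of n k] n Suc.prems by simp
      also have "expectation (\<lambda>w. f (euler n k w)) \<le> expectation (\<lambda>w. f (path s w))
      + expectation (\<lambda>w. LINT u:{s..grid n k}|lborel. discrete_rate n u w)
      + real k * ((C + 1 / 2 * C\<^sup>2 + 1) * e * ((t - s) / real n))" using Suc by simp
      finally show ?case unfolding add of_nat_Suc distrib_right mult_1 by linarith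
    qed
    from this[of n] have "expectation (\<lambda>w. f (euler n n w)) \<le> expectation (\<lambda>w. f (path s w))
      + expectation (\<lambda>w. LINT u:{s..t}|lborel. discrete_rate n u w) + (C + 1 / 2 * C\<^sup>2 + 1) * e * (t - s)"
      using n0 by (simp add: grid_n)
    moreover have "expectation (\<lambda>w. indicator {w. alive t w} w * f (path t w))
      \<le> expectation (\<lambda>w. f (euler n n w) + indicator {w. alive t w} w * norm (f (euler n n w) - f (path t w)))"
    proof (rule integral_mono)
      have a: "integrable M (\<lambda>w. indicator {w. alive t w} w * norm (f (euler n n w) - f (path t w)))"
        by (rule alive_difference_integrable) (measurable, simp add: f_bound)
      then show "integrable M (\<lambda>w. f (euler n n w) + indicator {w. alive t w} w * norm (f (euler n n w) - f (path t w)))"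
        by (intro Bochner_Integration.integrable_add test_function_integrable) measurable
      show "integrable M (\<lambda>w. indicator {w. alive t w} w * f (path t w))"
      proof (rule integrable_const_bound[where B = b])
        show "AE w in M. norm (indicator {w. alive t w} w * f (path t w)) \<le> b"
          using f_bound b_nonneg by (intro AE_I2) (auto simp: indicator_def)
      qed measurable
      show "indicator {w. alive t w} w * f (path t w) \<le> f (euler n n w) + indicator {w. alive t w} w * norm (f (euler n n w) - f (path t w))" for w
        using f_nonneg[of "euler n n w"] by (auto simp: indicator_def)
    qed
    moreover have "expectation (\<lambda>w. f (euler n n w) + indicator {w. alive t w} w * norm (f (euler n n w) - f (path t w)))
      \<le> expectation (\<lambda>w. f (euler n n w)) + e"
    proof -
      have a: "integrable M (\<lambda>w. indicator {w. alive t w} w * norm (f (euler n n w) - f (path t w)))"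
        by (rule alive_difference_integrable) (measurable, simp add: f_bound)
      have "integrable M (\<lambda>w. f (euler n n w))" by (rule test_function_integrable) measurable
      then show ?thesis using a N'(2)[of n n] n n0 by (simp add: grid_n)
    qed
    ultimately show ?thesis unfolding c_def by (simp add: algebra_simps)
  qed
  show "expectation (\<lambda>w. indicator {w. alive t w} w * f (path t w))
    \<le> expectation (\<lambda>w. f (path s w)) + expectation (\<lambda>w. LINT u:{s..t}|lborel. rate u w) + c * e"
  proof (rule LIMSEQ_le_const)
    show "(\<lambda>n. expectation (\<lambda>w. f (path s w)) + expectation (\<lambda>w. LINT u:{s..t}|lborel. discrete_rate (Suc n) u w) + c * e)
      \<longlonglongrightarrow> expectation (\<lambda>w. f (path s w)) + expectation (\<lambda>w. LINT u:{s..t}|lborel. rate u w) + c * e"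
      by (intro tendsto_add tendsto_const integral_discrete_rate_tendsto)
    show "\<exists>n0. \<forall>n\<ge>n0. expectation (\<lambda>w. indicator {w. alive t w} w * f (path t w))
      \<le> expectation (\<lambda>w. f (path s w)) + expectation (\<lambda>w. LINT u:{s..t}|lborel. discrete_rate (Suc n) u w) + c * e"
      using le by (intro exI[of _ "max N N'"] allI impI) simp
  qed
qed

end

section \<open>Lyapunov moments\<close>

definition cutoff :: "real \<Rightarrow> real \<Rightarrow> real" where
  "cutoff N v = max 0 (1 - v / N)"

text \<open>The derivative of the truncated powers: it grows like \<open>v\<^sup>k\<close>, has compact support, and satisfies
  \<open>v w'(v) \<le> k w(v)\<close>, which turns the ratio condition on \<open>V\<close> into a drift bound uniform in \<open>N\<close>.\<close>

definition weight :: "nat \<Rightarrow> real \<Rightarrow> real \<Rightarrow> real" where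
  "weight k N v = v ^ k * (cutoff N v)\<^sup>2"

definition weight_deriv :: "nat \<Rightarrow> real \<Rightarrow> real \<Rightarrow> real" where
  "weight_deriv k N v = real k * v ^ (k - 1) * (cutoff N v)\<^sup>2 - 2 / N * v ^ k * cutoff N v"

text \<open>The antiderivative of the weight, normalized to vanish at 1, the lower bound of
  \<open>V\<close>.\<close>

definition truncated_power :: "nat \<Rightarrow> real \<Rightarrow> real \<Rightarrow> real" where
  "truncated_power k N v = integral {0..v} (weight k N) - integral {0..1} (weight k N)"

lemma continuous_weight: "continuous_on A (weight k N)"
  unfolding weight_def[abs_def] cutoff_def[abs_def] divide_inverse by (intro continuous_intros)

lemma continuous_weight_deriv: "continuous_on A (weight_deriv k N)"
  unfolding weight_deriv_def[abs_def] cutoff_def[abs_def] divide_inverse by (intro continuous_intros)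

lemma cutoff_range: "0 \<le> cutoff N v" "0 < N \<Longrightarrow> 0 \<le> v \<Longrightarrow> cutoff N v \<le> 1" "0 < N \<Longrightarrow> N \<le> v \<Longrightarrow> cutoff N v = 0"
  "0 < N \<Longrightarrow> v \<le> N / 2 \<Longrightarrow> 1 / 2 \<le> cutoff N v"
  by (auto simp: cutoff_def field_simps)

text \<open>This is what the square in the weight is for: the square of the positive part is
  continuously differentiable across the kink, the positive part itself is not.\<close>

lemma weight_has_derivative:
  assumes "0 < N"
  shows "(weight k N has_real_derivative weight_deriv k N v) (at v)"
proof -
  have sq: "((\<lambda>x. (max 0 x)\<^sup>2) has_real_derivative 2 * max 0 x) (at x)" for x :: real
  proof (cases "x = 0")
    case True
    have "(\<lambda>h :: real. ((max 0 h)\<^sup>2 - 0) / h) \<midarrow>0\<rightarrow> 0"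
    proof (rule Lim_null_comparison)
      show "\<forall>\<^sub>F h in at 0. norm (((max 0 h)\<^sup>2 - 0) / h :: real) \<le> \<bar>h\<bar>"
        by (intro always_eventually allI) (auto simp: max_def power2_eq_square)
      show "(\<lambda>h::real. \<bar>h\<bar>) \<midarrow>0\<rightarrow> 0" by (intro tendsto_eq_intros) auto
    qed
    then show ?thesis using True by (simp add: has_field_derivative_iff)
  next
    case False
    then consider "x > 0" | "x < 0" by linarith
    then show ?thesis
    proof cases
      case 1
      have "((\<lambda>x. x\<^sup>2) has_real_derivative 2 * max 0 x) (at x)" using 1 by (auto intro!: derivative_eq_intros)
      then show ?thesis
        by (rule has_field_derivative_transform_within_open[where S = "{0<..}"]) (use 1 in auto)
    next
      case 2
      have "((\<lambda>x. 0) has_real_derivative 2 * max 0 x) (at x)" using 2 by simp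
      then show ?thesis
        by (rule has_field_derivative_transform_within_open[where S = "{..<0}"]) (use 2 in auto)
    qed
  qed
  have "((\<lambda>v. 1 - v / N) has_real_derivative - 1 / N) (at v)" using assms by (auto intro!: derivative_eq_intros)
  from DERIV_chain2[OF sq this] have c: "((\<lambda>v. (cutoff N v)\<^sup>2) has_real_derivative 2 * cutoff N v * (- 1 / N)) (at v)"
    by (simp add: cutoff_def)
  have "((\<lambda>v. v ^ k * (cutoff N v)\<^sup>2) has_real_derivative real k * v ^ (k - 1) * (cutoff N v)\<^sup>2 + 2 * cutoff N v * (- 1 / N) * v ^ k) (at v)"
    using DERIV_mult[OF DERIV_pow[of k v] c] by simp
  then show ?thesis by (simp add: weight_def[abs_def] weight_deriv_def mult_ac)
qed

lemma weight_nonneg: "0 \<le> v \<Longrightarrow> 0 \<le> weight k N v"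
  by (simp add: weight_def)

lemma weight_le: "0 < N \<Longrightarrow> 0 \<le> v \<Longrightarrow> weight k N v \<le> v ^ k"
  using cutoff_range[of N v] by (simp add: weight_def mult_left_le power_le_one)

text \<open>Up to half of \<open>N\<close> the cutoff is at least 1/2 and its square at least 1/4;
  this is the origin of the factors 4 in the moment bounds.\<close>

lemma weight_ge:
  assumes "0 < N" "0 \<le> v" "v \<le> N / 2"
  shows "v ^ k / 4 \<le> weight k N v"
proof -
  have "(1 / 2)\<^sup>2 \<le> (cutoff N v)\<^sup>2" using cutoff_range[of N v] assms by (intro power_mono) auto
  from mult_left_mono[OF this, of "v ^ k"] assms show ?thesis by (simp add: weight_def power_divide)
qed

lemma weight_eq_0: "0 < N \<Longrightarrow> N \<le> v \<Longrightarrow> weight k N v = 0"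
  by (simp add: weight_def cutoff_range)

lemma weight_deriv_eq_0: "0 < N \<Longrightarrow> N \<le> v \<Longrightarrow> weight_deriv k N v = 0"
  by (simp add: weight_deriv_def cutoff_range)

text \<open>The cutoff decreases, so its derivative contributes a non-positive term, which is
  dropped together with the slope 1/N.\<close>

lemma weight_deriv_le:
  assumes "0 < N" "1 \<le> v"
  shows "weight_deriv k N v \<le> real k * weight k N v / v"
proof -
  have "weight_deriv k N v \<le> real k * v ^ (k - 1) * (cutoff N v)\<^sup>2"
    using assms cutoff_range[of N v] by (simp add: weight_deriv_def)
  also have "\<dots> = real k * weight k N v / v"
    using assms by (cases k) (auto simp: weight_def)
  finally show ?thesis .
qed

lemma truncated_power_derivative:
  assumes v: "0 < v"
  shows "(truncated_power k N has_real_derivative weight k N v) (at v)"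
proof -
  have "((\<lambda>u. integral {0..u} (weight k N)) has_real_derivative weight k N v) (at v within {0..v + 1})"
    by (rule integral_has_real_derivative[OF continuous_weight]) (use v in auto)
  moreover have "at v within {0..v + 1} = at v"
    by (rule at_within_interior) (use v in \<open>auto simp: interior_atLeastAtMost_real\<close>)
  ultimately have "((\<lambda>u. integral {0..u} (weight k N)) has_real_derivative weight k N v) (at v)" by simp
  from DERIV_diff[OF this DERIV_const] show ?thesis by (simp add: truncated_power_def[abs_def])
qed

lemma truncated_power_1: "truncated_power k N 1 = 0"
  by (simp add: truncated_power_def)

lemma truncated_power_const:
  assumes N: "1 \<le> N" and v: "N \<le> v"
  shows "truncated_power k N v = truncated_power k N N"
proof -
  have "integral {N..v} (weight k N) = integral {N..v} (\<lambda>_. 0)"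
    by (intro Henstock_Kurzweil_Integration.integral_cong) (use N in \<open>auto simp: weight_eq_0\<close>)
  moreover have "integral {0..N} (weight k N) + integral {N..v} (weight k N) = integral {0..v} (weight k N)"
    using N v by (intro Henstock_Kurzweil_Integration.integral_combine integrable_continuous_real continuous_weight) auto
  ultimately show ?thesis by (simp add: truncated_power_def)
qed

lemma truncated_power_mono:
  assumes "1 \<le> v" "v \<le> w"
  shows "truncated_power k N v \<le> truncated_power k N w"
  by (rule DERIV_nonneg_imp_nondecreasing[OF assms(2)])
    (use assms(1) truncated_power_derivative[of _ k N] weight_nonneg in \<open>meson le_less_trans order_trans zero_less_one less_le_trans less_imp_le\<close>)

lemma truncated_power_nonneg: "1 \<le> v \<Longrightarrow> 0 \<le> truncated_power k N v"
  using truncated_power_mono[of 1 v k N] by (simp add: truncated_power_1)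

lemma truncated_power_le:
  assumes "0 < N" "1 \<le> v"
  shows "truncated_power k N v \<le> v ^ Suc k"
proof -
  have "(\<lambda>v. v ^ Suc k - truncated_power k N v) 1 \<le> (\<lambda>v. v ^ Suc k - truncated_power k N v) v"
  proof (rule DERIV_nonneg_imp_nondecreasing[OF assms(2)])
    fix x :: real assume x: "1 \<le> x" "x \<le> v"
    have "((\<lambda>v. v ^ Suc k - truncated_power k N v) has_real_derivative real (Suc k) * x ^ k - weight k N x) (at x)"
      using DERIV_diff[OF DERIV_pow[of "Suc k" x] truncated_power_derivative[of x k N]] x by simp
    moreover have "weight k N x \<le> real (Suc k) * x ^ k"
    proof (rule order_trans[OF weight_le])
      show "x ^ k \<le> real (Suc k) * x ^ k" using mult_right_mono[of 1 "real (Suc k)" "x ^ k"] x by simp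
    qed (use assms(1) x in auto)
    ultimately show "\<exists>y. ((\<lambda>v. v ^ Suc k - truncated_power k N v) has_real_derivative y) (at x) \<and> 0 \<le> y" by force
  qed
  then show ?thesis by (simp add: truncated_power_1)
qed

text \<open>Comparison of derivatives starting from 1, where both sides are equal. With the upper
  bound it makes the truncated power comparable to \<open>v ^ Suc k\<close> below
  \<open>N / 2\<close>, uniformly in \<open>N\<close>.\<close>

lemma truncated_power_ge:
  assumes N: "0 < N" and v: "1 \<le> v" "v \<le> N / 2"
  shows "v ^ Suc k \<le> 1 + 4 * real (Suc k) * truncated_power k N v"
proof -
  have "(\<lambda>v. 4 * real (Suc k) * truncated_power k N v - v ^ Suc k) 1 \<le> (\<lambda>v. 4 * real (Suc k) * truncated_power k N v - v ^ Suc k) v"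
  proof (rule DERIV_nonneg_imp_nondecreasing[OF v(1)])
    fix x :: real assume x: "1 \<le> x" "x \<le> v"
    have "((\<lambda>v. 4 * real (Suc k) * truncated_power k N v - v ^ Suc k) has_real_derivative 4 * real (Suc k) * weight k N x - real (Suc k) * x ^ k) (at x)"
      using DERIV_diff[OF DERIV_cmult[OF truncated_power_derivative[of x k N], of "4 * real (Suc k)"] DERIV_pow[of "Suc k" x]] x by simp
    moreover have "0 \<le> 4 * real (Suc k) * weight k N x - real (Suc k) * x ^ k"
    proof -
      have "real (Suc k) * x ^ k = 4 * real (Suc k) * (x ^ k / 4)" by simp
      also have "\<dots> \<le> 4 * real (Suc k) * weight k N x" using N x v by (intro mult_left_mono weight_ge) auto
      finally show ?thesis by simp
    qed
    ultimately show "\<exists>y. ((\<lambda>v. 4 * real (Suc k) * truncated_power k N v - v ^ Suc k) has_real_derivative y) (at x) \<and> 0 \<le> y" by blast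
  qed
  then show ?thesis by (simp add: truncated_power_1)
qed

lemma uniformly_continuous_on_compact_support:
  fixes F :: "'a::euclidean_space \<Rightarrow> 'b::real_normed_vector"
  assumes F: "continuous_on UNIV F" and K: "compact K" "\<And>x. x \<notin> K \<Longrightarrow> F x = 0"
  shows "uniformly_continuous_on UNIV F"
proof -
  obtain R where R: "\<And>x. x \<in> K \<Longrightarrow> norm x \<le> R" using compact_imp_bounded[OF K(1)] unfolding bounded_iff by auto
  \<comment> \<open>The margin 1 puts both points into the ball as soon as one of them is in
    \<open>K\<close> and their distance is below 1.\<close>
  have uc: "uniformly_continuous_on (cball 0 (R + 1)) F"
    by (intro compact_uniformly_continuous continuous_on_subset[OF F]) auto
  show ?thesis
    unfolding uniformly_continuous_on_def
  proof (intro allI impI)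
    fix e :: real assume e: "0 < e"
    have "\<exists>d>0. \<forall>x\<in>cball 0 (R + 1). \<forall>y\<in>cball 0 (R + 1). dist y x < d \<longrightarrow> dist (F y) (F x) < e"
      by (rule uc[unfolded uniformly_continuous_on_def, THEN spec, THEN mp, OF e])
    then obtain d where d: "0 < d" "\<forall>x\<in>cball 0 (R + 1). \<forall>y\<in>cball 0 (R + 1). dist y x < d \<longrightarrow> dist (F y) (F x) < e"
      by (elim exE conjE)
    have "dist (F y) (F x) < e" if xy: "dist y x < min d 1" for x y
    proof (cases "x \<in> K \<or> y \<in> K")
      case True
      then have "norm x \<le> R \<or> norm y \<le> R" using R by auto
      moreover have "norm x \<le> norm y + dist y x" "norm y \<le> norm x + dist y x"
        by (metis dist_commute dist_norm norm_triangle_sub, metis dist_norm norm_triangle_sub)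
      ultimately have "x \<in> cball 0 (R + 1)" "y \<in> cball 0 (R + 1)" using xy by auto
      then show ?thesis using d(2)[THEN bspec, THEN bspec, THEN mp, of x y] xy by simp
    qed (use K(2) e in auto)
    then show "\<exists>d>0. \<forall>x\<in>UNIV. \<forall>x'\<in>UNIV. dist x' x < d \<longrightarrow> dist (F x') (F x) < e"
      using d(1) by (intro exI[of _ "min d 1"]) auto
  qed
qed

lemma bounded_on_compact_support:
  fixes F :: "'a::euclidean_space \<Rightarrow> 'b::real_normed_vector"
  assumes F: "continuous_on UNIV F" and K: "compact K" "\<And>x. x \<notin> K \<Longrightarrow> F x = 0"
  obtains b where "\<And>x. norm (F x) \<le> b"
proof -
  have "bounded (F ` K)" by (intro compact_imp_bounded compact_continuous_image continuous_on_subset[OF F] K(1)) auto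
  then obtain b where b: "0 < b" "\<And>x. x \<in> K \<Longrightarrow> norm (F x) \<le> b" by (auto simp: bounded_pos)
  then show thesis using that[of b] K(2) by (metis less_imp_le norm_zero)
qed

definition outer_product :: "real ^ 'd \<Rightarrow> real ^ 'd \<Rightarrow> real ^ 'd ^ 'd" where
  "outer_product v w = (\<chi> i j. v $ i * w $ j)"

lemma outer_product_mult: "outer_product v w *v x = (w \<bullet> x) *\<^sub>R v"
  by (simp add: outer_product_def matrix_vector_mult_def vec_eq_iff inner_vec_def sum_distrib_left mult_ac)

lemma trace_congruence_outer_product:
  "trace (transpose A ** outer_product v v ** A) = (norm (transpose A *v v))\<^sup>2"
proof -
  have "transpose A ** outer_product v v ** A = outer_product (transpose A *v v) (transpose A *v v)"
    by (simp add: outer_product_def matrix_matrix_mult_def matrix_vector_mult_def transpose_def vec_eq_iff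
        sum_product sum_distrib_right sum_distrib_left mult_ac)
  then show ?thesis by (simp add: trace_def outer_product_def norm_vec_def L2_set_def sum_nonneg power2_eq_square)
qed

section \<open>Test functions built from the Lyapunov function\<close>

locale lyapunov_function_data =
  fixes V :: "real ^ 'd \<Rightarrow> real" and gV :: "real ^ 'd \<Rightarrow> real ^ 'd" and HV :: "real ^ 'd \<Rightarrow> real ^ 'd ^ 'd"
  assumes V_derivative: "\<And>x. (V has_derivative (\<lambda>v. gV x \<bullet> v)) (at x)"
    and gV_derivative: "\<And>x. (gV has_derivative (\<lambda>v. HV x *v v)) (at x)"
    and HV_continuous: "continuous_on UNIV HV"
    and V_ge_1: "\<And>x. 1 \<le> V x" and V_compact: "\<And>c. compact {x. V x \<le> c}"
begin

lemma V_continuous: "continuous_on UNIV V"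
  using has_derivative_continuous[OF V_derivative] by (auto simp: continuous_on_eq_continuous_at)

lemma gV_continuous: "continuous_on UNIV gV"
  using has_derivative_continuous[OF gV_derivative] by (auto simp: continuous_on_eq_continuous_at)

lemma V_measurable [measurable]: "V \<in> borel_measurable borel"
  by (rule borel_measurable_continuous_onI[OF V_continuous])

lemma V_pos: "0 < V x" using V_ge_1[of x] by linarith

definition test_fun :: "nat \<Rightarrow> real \<Rightarrow> real ^ 'd \<Rightarrow> real" where
  "test_fun k N x = truncated_power k N (V x)"

definition test_grad :: "nat \<Rightarrow> real \<Rightarrow> real ^ 'd \<Rightarrow> real ^ 'd" where
  "test_grad k N x = weight k N (V x) *\<^sub>R gV x"

definition test_hess :: "nat \<Rightarrow> real \<Rightarrow> real ^ 'd \<Rightarrow> real ^ 'd ^ 'd" where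
  "test_hess k N x = weight_deriv k N (V x) *\<^sub>R outer_product (gV x) (gV x) + weight k N (V x) *\<^sub>R HV x"

text \<open>The weight and its derivative vanish where \<open>V\<close> is at least
  \<open>N\<close>, so gradient and Hessian have support in a compact sublevel set, and the function
  itself is constant beyond. This yields boundedness and uniform continuity at once.\<close>

lemma test_function:
  assumes N: "1 \<le> N"
  obtains b where "C2_test_function (test_fun k N) (test_grad k N) (test_hess k N) b"
proof -
  have N0: "0 < N" using N by simp
  have W: "continuous_on UNIV (\<lambda>x. weight k N (V x))" "continuous_on UNIV (\<lambda>x. weight_deriv k N (V x))"
    by (intro continuous_on_compose2[OF continuous_weight[of UNIV] V_continuous]
        continuous_on_compose2[OF continuous_weight_deriv[of UNIV] V_continuous]; simp)+
  have cg: "continuous_on UNIV (test_grad k N)"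
    unfolding test_grad_def[abs_def] by (intro continuous_intros W gV_continuous)
  have "continuous_on UNIV (\<lambda>x. outer_product (gV x) (gV x))"
    unfolding outer_product_def by (intro continuous_intros continuous_on_component gV_continuous)
  then have cH: "continuous_on UNIV (test_hess k N)"
    unfolding test_hess_def[abs_def] by (intro continuous_intros W HV_continuous)
  have zero: "test_grad k N x = 0" "test_hess k N x = 0" if "x \<notin> {x. V x \<le> N}" for x
    using that N0 by (auto simp: test_grad_def test_hess_def weight_eq_0 weight_deriv_eq_0)
  obtain b1 where b1: "\<And>x. norm (test_grad k N x) \<le> b1" using bounded_on_compact_support[OF cg V_compact zero(1)] by blast
  obtain b2 where b2: "\<And>x. norm (test_hess k N x) \<le> b2" using bounded_on_compact_support[OF cH V_compact zero(2)] by blast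
  have b3: "\<bar>test_fun k N x\<bar> \<le> N ^ Suc k" for x
  proof -
    have "truncated_power k N (V x) \<le> truncated_power k N (max N (V x))" by (rule truncated_power_mono[OF V_ge_1]) simp
    also have "\<dots> = truncated_power k N N" using N by (intro truncated_power_const) auto
    also have "\<dots> \<le> N ^ Suc k" by (rule truncated_power_le[OF N0 N])
    finally show ?thesis using truncated_power_nonneg[OF V_ge_1[of x], of k N] by (simp add: test_fun_def)
  qed
  show thesis
  proof (rule that[of "max (N ^ Suc k) (max b1 b2)"], unfold_locales)
    fix x
    have "((truncated_power k N \<circ> V) has_derivative ((*) (weight k N (V x)) \<circ> (\<lambda>v. gV x \<bullet> v))) (at x)"
      using truncated_power_derivative[OF V_pos[of x], of k N] V_derivative[of x]
      by (intro diff_chain_at) (auto simp: has_field_derivative_def)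
    then show "(test_fun k N has_derivative (\<lambda>v. test_grad k N x \<bullet> v)) (at x)"
      by (simp add: test_fun_def[abs_def] test_grad_def comp_def)
    have "((weight k N \<circ> V) has_derivative ((*) (weight_deriv k N (V x)) \<circ> (\<lambda>v. gV x \<bullet> v))) (at x)"
      using weight_has_derivative[OF N0, of k "V x"] V_derivative[of x]
      by (intro diff_chain_at) (auto simp: has_field_derivative_def)
    then have "((\<lambda>x. weight k N (V x)) has_derivative (\<lambda>v. weight_deriv k N (V x) * (gV x \<bullet> v))) (at x)"
      by (simp add: comp_def)
    from has_derivative_scaleR[OF this gV_derivative]
    show "(test_grad k N has_derivative (\<lambda>v. test_hess k N x *v v)) (at x)"
      by (simp add: test_grad_def[abs_def] test_hess_def matrix_vector_mult_add_rdistrib scaleR_matrix_vector_assoc[symmetric]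
          outer_product_mult add.commute)
    show "\<bar>test_fun k N x\<bar> \<le> max (N ^ Suc k) (max b1 b2)" using b3[of x] by simp
    show "norm (test_grad k N x) \<le> max (N ^ Suc k) (max b1 b2)" using b1[of x] by simp
    show "norm (test_hess k N x) \<le> max (N ^ Suc k) (max b1 b2)" using b2[of x] by simp
  next
    show "uniformly_continuous_on UNIV (test_hess k N)"
      by (rule uniformly_continuous_on_compact_support[OF cH V_compact zero(2)])
  qed
qed

end

section \<open>Moment bounds from the drift condition\<close>

locale lyapunov_diffusion = ito_diffusion M G W X \<beta> S I + lyapunov_function_data V gV HV
  for M :: "'w measure" and G :: "real \<Rightarrow> 'w measure" and W :: "real \<Rightarrow> 'w \<Rightarrow> real ^ 'd"
    and X :: "real \<Rightarrow> 'w \<Rightarrow> real ^ 'd" and \<beta> :: "real ^ 'd \<Rightarrow> real ^ 'd"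
    and S :: "real ^ 'd \<Rightarrow> real ^ 'd ^ 'd" and I :: "real \<Rightarrow> 'w \<Rightarrow> real ^ 'd"
    and V :: "real ^ 'd \<Rightarrow> real" and gV :: "real ^ 'd \<Rightarrow> real ^ 'd" and HV :: "real ^ 'd \<Rightarrow> real ^ 'd ^ 'd" +
  fixes J \<alpha> :: real and p :: nat and x\<^sub>0 :: "real ^ 'd"
  assumes J_nonneg: "0 \<le> J" and \<alpha>_pos: "0 < \<alpha>"
    and gV_growth: "\<And>x. norm (gV x) \<le> J * V x ^ p" and HV_growth: "\<And>x. norm (HV x) \<le> J * V x ^ p"
    and \<beta>_growth: "\<And>x. norm (\<beta> x) \<le> J * V x ^ p" and S_growth: "\<And>x. norm (S x) \<le> J * V x ^ p"
    and S_hoelder: "\<And>x y. norm (S x - S y) \<le> J * (V x ^ p + V y ^ p) * norm (x - y) powr \<alpha>"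
    and initial: "AE w in M. X 0 w = x\<^sub>0"
    and generator_negative: "\<exists>c>0. \<exists>R. \<forall>x. R \<le> norm x \<longrightarrow>
      gV x \<bullet> \<beta> x + 1 / 2 * trace (transpose (S x) ** HV x ** S x) \<le> - c"
    and generator_ratio: "\<And>\<eta>. 0 < \<eta> \<Longrightarrow> \<exists>R. \<forall>x. R \<le> norm x \<longrightarrow>
      (norm (transpose (S x) *v gV x))\<^sup>2 \<le> \<eta> * (V x * \<bar>gV x \<bullet> \<beta> x + 1 / 2 * trace (transpose (S x) ** HV x ** S x)\<bar>)"
begin

definition LV :: "real ^ 'd \<Rightarrow> real" where
  "LV x = gV x \<bullet> \<beta> x + 1 / 2 * trace (transpose (S x) ** HV x ** S x)"

lemma generator_test_fun:
  "test_grad k N x \<bullet> \<beta> x + 1 / 2 * trace (transpose (S x) ** test_hess k N x ** S x)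
    = weight k N (V x) * LV x + 1 / 2 * weight_deriv k N (V x) * (norm (transpose (S x) *v gV x))\<^sup>2"
proof -
  have "transpose (S x) ** (a *\<^sub>R P + c *\<^sub>R Q) ** S x = a *\<^sub>R (transpose (S x) ** P ** S x) + c *\<^sub>R (transpose (S x) ** Q ** S x)"
    for a c :: real and P Q :: "real ^ 'd ^ 'd"
    by (simp add: matrix_matrix_mult_def vec_eq_iff sum_distrib_left sum_distrib_right sum.distrib ring_distribs mult_ac)
  moreover have "trace (a *\<^sub>R P + c *\<^sub>R Q) = a * trace P + c * trace Q" for a c :: real and P Q :: "real ^ 'd ^ 'd"
    by (simp add: trace_def sum.distrib sum_distrib_left)
  ultimately show ?thesis
    by (simp add: test_grad_def test_hess_def LV_def trace_congruence_outer_product algebra_simps)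
qed

lemma V_power_ge_1: "1 \<le> V x ^ k"
  using V_ge_1[of x] by (rule one_le_power)

text \<open>Outside a large ball \<open>LV\<close> is at most a negative constant, and the ratio
  condition bounds the gradient term by half of the weight times the modulus of \<open>LV\<close>,
  so half of the negative drift survives. Inside the ball everything is bounded by constants that do
  not involve \<open>N\<close>.\<close>

lemma generator_test_fun_le:
  obtains c C where "0 < c" "0 \<le> C" "\<And>N x. 1 \<le> N \<Longrightarrow>
    test_grad k N x \<bullet> \<beta> x + 1 / 2 * trace (transpose (S x) ** test_hess k N x ** S x) \<le> C - c * weight k N (V x)"
proof -
  obtain c R1 where c: "0 < c" "\<And>x. R1 \<le> norm x \<Longrightarrow> LV x \<le> - c"
    using generator_negative unfolding LV_def by blast
  \<comment> \<open>The derivative of the weight brings a factor \<open>k\<close>; this choice gives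
    \<open>real k * \<eta> \<le> 1\<close>, and the factor 1/2 of the second-order term then leaves
    half of the drift.\<close>
  define \<eta> where "\<eta> = 1 / (real k + 1)"
  have \<eta>: "0 < \<eta>" "real k * \<eta> \<le> 1" by (auto simp: \<eta>_def)
  obtain R2 where R2: "\<And>x. R2 \<le> norm x \<Longrightarrow> (norm (transpose (S x) *v gV x))\<^sup>2 \<le> \<eta> * (V x * \<bar>LV x\<bar>)"
    using generator_ratio[OF \<eta>(1)] unfolding LV_def by blast
  define R where "R = max 0 (max R1 R2)"
  have "bounded (V ` cball 0 R)"
    by (intro compact_imp_bounded compact_continuous_image continuous_on_subset[OF V_continuous]) auto
  then obtain B where "\<forall>x\<in>cball 0 R. \<bar>V x\<bar> \<le> B" unfolding bounded_iff by auto
  then have B: "V x \<le> B" if "norm x \<le> R" for x using that by (auto simp: abs_le_iff)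
  have B1: "1 \<le> B" using B[of 0] V_ge_1[of 0] by (simp add: R_def)
  define Lmax where "Lmax = J * B ^ p * (J * B ^ p) + 1 / 2 * (J * B ^ p * (J * B ^ p)\<^sup>2)"
  \<comment> \<open>Bounds inside the ball for the \<open>LV\<close> term and for the gradient term,
    plus a compensation for the subtracted \<open>c / 2\<close> times the weight.\<close>
  define C where "C = B ^ k * Lmax + 1 / 2 * (real k * B ^ k) * (J * B ^ p * (J * B ^ p))\<^sup>2 + c / 2 * B ^ k"
  have Lmax: "0 \<le> Lmax" using J_nonneg B1 by (simp add: Lmax_def)
  have C: "0 \<le> C" using Lmax J_nonneg B1 c(1) by (simp add: C_def)
  have outside: "weight k N (V x) * LV x + 1 / 2 * weight_deriv k N (V x) * (norm (transpose (S x) *v gV x))\<^sup>2 \<le> - (c / 2) * weight k N (V x)"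
    if N: "1 \<le> N" and x: "R \<le> norm x" for N x
  proof -
    have L: "LV x \<le> - c" and r: "(norm (transpose (S x) *v gV x))\<^sup>2 \<le> \<eta> * (V x * \<bar>LV x\<bar>)"
      using x c(2) R2 by (auto simp: R_def)
    have w: "0 \<le> weight k N (V x)" using V_pos[of x] by (intro weight_nonneg) simp
    have "weight_deriv k N (V x) * (norm (transpose (S x) *v gV x))\<^sup>2 \<le> real k * weight k N (V x) / V x * (norm (transpose (S x) *v gV x))\<^sup>2"
      using N V_ge_1 by (intro mult_right_mono weight_deriv_le) auto
    also have "\<dots> \<le> real k * weight k N (V x) / V x * (\<eta> * (V x * \<bar>LV x\<bar>))"
      using r w V_pos[of x] by (intro mult_left_mono) auto
    also have "\<dots> = (real k * \<eta>) * (weight k N (V x) * \<bar>LV x\<bar>)" using V_pos[of x] by (simp add: field_simps)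
    also have "\<dots> \<le> 1 * (weight k N (V x) * \<bar>LV x\<bar>)" using \<eta> w by (intro mult_right_mono) auto
    finally have d: "weight_deriv k N (V x) * (norm (transpose (S x) *v gV x))\<^sup>2 \<le> weight k N (V x) * \<bar>LV x\<bar>" by simp
    have "weight k N (V x) * \<bar>LV x\<bar> = - (weight k N (V x) * LV x)" using L c(1) by simp
    moreover have "weight k N (V x) * LV x \<le> weight k N (V x) * (- c)" using L w by (intro mult_left_mono) auto
    ultimately show ?thesis using d by (simp add: field_simps)
  qed
  have inside: "weight k N (V x) * LV x + 1 / 2 * weight_deriv k N (V x) * (norm (transpose (S x) *v gV x))\<^sup>2 \<le> C - (c / 2) * weight k N (V x)"
    if N: "1 \<le> N" and x: "norm x \<le> R" for N x
  proof -
    have VB: "V x \<le> B" by (rule B[OF x])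
    have VBp: "J * V x ^ p \<le> J * B ^ p"
      using VB V_pos[of x] J_nonneg by (intro mult_left_mono power_mono) auto
    have bounds: "norm (gV x) \<le> J * B ^ p" "norm (HV x) \<le> J * B ^ p" "norm (\<beta> x) \<le> J * B ^ p" "norm (S x) \<le> J * B ^ p"
      using gV_growth[of x] HV_growth[of x] \<beta>_growth[of x] S_growth[of x] VBp by auto
    have JB: "0 \<le> J * B ^ p" using J_nonneg B1 by simp
    have w: "0 \<le> weight k N (V x)" using V_pos[of x] by (intro weight_nonneg) simp
    have w_le: "weight k N (V x) \<le> B ^ k"
      using weight_le[of N "V x" k] N V_pos[of x] power_mono[OF VB, of k] by simp
    have "\<bar>gV x \<bullet> \<beta> x\<bar> \<le> J * B ^ p * (J * B ^ p)"
      by (rule order_trans[OF Cauchy_Schwarz_ineq2]) (intro mult_mono bounds JB norm_ge_zero)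
    moreover have "\<bar>trace (transpose (S x) ** HV x ** S x)\<bar> \<le> J * B ^ p * (J * B ^ p)\<^sup>2"
      by (rule order_trans[OF abs_trace_congruence_le]) (intro mult_mono power_mono bounds JB norm_ge_zero; simp)
    ultimately have "LV x \<le> Lmax" unfolding LV_def Lmax_def by linarith
    then have 1: "weight k N (V x) * LV x \<le> B ^ k * Lmax"
      using w w_le Lmax by (meson mult_left_mono mult_right_mono order_trans)
    have "weight_deriv k N (V x) \<le> real k * weight k N (V x) / V x"
      using N V_ge_1 by (intro weight_deriv_le) auto
    also have "\<dots> \<le> real k * weight k N (V x) / 1" using V_ge_1[of x] w by (intro divide_left_mono) auto
    also have "\<dots> \<le> real k * B ^ k" using w_le by (simp add: mult_left_mono)
    finally have wd: "weight_deriv k N (V x) \<le> real k * B ^ k" .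
    have "norm (transpose (S x) *v gV x) \<le> J * B ^ p * (J * B ^ p)"
      by (rule order_trans[OF norm_matrix_vector_mult_le]) (simp, intro mult_mono bounds JB norm_ge_zero)
    then have sq: "(norm (transpose (S x) *v gV x))\<^sup>2 \<le> (J * B ^ p * (J * B ^ p))\<^sup>2" by (intro power_mono) auto
    have "weight_deriv k N (V x) * (norm (transpose (S x) *v gV x))\<^sup>2 \<le> real k * B ^ k * (norm (transpose (S x) *v gV x))\<^sup>2"
      by (intro mult_right_mono wd) simp
    also have "\<dots> \<le> real k * B ^ k * (J * B ^ p * (J * B ^ p))\<^sup>2"
      using B1 by (intro mult_left_mono sq) auto
    finally have 2: "1 / 2 * weight_deriv k N (V x) * (norm (transpose (S x) *v gV x))\<^sup>2 \<le> 1 / 2 * (real k * B ^ k) * (J * B ^ p * (J * B ^ p))\<^sup>2" by simp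
    have 3: "c / 2 * weight k N (V x) \<le> c / 2 * B ^ k" using w_le c(1) by (intro mult_left_mono) auto
    show ?thesis using 1 2 3 unfolding C_def by linarith
  qed
  show thesis
  proof (rule that[of "c / 2" C])
    fix N x assume N: "(1 :: real) \<le> N"
    show "test_grad k N x \<bullet> \<beta> x + 1 / 2 * trace (transpose (S x) ** test_hess k N x ** S x) \<le> C - c / 2 * weight k N (V x)"
      unfolding generator_test_fun using inside[OF N, of x] outside[OF N, of x] C by (cases "norm x \<le> R") auto
  qed (use c(1) C in auto)
qed

lemma S_continuous: "continuous_on UNIV S"
  unfolding continuous_on_eq_continuous_at[OF open_UNIV]
proof
  fix x :: "real ^ 'd"
  have "(\<lambda>y. norm (y - x) powr \<alpha>) \<midarrow>x\<rightarrow> 0"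
  proof (rule tendsto_zero_powrI)
    show "(\<lambda>y. norm (y - x)) \<midarrow>x\<rightarrow> 0" by (intro tendsto_norm_zero) (simp add: LIM_zero_iff)
  qed (use \<alpha>_pos in auto)
  moreover have "V \<midarrow>x\<rightarrow> V x" using V_continuous by (simp add: continuous_on_eq_continuous_at isCont_def)
  ultimately have "(\<lambda>y. J * (V y ^ p + V x ^ p) * norm (y - x) powr \<alpha>) \<midarrow>x\<rightarrow> J * (V x ^ p + V x ^ p) * 0"
    by (intro tendsto_intros)
  then have "(\<lambda>y. J * (V y ^ p + V x ^ p) * norm (y - x) powr \<alpha>) \<midarrow>x\<rightarrow> 0" by simp
  then have "(\<lambda>y. S y - S x) \<midarrow>x\<rightarrow> 0"
    by (rule Lim_null_comparison[rotated]) (intro always_eventually allI S_hoelder)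
  then show "isCont S x" by (simp add: isCont_def LIM_zero_iff)
qed

text \<open>The event depends only on the path, the starting time and the sublevel set; naming it
  outside the localized setting lets the level \<open>D\<close> vary and tend to infinity.\<close>

definition alive_below :: "real \<Rightarrow> nat \<Rightarrow> real \<Rightarrow> 'w \<Rightarrow> bool" where
  "alive_below s D = localized_diffusion.alive X {x. V x \<le> real D} s"

lemma localized:
  assumes "0 \<le> s" "s < t"
  shows "localized_diffusion M G W X \<beta> S I {x. V x \<le> real D} (J * real D ^ p) s t"
proof (intro localized_diffusion.intro localized_diffusion_axioms.intro)
  show "ito_diffusion M G W X \<beta> S I" by (rule ito_diffusion_axioms)
  show "closed {x. V x \<le> real D}" by (rule compact_imp_closed[OF V_compact])
  have "J * V x ^ p \<le> J * real D ^ p" if "x \<in> {x. V x \<le> real D}" for x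
    using that V_pos[of x] J_nonneg by (intro mult_left_mono power_mono) auto
  then show "norm (\<beta> x) \<le> J * real D ^ p" "norm (S x) \<le> J * real D ^ p" if "x \<in> {x. V x \<le> real D}" for x
    using that \<beta>_growth[of x] S_growth[of x] by fastforce+
qed (use assms J_nonneg S_continuous in auto)

lemma alive_below_eventually:
  assumes "w \<in> space M" "0 \<le> s" "s < t" "s \<le> u"
  shows "\<forall>\<^sub>F D in sequentially. alive_below s D u w"
proof -
  have "continuous_on {s..u} (\<lambda>r. V (path r w))"
    by (intro continuous_on_compose2[OF V_continuous continuous_on_subset[OF continuous_path[OF assms(1)]]]) auto
  then have "bounded ((\<lambda>r. V (path r w)) ` {s..u})"
    by (intro compact_imp_bounded compact_continuous_image) auto
  then obtain B where "\<forall>r\<in>{s..u}. \<bar>V (path r w)\<bar> \<le> B" unfolding bounded_iff by auto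
  then have B: "V (path r w) \<le> B" if "r \<in> {s..u}" for r using that by (auto simp: abs_le_iff)
  obtain D0 where "B < real D0" using reals_Archimedean2 by blast
  then have "V (path r w) \<le> real D" if "r \<in> {s..u}" "D0 \<le> D" for r D
  proof -
    have "real D0 \<le> real D" using that by simp
    then show ?thesis using B[OF that(1)] \<open>B < real D0\<close> by linarith
  qed
  then show ?thesis
    unfolding alive_below_def
    by (intro eventually_sequentiallyI[of D0])
      (simp add: localized_diffusion.alive_iff[OF localized[OF assms(2,3)] assms(1,4)])
qed

lemma localized_moment_step:
  assumes st: "0 \<le> s" "s < t" and N: "1 \<le> N" and c: "0 < c" and C: "0 \<le> C"
    and le: "\<And>x. test_grad k N x \<bullet> \<beta> x + 1 / 2 * trace (transpose (S x) ** test_hess k N x ** S x) \<le> C - c * weight k N (V x)"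
  shows "expectation (\<lambda>w. indicator {w. alive_below s D t w} w * test_fun k N (path t w))
    + c * expectation (\<lambda>w. LINT u:{s..t}|lborel. indicator {w. alive_below s D u w} w * weight k N (V (path u w)))
    \<le> expectation (\<lambda>w. test_fun k N (path s w)) + C * (t - s)"
proof -
  obtain b where b: "C2_test_function (test_fun k N) (test_grad k N) (test_hess k N) b"
    using test_function[OF N] by blast
  interpret L: localized_diffusion M G W X \<beta> S I "{x. V x \<le> real D}" "J * real D ^ p" s t
    by (rule localized[OF st])
  interpret T: C2_test_function "test_fun k N" "test_grad k N" "test_hess k N" b by (rule b)
  interpret F: localized_test_function M G W X \<beta> S I "{x. V x \<le> real D}" "J * real D ^ p" s t
    "test_fun k N" "test_grad k N" "test_hess k N" b ..
  have al: "L.alive = alive_below s D" by (simp add: alive_below_def)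
  have w0: "0 \<le> weight k N (V x)" for x using V_pos[of x] by (intro weight_nonneg) simp
  have w_le: "weight k N (V x) \<le> N ^ k" for x
  proof (cases "V x \<le> N")
    case True
    then show ?thesis using weight_le[of N "V x" k] power_mono[OF True, of k] N V_pos[of x] by simp
  qed (use N in \<open>simp add: weight_eq_0\<close>)
  let ?w = "\<lambda>u w. indicator {w. alive_below s D u w} w * weight k N (V (path u w))"
  have [measurable]: "weight k N \<in> borel_measurable borel" by (rule borel_measurable_continuous_onI[OF continuous_weight])
  have wm: "(\<lambda>(w, u). ?w u w) \<in> borel_measurable (M \<Otimes>\<^sub>M lborel)"
    unfolding al[symmetric] split_def by measurable
  have w_abs: "\<bar>?w u w\<bar> \<le> N ^ k" for u w
    using w0[of "path u w"] w_le[of "path u w"] N by (auto simp: indicator_def)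
  have wi: "integrable M (\<lambda>w. LINT u:{s..t}|lborel. ?w u w)"
    by (rule F.bounded_set_integral_integrable[OF wm w_abs])
  have rm: "(\<lambda>(w, u). F.rate u w) \<in> borel_measurable (M \<Otimes>\<^sub>M lborel)"
    unfolding split_def by measurable
  have ri: "integrable M (\<lambda>w. LINT u:{s..t}|lborel. F.rate u w)"
    by (rule F.bounded_set_integral_integrable[OF rm F.rate_abs_le])
  have "expectation (\<lambda>w. LINT u:{s..t}|lborel. F.rate u w) \<le> expectation (\<lambda>w. C * (t - s) - c * (LINT u:{s..t}|lborel. ?w u w))"
  proof (rule integral_mono[OF ri])
    show "integrable M (\<lambda>w. C * (t - s) - c * (LINT u:{s..t}|lborel. ?w u w))"
      by (intro Bochner_Integration.integrable_diff Bochner_Integration.integrable_mult_right wi integrable_const)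
    fix w assume w: "w \<in> space M"
    have ws: "set_integrable lborel {s..t} (\<lambda>u. ?w u w)"
      by (rule F.bounded_set_integrable(1)[OF _ w_abs]) (use measurable_Pair2[OF wm w] in simp)
    have rs: "set_integrable lborel {s..t} (\<lambda>u. F.rate u w)"
      by (rule F.bounded_set_integrable(1)[OF _ F.rate_abs_le[OF w]]) (use measurable_Pair2[OF rm w] in simp)
    have Cs: "set_integrable lborel {s..t} (\<lambda>u. C)" by (intro borel_integrable_atLeastAtMost' continuous_on_const)
    have "(LINT u:{s..t}|lborel. F.rate u w) \<le> (LINT u:{s..t}|lborel. C - c * ?w u w)"
    proof (rule set_integral_mono_AE[OF rs])
      show "set_integrable lborel {s..t} (\<lambda>u. C - c * ?w u w)"
        by (intro set_integral_diff(1) Cs set_integrable_mult_right ws)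
      show "AE u\<in>{s..t} in lborel. F.rate u w \<le> C - c * ?w u w"
        using AE_lborel_singleton[of s]
      proof eventually_elim
        case (elim u)
        \<comment> \<open>On paths no longer alive the rate and the weight term are both 0, and the
          bound reads 0 \<le> C.\<close>
        then show ?case
          using le[of "path u w"] C unfolding F.rate_def F.second_order_def al by (auto simp: indicator_def)
      qed
    qed
    also have "\<dots> = C * (t - s) - c * (LINT u:{s..t}|lborel. ?w u w)"
      using set_integral_diff(2)[OF Cs set_integrable_mult_right[OF ws, of c]] st by (simp add: set_lebesgue_integral_def)
    finally show "(LINT u:{s..t}|lborel. F.rate u w) \<le> C * (t - s) - c * (LINT u:{s..t}|lborel. ?w u w)" .
  qed
  also have "\<dots> = C * (t - s) - c * expectation (\<lambda>w. LINT u:{s..t}|lborel. ?w u w)"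
    using wi by (simp add: prob_space)
  finally have "expectation (\<lambda>w. LINT u:{s..t}|lborel. F.rate u w) \<le> C * (t - s) - c * expectation (\<lambda>w. LINT u:{s..t}|lborel. ?w u w)" .
  moreover have "expectation (\<lambda>w. indicator {w. alive_below s D t w} w * test_fun k N (path t w))
    \<le> expectation (\<lambda>w. test_fun k N (path s w)) + expectation (\<lambda>w. LINT u:{s..t}|lborel. F.rate u w)"
    unfolding al[symmetric]
    by (rule F.dynkin_inequality) (simp add: test_fun_def truncated_power_nonneg V_ge_1)
  ultimately show ?thesis by linarith
qed

lemma weight_measurable [measurable]: "weight k N \<in> borel_measurable borel"
  by (rule borel_measurable_continuous_onI[OF continuous_weight])

lemma weight_V_nonneg: "0 \<le> weight k N (V x)"
  using V_pos[of x] by (intro weight_nonneg) simp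

lemma weight_V_le:
  assumes "1 \<le> N"
  shows "weight k N (V x) \<le> N ^ k"
proof (cases "V x \<le> N")
  case True
  then show ?thesis using weight_le[of N "V x" k] power_mono[OF True, of k] assms V_pos[of x] by simp
qed (use assms in \<open>simp add: weight_eq_0\<close>)

lemma test_fun_nonneg: "0 \<le> test_fun k N x"
  by (simp add: test_fun_def truncated_power_nonneg V_ge_1)

lemma test_fun_integrable:
  assumes "1 \<le> N" and [measurable]: "Y \<in> borel_measurable M"
  shows "integrable M (\<lambda>w. test_fun k N (Y w))"
proof -
  obtain b where "C2_test_function (test_fun k N) (test_grad k N) (test_hess k N) b" using test_function[OF assms(1)] by blast
  then interpret C2_test_function "test_fun k N" "test_grad k N" "test_hess k N" b .
  show ?thesis by (rule integrable_const_bound[where B = b]) (auto intro!: AE_I2 f_bound)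
qed

lemma test_fun_measurable:
  assumes "1 \<le> N"
  shows "test_fun k N \<in> borel_measurable borel"
proof -
  obtain b where "C2_test_function (test_fun k N) (test_grad k N) (test_hess k N) b" using test_function[OF assms] by blast
  then interpret C2_test_function "test_fun k N" "test_grad k N" "test_hess k N" b .
  show ?thesis by measurable
qed

lemma path_measurable_M [measurable]: "path u \<in> borel_measurable M"
  by measurable

lemma set_integral_weight:
  assumes N: "1 \<le> N"
  shows "w \<in> space M \<Longrightarrow> set_integrable lborel {s..t} (\<lambda>u. weight k N (V (path u w)))"
    and "w \<in> space M \<Longrightarrow> \<bar>LINT u:{s..t}|lborel. weight k N (V (path u w))\<bar> \<le> N ^ k * max 0 (t - s)"
    and "(\<lambda>w. LINT u:{s..t}|lborel. weight k N (V (path u w))) \<in> borel_measurable M"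
proof -
  have c: "set_integrable lborel {s..t} (\<lambda>_. N ^ k)" by (intro borel_integrable_atLeastAtMost' continuous_on_const)
  have w_abs: "\<bar>weight k N (V x)\<bar> \<le> N ^ k" for x using weight_V_nonneg[of k N x] weight_V_le[OF N, of k x] by simp
  show int: "set_integrable lborel {s..t} (\<lambda>u. weight k N (V (path u w)))" if w [measurable]: "w \<in> space M" for w
    unfolding set_integrable_def
  proof (rule Bochner_Integration.integrable_bound[OF c[unfolded set_integrable_def]])
    show "(\<lambda>u. indicator {s..t} u *\<^sub>R weight k N (V (path u w))) \<in> borel_measurable lborel" using w by measurable
  qed (use w_abs N in \<open>auto simp: indicator_def\<close>)
  show "\<bar>LINT u:{s..t}|lborel. weight k N (V (path u w))\<bar> \<le> N ^ k * max 0 (t - s)" if w: "w \<in> space M" for w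
  proof -
    have "\<bar>LINT u:{s..t}|lborel. weight k N (V (path u w))\<bar> \<le> (LINT u:{s..t}|lborel. N ^ k)"
      using set_integral_norm_bound[OF int[OF w]] set_integral_mono[OF set_integrable_abs[OF int[OF w]] c] w_abs
      by (auto intro: order_trans)
    also have "\<dots> = N ^ k * max 0 (t - s)" by (simp add: set_lebesgue_integral_def max_def)
    finally show ?thesis .
  qed
  show "(\<lambda>w. LINT u:{s..t}|lborel. weight k N (V (path u w))) \<in> borel_measurable M"
    unfolding set_lebesgue_integral_def by measurable
qed

text \<open>\<open>D\<close> tends to infinity for fixed \<open>N\<close>: on a bounded interval
  every continuous path is alive below some level, and test function and weight are bounded for
  fixed \<open>N\<close>, so dominated convergence applies. Only afterwards does \<open>N\<close>
  grow.\<close>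

lemma moment_step:
  assumes st: "0 \<le> s" "s < t" and N: "1 \<le> N" and c: "0 < c" and C: "0 \<le> C"
    and le: "\<And>x. test_grad k N x \<bullet> \<beta> x + 1 / 2 * trace (transpose (S x) ** test_hess k N x ** S x) \<le> C - c * weight k N (V x)"
  shows "expectation (\<lambda>w. test_fun k N (path t w)) + c * expectation (\<lambda>w. LINT u:{s..t}|lborel. weight k N (V (path u w)))
    \<le> expectation (\<lambda>w. test_fun k N (path s w)) + C * (t - s)"
proof (rule LIMSEQ_le_const2)
  let ?ind = "\<lambda>D u w. indicator {w. alive_below s D u w} w :: real"
  have ind_lim: "(\<lambda>D. ?ind D u w * x) \<longlonglongrightarrow> x" if "w \<in> space M" "s \<le> u" for u w x
  proof (rule Lim_transform_eventually[OF tendsto_const])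
    show "\<forall>\<^sub>F D in sequentially. x = ?ind D u w * x"
      using alive_below_eventually[OF that(1) st that(2)] by eventually_elim simp
  qed
  obtain b where b: "C2_test_function (test_fun k N) (test_grad k N) (test_hess k N) b"
    using test_function[OF N] by blast
  interpret T: C2_test_function "test_fun k N" "test_grad k N" "test_hess k N" b by (rule b)
  note [measurable (raw)] = localized_diffusion.alive_measurable[OF localized[OF st], folded alive_below_def]
  have c': "set_integrable lborel {s..t} (\<lambda>_. N ^ k)" by (intro borel_integrable_atLeastAtMost' continuous_on_const)
  have w_abs: "\<bar>?ind D u w * weight k N (V x)\<bar> \<le> N ^ k" for D u w x
    using weight_V_nonneg[of k N x] weight_V_le[OF N, of k x] N by (auto simp: indicator_def)
  have 1: "(\<lambda>D. expectation (\<lambda>w. ?ind D t w * test_fun k N (path t w))) \<longlonglongrightarrow> expectation (\<lambda>w. test_fun k N (path t w))"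
  proof (rule integral_dominated_convergence[where w = "\<lambda>_. b"])
    show "AE w in M. (\<lambda>D. ?ind D t w * test_fun k N (path t w)) \<longlonglongrightarrow> test_fun k N (path t w)"
      using st by (intro AE_I2 ind_lim) auto
    show "AE w in M. norm (?ind D t w * test_fun k N (path t w)) \<le> b" for D
      using T.f_bound T.b_nonneg by (intro AE_I2) (auto simp: indicator_def)
  qed measurable
  have inner: "(\<lambda>D. LINT u:{s..t}|lborel. ?ind D u w * weight k N (V (path u w))) \<longlonglongrightarrow> (LINT u:{s..t}|lborel. weight k N (V (path u w)))"
    "\<bar>LINT u:{s..t}|lborel. ?ind D u w * weight k N (V (path u w))\<bar> \<le> N ^ k * (t - s)"
    if w: "w \<in> space M" for w D
  proof -
    note [measurable] = w
    show "(\<lambda>D. LINT u:{s..t}|lborel. ?ind D u w * weight k N (V (path u w))) \<longlonglongrightarrow> (LINT u:{s..t}|lborel. weight k N (V (path u w)))"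
      unfolding set_lebesgue_integral_def
    proof (rule integral_dominated_convergence[where w = "\<lambda>u. indicator {s..t} u *\<^sub>R N ^ k"])
      show "integrable lborel (\<lambda>u. indicator {s..t} u *\<^sub>R N ^ k)" using c' by (simp add: set_integrable_def)
      show "AE u in lborel. (\<lambda>D. indicator {s..t} u *\<^sub>R (?ind D u w * weight k N (V (path u w)))) \<longlonglongrightarrow> indicator {s..t} u *\<^sub>R weight k N (V (path u w))"
      proof (rule AE_I2)
        fix u show "(\<lambda>D. indicator {s..t} u *\<^sub>R (?ind D u w * weight k N (V (path u w)))) \<longlonglongrightarrow> indicator {s..t} u *\<^sub>R weight k N (V (path u w))"
          using ind_lim[OF w, of u] by (cases "u \<in> {s..t}") auto
      qed
      show "AE u in lborel. norm (indicator {s..t} u *\<^sub>R (?ind D u w * weight k N (V (path u w)))) \<le> indicator {s..t} u *\<^sub>R N ^ k" for D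
        using w_abs[of D _ w] N by (intro AE_I2) (auto simp: indicator_def)
    qed measurable
    have int: "set_integrable lborel {s..t} (\<lambda>u. ?ind D u w * weight k N (V (path u w)))"
      unfolding set_integrable_def
    proof (rule Bochner_Integration.integrable_bound[OF c'[unfolded set_integrable_def]])
      show "AE u in lborel. norm (indicator {s..t} u *\<^sub>R (?ind D u w * weight k N (V (path u w)))) \<le> norm (indicator {s..t} u *\<^sub>R N ^ k)"
        using w_abs[of D _ w] N by (intro AE_I2) (auto simp: indicator_def)
    qed measurable
    have "\<bar>LINT u:{s..t}|lborel. ?ind D u w * weight k N (V (path u w))\<bar> \<le> (LINT u:{s..t}|lborel. N ^ k)"
      using set_integral_norm_bound[OF int] set_integral_mono[OF set_integrable_abs[OF int] c'] w_abs
      by (auto intro: order_trans)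
    also have "\<dots> = N ^ k * (t - s)" using st by (simp add: set_lebesgue_integral_def)
    finally show "\<bar>LINT u:{s..t}|lborel. ?ind D u w * weight k N (V (path u w))\<bar> \<le> N ^ k * (t - s)" .
  qed
  have 2: "(\<lambda>D. expectation (\<lambda>w. LINT u:{s..t}|lborel. ?ind D u w * weight k N (V (path u w))))
    \<longlonglongrightarrow> expectation (\<lambda>w. LINT u:{s..t}|lborel. weight k N (V (path u w)))"
  proof (rule integral_dominated_convergence[where w = "\<lambda>_. N ^ k * (t - s)"])
    show "AE w in M. (\<lambda>D. LINT u:{s..t}|lborel. ?ind D u w * weight k N (V (path u w))) \<longlonglongrightarrow> (LINT u:{s..t}|lborel. weight k N (V (path u w)))"
      by (intro AE_I2 inner)
    show "AE w in M. norm (LINT u:{s..t}|lborel. ?ind D u w * weight k N (V (path u w))) \<le> N ^ k * (t - s)" for D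
      unfolding real_norm_def by (intro AE_I2 inner)
  qed (unfold set_lebesgue_integral_def, measurable)
  show "(\<lambda>D. expectation (\<lambda>w. ?ind D t w * test_fun k N (path t w))
      + c * expectation (\<lambda>w. LINT u:{s..t}|lborel. ?ind D u w * weight k N (V (path u w))))
    \<longlonglongrightarrow> expectation (\<lambda>w. test_fun k N (path t w)) + c * expectation (\<lambda>w. LINT u:{s..t}|lborel. weight k N (V (path u w)))"
    by (intro tendsto_intros 1 2)
  show "\<exists>D0. \<forall>D\<ge>D0. expectation (\<lambda>w. ?ind D t w * test_fun k N (path t w))
      + c * expectation (\<lambda>w. LINT u:{s..t}|lborel. ?ind D u w * weight k N (V (path u w)))
    \<le> expectation (\<lambda>w. test_fun k N (path s w)) + C * (t - s)"
    using localized_moment_step[OF st N c C le] by blast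
qed

text \<open>The non-negative test function at time \<open>T\<close> is dropped and the deterministic
  start bounds the initial one; division by \<open>c\<close> leaves the time integral of the weight.
  Fatou's lemma in \<open>N\<close> replaces the weight by \<open>V ^ k\<close> at the price of a
  factor 4.\<close>

lemma time_average_moment:
  obtains C where "0 \<le> C" "\<And>T. 0 \<le> T \<Longrightarrow>
    (\<integral>\<^sup>+ w. (\<integral>\<^sup>+ u\<in>{0..T}. ennreal (V (path u w) ^ k) \<partial>lborel) \<partial>M) \<le> ennreal (C * (1 + T))"
proof -
  obtain c C where c: "0 < c" and C: "0 \<le> C" and le: "\<And>N x. 1 \<le> N \<Longrightarrow>
    test_grad k N x \<bullet> \<beta> x + 1 / 2 * trace (transpose (S x) ** test_hess k N x ** S x) \<le> C - c * weight k N (V x)"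
    using generator_test_fun_le by blast
  define C' where "C' = 4 / c * (V x\<^sub>0 ^ Suc k + C)"
  have C': "0 \<le> C'" using c C V_power_ge_1[of x\<^sub>0 "Suc k"] unfolding C'_def by (intro mult_nonneg_nonneg) auto
  show thesis
  proof (rule that[OF C'])
    fix T :: real assume T: "0 \<le> T"
    show "(\<integral>\<^sup>+ w. (\<integral>\<^sup>+ u\<in>{0..T}. ennreal (V (path u w) ^ k) \<partial>lborel) \<partial>M) \<le> ennreal (C' * (1 + T))"
    proof (cases "T = 0")
      case True
      have "(\<integral>\<^sup>+ u\<in>{0..0}. ennreal (V (path u w) ^ k) \<partial>lborel) = 0" for w
        by (simp add: nn_integral_indicator_singleton)
      then show ?thesis using True by simp
    next
      case False
      then have T: "0 < T" using T by simp
      have bound: "(\<integral>\<^sup>+ w. ennreal 4 * (\<integral>\<^sup>+ u\<in>{0..T}. ennreal (weight k (real N) (V (path u w))) \<partial>lborel) \<partial>M) \<le> ennreal (C' * (1 + T))"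
        if N: "1 \<le> N" for N :: nat
      proof -
        have N: "1 \<le> real N" using N by simp
        have "expectation (\<lambda>w. test_fun k N (path 0 w)) = expectation (\<lambda>w. test_fun k N x\<^sub>0)"
        proof (rule integral_cong_AE)
          show "AE w in M. test_fun k N (path 0 w) = test_fun k N x\<^sub>0" using initial by eventually_elim simp
          show "(\<lambda>w. test_fun k N (path 0 w)) \<in> borel_measurable M"
            by (rule measurable_compose[OF path_measurable_M test_fun_measurable[OF N]])
        qed simp
        also have "\<dots> \<le> V x\<^sub>0 ^ Suc k"
          using truncated_power_le[of "real N" "V x\<^sub>0" k] N V_ge_1 by (simp add: prob_space test_fun_def)
        finally have start: "expectation (\<lambda>w. test_fun k N (path 0 w)) \<le> V x\<^sub>0 ^ Suc k" .
        have "0 \<le> expectation (\<lambda>w. test_fun k N (path T w))" by (intro integral_nonneg_AE AE_I2 test_fun_nonneg)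
        then have "c * expectation (\<lambda>w. LINT u:{0..T}|lborel. weight k N (V (path u w))) \<le> V x\<^sub>0 ^ Suc k + C * T"
          using moment_step[OF order_refl T N c C le[OF N], unfolded diff_zero] start by linarith
        also have "\<dots> \<le> (V x\<^sub>0 ^ Suc k + C) * (1 + T)"
          using T C V_pos[of x\<^sub>0] by (simp add: algebra_simps)
        finally have E: "4 * expectation (\<lambda>w. LINT u:{0..T}|lborel. weight k N (V (path u w))) \<le> C' * (1 + T)"
          using c by (simp add: C'_def field_simps)
        have "(\<integral>\<^sup>+ w. ennreal 4 * (\<integral>\<^sup>+ u\<in>{0..T}. ennreal (weight k (real N) (V (path u w))) \<partial>lborel) \<partial>M)
          = (\<integral>\<^sup>+ w. ennreal (4 * (LINT u:{0..T}|lborel. weight k N (V (path u w)))) \<partial>M)"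
        proof (intro nn_integral_cong)
          fix w assume w: "w \<in> space M"
          have "(\<integral>\<^sup>+ u\<in>{0..T}. ennreal (weight k (real N) (V (path u w))) \<partial>lborel) = (\<integral>\<^sup>+ u. ennreal (indicator {0..T} u *\<^sub>R weight k N (V (path u w))) \<partial>lborel)"
            by (intro nn_integral_cong) (simp add: indicator_def)
          also have "\<dots> = ennreal (LINT u:{0..T}|lborel. weight k N (V (path u w)))"
            unfolding set_lebesgue_integral_def
            using set_integral_weight(1)[OF N w, of 0 T k] weight_V_nonneg
            by (intro nn_integral_eq_integral) (auto simp: set_integrable_def)
          finally show "ennreal 4 * (\<integral>\<^sup>+ u\<in>{0..T}. ennreal (weight k (real N) (V (path u w))) \<partial>lborel)
            = ennreal (4 * (LINT u:{0..T}|lborel. weight k N (V (path u w))))"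
            using weight_V_nonneg by (simp add: ennreal_mult set_lebesgue_integral_def integral_nonneg_AE)
        qed
        also have "\<dots> = ennreal (expectation (\<lambda>w. 4 * (LINT u:{0..T}|lborel. weight k N (V (path u w)))))"
        proof (rule nn_integral_eq_integral)
          show "integrable M (\<lambda>w. 4 * (LINT u:{0..T}|lborel. weight k N (V (path u w))))"
            using set_integral_weight(2,3)[OF N, where s = 0 and t = T and k = k]
            by (intro Bochner_Integration.integrable_mult_right integrable_const_bound[where B = "real N ^ k * max 0 (T - 0)"]) auto
          show "AE w in M. 0 \<le> 4 * (LINT u:{0..T}|lborel. weight k N (V (path u w)))"
            using weight_V_nonneg by (intro AE_I2) (simp add: set_lebesgue_integral_def integral_nonneg_AE)
        qed
        also have "\<dots> \<le> ennreal (C' * (1 + T))" using E by (intro ennreal_leI) simp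
        finally show ?thesis .
      qed
      show ?thesis
      proof (rule nn_integral_le_liminf[where i\<^sub>0 = 1, OF _ AE_I2 bound])
        fix w assume w [measurable]: "w \<in> space M"
        have "(\<integral>\<^sup>+ u\<in>{0..T}. ennreal (V (path u w) ^ k) \<partial>lborel)
          \<le> (\<integral>\<^sup>+ u. liminf (\<lambda>N. ennreal 4 * (ennreal (weight k (real N) (V (path u w))) * indicator {0..T} u)) \<partial>lborel)"
        proof (intro nn_integral_mono Liminf_bounded)
          fix u
          obtain N0 where N0: "2 * V (path u w) < real N0" using reals_Archimedean2 by blast
          show "\<forall>\<^sub>F N in sequentially. ennreal (V (path u w) ^ k) * indicator {0..T} u \<le> ennreal 4 * (ennreal (weight k (real N) (V (path u w))) * indicator {0..T} u)"
          proof (rule eventually_sequentiallyI[of N0])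
            fix N assume "N0 \<le> N"
            then have "V (path u w) \<le> real N / 2" using N0 by simp
            then have "V (path u w) ^ k \<le> 4 * weight k (real N) (V (path u w))"
              using weight_ge[of "real N" "V (path u w)" k] V_pos[of "path u w"] by simp
            then have "ennreal (V (path u w) ^ k) \<le> ennreal (4 * weight k (real N) (V (path u w)))" by (rule ennreal_leI)
            also have "\<dots> = ennreal 4 * ennreal (weight k (real N) (V (path u w)))" using weight_V_nonneg by (intro ennreal_mult) auto
            finally show "ennreal (V (path u w) ^ k) * indicator {0..T} u \<le> ennreal 4 * (ennreal (weight k (real N) (V (path u w))) * indicator {0..T} u)"
              by (simp add: indicator_def del: path_nonneg)
          qed
        qed
        also have "\<dots> \<le> liminf (\<lambda>N. \<integral>\<^sup>+ u. ennreal 4 * (ennreal (weight k (real N) (V (path u w))) * indicator {0..T} u) \<partial>lborel)"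
          by (rule nn_integral_liminf) measurable
        also have "\<dots> = liminf (\<lambda>N. ennreal 4 * (\<integral>\<^sup>+ u\<in>{0..T}. ennreal (weight k (real N) (V (path u w))) \<partial>lborel))"
          by (subst nn_integral_cmult) measurable
        finally show "(\<integral>\<^sup>+ u\<in>{0..T}. ennreal (V (path u w) ^ k) \<partial>lborel)
          \<le> liminf (\<lambda>N. ennreal 4 * (\<integral>\<^sup>+ u\<in>{0..T}. ennreal (weight k (real N) (V (path u w))) \<partial>lborel))" .
      qed measurable
    qed
  qed
qed

text \<open>Here the integral of the weight is dropped and the test function is kept: over at most
  one unit of time its mean grows by at most a constant. The truncated power is exchanged for
  \<open>V ^ Suc k\<close> by its lower bound at \<open>t\<close> and its upper bound at
  \<open>s\<close>.\<close>

lemma one_step_moment: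
  obtains C where "0 \<le> C" "\<And>s t. 0 \<le> s \<Longrightarrow> s \<le> t \<Longrightarrow> t \<le> s + 1 \<Longrightarrow>
    (\<integral>\<^sup>+ w. ennreal (V (path t w) ^ Suc k) \<partial>M) \<le> ennreal C * (1 + (\<integral>\<^sup>+ w. ennreal (V (path s w) ^ Suc k) \<partial>M))"
proof -
  obtain c C where c: "0 < c" and C: "0 \<le> C" and le: "\<And>N x. 1 \<le> N \<Longrightarrow>
    test_grad k N x \<bullet> \<beta> x + 1 / 2 * trace (transpose (S x) ** test_hess k N x ** S x) \<le> C - c * weight k N (V x)"
    using generator_test_fun_le by blast
  \<comment> \<open>The factor in the lower bound for the truncated power; \<open>C'\<close> is
    taken large enough for both \<open>1 + K * C\<close> and \<open>K\<close>.\<close>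
  define K where "K = 4 * real (Suc k)"
  define C' where "C' = 1 + K * (1 + C)"
  have C': "1 \<le> C'" using C by (simp add: C'_def K_def)
  show thesis
  proof (rule that[of C'])
    fix s t :: real assume s: "0 \<le> s" "s \<le> t" "t \<le> s + 1"
    let ?m = "\<integral>\<^sup>+ w. ennreal (V (path s w) ^ Suc k) \<partial>M"
    show "(\<integral>\<^sup>+ w. ennreal (V (path t w) ^ Suc k) \<partial>M) \<le> ennreal C' * (1 + ?m)"
    proof (cases "s = t")
      case True
      have "1 * (0 + ?m) \<le> ennreal C' * (1 + ?m)" using C' by (intro mult_mono add_right_mono) auto
      then show ?thesis using True by simp
    next
      case False
      then have st: "s < t" using s by simp
      show ?thesis
      proof (rule nn_integral_le_liminf[where i\<^sub>0 = 1 and F = "\<lambda>N w. ennreal (1 + K * test_fun k (real (Suc N)) (path t w))", OF _ AE_I2])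
        fix N :: nat
        note [measurable] = test_fun_measurable[of "real (Suc N)" k]
        have N: "1 \<le> real (Suc N)" by simp
        show "(\<lambda>w. ennreal (1 + K * test_fun k (real (Suc N)) (path t w))) \<in> borel_measurable M" by measurable
        have E: "expectation (\<lambda>w. test_fun k (real (Suc N)) (path t w)) \<le> expectation (\<lambda>w. test_fun k (real (Suc N)) (path s w)) + C"
        proof -
          have "0 \<le> c * expectation (\<lambda>w. LINT u:{s..t}|lborel. weight k (real (Suc N)) (V (path u w)))"
            using c weight_V_nonneg by (intro mult_nonneg_nonneg integral_nonneg_AE AE_I2) (auto simp: set_lebesgue_integral_def integral_nonneg_AE)
          moreover have "C * (t - s) \<le> C * 1" using C s by (intro mult_left_mono) auto
          ultimately show ?thesis using moment_step[OF s(1) st N c C le[OF N]] by simp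
        qed
        have "(\<integral>\<^sup>+ w. ennreal (1 + K * test_fun k (real (Suc N)) (path t w)) \<partial>M) = ennreal (expectation (\<lambda>w. 1 + K * test_fun k (real (Suc N)) (path t w)))"
          using test_fun_integrable[OF N] test_fun_nonneg
          by (intro nn_integral_eq_integral) (auto simp: K_def)
        also have "\<dots> \<le> ennreal (1 + K * (expectation (\<lambda>w. test_fun k (real (Suc N)) (path s w)) + C))"
        proof (rule ennreal_leI)
          have "expectation (\<lambda>w. 1 + K * test_fun k (real (Suc N)) (path t w)) = 1 + K * expectation (\<lambda>w. test_fun k (real (Suc N)) (path t w))"
            using test_fun_integrable[OF N] by (simp add: prob_space)
          also have "\<dots> \<le> 1 + K * (expectation (\<lambda>w. test_fun k (real (Suc N)) (path s w)) + C)"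
            using E by (intro add_left_mono mult_left_mono) (auto simp: K_def)
          finally show "expectation (\<lambda>w. 1 + K * test_fun k (real (Suc N)) (path t w))
            \<le> 1 + K * (expectation (\<lambda>w. test_fun k (real (Suc N)) (path s w)) + C)" .
        qed
        also have "\<dots> = ennreal (1 + K * C) + ennreal K * ennreal (expectation (\<lambda>w. test_fun k (real (Suc N)) (path s w)))"
          using C test_fun_nonneg by (simp add: K_def integral_nonneg_AE algebra_simps flip: ennreal_mult ennreal_plus)
        also have "\<dots> \<le> ennreal (1 + K * C) + ennreal K * ?m"
        proof (intro add_left_mono mult_left_mono)
          have "ennreal (expectation (\<lambda>w. test_fun k (real (Suc N)) (path s w))) = (\<integral>\<^sup>+ w. ennreal (test_fun k (real (Suc N)) (path s w)) \<partial>M)"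
            using test_fun_integrable[OF N] test_fun_nonneg by (intro nn_integral_eq_integral[symmetric]) auto
          also have "\<dots> \<le> ?m"
            using truncated_power_le[of "real (Suc N)" _ k] V_ge_1 by (intro nn_integral_mono ennreal_leI) (simp add: test_fun_def del: of_nat_Suc power_Suc)
          finally show "ennreal (expectation (\<lambda>w. test_fun k (real (Suc N)) (path s w))) \<le> ?m" .
        qed simp
        also have "\<dots> \<le> ennreal C' + ennreal C' * ?m"
          using C by (intro add_mono mult_right_mono ennreal_leI) (auto simp: C'_def K_def algebra_simps)
        also have "\<dots> = ennreal C' * (1 + ?m)" by (simp add: distrib_left)
        finally show "(\<integral>\<^sup>+ w. ennreal (1 + K * test_fun k (real (Suc N)) (path t w)) \<partial>M) \<le> ennreal C' * (1 + ?m)" .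
      next
        fix w
        obtain N0 where N0: "2 * V (path t w) < real N0" using reals_Archimedean2 by blast
        show "ennreal (V (path t w) ^ Suc k) \<le> liminf (\<lambda>N. ennreal (1 + K * test_fun k (real (Suc N)) (path t w)))"
        proof (rule Liminf_bounded, rule eventually_sequentiallyI[of N0])
          fix N assume "N0 \<le> N"
          then have "V (path t w) \<le> real (Suc N) / 2" using N0 by simp
          then show "ennreal (V (path t w) ^ Suc k) \<le> ennreal (1 + K * test_fun k (real (Suc N)) (path t w))"
            using truncated_power_ge[of "real (Suc N)" "V (path t w)" k] V_ge_1 unfolding K_def test_fun_def
            by (intro ennreal_leI) (simp del: of_nat_Suc power_Suc)
        qed
      qed
    qed
  qed (use C' in simp)
qed

end

section \<open>Moments along the sampling grid\<close>

lemma nn_integral_grid_sum: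
  fixes h :: "real \<Rightarrow> ennreal"
  assumes [measurable]: "h \<in> borel_measurable borel" and \<delta>: "0 \<le> \<delta>"
  shows "(\<Sum>i<m. \<integral>\<^sup>+ u\<in>{real i * \<delta>..real (Suc i) * \<delta>}. h u \<partial>lborel) = (\<integral>\<^sup>+ u\<in>{0..real m * \<delta>}. h u \<partial>lborel)"
proof (induction m)
  case 0
  have "(\<integral>\<^sup>+ u\<in>{0..0}. h u \<partial>lborel) = (\<integral>\<^sup>+ (u :: real). 0 \<partial>lborel)"
    using AE_lborel_singleton[of "0::real"] by (intro nn_integral_cong_AE) (auto elim!: eventually_mono)
  then show ?case by simp
next
  case (Suc m)
  have "(\<integral>\<^sup>+ u\<in>{0..real (Suc m) * \<delta>}. h u \<partial>lborel)
    = (\<integral>\<^sup>+ u. h u * indicator {0..real m * \<delta>} u + h u * indicator {real m * \<delta>..real (Suc m) * \<delta>} u \<partial>lborel)"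
  proof (rule nn_integral_cong_AE)
    show "AE u in lborel. h u * indicator {0..real (Suc m) * \<delta>} u = h u * indicator {0..real m * \<delta>} u + h u * indicator {real m * \<delta>..real (Suc m) * \<delta>} u"
      using AE_lborel_singleton[of "real m * \<delta>"]
    proof eventually_elim
      case (elim u)
      have "real m * \<delta> \<le> real (Suc m) * \<delta>" "0 \<le> real m * \<delta>" using \<delta> by (auto intro: mult_right_mono)
      then show ?case using elim by (auto simp: indicator_def)
    qed
  qed
  also have "\<dots> = (\<integral>\<^sup>+ u\<in>{0..real m * \<delta>}. h u \<partial>lborel) + (\<integral>\<^sup>+ u\<in>{real m * \<delta>..real (Suc m) * \<delta>}. h u \<partial>lborel)"
    by (rule nn_integral_add) measurable
  finally show ?case using Suc by simp
qed

lemma set_integral_norm_squared_le: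
  fixes F :: "real \<Rightarrow> 'a::euclidean_space"
  assumes [measurable]: "F \<in> borel_measurable borel" and su: "s \<le> u"
  shows "sqnorm (LINT r:{s..u}|lborel. F r) \<le> ennreal (u - s) * (\<integral>\<^sup>+ r\<in>{s..u}. sqnorm (F r) \<partial>lborel)"
proof -
  have "ennreal (norm (LINT r:{s..u}|lborel. F r)) \<le> (\<integral>\<^sup>+ r. ennreal (norm (indicator {s..u} r *\<^sub>R F r)) \<partial>lborel)"
  proof (cases "set_integrable lborel {s..u} F")
    case True
    then show ?thesis unfolding set_integrable_def set_lebesgue_integral_def by (rule integral_norm_bound_ennreal)
  \<comment> \<open>If \<open>F\<close> is not integrable, the integral is 0 by convention and the
    bound is trivial.\<close>
  qed (simp add: set_lebesgue_integral_def set_integrable_def not_integrable_integral_eq)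
  also have "\<dots> = (\<integral>\<^sup>+ r. indicator {s..u} r * (ennreal (norm (F r)) * indicator {s..u} r) \<partial>lborel)"
    by (intro nn_integral_cong) (simp add: indicator_def)
  finally have "(ennreal (norm (LINT r:{s..u}|lborel. F r)))\<^sup>2 \<le> (\<integral>\<^sup>+ r. indicator {s..u} r * (ennreal (norm (F r)) * indicator {s..u} r) \<partial>lborel)\<^sup>2"
    by (intro power_mono) auto
  also have "\<dots> \<le> (\<integral>\<^sup>+ r. (indicator {s..u} r)\<^sup>2 \<partial>lborel) * (\<integral>\<^sup>+ r. (ennreal (norm (F r)) * indicator {s..u} r)\<^sup>2 \<partial>lborel)"
    by (rule Cauchy_Schwarz_nn_integral) measurable
  also have "(\<integral>\<^sup>+ r. (indicator {s..u} r)\<^sup>2 \<partial>lborel) = (\<integral>\<^sup>+ r. indicator {s..u} r \<partial>lborel)"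
    by (intro nn_integral_cong) (simp add: indicator_def)
  also have "\<dots> = ennreal (u - s)" using su by simp
  also have "(\<integral>\<^sup>+ r. (ennreal (norm (F r)) * indicator {s..u} r)\<^sup>2 \<partial>lborel) = (\<integral>\<^sup>+ r\<in>{s..u}. sqnorm (F r) \<partial>lborel)"
    by (intro nn_integral_cong) (simp add: indicator_def ennreal_power)
  finally show ?thesis by (simp add: ennreal_power)
qed

context lyapunov_diffusion
begin

lemma Fubini_M_lborel:
  assumes "(\<lambda>(w, u). f w u) \<in> borel_measurable (M \<Otimes>\<^sub>M lborel)"
  shows "(\<integral>\<^sup>+ w. (\<integral>\<^sup>+ u. f w u \<partial>lborel) \<partial>M) = (\<integral>\<^sup>+ (u :: real). (\<integral>\<^sup>+ w. f w u \<partial>M) \<partial>lborel)"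
proof -
  interpret P: pair_sigma_finite M "lborel :: real measure"
    by (intro pair_sigma_finite.intro sigma_finite_measure_axioms sigma_finite_lborel)
  show ?thesis using P.Fubini'[OF assms] by simp
qed

text \<open>The growth bound compares the moment at the right end of a cell with the moment at every
  time of the cell, hence with its average there. Summation gives the time integral already
  controlled, and the shift by one grid point leaves the deterministic start. The exponent is raised
  to \<open>Suc k\<close>, the form of the growth bound, at no cost since \<open>V\<close> is at
  least 1.\<close>

lemma grid_moment:
  obtains C where "0 \<le> C" "\<And>\<delta> m. 0 < \<delta> \<Longrightarrow> \<delta> \<le> 1 \<Longrightarrow>
    (\<Sum>i<m. ennreal \<delta> * (\<integral>\<^sup>+ w. ennreal (V (path (real i * \<delta>) w) ^ k) \<partial>M)) \<le> ennreal (C * (1 + real m * \<delta>))"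
proof -
  obtain C1 where C1: "0 \<le> C1" "\<And>s t. 0 \<le> s \<Longrightarrow> s \<le> t \<Longrightarrow> t \<le> s + 1 \<Longrightarrow>
    (\<integral>\<^sup>+ w. ennreal (V (path t w) ^ Suc k) \<partial>M) \<le> ennreal C1 * (1 + (\<integral>\<^sup>+ w. ennreal (V (path s w) ^ Suc k) \<partial>M))"
    using one_step_moment[of k] by blast
  obtain C2 where C2: "0 \<le> C2" "\<And>T. 0 \<le> T \<Longrightarrow>
    (\<integral>\<^sup>+ w. (\<integral>\<^sup>+ u\<in>{0..T}. ennreal (V (path u w) ^ Suc k) \<partial>lborel) \<partial>M) \<le> ennreal (C2 * (1 + T))"
    using time_average_moment[of "Suc k"] by blast
  define F where "F s = (\<integral>\<^sup>+ w. ennreal (V (path s w) ^ Suc k) \<partial>M)" for s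
  have [measurable]: "F \<in> borel_measurable borel" unfolding F_def by measurable
  define C where "C = V x\<^sub>0 ^ Suc k + C1 + C1 * C2"
  have C: "0 \<le> C" using C1 C2 V_pos[of x\<^sub>0] by (simp add: C_def)
  show thesis
  proof (rule that[OF C])
    fix \<delta> :: real and m :: nat assume \<delta>: "0 < \<delta>" "\<delta> \<le> 1"
    let ?T = "real m * \<delta>"
    have T: "0 \<le> ?T" using \<delta> by simp
    have F0: "F 0 = ennreal (V x\<^sub>0 ^ Suc k)"
    proof -
      have "F 0 = (\<integral>\<^sup>+ w. ennreal (V x\<^sub>0 ^ Suc k) \<partial>M)"
        unfolding F_def using initial by (intro nn_integral_cong_AE) (auto elim!: eventually_mono)
      then show ?thesis by (simp add: emeasure_space_1)
    qed
    have "(\<Sum>i<m. ennreal \<delta> * F (real (Suc i) * \<delta>)) \<le> (\<Sum>i<m. \<integral>\<^sup>+ u\<in>{real i * \<delta>..real (Suc i) * \<delta>}. ennreal C1 * (1 + F u) \<partial>lborel)"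
    proof (rule sum_mono)
      fix i
      have len: "real (Suc i) * \<delta> - real i * \<delta> = \<delta>" by (simp add: algebra_simps)
      then have le: "real i * \<delta> \<le> real (Suc i) * \<delta>" using \<delta> by linarith
      have "(\<integral>\<^sup>+ u. F (real (Suc i) * \<delta>) * indicator {real i * \<delta>..real (Suc i) * \<delta>} u \<partial>lborel) = F (real (Suc i) * \<delta>) * ennreal \<delta>"
        using le by (subst nn_integral_cmult_indicator) (simp_all add: len del: of_nat_Suc)
      then have "ennreal \<delta> * F (real (Suc i) * \<delta>) = (\<integral>\<^sup>+ u. F (real (Suc i) * \<delta>) * indicator {real i * \<delta>..real (Suc i) * \<delta>} u \<partial>lborel)"
        by (simp only: mult.commute)
      also have "\<dots> \<le> (\<integral>\<^sup>+ u\<in>{real i * \<delta>..real (Suc i) * \<delta>}. ennreal C1 * (1 + F u) \<partial>lborel)"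
      proof (intro nn_integral_mono)
        fix u
        show "F (real (Suc i) * \<delta>) * indicator {real i * \<delta>..real (Suc i) * \<delta>} u \<le> ennreal C1 * (1 + F u) * indicator {real i * \<delta>..real (Suc i) * \<delta>} u"
        proof (cases "u \<in> {real i * \<delta>..real (Suc i) * \<delta>}")
          case True
          moreover have "0 \<le> u" using True \<delta> by (auto intro: order_trans[of 0 "real i * \<delta>"])
          moreover have "real (Suc i) * \<delta> \<le> u + 1" using True len \<delta> by auto
          ultimately show ?thesis using C1(2)[of u "real (Suc i) * \<delta>"] unfolding F_def by (simp del: of_nat_Suc path_nonneg)
        qed simp
      qed
      finally show "ennreal \<delta> * F (real (Suc i) * \<delta>) \<le> (\<integral>\<^sup>+ u\<in>{real i * \<delta>..real (Suc i) * \<delta>}. ennreal C1 * (1 + F u) \<partial>lborel)" .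
    qed
    also have "\<dots> = (\<integral>\<^sup>+ u\<in>{0..?T}. ennreal C1 * (1 + F u) \<partial>lborel)"
      using \<delta> by (intro nn_integral_grid_sum) auto
    also have "\<dots> = (\<integral>\<^sup>+ u. ennreal C1 * (indicator {0..?T} u + F u * indicator {0..?T} u) \<partial>lborel)"
      by (intro nn_integral_cong) (simp add: indicator_def)
    also have "\<dots> = ennreal C1 * (\<integral>\<^sup>+ u. indicator {0..?T} u + F u * indicator {0..?T} u \<partial>lborel)"
      by (rule nn_integral_cmult) measurable
    also have "(\<integral>\<^sup>+ u. indicator {0..?T} u + F u * indicator {0..?T} u \<partial>lborel)
      = (\<integral>\<^sup>+ u. indicator {0..?T} u \<partial>lborel) + (\<integral>\<^sup>+ u\<in>{0..?T}. F u \<partial>lborel)"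
      by (rule nn_integral_add) measurable
    also have "(\<integral>\<^sup>+ u. indicator {0..?T} u \<partial>lborel) = ennreal ?T" using T by simp
    finally have shifted: "(\<Sum>i<m. ennreal \<delta> * F (real (Suc i) * \<delta>)) \<le> ennreal C1 * (ennreal ?T + (\<integral>\<^sup>+ u\<in>{0..?T}. F u \<partial>lborel))" .
    have "(\<integral>\<^sup>+ u\<in>{0..?T}. F u \<partial>lborel) = (\<integral>\<^sup>+ u. (\<integral>\<^sup>+ w. ennreal (V (path u w) ^ Suc k) * indicator {0..?T} u \<partial>M) \<partial>lborel)"
      unfolding F_def by (intro nn_integral_cong) (subst nn_integral_multc; measurable)
    also have "\<dots> = (\<integral>\<^sup>+ w. (\<integral>\<^sup>+ u\<in>{0..?T}. ennreal (V (path u w) ^ Suc k) \<partial>lborel) \<partial>M)"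
      by (rule Fubini_M_lborel[symmetric]) (unfold split_def, measurable)
    also have "\<dots> \<le> ennreal (C2 * (1 + ?T))" by (rule C2(2)[OF T])
    finally have integral: "(\<integral>\<^sup>+ u\<in>{0..?T}. F u \<partial>lborel) \<le> ennreal (C2 * (1 + ?T))" .
    have "(\<integral>\<^sup>+ w. ennreal (V (path (real i * \<delta>) w) ^ k) \<partial>M) \<le> F (real i * \<delta>)" for i
      unfolding F_def using V_ge_1 by (intro nn_integral_mono ennreal_leI power_increasing) auto
    then have "(\<Sum>i<m. ennreal \<delta> * (\<integral>\<^sup>+ w. ennreal (V (path (real i * \<delta>) w) ^ k) \<partial>M)) \<le> (\<Sum>i<m. ennreal \<delta> * F (real i * \<delta>))"
      by (intro sum_mono mult_left_mono) auto
    also have "\<dots> \<le> (\<Sum>i<Suc m. ennreal \<delta> * F (real i * \<delta>))" by simp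
    also have "\<dots> = ennreal \<delta> * F 0 + (\<Sum>i<m. ennreal \<delta> * F (real (Suc i) * \<delta>))"
      by (simp only: sum.lessThan_Suc_shift of_nat_0 mult_zero_left)
    also have "\<dots> \<le> ennreal \<delta> * ennreal (V x\<^sub>0 ^ Suc k) + ennreal C1 * (ennreal ?T + ennreal (C2 * (1 + ?T)))"
      unfolding F0 by (intro add_left_mono order_trans[OF shifted] mult_left_mono integral) simp
    also have "\<dots> = ennreal (\<delta> * V x\<^sub>0 ^ Suc k + C1 * (?T + C2 * (1 + ?T)))"
      using \<delta> C1 C2 V_pos[of x\<^sub>0] by (simp flip: ennreal_mult ennreal_plus)
    also have "\<dots> \<le> ennreal (C * (1 + ?T))"
    proof (rule ennreal_leI)
      have "\<delta> \<le> 1 + ?T" using \<delta> T by linarith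
      then have "\<delta> * V x\<^sub>0 ^ Suc k \<le> (1 + ?T) * V x\<^sub>0 ^ Suc k" using V_pos[of x\<^sub>0] by (intro mult_right_mono) auto
      moreover have "C1 * ?T \<le> C1 * (1 + ?T)" using C1 by (intro mult_left_mono) auto
      ultimately show "\<delta> * V x\<^sub>0 ^ Suc k + C1 * (?T + C2 * (1 + ?T)) \<le> C * (1 + ?T)"
        unfolding C_def by (simp add: algebra_simps)
    qed
    finally show "(\<Sum>i<m. ennreal \<delta> * (\<integral>\<^sup>+ w. ennreal (V (path (real i * \<delta>) w) ^ k) \<partial>M)) \<le> ennreal (C * (1 + ?T))" .
  qed
qed

lemma V_power_mono: "i \<le> j \<Longrightarrow> V x ^ i \<le> V x ^ j"
  by (rule power_increasing[OF _ V_ge_1])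

text \<open>The exponent \<open>4 * p\<close> is common to squares and fourth powers, so a single
  moment of \<open>V\<close> controls drift, diffusion and the martingale part.\<close>

lemma growth_squared:
  "(norm (\<beta> x))\<^sup>2 \<le> J\<^sup>2 * V x ^ (4 * p)" "(norm (S x))\<^sup>2 \<le> J\<^sup>2 * V x ^ (4 * p)" "norm (S x) ^ 4 \<le> J ^ 4 * V x ^ (4 * p)"
proof -
  have "(J * V x ^ p)\<^sup>2 = J\<^sup>2 * V x ^ (2 * p)" by (simp add: power_mult_distrib power_mult[symmetric] mult.commute)
  also have "\<dots> \<le> J\<^sup>2 * V x ^ (4 * p)" by (intro mult_left_mono V_power_mono) auto
  finally have "(J * V x ^ p)\<^sup>2 \<le> J\<^sup>2 * V x ^ (4 * p)" .
  then show "(norm (\<beta> x))\<^sup>2 \<le> J\<^sup>2 * V x ^ (4 * p)" "(norm (S x))\<^sup>2 \<le> J\<^sup>2 * V x ^ (4 * p)"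
    using power_mono[OF \<beta>_growth[of x], of 2] power_mono[OF S_growth[of x], of 2] by auto
  show "norm (S x) ^ 4 \<le> J ^ 4 * V x ^ (4 * p)"
    using power_mono[OF S_growth[of x], of 4] by (simp add: power_mult_distrib power_mult[symmetric] mult.commute)
qed

lemma growth_squared_ennreal:
  "sqnorm (\<beta> x) \<le> ennreal (J\<^sup>2) * ennreal (V x ^ (4 * p))"
  "sqnorm (S x) \<le> ennreal (J\<^sup>2) * ennreal (V x ^ (4 * p))"
proof -
  have eq: "ennreal (J\<^sup>2) * ennreal (V x ^ (4 * p)) = ennreal (J\<^sup>2 * V x ^ (4 * p))"
    using V_pos[of x] by (intro ennreal_mult[symmetric]) auto
  show "sqnorm (\<beta> x) \<le> ennreal (J\<^sup>2) * ennreal (V x ^ (4 * p))"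
    "sqnorm (S x) \<le> ennreal (J\<^sup>2) * ennreal (V x ^ (4 * p))"
    unfolding eq by (intro ennreal_leI growth_squared)+
qed

text \<open>The Hoelder condition is traded for an arbitrarily small multiple of moments plus a
  quadratic term in the distance, since it is mean squares of path increments that are controlled.
  Close points use the Hoelder bound; distant ones use the growth bound together with the fact that
  the distance exceeds \<open>\<eta>\<close>.\<close>

lemma S_modulus:
  assumes e: "0 < e"
  obtains K where "0 \<le> K" "\<And>x y. (norm (S x - S y))\<^sup>2 \<le> e * (V x ^ (4 * p) + V y ^ (4 * p)) + K * (norm (x - y))\<^sup>2"
proof -
  \<comment> \<open>Absorbs \<open>J\<^sup>2\<close>, the 2 in front of \<open>e'\<close>, and the 8
    that comes from the fourth power of a sum.\<close>
  define e' where "e' = e / (16 * (J\<^sup>2 + 1))"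
  have e': "0 < e'" "J\<^sup>2 * (2 * e' * 8) \<le> e"
  proof -
    show "0 < e'" using e by (simp add: e'_def add_nonneg_pos)
    have "J\<^sup>2 * (2 * e' * 8) \<le> (J\<^sup>2 + 1) * (2 * e' * 8)" using \<open>0 < e'\<close> by (intro mult_right_mono) auto
    also have "\<dots> = e"
    proof -
      have "J\<^sup>2 + 1 \<noteq> 0" using add_nonneg_pos[of "J\<^sup>2" 1] by simp
      then show ?thesis by (simp add: e'_def field_simps)
    qed
    finally show "J\<^sup>2 * (2 * e' * 8) \<le> e" .
  qed
  define \<eta> where "\<eta> = e' powr (1 / (2 * \<alpha>))"
  have \<eta>: "0 < \<eta>" "(\<eta> powr \<alpha>)\<^sup>2 = e'"
    using e' \<alpha>_pos by (auto simp: \<eta>_def powr_powr power2_eq_square simp flip: powr_add)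
  define K where "K = J\<^sup>2 / (4 * e' * \<eta>\<^sup>2)"
  have K: "0 \<le> K" using e' by (simp add: K_def)
  show thesis
  proof (rule that[OF K])
    fix x y
    define w where "w = V x ^ p + V y ^ p"
    have w: "1 \<le> w" using V_power_ge_1[of x p] V_power_ge_1[of y p] unfolding w_def by linarith
    define D where "D = norm (x - y)"
    have w4: "w ^ 4 \<le> 8 * (V x ^ (4 * p) + V y ^ (4 * p))"
    proof -
      have "w\<^sup>2 \<le> 2 * ((V x ^ p)\<^sup>2 + (V y ^ p)\<^sup>2)"
        using sum_squares_bound[of "V x ^ p" "V y ^ p"] by (simp add: w_def power2_sum)
      then have "(w\<^sup>2)\<^sup>2 \<le> (2 * ((V x ^ p)\<^sup>2 + (V y ^ p)\<^sup>2))\<^sup>2" by (intro power_mono) auto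
      also have "\<dots> \<le> 8 * (((V x ^ p)\<^sup>2)\<^sup>2 + ((V y ^ p)\<^sup>2)\<^sup>2)"
        using sum_squares_bound[of "(V x ^ p)\<^sup>2" "(V y ^ p)\<^sup>2"] by (simp add: power2_sum power_mult_distrib)
      finally show ?thesis by (simp add: power_mult[symmetric] mult.commute)
    qed
    have w2: "w\<^sup>2 \<le> w ^ 4" using w by (intro power_increasing) auto
    have main: "(norm (S x - S y))\<^sup>2 \<le> J\<^sup>2 * (2 * e' * w ^ 4 + D\<^sup>2 / (4 * e' * \<eta>\<^sup>2))"
    proof (cases "D \<le> \<eta>")
      case True
      have "norm (S x - S y) \<le> J * w * D powr \<alpha>" using S_hoelder[of x y] by (simp add: w_def D_def)
      also have "\<dots> \<le> J * w * \<eta> powr \<alpha>"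
        using True J_nonneg w \<alpha>_pos by (intro mult_left_mono powr_mono2) (auto simp: D_def)
      finally have "(norm (S x - S y))\<^sup>2 \<le> (J * w * \<eta> powr \<alpha>)\<^sup>2" by (intro power_mono) auto
      also have "\<dots> = J\<^sup>2 * (e' * w\<^sup>2)" by (simp add: power_mult_distrib \<eta>(2))
      also have "\<dots> \<le> J\<^sup>2 * (2 * e' * w ^ 4 + D\<^sup>2 / (4 * e' * \<eta>\<^sup>2))"
      proof (rule mult_left_mono)
        have "e' * w\<^sup>2 \<le> 2 * e' * w ^ 4" using e' w2 by (intro mult_mono) auto
        moreover have "0 \<le> D\<^sup>2 / (4 * e' * \<eta>\<^sup>2)" using e' by simp
        ultimately show "e' * w\<^sup>2 \<le> 2 * e' * w ^ 4 + D\<^sup>2 / (4 * e' * \<eta>\<^sup>2)" by linarith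
      qed simp
      finally show ?thesis .
    next
      case False
      have "norm (S x - S y) \<le> J * w"
        by (rule order_trans[OF norm_triangle_ineq4]) (use S_growth[of x] S_growth[of y] in \<open>simp add: w_def distrib_left\<close>)
      then have "(norm (S x - S y))\<^sup>2 \<le> (J * w)\<^sup>2" by (intro power_mono) auto
      also have "\<dots> = J\<^sup>2 * w\<^sup>2" by (simp add: power_mult_distrib)
      also have "\<dots> \<le> J\<^sup>2 * (2 * e' * w ^ 4 + D\<^sup>2 / (4 * e' * \<eta>\<^sup>2))"
      proof (rule mult_left_mono)
        \<comment> \<open>Completing the square bounds \<open>w\<^sup>2\<close> by a small multiple
          of \<open>w ^ 4\<close> and a constant; the constant is then paid for by
          \<open>D\<^sup>2 / \<eta>\<^sup>2\<close>, which is at least 1.\<close>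
        have "0 \<le> (2 * e' * w\<^sup>2 - 1)\<^sup>2 / (4 * e')" using e' by simp
        also have "\<dots> = e' * w ^ 4 - w\<^sup>2 + 1 / (4 * e')" using e'
          by (simp add: power2_diff field_simps power2_eq_square power4_eq_xxxx)
        finally have 1: "w\<^sup>2 \<le> e' * w ^ 4 + 1 / (4 * e')" by simp
        have "\<eta>\<^sup>2 \<le> D\<^sup>2" using False \<eta> by (intro power_mono) auto
        then have "1 / (4 * e') \<le> D\<^sup>2 / (4 * e' * \<eta>\<^sup>2)" using e' \<eta> by (simp add: field_simps)
        moreover have "e' * w ^ 4 \<le> 2 * e' * w ^ 4" using e' w by simp
        ultimately show "w\<^sup>2 \<le> 2 * e' * w ^ 4 + D\<^sup>2 / (4 * e' * \<eta>\<^sup>2)" using 1 by linarith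
      qed simp
      finally show ?thesis .
    qed
    also have "\<dots> = J\<^sup>2 * (2 * e') * w ^ 4 + K * D\<^sup>2" by (simp add: K_def distrib_left mult_ac)
    also have "J\<^sup>2 * (2 * e') * w ^ 4 \<le> J\<^sup>2 * (2 * e') * (8 * (V x ^ (4 * p) + V y ^ (4 * p)))"
      using e' by (intro mult_left_mono w4) auto
    also have "\<dots> = J\<^sup>2 * (2 * e' * 8) * (V x ^ (4 * p) + V y ^ (4 * p))" by simp
    also have "\<dots> \<le> e * (V x ^ (4 * p) + V y ^ (4 * p))"
      using e'(2) V_pos by (intro mult_right_mono) (auto intro!: add_nonneg_nonneg zero_le_power less_imp_le add_pos_pos zero_less_power)
    finally show "(norm (S x - S y))\<^sup>2 \<le> e * (V x ^ (4 * p) + V y ^ (4 * p)) + K * (norm (x - y))\<^sup>2" by (simp add: D_def)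
  qed
qed

lemma drift_integral_squared_le:
  assumes "0 \<le> s" "s \<le> u" and w: "w \<in> space M"
  shows "sqnorm (LINT r:{s..u}|lborel. \<beta> (path r w))
    \<le> ennreal ((u - s) * J\<^sup>2) * (\<integral>\<^sup>+ r\<in>{s..u}. ennreal (V (path r w) ^ (4 * p)) \<partial>lborel)"
proof -
  note [measurable] = w
  have "sqnorm (LINT r:{s..u}|lborel. \<beta> (path r w))
    \<le> ennreal (u - s) * (\<integral>\<^sup>+ r\<in>{s..u}. sqnorm (\<beta> (path r w)) \<partial>lborel)"
    by (rule set_integral_norm_squared_le) (use assms in measurable)
  also have "\<dots> \<le> ennreal (u - s) * (\<integral>\<^sup>+ r. ennreal (J\<^sup>2) * (ennreal (V (path r w) ^ (4 * p)) * indicator {s..u} r) \<partial>lborel)"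
    using growth_squared_ennreal(1)
    by (intro mult_left_mono nn_integral_mono) (auto simp: indicator_def simp del: path_nonneg)
  also have "\<dots> = ennreal ((u - s) * J\<^sup>2) * (\<integral>\<^sup>+ r\<in>{s..u}. ennreal (V (path r w) ^ (4 * p)) \<partial>lborel)"
    using assms by (subst nn_integral_cmult) (auto simp: ennreal_mult mult.assoc)
  finally show ?thesis .
qed

text \<open>Drift by Cauchy-Schwarz, noise by the isometry with frozen coefficient 0. Each
  contributes \<open>2 * J\<^sup>2\<close>; the length of the interval in the drift bound is
  estimated by 1.\<close>

lemma state_increment:
  assumes st: "0 \<le> s" "s \<le> u" "u \<le> s + 1"
  shows "(\<integral>\<^sup>+ w. sqnorm (path u w - path s w) \<partial>M)
    \<le> ennreal (4 * J\<^sup>2) * (\<integral>\<^sup>+ w. (\<integral>\<^sup>+ r\<in>{s..u}. ennreal (V (path r w) ^ (4 * p)) \<partial>lborel) \<partial>M)"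
proof -
  let ?Q = "\<lambda>w. \<integral>\<^sup>+ r\<in>{s..u}. ennreal (V (path r w) ^ (4 * p)) \<partial>lborel"
  have u: "0 \<le> u" using st by simp
  note [measurable] = I_measurable[OF st(1)] I_measurable[OF u]
  have Im: "(\<lambda>w. I u w - I s w) \<in> borel_measurable M" by measurable
  have "(\<integral>\<^sup>+ w. sqnorm (path u w - path s w) \<partial>M)
    \<le> (\<integral>\<^sup>+ w. ennreal (2 * J\<^sup>2) * ?Q w + 2 * sqnorm (I u w - I s w) \<partial>M)"
  proof (rule nn_integral_mono_AE)
    show "AE w in M. sqnorm (path u w - path s w) \<le> ennreal (2 * J\<^sup>2) * ?Q w + 2 * sqnorm (I u w - I s w)"
      using X_increment AE_space
    proof eventually_elim
      case (elim w)
      let ?d = "LINT r:{s..u}|lborel. \<beta> (path r w)"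
      have "path u w - path s w = ?d + (I u w - I s w)" using elim(1) st by blast
      then have "(norm (path u w - path s w))\<^sup>2 \<le> 2 * (norm ?d)\<^sup>2 + 2 * (norm (I u w - I s w))\<^sup>2"
        using norm_add_squared_le[of 1 ?d "I u w - I s w"] by simp
      then have "sqnorm (path u w - path s w) \<le> 2 * sqnorm ?d + 2 * sqnorm (I u w - I s w)"
        by (simp add: ennreal_leI ennreal_mult'[symmetric] flip: ennreal_plus ennreal_numeral)
      also have "2 * sqnorm ?d \<le> 2 * (ennreal ((u - s) * J\<^sup>2) * ?Q w)"
        by (intro mult_left_mono drift_integral_squared_le st elim(2)) simp
      also have "\<dots> \<le> 2 * (ennreal (1 * J\<^sup>2) * ?Q w)"
        using st by (intro mult_left_mono mult_right_mono ennreal_leI) auto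
      also have "\<dots> = ennreal (2 * J\<^sup>2) * ?Q w"
        by (simp add: ennreal_mult mult.assoc)
      finally show ?case by (simp add: add_right_mono)
    qed
  qed
  also have "\<dots> = ennreal (2 * J\<^sup>2) * (\<integral>\<^sup>+ w. ?Q w \<partial>M) + 2 * (\<integral>\<^sup>+ w. sqnorm (I u w - I s w) \<partial>M)"
    by (subst nn_integral_add, measurable, subst nn_integral_cmult, measurable, subst nn_integral_cmult, measurable)
  also have "(\<integral>\<^sup>+ w. sqnorm (I u w - I s w) \<partial>M) \<le> (\<integral>\<^sup>+ w. (\<integral>\<^sup>+ r\<in>{s..u}. sqnorm (S (path r w)) \<partial>lborel) \<partial>M)"
    using ito_increment_frozen[OF st(1,2), of "\<lambda>_. 0"] by simp
  also have "\<dots> \<le> (\<integral>\<^sup>+ w. (\<integral>\<^sup>+ r. ennreal (J\<^sup>2) * (ennreal (V (path r w) ^ (4 * p)) * indicator {s..u} r) \<partial>lborel) \<partial>M)"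
    using growth_squared_ennreal(2)
    by (intro nn_integral_mono) (auto simp: indicator_def simp del: path_nonneg)
  also have "\<dots> = ennreal (J\<^sup>2) * (\<integral>\<^sup>+ w. ?Q w \<partial>M)"
  proof -
    have "(\<integral>\<^sup>+ r. ennreal (J\<^sup>2) * (ennreal (V (path r w) ^ (4 * p)) * indicator {s..u} r) \<partial>lborel) = ennreal (J\<^sup>2) * ?Q w" if "w \<in> space M" for w
      using that by (intro nn_integral_cmult) measurable
    then have "(\<integral>\<^sup>+ w. (\<integral>\<^sup>+ r. ennreal (J\<^sup>2) * (ennreal (V (path r w) ^ (4 * p)) * indicator {s..u} r) \<partial>lborel) \<partial>M)
      = (\<integral>\<^sup>+ w. ennreal (J\<^sup>2) * ?Q w \<partial>M)" by (intro nn_integral_cong)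
    then show ?thesis by (simp add: nn_integral_cmult)
  qed
  finally have "(\<integral>\<^sup>+ w. sqnorm (path u w - path s w) \<partial>M)
    \<le> ennreal (2 * J\<^sup>2) * (\<integral>\<^sup>+ w. ?Q w \<partial>M) + 2 * (ennreal (J\<^sup>2) * (\<integral>\<^sup>+ w. ?Q w \<partial>M))"
    by (simp add: add_left_mono mult_left_mono)
  also have "\<dots> = (ennreal (2 * J\<^sup>2) + ennreal (2 * J\<^sup>2)) * (\<integral>\<^sup>+ w. ?Q w \<partial>M)"
    by (simp add: ennreal_mult distrib_right mult.assoc)
  also have "ennreal (2 * J\<^sup>2) + ennreal (2 * J\<^sup>2) = ennreal (4 * J\<^sup>2)" by (simp flip: ennreal_plus)
  finally show ?thesis .
qed

end

section \<open>Realized quadratic variation\<close>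

lemma inner_outer_square: "N \<bullet> outer_square v = v \<bullet> (N *v v)"
  by (simp add: inner_vec_def outer_square_def matrix_vector_mult_def sum_distrib_left mult_ac)

lemma inner_matrix_square:
  fixes N A :: "real ^ 'd ^ 'd"
  shows "N \<bullet> (A ** transpose A) = trace (transpose A ** N ** A)"
proof -
  have "N \<bullet> (A ** transpose A) = (\<Sum>i\<in>UNIV. \<Sum>j\<in>UNIV. \<Sum>k\<in>UNIV. N $ i $ j * (A $ i $ k * A $ j $ k))"
    by (simp add: inner_vec_def matrix_matrix_mult_def transpose_def sum_distrib_left)
  also have "\<dots> = (\<Sum>i\<in>UNIV. \<Sum>k\<in>UNIV. \<Sum>j\<in>UNIV. N $ i $ j * (A $ i $ k * A $ j $ k))"
    by (intro sum.cong refl sum.swap)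
  also have "\<dots> = (\<Sum>k\<in>UNIV. \<Sum>i\<in>UNIV. \<Sum>j\<in>UNIV. N $ i $ j * (A $ i $ k * A $ j $ k))"
    by (rule sum.swap)
  also have "\<dots> = (\<Sum>k\<in>UNIV. \<Sum>j\<in>UNIV. \<Sum>i\<in>UNIV. N $ i $ j * (A $ i $ k * A $ j $ k))"
    by (intro sum.cong refl sum.swap)
  also have "\<dots> = trace (transpose A ** N ** A)"
    by (simp add: trace_def matrix_matrix_mult_def transpose_def sum_distrib_left sum_distrib_right mult_ac)
  finally show ?thesis .
qed

context lyapunov_diffusion
begin

text \<open>The modulus of \<open>S\<close> is integrated over the interval. The quadratic part is a
  path increment, whose mean square is itself bounded by an integral over the interval; integrating
  once more gives the factor \<open>c - a\<close>, which makes up for a large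
  \<open>K\<close>.\<close>

lemma frozen_coefficient_interval:
  assumes a: "0 \<le> a" "a \<le> c" "c \<le> a + 1" and e: "0 \<le> e" and K: "0 \<le> K"
    and modulus: "\<And>x y. (norm (S x - S y))\<^sup>2 \<le> e * (V x ^ (4 * p) + V y ^ (4 * p)) + K * (norm (x - y))\<^sup>2"
  shows "(\<integral>\<^sup>+ w. (\<integral>\<^sup>+ u\<in>{a..c}. sqnorm (S (path u w) - S (path a w)) \<partial>lborel) \<partial>M)
    \<le> ennreal (e + K * (c - a) * (4 * J\<^sup>2)) * (\<integral>\<^sup>+ w. (\<integral>\<^sup>+ u\<in>{a..c}. ennreal (V (path u w) ^ (4 * p)) \<partial>lborel) \<partial>M)
      + ennreal e * (ennreal (c - a) * (\<integral>\<^sup>+ w. ennreal (V (path a w) ^ (4 * p)) \<partial>M))"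
proof -
  define P where "P = (\<integral>\<^sup>+ w. (\<integral>\<^sup>+ u\<in>{a..c}. ennreal (V (path u w) ^ (4 * p)) \<partial>lborel) \<partial>M)"
  define m where "m = (\<integral>\<^sup>+ w. ennreal (V (path a w) ^ (4 * p)) \<partial>M)"
  have "(\<integral>\<^sup>+ w. (\<integral>\<^sup>+ u\<in>{a..c}. sqnorm (S (path u w) - S (path a w)) \<partial>lborel) \<partial>M)
    \<le> (\<integral>\<^sup>+ w. (\<integral>\<^sup>+ u. ennreal e * (ennreal (V (path u w) ^ (4 * p)) * indicator {a..c} u)
      + (ennreal e * (ennreal (V (path a w) ^ (4 * p)) * indicator {a..c} u)
      + ennreal K * (sqnorm (path u w - path a w) * indicator {a..c} u)) \<partial>lborel) \<partial>M)"
  proof (intro nn_integral_mono)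
    fix w u
    have "sqnorm (S (path u w) - S (path a w)) \<le> ennreal (e * V (path u w) ^ (4 * p) + (e * V (path a w) ^ (4 * p) + K * (norm (path u w - path a w))\<^sup>2))"
      using modulus[of "path u w" "path a w"] by (intro ennreal_leI) (simp add: distrib_left)
    also have "\<dots> = ennreal e * ennreal (V (path u w) ^ (4 * p)) + (ennreal e * ennreal (V (path a w) ^ (4 * p)) + ennreal K * sqnorm (path u w - path a w))"
      using e K V_pos[of "path u w"] V_pos[of "path a w"]
      by (subst ennreal_plus, simp, simp, subst ennreal_plus, simp, simp) (simp add: ennreal_mult)
    finally show "sqnorm (S (path u w) - S (path a w)) * indicator {a..c} u
      \<le> ennreal e * (ennreal (V (path u w) ^ (4 * p)) * indicator {a..c} u)
      + (ennreal e * (ennreal (V (path a w) ^ (4 * p)) * indicator {a..c} u)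
      + ennreal K * (sqnorm (path u w - path a w) * indicator {a..c} u))"
      by (simp add: indicator_def del: path_nonneg)
  qed
  also have "\<dots> = (\<integral>\<^sup>+ w. ennreal e * (\<integral>\<^sup>+ u\<in>{a..c}. ennreal (V (path u w) ^ (4 * p)) \<partial>lborel)
      + (ennreal e * (ennreal (V (path a w) ^ (4 * p)) * ennreal (c - a))
      + ennreal K * (\<integral>\<^sup>+ u\<in>{a..c}. sqnorm (path u w - path a w) \<partial>lborel)) \<partial>M)"
  proof (intro nn_integral_cong)
    fix w assume [measurable]: "w \<in> space M"
    have "(\<integral>\<^sup>+ u. ennreal (V (path a w) ^ (4 * p)) * indicator {a..c} u \<partial>lborel) = ennreal (V (path a w) ^ (4 * p)) * ennreal (c - a)"
      using a by (subst nn_integral_cmult_indicator) auto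
    then show "(\<integral>\<^sup>+ u. ennreal e * (ennreal (V (path u w) ^ (4 * p)) * indicator {a..c} u)
      + (ennreal e * (ennreal (V (path a w) ^ (4 * p)) * indicator {a..c} u)
      + ennreal K * (sqnorm (path u w - path a w) * indicator {a..c} u)) \<partial>lborel)
      = ennreal e * (\<integral>\<^sup>+ u\<in>{a..c}. ennreal (V (path u w) ^ (4 * p)) \<partial>lborel)
      + (ennreal e * (ennreal (V (path a w) ^ (4 * p)) * ennreal (c - a))
      + ennreal K * (\<integral>\<^sup>+ u\<in>{a..c}. sqnorm (path u w - path a w) \<partial>lborel))"
      by (simp add: nn_integral_add nn_integral_cmult del: path_nonneg)
  qed
  also have "\<dots> = ennreal e * P + (ennreal e * (m * ennreal (c - a))
      + ennreal K * (\<integral>\<^sup>+ w. (\<integral>\<^sup>+ u\<in>{a..c}. sqnorm (path u w - path a w) \<partial>lborel) \<partial>M))"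
    unfolding P_def m_def
    by (simp add: nn_integral_add nn_integral_cmult nn_integral_multc del: path_nonneg)
  also have "\<dots> \<le> ennreal e * P + (ennreal e * (m * ennreal (c - a)) + ennreal K * (ennreal (c - a) * (ennreal (4 * J\<^sup>2) * P)))"
  proof (intro add_left_mono mult_left_mono)
    have "(\<integral>\<^sup>+ w. (\<integral>\<^sup>+ u\<in>{a..c}. sqnorm (path u w - path a w) \<partial>lborel) \<partial>M)
      = (\<integral>\<^sup>+ u. (\<integral>\<^sup>+ w. sqnorm (path u w - path a w) * indicator {a..c} u \<partial>M) \<partial>lborel)"
      by (rule Fubini_M_lborel) (unfold split_def, measurable)
    also have "\<dots> = (\<integral>\<^sup>+ u. (\<integral>\<^sup>+ w. sqnorm (path u w - path a w) \<partial>M) * indicator {a..c} u \<partial>lborel)"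
      by (intro nn_integral_cong) (subst nn_integral_multc; measurable)
    also have "\<dots> \<le> (\<integral>\<^sup>+ u. (ennreal (4 * J\<^sup>2) * P) * indicator {a..c} u \<partial>lborel)"
    proof (intro nn_integral_mono)
      fix u
      have "(\<integral>\<^sup>+ w. sqnorm (path u w - path a w) \<partial>M) \<le> ennreal (4 * J\<^sup>2) * P" if u: "u \<in> {a..c}"
      proof -
        have "(\<integral>\<^sup>+ w. sqnorm (path u w - path a w) \<partial>M)
          \<le> ennreal (4 * J\<^sup>2) * (\<integral>\<^sup>+ w. (\<integral>\<^sup>+ r\<in>{a..u}. ennreal (V (path r w) ^ (4 * p)) \<partial>lborel) \<partial>M)"
          using u a by (intro state_increment) auto
        also have "\<dots> \<le> ennreal (4 * J\<^sup>2) * P"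
          unfolding P_def using u by (intro mult_left_mono nn_integral_mono) (auto simp: indicator_def)
        finally show ?thesis .
      qed
      then show "(\<integral>\<^sup>+ w. sqnorm (path u w - path a w) \<partial>M) * indicator {a..c} u \<le> ennreal (4 * J\<^sup>2) * P * indicator {a..c} u"
        by (simp add: indicator_def del: path_nonneg)
    qed
    also have "\<dots> = ennreal (c - a) * (ennreal (4 * J\<^sup>2) * P)"
      using a by (subst nn_integral_cmult_indicator) (auto simp: mult.commute)
    finally show "(\<integral>\<^sup>+ w. (\<integral>\<^sup>+ u\<in>{a..c}. sqnorm (path u w - path a w) \<partial>lborel) \<partial>M) \<le> ennreal (c - a) * (ennreal (4 * J\<^sup>2) * P)" .
  qed simp
  also have "\<dots> = ennreal (e + K * (c - a) * (4 * J\<^sup>2)) * P + ennreal e * (ennreal (c - a) * m)"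
    using a e K by (simp add: ennreal_plus ennreal_mult distrib_right distrib_left mult_ac add_ac)
  finally show ?thesis unfolding P_def m_def .
qed

lemma sum_interval_moments:
  assumes "0 \<le> \<delta>"
  shows "(\<Sum>i<m. \<integral>\<^sup>+ w. (\<integral>\<^sup>+ u\<in>{real i * \<delta>..real (Suc i) * \<delta>}. ennreal (V (path u w) ^ k) \<partial>lborel) \<partial>M)
    = (\<integral>\<^sup>+ w. (\<integral>\<^sup>+ u\<in>{0..real m * \<delta>}. ennreal (V (path u w) ^ k) \<partial>lborel) \<partial>M)"
proof -
  have "(\<Sum>i<m. \<integral>\<^sup>+ w. (\<integral>\<^sup>+ u\<in>{real i * \<delta>..real (Suc i) * \<delta>}. ennreal (V (path u w) ^ k) \<partial>lborel) \<partial>M)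
    = (\<integral>\<^sup>+ w. (\<Sum>i<m. \<integral>\<^sup>+ u\<in>{real i * \<delta>..real (Suc i) * \<delta>}. ennreal (V (path u w) ^ k) \<partial>lborel) \<partial>M)"
    by (subst nn_integral_sum) measurable
  also have "\<dots> = (\<integral>\<^sup>+ w. (\<integral>\<^sup>+ u\<in>{0..real m * \<delta>}. ennreal (V (path u w) ^ k) \<partial>lborel) \<partial>M)"
  proof (intro nn_integral_cong nn_integral_grid_sum assms)
    fix w assume [measurable]: "w \<in> space M"
    show "(\<lambda>u. ennreal (V (path u w) ^ k)) \<in> borel_measurable borel" by measurable
  qed
  finally show ?thesis .
qed

text \<open>The order of the choices matters: \<open>e'\<close> fixes the multiple of the moments,
  \<open>K\<close> depends on \<open>e'\<close>, and only then is the step made small enough to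
  compensate \<open>K\<close>.\<close>

lemma frozen_coefficient_error:
  assumes e: "0 < e"
  obtains \<delta>\<^sub>0 where "0 < \<delta>\<^sub>0" "\<delta>\<^sub>0 \<le> 1" "\<And>\<delta> m. 0 < \<delta> \<Longrightarrow> \<delta> \<le> \<delta>\<^sub>0 \<Longrightarrow>
    (\<Sum>i<m. \<integral>\<^sup>+ w. (\<integral>\<^sup>+ u\<in>{real i * \<delta>..real (Suc i) * \<delta>}. sqnorm (S (path u w) - S (path (real i * \<delta>) w)) \<partial>lborel) \<partial>M)
    \<le> ennreal (e * (1 + real m * \<delta>))"
proof -
  obtain A where A: "0 \<le> A" "\<And>T. 0 \<le> T \<Longrightarrow>
    (\<integral>\<^sup>+ w. (\<integral>\<^sup>+ u\<in>{0..T}. ennreal (V (path u w) ^ (4 * p)) \<partial>lborel) \<partial>M) \<le> ennreal (A * (1 + T))"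
    using time_average_moment by blast
  obtain B where B: "0 \<le> B" "\<And>\<delta> m. 0 < \<delta> \<Longrightarrow> \<delta> \<le> 1 \<Longrightarrow>
    (\<Sum>i<m. ennreal \<delta> * (\<integral>\<^sup>+ w. ennreal (V (path (real i * \<delta>) w) ^ (4 * p)) \<partial>M)) \<le> ennreal (B * (1 + real m * \<delta>))"
    using grid_moment by blast
  define e' where "e' = e / (2 * (A + B + 1))"
  have e': "0 < e'" "e' * (A + B) \<le> e / 2"
  proof -
    show "0 < e'" using e A(1) B(1) by (simp add: e'_def)
    have "e' * (A + B) \<le> e' * (A + B + 1)" using \<open>0 < e'\<close> by simp
    also have "\<dots> = e / 2" using A(1) B(1) by (simp add: e'_def field_simps)
    finally show "e' * (A + B) \<le> e / 2" .
  qed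
  obtain K where K: "0 \<le> K" "\<And>x y. (norm (S x - S y))\<^sup>2 \<le> e' * (V x ^ (4 * p) + V y ^ (4 * p)) + K * (norm (x - y))\<^sup>2"
    using S_modulus[OF e'(1)] by blast
  define L where "L = K * (4 * J\<^sup>2) * A"
  have L: "0 \<le> L" using K A by (simp add: L_def)
  define \<delta>\<^sub>0 where "\<delta>\<^sub>0 = min 1 (e / (2 * (L + 1)))"
  show thesis
  proof (rule that[of \<delta>\<^sub>0])
    show "0 < \<delta>\<^sub>0" "\<delta>\<^sub>0 \<le> 1" using e L by (auto simp: \<delta>\<^sub>0_def)
    fix \<delta> :: real and m :: nat assume \<delta>: "0 < \<delta>" "\<delta> \<le> \<delta>\<^sub>0"
    then have \<delta>1: "\<delta> \<le> 1" "\<delta> * L \<le> e / 2"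
    proof -
      show "\<delta> \<le> 1" using \<delta> by (simp add: \<delta>\<^sub>0_def)
      have "\<delta> * L \<le> e / (2 * (L + 1)) * (L + 1)" using \<delta> L by (intro mult_mono) (auto simp: \<delta>\<^sub>0_def)
      also have "\<dots> = e / 2" using L by (simp add: field_simps)
      finally show "\<delta> * L \<le> e / 2" .
    qed
    let ?T = "real m * \<delta>"
    have T: "0 \<le> ?T" using \<delta> by simp
    let ?P = "\<lambda>i. \<integral>\<^sup>+ w. (\<integral>\<^sup>+ u\<in>{real i * \<delta>..real (Suc i) * \<delta>}. ennreal (V (path u w) ^ (4 * p)) \<partial>lborel) \<partial>M"
    let ?m = "\<lambda>i. \<integral>\<^sup>+ w. ennreal (V (path (real i * \<delta>) w) ^ (4 * p)) \<partial>M"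
    have "(\<Sum>i<m. \<integral>\<^sup>+ w. (\<integral>\<^sup>+ u\<in>{real i * \<delta>..real (Suc i) * \<delta>}. sqnorm (S (path u w) - S (path (real i * \<delta>) w)) \<partial>lborel) \<partial>M)
      \<le> (\<Sum>i<m. ennreal (e' + K * \<delta> * (4 * J\<^sup>2)) * ?P i + ennreal e' * (ennreal \<delta> * ?m i))"
    proof (rule sum_mono)
      fix i
      have len: "real (Suc i) * \<delta> - real i * \<delta> = \<delta>" by (simp add: algebra_simps)
      have "0 \<le> real i * \<delta>" "real i * \<delta> \<le> real (Suc i) * \<delta>" "real (Suc i) * \<delta> \<le> real i * \<delta> + 1"
        using \<delta> \<delta>1 len by (simp, linarith, linarith)
      from frozen_coefficient_interval[OF this less_imp_le[OF e'(1)] K]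
      show "(\<integral>\<^sup>+ w. (\<integral>\<^sup>+ u\<in>{real i * \<delta>..real (Suc i) * \<delta>}. sqnorm (S (path u w) - S (path (real i * \<delta>) w)) \<partial>lborel) \<partial>M)
        \<le> ennreal (e' + K * \<delta> * (4 * J\<^sup>2)) * ?P i + ennreal e' * (ennreal \<delta> * ?m i)" unfolding len .
    qed
    also have "\<dots> = ennreal (e' + K * \<delta> * (4 * J\<^sup>2)) * (\<Sum>i<m. ?P i) + ennreal e' * (\<Sum>i<m. ennreal \<delta> * ?m i)"
      by (simp only: sum.distrib sum_distrib_left)
    also have "\<dots> \<le> ennreal (e' + K * \<delta> * (4 * J\<^sup>2)) * ennreal (A * (1 + ?T)) + ennreal e' * ennreal (B * (1 + ?T))"
      unfolding sum_interval_moments[OF less_imp_le[OF \<delta>(1)]]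
      by (intro add_mono mult_left_mono A(2)[OF T] B(2)[OF \<delta>(1) \<delta>1(1)]) auto
    also have "\<dots> = ennreal ((e' * (A + B) + \<delta> * L) * (1 + ?T))"
      using e' K A B \<delta> T by (simp add: L_def algebra_simps flip: ennreal_mult ennreal_plus)
    also have "\<dots> \<le> ennreal (e * (1 + ?T))"
      using e'(2) \<delta>1(2) T by (intro ennreal_leI mult_right_mono) auto
    finally show "(\<Sum>i<m. \<integral>\<^sup>+ w. (\<integral>\<^sup>+ u\<in>{real i * \<delta>..real (Suc i) * \<delta>}. sqnorm (S (path u w) - S (path (real i * \<delta>) w)) \<partial>lborel) \<partial>M)
      \<le> ennreal (e * (1 + ?T))" .
  qed
qed

section \<open>Leading term, remainder and martingale part of the increments\<close>

abbreviation leading :: "real \<Rightarrow> real \<Rightarrow> 'w \<Rightarrow> real ^ 'd" where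
  "leading s t w \<equiv> S (path s w) *v (W t w - W s w)"

text \<open>What remains is a drift integral plus the stochastic integral of \<open>S\<close> minus
  its frozen value; Cauchy-Schwarz gives the drift integral an extra factor
  \<open>t - s\<close>.\<close>

lemma leading_remainder:
  assumes st: "0 \<le> s" "s \<le> t"
  shows "(\<integral>\<^sup>+ w. sqnorm (path t w - path s w - leading s t w) \<partial>M)
    \<le> ennreal (2 * (t - s) * J\<^sup>2) * (\<integral>\<^sup>+ w. (\<integral>\<^sup>+ u\<in>{s..t}. ennreal (V (path u w) ^ (4 * p)) \<partial>lborel) \<partial>M)
      + 2 * (\<integral>\<^sup>+ w. (\<integral>\<^sup>+ u\<in>{s..t}. sqnorm (S (path u w) - S (path s w)) \<partial>lborel) \<partial>M)"
proof -
  let ?Q = "\<lambda>w. \<integral>\<^sup>+ r\<in>{s..t}. ennreal (V (path r w) ^ (4 * p)) \<partial>lborel"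
  have t: "0 \<le> t" using st by simp
  note [measurable] = I_measurable[OF st(1)] I_measurable[OF t] W_measurable[OF st(1)] W_measurable[OF t]
  have "(\<integral>\<^sup>+ w. sqnorm (path t w - path s w - leading s t w) \<partial>M)
    \<le> (\<integral>\<^sup>+ w. ennreal (2 * (t - s) * J\<^sup>2) * ?Q w + 2 * sqnorm (I t w - I s w - leading s t w) \<partial>M)"
  proof (rule nn_integral_mono_AE)
    show "AE w in M. sqnorm (path t w - path s w - leading s t w)
      \<le> ennreal (2 * (t - s) * J\<^sup>2) * ?Q w + 2 * sqnorm (I t w - I s w - leading s t w)"
      using X_increment AE_space
    proof eventually_elim
      case (elim w)
      let ?d = "LINT r:{s..t}|lborel. \<beta> (path r w)"
      have eq: "path t w - path s w = ?d + (I t w - I s w)" using elim(1) st by blast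
      have "(norm (path t w - path s w - leading s t w))\<^sup>2 \<le> 2 * (norm ?d)\<^sup>2 + 2 * (norm (I t w - I s w - leading s t w))\<^sup>2"
        using norm_add_squared_le[of 1 ?d "I t w - I s w - leading s t w"] unfolding eq by (simp add: algebra_simps del: path_nonneg)
      then have "sqnorm (path t w - path s w - leading s t w) \<le> 2 * sqnorm ?d + 2 * sqnorm (I t w - I s w - leading s t w)"
        by (simp add: ennreal_leI ennreal_mult'[symmetric] del: path_nonneg flip: ennreal_plus ennreal_numeral)
      also have "2 * sqnorm ?d \<le> 2 * (ennreal ((t - s) * J\<^sup>2) * ?Q w)"
        by (intro mult_left_mono drift_integral_squared_le st elim(2)) simp
      also have "\<dots> = ennreal (2 * (t - s) * J\<^sup>2) * ?Q w"
        using st by (simp add: ennreal_mult mult.assoc del: right_diff_distrib_numeral)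
      finally show ?case by (simp add: add_right_mono del: path_nonneg)
    qed
  qed
  also have "\<dots> = ennreal (2 * (t - s) * J\<^sup>2) * (\<integral>\<^sup>+ w. ?Q w \<partial>M) + 2 * (\<integral>\<^sup>+ w. sqnorm (I t w - I s w - leading s t w) \<partial>M)"
    by (simp add: nn_integral_add nn_integral_cmult del: path_nonneg)
  also have "\<dots> \<le> ennreal (2 * (t - s) * J\<^sup>2) * (\<integral>\<^sup>+ w. ?Q w \<partial>M)
      + 2 * (\<integral>\<^sup>+ w. (\<integral>\<^sup>+ u\<in>{s..t}. sqnorm (S (path u w) - S (path s w)) \<partial>lborel) \<partial>M)"
    by (intro add_left_mono mult_left_mono ito_increment_frozen[OF st]
        measurable_compose[OF path_measurable_G[OF order_refl st(1)] S_measurable]) simp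
  finally show ?thesis .
qed

lemma leading_remainder_sum:
  assumes e: "0 < e"
  obtains \<delta>\<^sub>0 where "0 < \<delta>\<^sub>0" "\<delta>\<^sub>0 \<le> 1" "\<And>\<delta> m. 0 < \<delta> \<Longrightarrow> \<delta> \<le> \<delta>\<^sub>0 \<Longrightarrow>
    (\<Sum>i<m. \<integral>\<^sup>+ w. sqnorm (path (real (Suc i) * \<delta>) w - path (real i * \<delta>) w - leading (real i * \<delta>) (real (Suc i) * \<delta>) w) \<partial>M)
    \<le> ennreal (e * (1 + real m * \<delta>))"
proof -
  obtain A where A: "0 \<le> A" "\<And>T. 0 \<le> T \<Longrightarrow>
    (\<integral>\<^sup>+ w. (\<integral>\<^sup>+ u\<in>{0..T}. ennreal (V (path u w) ^ (4 * p)) \<partial>lborel) \<partial>M) \<le> ennreal (A * (1 + T))"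
    using time_average_moment by blast
  obtain \<delta>\<^sub>1 where \<delta>\<^sub>1: "0 < \<delta>\<^sub>1" "\<delta>\<^sub>1 \<le> 1" "\<And>\<delta> m. 0 < \<delta> \<Longrightarrow> \<delta> \<le> \<delta>\<^sub>1 \<Longrightarrow>
    (\<Sum>i<m. \<integral>\<^sup>+ w. (\<integral>\<^sup>+ u\<in>{real i * \<delta>..real (Suc i) * \<delta>}. sqnorm (S (path u w) - S (path (real i * \<delta>) w)) \<partial>lborel) \<partial>M)
    \<le> ennreal (e / 4 * (1 + real m * \<delta>))"
    using frozen_coefficient_error[of "e / 4"] e by auto
  define L where "L = 2 * J\<^sup>2 * A"
  have L: "0 \<le> L" using A by (simp add: L_def)
  define \<delta>\<^sub>0 where "\<delta>\<^sub>0 = min \<delta>\<^sub>1 (e / (2 * (L + 1)))"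
  show thesis
  proof (rule that[of \<delta>\<^sub>0])
    show "0 < \<delta>\<^sub>0" "\<delta>\<^sub>0 \<le> 1" using e L \<delta>\<^sub>1 by (auto simp: \<delta>\<^sub>0_def)
    fix \<delta> :: real and m :: nat assume \<delta>: "0 < \<delta>" "\<delta> \<le> \<delta>\<^sub>0"
    have \<delta>1: "\<delta> \<le> \<delta>\<^sub>1" using \<delta> by (simp add: \<delta>\<^sub>0_def)
    have \<delta>L: "\<delta> * L \<le> e / 2"
    proof -
      have "\<delta> * L \<le> e / (2 * (L + 1)) * (L + 1)" using \<delta> L by (intro mult_mono) (auto simp: \<delta>\<^sub>0_def)
      also have "\<dots> = e / 2" using L by (simp add: field_simps)
      finally show ?thesis .
    qed
    let ?T = "real m * \<delta>"
    let ?P = "\<lambda>i. \<integral>\<^sup>+ w. (\<integral>\<^sup>+ u\<in>{real i * \<delta>..real (Suc i) * \<delta>}. ennreal (V (path u w) ^ (4 * p)) \<partial>lborel) \<partial>M"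
    let ?F = "\<lambda>i. \<integral>\<^sup>+ w. (\<integral>\<^sup>+ u\<in>{real i * \<delta>..real (Suc i) * \<delta>}. sqnorm (S (path u w) - S (path (real i * \<delta>) w)) \<partial>lborel) \<partial>M"
    let ?R = "\<lambda>i. \<integral>\<^sup>+ w. sqnorm (path (real (Suc i) * \<delta>) w - path (real i * \<delta>) w - leading (real i * \<delta>) (real (Suc i) * \<delta>) w) \<partial>M"
    have T: "0 \<le> ?T" using \<delta> by simp
    have "sum ?R {..<m} \<le> (\<Sum>i<m. ennreal (2 * \<delta> * J\<^sup>2) * ?P i + 2 * ?F i)"
    proof (rule sum_mono)
      fix i
      have len: "real (Suc i) * \<delta> - real i * \<delta> = \<delta>" by (simp add: algebra_simps)
      have "0 \<le> real i * \<delta>" "real i * \<delta> \<le> real (Suc i) * \<delta>" using \<delta> len by (simp, linarith)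
      from leading_remainder[OF this] show "?R i \<le> ennreal (2 * \<delta> * J\<^sup>2) * ?P i + 2 * ?F i" unfolding len .
    qed
    also have "\<dots> = ennreal (2 * \<delta> * J\<^sup>2) * sum ?P {..<m} + 2 * sum ?F {..<m}"
      by (simp only: sum.distrib sum_distrib_left)
    also have "\<dots> \<le> ennreal (2 * \<delta> * J\<^sup>2) * ennreal (A * (1 + ?T)) + ennreal 2 * ennreal (e / 4 * (1 + ?T))"
      unfolding sum_interval_moments[OF less_imp_le[OF \<delta>(1)]] ennreal_numeral
      by (intro add_mono mult_left_mono A(2)[OF T] \<delta>\<^sub>1(3)[OF \<delta>(1) \<delta>1]) auto
    also have "\<dots> = ennreal ((\<delta> * L + e / 2) * (1 + ?T))"
      using e A \<delta> T by (simp add: L_def algebra_simps flip: ennreal_mult ennreal_plus ennreal_numeral)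
    also have "\<dots> \<le> ennreal (e * (1 + ?T))"
      using \<delta>L T by (intro ennreal_leI mult_right_mono) auto
    finally show "sum ?R {..<m} \<le> ennreal (e * (1 + ?T))" .
  qed
qed

text \<open>A martingale difference: given \<open>G s\<close>, the leading term is Gaussian with
  covariance \<open>t - s\<close> times \<open>S\<close> times its transpose at the left point, and
  this conditional mean of the outer square is subtracted.\<close>

definition deviation :: "real \<Rightarrow> real \<Rightarrow> 'w \<Rightarrow> real ^ 'd ^ 'd" where
  "deviation s t w = outer_square (leading s t w) - (t - s) *\<^sub>R (S (path s w) ** transpose (S (path s w)))"

lemma deviation_measurable_G:
  assumes "0 \<le> s" "s \<le> t"
  shows "deviation s t \<in> borel_measurable (G t)"
proof -
  have [measurable]: "path s \<in> borel_measurable (G t)" "W t \<in> borel_measurable (G t)" "W s \<in> borel_measurable (G t)"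
    using assms by (auto intro: path_measurable_G W_measurable_G measurable_G_mono[OF W_measurable_G[of s]] simp del: path_nonneg)
  show ?thesis unfolding deviation_def[abs_def] by measurable
qed

text \<open>The cross term has mean 0, so second moments add instead of norms. The constant consists
  of twice the fourth-moment constant \<open>3 * (real CARD('d))\<^sup>2\<close> from the outer
  square and 2 from the subtracted mean.\<close>

lemma deviation_step:
  fixes N :: "'w \<Rightarrow> real ^ 'd ^ 'd"
  assumes st: "0 \<le> s" "s < t" and N: "N \<in> borel_measurable (G s)" "integrable M (\<lambda>w. (norm (N w))\<^sup>2)"
    and V: "integrable M (\<lambda>w. V (path s w) ^ (4 * p))"
  shows "integrable M (\<lambda>w. (norm (N w + deviation s t w))\<^sup>2)"
    and "expectation (\<lambda>w. (norm (N w + deviation s t w))\<^sup>2)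
      \<le> expectation (\<lambda>w. (norm (N w))\<^sup>2) + (6 * (real CARD('d))\<^sup>2 + 2) * J ^ 4 * (t - s)\<^sup>2 * expectation (\<lambda>w. V (path s w) ^ (4 * p))"
proof -
  define \<zeta> where "\<zeta> = (\<lambda>w. S (path s w))"
  define Z where "Z = (\<lambda>w. W t w - W s w)"
  define D where "D = deviation s t"
  have D_eq: "D w = outer_square (\<zeta> w *v Z w) - (t - s) *\<^sub>R (\<zeta> w ** transpose (\<zeta> w))" for w
    by (simp add: D_def deviation_def \<zeta>_def Z_def del: path_nonneg)
  have [measurable]: "\<zeta> \<in> borel_measurable (G s)"
    unfolding \<zeta>_def using path_measurable_G[OF order_refl st(1)] by measurable
  note \<zeta>G = this
  have [measurable]: "\<zeta> \<in> borel_measurable M" "N \<in> borel_measurable M" by (rule measurable_G, fact)+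
  have [measurable]: "D \<in> borel_measurable M" unfolding D_def using st by (intro measurable_G[OF deviation_measurable_G]) auto
  have \<zeta>4: "norm (\<zeta> w) ^ 4 \<le> J ^ 4 * V (path s w) ^ (4 * p)" for w
    unfolding \<zeta>_def by (rule growth_squared(3))
  have \<zeta>4i: "integrable M (\<lambda>w. norm (\<zeta> w) ^ 4)"
    by (rule Bochner_Integration.integrable_bound[OF integrable_mult_right[OF V, of "J ^ 4"]])
      (use \<zeta>4 J_nonneg in \<open>auto intro!: AE_I2 simp del: path_nonneg intro: order_trans[OF _ abs_ge_self]\<close>)
  have \<zeta>4E: "expectation (\<lambda>w. norm (\<zeta> w) ^ 4) \<le> J ^ 4 * expectation (\<lambda>w. V (path s w) ^ (4 * p))"
    using integral_mono[OF \<zeta>4i integrable_mult_right[OF V, of "J ^ 4"] \<zeta>4] by simp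
  have [measurable]: "(\<lambda>w. norm (\<zeta> w) ^ 4) \<in> borel_measurable (G s)" by measurable
  note P4 = integrable_increment_power4[OF st this \<zeta>4i] expectation_increment_power4[OF st this \<zeta>4i]
  have P4i: "integrable M (\<lambda>w. norm (\<zeta> w) ^ 4 * norm (Z w) ^ 4)"
    and P4E: "expectation (\<lambda>w. norm (\<zeta> w) ^ 4 * norm (Z w) ^ 4) \<le> 3 * (real CARD('d))\<^sup>2 * (t - s)\<^sup>2 * expectation (\<lambda>w. norm (\<zeta> w) ^ 4)"
    using P4 by (auto simp: Z_def)
  have D2: "(norm (D w))\<^sup>2 \<le> 2 * (norm (\<zeta> w) ^ 4 * norm (Z w) ^ 4) + 2 * (t - s)\<^sup>2 * norm (\<zeta> w) ^ 4" for w
  proof -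
    have 1: "norm (outer_square (\<zeta> w *v Z w)) \<le> (norm (\<zeta> w) * norm (Z w))\<^sup>2"
      unfolding norm_outer_square by (intro power_mono norm_matrix_vector_mult_le) simp
    have 2: "norm ((t - s) *\<^sub>R (\<zeta> w ** transpose (\<zeta> w))) \<le> (t - s) * (norm (\<zeta> w))\<^sup>2"
      using norm_matrix_matrix_mult_le[of "\<zeta> w" "transpose (\<zeta> w)"] st
      by (simp add: norm_transpose power2_eq_square mult_left_mono)
    have "(norm (D w))\<^sup>2 \<le> 2 * (norm (outer_square (\<zeta> w *v Z w)))\<^sup>2 + 2 * (norm ((t - s) *\<^sub>R (\<zeta> w ** transpose (\<zeta> w))))\<^sup>2"
      using norm_add_squared_le[of 1 "outer_square (\<zeta> w *v Z w)" "- ((t - s) *\<^sub>R (\<zeta> w ** transpose (\<zeta> w)))"] by (simp add: D_eq)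
    also have "\<dots> \<le> 2 * ((norm (\<zeta> w) * norm (Z w))\<^sup>2)\<^sup>2 + 2 * ((t - s) * (norm (\<zeta> w))\<^sup>2)\<^sup>2"
      using power_mono[OF 1, of 2] power_mono[OF 2, of 2] by auto
    finally show ?thesis by (simp add: power_mult_distrib power_mult[symmetric] mult_ac)
  qed
  have D2i: "integrable M (\<lambda>w. (norm (D w))\<^sup>2)"
    by (rule Bochner_Integration.integrable_bound[OF Bochner_Integration.integrable_add[OF integrable_mult_right[OF P4i, of 2] integrable_mult_right[OF \<zeta>4i, of "2 * (t - s)\<^sup>2"]]])
      (use D2 in \<open>auto intro!: AE_I2 intro: order_trans[OF _ abs_ge_self]\<close>)
  have "expectation (\<lambda>w. (norm (D w))\<^sup>2) \<le> expectation (\<lambda>w. 2 * (norm (\<zeta> w) ^ 4 * norm (Z w) ^ 4) + 2 * (t - s)\<^sup>2 * norm (\<zeta> w) ^ 4)"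
    by (rule integral_mono[OF D2i _ D2]) (use P4i \<zeta>4i in auto)
  also have "\<dots> = 2 * expectation (\<lambda>w. norm (\<zeta> w) ^ 4 * norm (Z w) ^ 4) + 2 * (t - s)\<^sup>2 * expectation (\<lambda>w. norm (\<zeta> w) ^ 4)"
    using P4i \<zeta>4i by simp
  also have "\<dots> \<le> (6 * (real CARD('d))\<^sup>2 + 2) * (t - s)\<^sup>2 * expectation (\<lambda>w. norm (\<zeta> w) ^ 4)"
    using P4E by (simp add: algebra_simps)
  also have "\<dots> \<le> (6 * (real CARD('d))\<^sup>2 + 2) * (t - s)\<^sup>2 * (J ^ 4 * expectation (\<lambda>w. V (path s w) ^ (4 * p)))"
    by (intro mult_left_mono \<zeta>4E) auto
  finally have D2E: "expectation (\<lambda>w. (norm (D w))\<^sup>2) \<le> (6 * (real CARD('d))\<^sup>2 + 2) * J ^ 4 * (t - s)\<^sup>2 * expectation (\<lambda>w. V (path s w) ^ (4 * p))"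
    by (simp add: mult_ac)
  define A where "A = (\<lambda>w. transpose (\<zeta> w) ** N w ** \<zeta> w)"
  have AG: "A \<in> borel_measurable (G s)" unfolding A_def using N(1) \<zeta>G by measurable
  have [measurable]: "A \<in> borel_measurable M" by (rule measurable_G[OF AG])
  have Ai: "integrable M A"
  proof (rule Bochner_Integration.integrable_bound[OF Bochner_Integration.integrable_add[OF \<zeta>4i N(2)]])
    have "norm (A w) \<le> norm (\<zeta> w) ^ 4 + (norm (N w))\<^sup>2" for w
    proof -
      have "norm (A w) \<le> norm (transpose (\<zeta> w) ** N w) * norm (\<zeta> w)"
        unfolding A_def by (rule norm_matrix_matrix_mult_le)
      also have "\<dots> \<le> (norm (\<zeta> w) * norm (N w)) * norm (\<zeta> w)"
        using norm_matrix_matrix_mult_le[of "transpose (\<zeta> w)" "N w"] by (intro mult_right_mono) (auto simp: norm_transpose)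
      also have "\<dots> = (norm (\<zeta> w))\<^sup>2 * norm (N w)" by (simp add: power2_eq_square)
      also have "\<dots> \<le> 2 * (norm (\<zeta> w))\<^sup>2 * norm (N w)" by simp
      also have "\<dots> \<le> ((norm (\<zeta> w))\<^sup>2)\<^sup>2 + (norm (N w))\<^sup>2" by (rule sum_squares_bound)
      finally show ?thesis by (simp add: power_mult[symmetric])
    qed
    then show "AE w in M. norm (A w) \<le> norm (norm (\<zeta> w) ^ 4 + (norm (N w))\<^sup>2)" by simp
  qed simp
  \<comment> \<open>Pairing with \<open>N\<close> turns the deviation into a quadratic form of the
    increment minus its mean, with the matrix \<open>A\<close> known at time
    \<open>s\<close>.\<close>
  have ND: "N w \<bullet> D w = Z w \<bullet> (A w *v Z w) - (t - s) * trace (A w)" for w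
  proof -
    have "(\<zeta> w *v Z w) \<bullet> (N w *v (\<zeta> w *v Z w)) = Z w \<bullet> (A w *v Z w)"
      using dot_lmul_matrix[of "N w *v (\<zeta> w *v Z w)" "\<zeta> w" "Z w"]
      by (simp add: A_def matrix_vector_mul_assoc[symmetric] transpose_matrix_vector inner_commute)
    then show ?thesis by (simp add: D_eq inner_diff_right inner_outer_square inner_matrix_square A_def)
  qed
  have trA: "integrable M (\<lambda>w. trace (A w))"
    unfolding trace_def by (intro Bochner_Integration.integrable_sum)
      (use Bochner_Integration.integrable_inner_left[OF Ai, of "axis _ (axis _ 1)"] in \<open>simp add: inner_axis\<close>)
  have NDi: "integrable M (\<lambda>w. N w \<bullet> D w)"
    unfolding ND Z_def by (intro Bochner_Integration.integrable_diff integrable_quadratic_increment[OF st AG Ai] integrable_mult_right trA)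
  have NDE: "expectation (\<lambda>w. N w \<bullet> D w) = 0"
    unfolding ND using integrable_quadratic_increment[OF st AG Ai] expectation_quadratic_increment[OF st AG Ai] trA
    by (simp add: Z_def)
  have eq: "(norm (N w + deviation s t w))\<^sup>2 = (norm (N w))\<^sup>2 + 2 * (N w \<bullet> D w) + (norm (D w))\<^sup>2" for w
    unfolding D_def[symmetric] by (simp add: power2_norm_eq_inner inner_add_left inner_add_right inner_commute)
  show "integrable M (\<lambda>w. (norm (N w + deviation s t w))\<^sup>2)" unfolding eq using N(2) NDi D2i by simp
  show "expectation (\<lambda>w. (norm (N w + deviation s t w))\<^sup>2)
      \<le> expectation (\<lambda>w. (norm (N w))\<^sup>2) + (6 * (real CARD('d))\<^sup>2 + 2) * J ^ 4 * (t - s)\<^sup>2 * expectation (\<lambda>w. V (path s w) ^ (4 * p))"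
    unfolding eq using N(2) NDi D2i NDE D2E by simp
qed

lemma grid_moment_integrable:
  assumes "0 < \<delta>" "\<delta> \<le> 1"
  shows "integrable M (\<lambda>w. V (path (real i * \<delta>) w) ^ k)"
proof (rule integrableI_nonneg)
  obtain C where C: "\<And>\<delta> m. 0 < \<delta> \<Longrightarrow> \<delta> \<le> 1 \<Longrightarrow>
    (\<Sum>i<m. ennreal \<delta> * (\<integral>\<^sup>+ w. ennreal (V (path (real i * \<delta>) w) ^ k) \<partial>M)) \<le> ennreal (C * (1 + real m * \<delta>))"
    using grid_moment by blast
  have "ennreal \<delta> * (\<integral>\<^sup>+ w. ennreal (V (path (real i * \<delta>) w) ^ k) \<partial>M)
    \<le> (\<Sum>i<Suc i. ennreal \<delta> * (\<integral>\<^sup>+ w. ennreal (V (path (real i * \<delta>) w) ^ k) \<partial>M))"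
    by (simp del: path_nonneg)
  also have "\<dots> < \<infinity>" using C[OF assms, of "Suc i"] by (rule le_less_trans) simp
  finally have "ennreal \<delta> * (\<integral>\<^sup>+ w. ennreal (V (path (real i * \<delta>) w) ^ k) \<partial>M) < \<infinity>" .
  then show "(\<integral>\<^sup>+ w. ennreal (V (path (real i * \<delta>) w) ^ k) \<partial>M) < \<infinity>"
    using assms by (auto simp: ennreal_mult_less_top simp del: path_nonneg)
qed (use V_pos in \<open>auto simp: less_imp_le simp del: path_nonneg\<close>)

lemma grid_moment_expectation:
  obtains C where "0 \<le> C" "\<And>\<delta> m. 0 < \<delta> \<Longrightarrow> \<delta> \<le> 1 \<Longrightarrow>
    (\<Sum>i<m. \<delta> * expectation (\<lambda>w. V (path (real i * \<delta>) w) ^ k)) \<le> C * (1 + real m * \<delta>)"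
proof -
  obtain C where C: "0 \<le> C" "\<And>\<delta> m. 0 < \<delta> \<Longrightarrow> \<delta> \<le> 1 \<Longrightarrow>
    (\<Sum>i<m. ennreal \<delta> * (\<integral>\<^sup>+ w. ennreal (V (path (real i * \<delta>) w) ^ k) \<partial>M)) \<le> ennreal (C * (1 + real m * \<delta>))"
    using grid_moment by blast
  show thesis
  proof (rule that[OF C(1)])
    fix \<delta> :: real and m :: nat assume \<delta>: "0 < \<delta>" "\<delta> \<le> 1"
    have eq: "(\<integral>\<^sup>+ w. ennreal (V (path (real i * \<delta>) w) ^ k) \<partial>M) = ennreal (expectation (\<lambda>w. V (path (real i * \<delta>) w) ^ k))" for i
      using grid_moment_integrable[OF \<delta>] V_pos by (intro nn_integral_eq_integral) (auto simp: less_imp_le simp del: path_nonneg)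
    have pos: "0 \<le> expectation (\<lambda>w. V (path (real i * \<delta>) w) ^ k)" for i
      using V_pos by (intro integral_nonneg_AE AE_I2) (auto simp: less_imp_le simp del: path_nonneg)
    have "ennreal (\<Sum>i<m. \<delta> * expectation (\<lambda>w. V (path (real i * \<delta>) w) ^ k)) \<le> ennreal (C * (1 + real m * \<delta>))"
      using C(2)[OF \<delta>, of m] \<delta> pos unfolding eq by (simp add: ennreal_mult sum_nonneg flip: sum_ennreal del: path_nonneg)
    then show "(\<Sum>i<m. \<delta> * expectation (\<lambda>w. V (path (real i * \<delta>) w) ^ k)) \<le> C * (1 + real m * \<delta>)"
      using C \<delta> by (subst (asm) ennreal_le_iff) auto
  qed
qed

text \<open>Each step contributes \<open>\<delta>\<^sup>2\<close> times a moment; one factor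
  \<open>\<delta>\<close> stays in front, the other makes the sum of moments one that is bounded by
  a multiple of 1 + T.\<close>

lemma deviation_sum:
  assumes \<delta>: "0 < \<delta>" "\<delta> \<le> 1"
  defines "D \<equiv> \<lambda>i. deviation (real i * \<delta>) (real (Suc i) * \<delta>)"
  shows "(\<lambda>w. \<Sum>i<k. D i w) \<in> borel_measurable (G (real k * \<delta>))" (is "?m k")
    and "integrable M (\<lambda>w. (norm (\<Sum>i<k. D i w))\<^sup>2)" (is "?i k")
    and "expectation (\<lambda>w. (norm (\<Sum>i<k. D i w))\<^sup>2)
      \<le> (6 * (real CARD('d))\<^sup>2 + 2) * J ^ 4 * \<delta> * (\<Sum>i<k. \<delta> * expectation (\<lambda>w. V (path (real i * \<delta>) w) ^ (4 * p)))" (is "?E k")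
proof -
  have "?m k \<and> ?i k \<and> ?E k"
  proof (induction k)
    case 0
    then show ?case by simp
  next
    case (Suc k)
    have len: "real (Suc k) * \<delta> - real k * \<delta> = \<delta>" by (simp add: algebra_simps)
    have st: "0 \<le> real k * \<delta>" "real k * \<delta> < real (Suc k) * \<delta>" using \<delta> len by (simp, linarith)
    note step = deviation_step[OF st conjunct1[OF Suc] _ grid_moment_integrable[OF \<delta>], unfolded len]
    have "?m (Suc k)"
      unfolding sum.lessThan_Suc D_def
      by (intro borel_measurable_add deviation_measurable_G measurable_G_mono[OF conjunct1[OF Suc, unfolded D_def]]) (use st in auto)
    moreover have "?i (Suc k)" using step(1) Suc by (simp only: sum.lessThan_Suc D_def)
    moreover have "?E (Suc k)"
    proof -
      have "expectation (\<lambda>w. (norm (\<Sum>i<Suc k. D i w))\<^sup>2) \<le> expectation (\<lambda>w. (norm (\<Sum>i<k. D i w))\<^sup>2)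
        + (6 * (real CARD('d))\<^sup>2 + 2) * J ^ 4 * \<delta>\<^sup>2 * expectation (\<lambda>w. V (path (real k * \<delta>) w) ^ (4 * p))"
        using step(2) Suc by (simp only: sum.lessThan_Suc D_def)
      also have "\<dots> \<le> (6 * (real CARD('d))\<^sup>2 + 2) * J ^ 4 * \<delta> * (\<Sum>i<k. \<delta> * expectation (\<lambda>w. V (path (real i * \<delta>) w) ^ (4 * p)))
        + (6 * (real CARD('d))\<^sup>2 + 2) * J ^ 4 * \<delta>\<^sup>2 * expectation (\<lambda>w. V (path (real k * \<delta>) w) ^ (4 * p))"
        using Suc by (intro add_right_mono) simp
      finally show ?thesis by (simp only: sum.lessThan_Suc power2_eq_square distrib_left mult_ac)
    qed
    ultimately show ?case by blast
  qed
  then show "?m k" "?i k" "?E k" by auto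
qed

lemma leading_moment:
  assumes st: "0 \<le> s" "s < t" and V: "integrable M (\<lambda>w. V (path s w) ^ (4 * p))"
  shows "(\<integral>\<^sup>+ w. sqnorm (leading s t w) \<partial>M)
    \<le> ennreal (J\<^sup>2 * real CARD('d) * ((t - s) * expectation (\<lambda>w. V (path s w) ^ (4 * p))))"
proof -
  have meas: "(\<lambda>w. V (path s w) ^ (4 * p)) \<in> borel_measurable (G s)"
    using path_measurable_G[OF order_refl st(1)] by measurable
  have g: "(\<lambda>z :: real ^ 'd. (norm z)\<^sup>2) \<in> borel_measurable borel" by measurable
  note I = integrable_increment_mult[OF st meas V g integrable_increment_norm2[OF st]]
    expectation_increment_mult[OF st meas V g integrable_increment_norm2[OF st]]
  have "(\<integral>\<^sup>+ w. sqnorm (leading s t w) \<partial>M)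
    \<le> (\<integral>\<^sup>+ w. ennreal (J\<^sup>2 * (V (path s w) ^ (4 * p) * (norm (W t w - W s w))\<^sup>2)) \<partial>M)"
  proof (intro nn_integral_mono ennreal_leI)
    fix w
    have "(norm (leading s t w))\<^sup>2 \<le> (norm (S (path s w)))\<^sup>2 * (norm (W t w - W s w))\<^sup>2"
      using power_mono[OF norm_matrix_vector_mult_le[of "S (path s w)" "W t w - W s w"], of 2] by (simp add: power_mult_distrib del: path_nonneg)
    also have "\<dots> \<le> J\<^sup>2 * V (path s w) ^ (4 * p) * (norm (W t w - W s w))\<^sup>2"
      by (intro mult_right_mono growth_squared) auto
    finally show "(norm (leading s t w))\<^sup>2 \<le> J\<^sup>2 * (V (path s w) ^ (4 * p) * (norm (W t w - W s w))\<^sup>2)" by (simp add: mult.assoc)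
  qed
  also have "\<dots> = ennreal (expectation (\<lambda>w. J\<^sup>2 * (V (path s w) ^ (4 * p) * (norm (W t w - W s w))\<^sup>2)))"
    using I(1) V_pos by (intro nn_integral_eq_integral integrable_mult_right) (auto simp: less_imp_le simp del: path_nonneg)
  also have "expectation (\<lambda>w. J\<^sup>2 * (V (path s w) ^ (4 * p) * (norm (W t w - W s w))\<^sup>2))
    = J\<^sup>2 * real CARD('d) * ((t - s) * expectation (\<lambda>w. V (path s w) ^ (4 * p)))"
    using I expectation_increment_norm2[OF st] by (simp add: mult_ac del: path_nonneg)
  finally show ?thesis .
qed

section \<open>Error of the realized quadratic variation\<close>

definition spot_sum :: "real \<Rightarrow> nat \<Rightarrow> 'w \<Rightarrow> real ^ 'd ^ 'd" where
  "spot_sum \<delta> m w = (\<Sum>i<m. \<delta> *\<^sub>R (S (path (real i * \<delta>) w) ** transpose (S (path (real i * \<delta>) w))))"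

definition quad_error :: "real \<Rightarrow> nat \<Rightarrow> 'w \<Rightarrow> real ^ 'd ^ 'd" where
  "quad_error \<delta> m w = quad_stat X \<delta> m w - spot_sum \<delta> m w"

text \<open>A pathwise inequality. Young's inequality with weights \<open>l\<close> and
  \<open>\<theta>\<close> converts the mixed terms and the norm of the martingale into squares, the
  quantities whose means are controlled.\<close>

lemma quadratic_variation_decomposition:
  fixes m :: nat
  assumes \<delta>: "0 < \<delta>" and l: "0 < l" and \<theta>: "0 < \<theta>"
  defines "z \<equiv> \<lambda>i w. leading (real i * \<delta>) (real (Suc i) * \<delta>) w"
    and "r \<equiv> \<lambda>i w. path (real (Suc i) * \<delta>) w - path (real i * \<delta>) w - leading (real i * \<delta>) (real (Suc i) * \<delta>) w"
    and "N \<equiv> \<lambda>w. \<Sum>i<m. deviation (real i * \<delta>) (real (Suc i) * \<delta>) w"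
  shows "norm (quad_error \<delta> m w)
    \<le> l * (\<Sum>i<m. (norm (z i w))\<^sup>2) + (1 + 1 / l) * (\<Sum>i<m. (norm (r i w))\<^sup>2) + (\<theta> / 2 + 1 / (2 * \<theta>) * (norm (N w))\<^sup>2)"
proof -
  have inc: "X (real (Suc i) * \<delta>) w - X (real i * \<delta>) w = z i w + r i w" for i
    using \<delta> by (simp add: z_def r_def)
  have len: "real (Suc i) * \<delta> - real i * \<delta> = \<delta>" for i by (simp add: algebra_simps)
  have "quad_error \<delta> m w = (\<Sum>i<m. outer_square (z i w + r i w) - outer_square (z i w)) + N w"
    unfolding quad_error_def spot_sum_def quad_stat_def inc N_def deviation_def len sum_subtractf z_def by simp
  also have "norm \<dots> \<le> (\<Sum>i<m. norm (outer_square (z i w + r i w) - outer_square (z i w))) + norm (N w)"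
    by (intro norm_triangle_mono norm_sum order_refl)
  also have "\<dots> \<le> (\<Sum>i<m. l * (norm (z i w))\<^sup>2 + (1 + 1 / l) * (norm (r i w))\<^sup>2) + (\<theta> / 2 + 1 / (2 * \<theta>) * (norm (N w))\<^sup>2)"
  proof (intro add_mono sum_mono)
    fix i
    have "0 \<le> (l * norm (z i w) - norm (r i w))\<^sup>2 / l" using l by simp
    also have "\<dots> = l * (norm (z i w))\<^sup>2 + 1 / l * (norm (r i w))\<^sup>2 - 2 * norm (z i w) * norm (r i w)"
      using l by (simp add: power2_eq_square field_simps)
    finally have "2 * norm (z i w) * norm (r i w) \<le> l * (norm (z i w))\<^sup>2 + 1 / l * (norm (r i w))\<^sup>2" by simp
    then show "norm (outer_square (z i w + r i w) - outer_square (z i w)) \<le> l * (norm (z i w))\<^sup>2 + (1 + 1 / l) * (norm (r i w))\<^sup>2"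
      using norm_outer_square_add_diff_le[of "z i w" "r i w"] by (simp add: distrib_right)
  next
    have "0 \<le> (\<theta> - norm (N w))\<^sup>2 / (2 * \<theta>)" using \<theta> by simp
    also have "\<dots> = \<theta> / 2 + 1 / (2 * \<theta>) * (norm (N w))\<^sup>2 - norm (N w)"
      using \<theta> by (simp add: power2_eq_square field_simps)
    finally show "norm (N w) \<le> \<theta> / 2 + 1 / (2 * \<theta>) * (norm (N w))\<^sup>2" by simp
  qed
  finally show ?thesis by (simp add: sum.distrib sum_distrib_left)
qed

lemma quadratic_variation:
  assumes \<epsilon>: "0 < \<epsilon>"
  obtains \<delta>\<^sub>0 where "0 < \<delta>\<^sub>0" "\<delta>\<^sub>0 \<le> 1" "\<And>\<delta> m. 0 < \<delta> \<Longrightarrow> \<delta> \<le> \<delta>\<^sub>0 \<Longrightarrow>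
    (\<integral>\<^sup>+ w. ennreal (norm (quad_error \<delta> m w)) \<partial>M)
    \<le> ennreal (\<epsilon> * (1 + real m * \<delta>))"
proof -
  obtain B where B: "0 \<le> B" "\<And>\<delta> m. 0 < \<delta> \<Longrightarrow> \<delta> \<le> 1 \<Longrightarrow>
    (\<Sum>i<m. \<delta> * expectation (\<lambda>w. V (path (real i * \<delta>) w) ^ (4 * p))) \<le> B * (1 + real m * \<delta>)"
    using grid_moment_expectation by blast
  define K1 where "K1 = J\<^sup>2 * real CARD('d)"
  define K2 where "K2 = (6 * (real CARD('d))\<^sup>2 + 2) * J ^ 4"
  have K: "0 \<le> K1 * B" "0 \<le> K2 * B" "0 \<le> K1" "0 \<le> K2" using B J_nonneg by (auto simp: K1_def K2_def)
  \<comment> \<open>Each of the four parts of the error gets \<open>\<epsilon> / 4\<close> times 1 +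
    T; this is the share of the leading terms.\<close>
  define l where "l = \<epsilon> / (4 * (K1 * B + 1))"
  have l: "0 < l" "l * (K1 * B) \<le> \<epsilon> / 4"
  proof -
    show "0 < l" using \<epsilon> K by (simp add: l_def)
    then have "l * (K1 * B) \<le> l * (K1 * B + 1)" by simp
    also have "\<dots> = \<epsilon> / 4" using K by (simp add: l_def field_simps)
    finally show "l * (K1 * B) \<le> \<epsilon> / 4" .
  qed
  \<comment> \<open>Fixed after \<open>l\<close>, because the squared remainders are multiplied by
    \<open>1 + 1 / l\<close>.\<close>
  define e where "e = \<epsilon> / (4 * (1 + 1 / l))"
  have e: "0 < e" "(1 + 1 / l) * e = \<epsilon> / 4"
  proof -
    have l': "0 < 1 + 1 / l" using l by (simp add: add_pos_pos)
    show "0 < e" using \<epsilon> l' by (simp add: e_def)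
    have "w * (\<epsilon> / (4 * w)) = \<epsilon> / 4" if "0 < w" for w :: real using that by simp
    from this[OF l'] show "(1 + 1 / l) * e = \<epsilon> / 4" unfolding e_def .
  qed
  obtain \<delta>\<^sub>1 where \<delta>\<^sub>1: "0 < \<delta>\<^sub>1" "\<delta>\<^sub>1 \<le> 1" "\<And>\<delta> m. 0 < \<delta> \<Longrightarrow> \<delta> \<le> \<delta>\<^sub>1 \<Longrightarrow>
    (\<Sum>i<m. \<integral>\<^sup>+ w. sqnorm (path (real (Suc i) * \<delta>) w - path (real i * \<delta>) w - leading (real i * \<delta>) (real (Suc i) * \<delta>) w) \<partial>M)
    \<le> ennreal (e * (1 + real m * \<delta>))"
    using leading_remainder_sum[OF e(1)] by blast
  define \<delta>\<^sub>0 where "\<delta>\<^sub>0 = min \<delta>\<^sub>1 (\<epsilon>\<^sup>2 / (4 * (K2 * B + 1)))"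
  show thesis
  proof (rule that[of \<delta>\<^sub>0])
    show "0 < \<delta>\<^sub>0" "\<delta>\<^sub>0 \<le> 1" using \<epsilon> K \<delta>\<^sub>1 by (auto simp: \<delta>\<^sub>0_def)
    fix \<delta> :: real and m :: nat assume \<delta>: "0 < \<delta>" "\<delta> \<le> \<delta>\<^sub>0"
    have \<delta>1: "\<delta> \<le> \<delta>\<^sub>1" "\<delta> \<le> 1" using \<delta> \<delta>\<^sub>1 by (auto simp: \<delta>\<^sub>0_def)
    have \<delta>K: "\<delta> * (K2 * B) \<le> \<epsilon>\<^sup>2 / 4"
    proof -
      have "\<delta> * (K2 * B) \<le> \<epsilon>\<^sup>2 / (4 * (K2 * B + 1)) * (K2 * B + 1)" using \<delta> K by (intro mult_mono) (auto simp: \<delta>\<^sub>0_def)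
      also have "\<dots> = \<epsilon>\<^sup>2 / 4" using K by (simp add: field_simps)
      finally show ?thesis .
    qed
    let ?T = "real m * \<delta>"
    let ?z = "\<lambda>i w. leading (real i * \<delta>) (real (Suc i) * \<delta>) w"
    let ?r = "\<lambda>i w. path (real (Suc i) * \<delta>) w - path (real i * \<delta>) w - leading (real i * \<delta>) (real (Suc i) * \<delta>) w"
    define N where "N = (\<lambda>w. \<Sum>i<m. deviation (real i * \<delta>) (real (Suc i) * \<delta>) w)"
    define v where "v = (\<Sum>i<m. \<delta> * expectation (\<lambda>w. V (path (real i * \<delta>) w) ^ (4 * p)))"
    \<comment> \<open>Proportional to 1 + T, so that \<open>\<theta> / 2\<close> is a quarter of the
      budget; the second moment of \<open>N\<close> is of order \<open>\<delta>\<close> times 1 + T,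
      and division by \<open>\<theta>\<close> leaves order \<open>\<delta>\<close>.\<close>
    define \<theta> where "\<theta> = \<epsilon> * (1 + ?T) / 2"
    have T: "0 \<le> ?T" using \<delta> by simp
    have \<theta>: "0 < \<theta>" using \<epsilon> T by (simp add: \<theta>_def)
    have v: "v \<le> B * (1 + ?T)" unfolding v_def by (rule B(2)[OF \<delta>(1) \<delta>1(2)])
    have W_grid [measurable]: "W (real i * \<delta>) \<in> borel_measurable M" for i using \<delta> by (intro W_measurable) simp
    have [measurable]: "N \<in> borel_measurable M"
      unfolding N_def by (rule measurable_G[OF deviation_sum(1)[OF \<delta>(1) \<delta>1(2)]])
    have "(\<integral>\<^sup>+ w. ennreal (norm (quad_error \<delta> m w)) \<partial>M)
      \<le> (\<integral>\<^sup>+ w. ennreal l * (\<Sum>i<m. sqnorm (?z i w)) + ennreal (1 + 1 / l) * (\<Sum>i<m. sqnorm (?r i w))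
        + (ennreal (\<theta> / 2) + ennreal (1 / (2 * \<theta>)) * sqnorm (N w)) \<partial>M)"
    proof (intro nn_integral_mono order_trans[OF ennreal_leI[OF quadratic_variation_decomposition[OF \<delta>(1) l(1) \<theta>]]])
      fix w
      have "0 \<le> 1 + 1 / l" using l by simp
      then show "ennreal (l * (\<Sum>i<m. (norm (?z i w))\<^sup>2) + (1 + 1 / l) * (\<Sum>i<m. (norm (?r i w))\<^sup>2)
          + (\<theta> / 2 + 1 / (2 * \<theta>) * (norm (\<Sum>i<m. deviation (real i * \<delta>) (real (Suc i) * \<delta>) w))\<^sup>2))
        \<le> ennreal l * (\<Sum>i<m. sqnorm (?z i w)) + ennreal (1 + 1 / l) * (\<Sum>i<m. sqnorm (?r i w))
        + (ennreal (\<theta> / 2) + ennreal (1 / (2 * \<theta>)) * sqnorm (N w))"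
        using l(1) \<theta> unfolding N_def
        by (simp only: ennreal_plus ennreal_mult sum_ennreal sum_nonneg zero_le_power2 mult_nonneg_nonneg less_imp_le add_nonneg_nonneg
            zero_le_divide_1_iff zero_le_divide_iff zero_le_numeral order_refl simp_thms)
    qed
    also have "\<dots> = ennreal l * (\<Sum>i<m. \<integral>\<^sup>+ w. sqnorm (?z i w) \<partial>M) + ennreal (1 + 1 / l) * (\<Sum>i<m. \<integral>\<^sup>+ w. sqnorm (?r i w) \<partial>M)
        + (ennreal (\<theta> / 2) + ennreal (1 / (2 * \<theta>)) * (\<integral>\<^sup>+ w. sqnorm (N w) \<partial>M))"
      by (simp add: nn_integral_add nn_integral_cmult nn_integral_sum emeasure_space_1 del: path_nonneg of_nat_Suc sum_ennreal)
    also have "\<dots> \<le> ennreal l * ennreal (K1 * (B * (1 + ?T))) + ennreal (1 + 1 / l) * ennreal (e * (1 + ?T))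
        + (ennreal (\<theta> / 2) + ennreal (1 / (2 * \<theta>)) * ennreal (K2 * \<delta> * (B * (1 + ?T))))"
    proof (intro add_mono mult_left_mono \<delta>\<^sub>1(3)[OF \<delta>(1) \<delta>1(1)] order_refl)
      have "(\<Sum>i<m. \<integral>\<^sup>+ w. sqnorm (?z i w) \<partial>M) \<le> (\<Sum>i<m. ennreal (K1 * (\<delta> * expectation (\<lambda>w. V (path (real i * \<delta>) w) ^ (4 * p)))))"
      proof (rule sum_mono)
        fix i
        have len: "real (Suc i) * \<delta> - real i * \<delta> = \<delta>" by (simp add: algebra_simps)
        have "0 \<le> real i * \<delta>" "real i * \<delta> < real (Suc i) * \<delta>" using \<delta> len by (simp, linarith)
        from leading_moment[OF this grid_moment_integrable[OF \<delta>(1) \<delta>1(2)]]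
        show "(\<integral>\<^sup>+ w. sqnorm (?z i w) \<partial>M) \<le> ennreal (K1 * (\<delta> * expectation (\<lambda>w. V (path (real i * \<delta>) w) ^ (4 * p))))"
          unfolding len K1_def .
      qed
      also have "\<dots> = ennreal (K1 * v)"
      proof -
        have "0 \<le> expectation (\<lambda>w. V (path (real i * \<delta>) w) ^ (4 * p))" for i
          using V_pos by (intro integral_nonneg_AE AE_I2) (auto simp: less_imp_le simp del: path_nonneg)
        then show ?thesis unfolding v_def sum_distrib_left using K \<delta> by (intro sum_ennreal) auto
      qed
      also have "\<dots> \<le> ennreal (K1 * (B * (1 + ?T)))" using K v by (intro ennreal_leI mult_left_mono)
      finally show "(\<Sum>i<m. \<integral>\<^sup>+ w. sqnorm (?z i w) \<partial>M) \<le> ennreal (K1 * (B * (1 + ?T)))" .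
    next
      have "(\<integral>\<^sup>+ w. sqnorm (N w) \<partial>M) = ennreal (expectation (\<lambda>w. (norm (N w))\<^sup>2))"
        unfolding N_def using deviation_sum(2)[OF \<delta>(1) \<delta>1(2)] by (intro nn_integral_eq_integral) auto
      also have "\<dots> \<le> ennreal (K2 * \<delta> * v)"
        unfolding N_def v_def K2_def by (intro ennreal_leI deviation_sum(3)[OF \<delta>(1) \<delta>1(2)])
      also have "\<dots> \<le> ennreal (K2 * \<delta> * (B * (1 + ?T)))" using K v \<delta> by (intro ennreal_leI mult_left_mono) auto
      finally show "(\<integral>\<^sup>+ w. sqnorm (N w) \<partial>M) \<le> ennreal (K2 * \<delta> * (B * (1 + ?T)))" .
    qed auto
    also have "\<dots> = ennreal (l * (K1 * B) * (1 + ?T) + (1 + 1 / l) * e * (1 + ?T) + (\<theta> / 2 + 1 / (2 * \<theta>) * (K2 * \<delta> * (B * (1 + ?T)))))"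
    proof -
      have "0 \<le> 1 + 1 / l" using l by simp
      then show ?thesis
        using l(1) \<theta> K B(1) \<delta>(1) T e(1) by (simp add: mult.assoc flip: ennreal_mult ennreal_plus)
    qed
    also have "\<dots> \<le> ennreal (\<epsilon> * (1 + ?T))"
    proof (rule ennreal_leI)
      have "1 / (2 * \<theta>) * (K2 * \<delta> * (B * (1 + ?T))) = \<delta> * (K2 * B) / \<epsilon>"
      proof -
        have "1 / (2 * (\<epsilon> * u / 2)) * (K2 * \<delta> * (B * u)) = \<delta> * (K2 * B) / \<epsilon>" if "0 < u" for u
          using that \<epsilon> by (simp add: field_simps)
        then show ?thesis unfolding \<theta>_def using T by simp
      qed
      also have "\<dots> \<le> \<epsilon>\<^sup>2 / 4 / \<epsilon>" using \<delta>K \<epsilon> by (intro divide_right_mono) auto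
      also have "\<dots> = \<epsilon> / 4" by (simp add: power2_eq_square)
      also have "\<dots> \<le> \<epsilon> / 4 * (1 + ?T)" using \<epsilon> T by (simp add: distrib_left)
      finally have "1 / (2 * \<theta>) * (K2 * \<delta> * (B * (1 + ?T))) \<le> \<epsilon> / 4 * (1 + ?T)" .
      moreover have "l * (K1 * B) * (1 + ?T) \<le> \<epsilon> / 4 * (1 + ?T)" using l T by (intro mult_right_mono) auto
      ultimately show "l * (K1 * B) * (1 + ?T) + (1 + 1 / l) * e * (1 + ?T) + (\<theta> / 2 + 1 / (2 * \<theta>) * (K2 * \<delta> * (B * (1 + ?T)))) \<le> \<epsilon> * (1 + ?T)"
        unfolding e(2) \<theta>_def by linarith
    qed
    finally show "(\<integral>\<^sup>+ w. ennreal (norm (quad_error \<delta> m w)) \<partial>M)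
      \<le> ennreal (\<epsilon> * (1 + ?T))" .
  qed
qed

end

section \<open>Consistency of the estimators\<close>

lemma matrix_vector_mult_sum_left: "(\<Sum>i\<in>A. f i) *v v = (\<Sum>i\<in>A. f i *v v)"
  by (induction A rule: infinite_finite_induct) (simp_all add: matrix_vector_mult_add_rdistrib)

lemma scaled_sum_quadratic_form:
  fixes f :: "nat \<Rightarrow> real ^ 'k ^ 'k"
  shows "v \<bullet> ((\<Sum>i<m. \<delta> *\<^sub>R f i) *v v) = (\<Sum>i<m. \<delta> * (v \<bullet> (f i *v v)))"
  by (simp add: matrix_vector_mult_sum_left inner_sum_right scaleR_matrix_vector_assoc[symmetric])

lemma matrix_mult_sum_left: "(\<Sum>i\<in>A. f i) ** B = (\<Sum>i\<in>A. f i ** B)"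
  by (induction A rule: infinite_finite_induct) (simp_all add: matrix_matrix_mult_def vec_eq_iff distrib_right sum.distrib)

lemma continuous_on_matrix_mult:
  fixes A :: "'a::topological_space \<Rightarrow> real ^ 'n ^ 'm" and B :: "'a \<Rightarrow> real ^ 'k ^ 'n"
  assumes "continuous_on U A" "continuous_on U B"
  shows "continuous_on U (\<lambda>x. A x ** B x)"
  unfolding matrix_matrix_mult_def by (intro continuous_on_vec_lambda continuous_intros assms)

lemma continuous_on_transpose:
  fixes A :: "'a::topological_space \<Rightarrow> real ^ 'n ^ 'm"
  assumes "continuous_on U A"
  shows "continuous_on U (\<lambda>x. transpose (A x))"
  unfolding transpose_def by (intro continuous_on_vec_lambda continuous_intros assms)

lemma continuous_on_kronecker:
  fixes A :: "'a::topological_space \<Rightarrow> real ^ 'd ^ 'd"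
  assumes "continuous_on U A"
  shows "continuous_on U (\<lambda>x. kronecker (A x) (A x))"
  unfolding kronecker_def by (intro continuous_on_vec_lambda continuous_intros assms)

lemma norm_vec_mat: "norm (vec_mat A) = norm A"
proof -
  have "(norm (vec_mat A))\<^sup>2 = (\<Sum>q\<in>UNIV. (A $ snd q $ fst q)\<^sup>2)"
    by (simp add: vec_mat_def norm_vec_def L2_set_def sum_nonneg)
  also have "\<dots> = (\<Sum>j\<in>UNIV. \<Sum>i\<in>UNIV. (A $ i $ j)\<^sup>2)"
    by (simp add: sum.cartesian_product UNIV_Times_UNIV[symmetric] split_def del: UNIV_Times_UNIV)
  also have "\<dots> = (norm A)\<^sup>2" unfolding norm_matrix_squared by (rule sum.swap)
  finally show ?thesis by simp
qed

lemma norm_unvec_mat: "norm (unvec_mat v) = norm v"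
  using norm_vec_mat[of "unvec_mat v"] by simp

lemma vec_mat_linear: "linear vec_mat"
  by (rule linearI) (simp_all add: vec_mat_def vec_eq_iff)

lemma unvec_mat_diff: "unvec_mat (v - w) = unvec_mat v - unvec_mat w"
  by (simp add: unvec_mat_def vec_eq_iff)

text \<open>Up to the end point, a null set, the integrand is a step function. As \<open>f\<close>
  is arbitrary, measurability too is taken from the representation by finitely many values, with the
  end point included.\<close>

lemma integral_grid_floor:
  fixes f :: "real \<Rightarrow> 'b::{banach, second_countable_topology}"
  assumes \<delta>: "0 < \<delta>"
  shows "(LINT s:{0..real m * \<delta>}|lborel. f (grid_floor \<delta> s)) = (\<Sum>i<m. \<delta> *\<^sub>R f (real i * \<delta>))"
proof -
  let ?A = "\<lambda>i. {real i * \<delta>..<real (Suc i) * \<delta>}"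
  have len: "real (Suc i) * \<delta> - real i * \<delta> = \<delta>" for i by (simp add: algebra_simps)
  have grid: "grid_floor \<delta> s = real i * \<delta>" if "s \<in> ?A i" for i s
  proof -
    have "\<lfloor>s / \<delta>\<rfloor> = int i" using that \<delta> by (intro floor_unique) (auto simp: field_simps)
    then show ?thesis by (simp add: grid_floor_def)
  qed
  have eq: "indicator {0..<real k * \<delta>} s *\<^sub>R f (grid_floor \<delta> s) = (\<Sum>i<k. indicator (?A i) s *\<^sub>R f (real i * \<delta>))" for k s
  proof (induction k)
    case (Suc k)
    have "0 \<le> real k * \<delta>" "real k * \<delta> < real (Suc k) * \<delta>" using \<delta> len[of k] by (simp, linarith)
    then have "indicator {0..<real (Suc k) * \<delta>} s = indicator {0..<real k * \<delta>} s + (indicator (?A k) s :: real)"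
      by (auto simp: indicator_def)
    then have "indicator {0..<real (Suc k) * \<delta>} s *\<^sub>R f (grid_floor \<delta> s)
      = indicator {0..<real k * \<delta>} s *\<^sub>R f (grid_floor \<delta> s) + indicator (?A k) s *\<^sub>R f (grid_floor \<delta> s)"
      by (simp only: scaleR_add_left)
    also have "indicator (?A k) s *\<^sub>R f (grid_floor \<delta> s) = indicator (?A k) s *\<^sub>R f (real k * \<delta>)"
      using grid[of s k] by (cases "s \<in> ?A k") auto
    finally show ?case using Suc by simp
  qed simp
  have "(LINT s:{0..real m * \<delta>}|lborel. f (grid_floor \<delta> s)) = (LINT s|lborel. (\<Sum>i<m. indicator (?A i) s *\<^sub>R f (real i * \<delta>)))"
    unfolding set_lebesgue_integral_def
  proof (rule integral_cong_AE)
    show "AE s in lborel. indicator {0..real m * \<delta>} s *\<^sub>R f (grid_floor \<delta> s) = (\<Sum>i<m. indicator (?A i) s *\<^sub>R f (real i * \<delta>))"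
      unfolding eq[symmetric] using AE_lborel_singleton[of "real m * \<delta>"]
      by eventually_elim (auto simp: indicator_def)
    have "(\<lambda>s. indicator {0..real m * \<delta>} s *\<^sub>R f (grid_floor \<delta> s))
      = (\<lambda>s. (\<Sum>i<m. indicator (?A i) s *\<^sub>R f (real i * \<delta>)) + indicator {real m * \<delta>} s *\<^sub>R f (real m * \<delta>))"
    proof (rule ext)
      fix s
      have "grid_floor \<delta> (real m * \<delta>) = real m * \<delta>" using grid[of "real m * \<delta>" m] len[of m] \<delta> by auto
      then show "indicator {0..real m * \<delta>} s *\<^sub>R f (grid_floor \<delta> s)
        = (\<Sum>i<m. indicator (?A i) s *\<^sub>R f (real i * \<delta>)) + indicator {real m * \<delta>} s *\<^sub>R f (real m * \<delta>)"
        unfolding eq[symmetric] using \<delta> by (auto simp: indicator_def)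
    qed
    then show "(\<lambda>s. indicator {0..real m * \<delta>} s *\<^sub>R f (grid_floor \<delta> s)) \<in> borel_measurable lborel"
      by (simp only:) measurable
  qed measurable
  also have "\<dots> = (\<Sum>i<m. LINT s|lborel. indicator (?A i) s *\<^sub>R f (real i * \<delta>))"
  proof (rule Bochner_Integration.integral_sum)
    fix i
    have "real i * \<delta> \<le> real (Suc i) * \<delta>" using \<delta> by (intro mult_right_mono) auto
    then show "integrable lborel (\<lambda>s. indicator (?A i) s *\<^sub>R f (real i * \<delta>))"
      by (intro integrable_scaleR_left integrable_real_indicator) auto
  qed
  also have "\<dots> = (\<Sum>i<m. \<delta> *\<^sub>R f (real i * \<delta>))"
    by (intro sum.cong refl) (use \<delta> len in \<open>simp del: of_nat_Suc\<close>)
  finally show ?thesis .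
qed

context lyapunov_function_data
begin

text \<open>By Markov's inequality for the empirical measure, at least half of the points lie in the compact
  set \<open>{V \<le> R}\<close>.\<close>

lemma sampled_sum_coercive:
  fixes F :: "real ^ 'd \<Rightarrow> real ^ 'k ^ 'k"
  assumes F: "continuous_on UNIV F" "\<And>x v. v \<noteq> 0 \<Longrightarrow> 0 < v \<bullet> (F x *v v)" and R: "0 < R"
  obtains l where "0 < l" "\<And>\<delta> m (x :: nat \<Rightarrow> real ^ 'd) v. 0 < \<delta> \<Longrightarrow> (\<Sum>i<m. \<delta> * V (x i)) \<le> R * (real m * \<delta>) / 2 \<Longrightarrow>
    l * (real m * \<delta>) * (norm v)\<^sup>2 \<le> v \<bullet> ((\<Sum>i<m. \<delta> *\<^sub>R F (x i)) *v v)"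
proof -
  obtain l where l: "0 < l" "\<And>x v. x \<in> {x. V x \<le> R} \<Longrightarrow> l * (norm v)\<^sup>2 \<le> v \<bullet> (F x *v v)"
    using uniformly_posdef_on_compact[OF V_compact[of R] continuous_on_subset[OF F(1)]] F(2) by (metis subset_UNIV)
  show thesis
  proof (rule that[of "l / 2"])
    show "0 < l / 2" using l by simp
    fix \<delta> :: real and m and x :: "nat \<Rightarrow> real ^ 'd" and v
    assume \<delta>: "0 < \<delta>" and le: "(\<Sum>i<m. \<delta> * V (x i)) \<le> R * (real m * \<delta>) / 2"
    have F0: "0 \<le> v \<bullet> (F y *v v)" for y using F(2)[of v y] by (cases "v = 0") auto
    have "l / 2 * (real m * \<delta>) * (norm v)\<^sup>2 = l * (norm v)\<^sup>2 / R * (R * (real m * \<delta>) / 2)" using R by (simp add: field_simps)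
    also have "\<dots> \<le> l * (norm v)\<^sup>2 / R * (R * (real m * \<delta>) - (\<Sum>i<m. \<delta> * V (x i)))"
      using l(1) R le by (intro mult_left_mono) (auto simp: mult_ac)
    also have "\<dots> = (\<Sum>i<m. \<delta> * (l * (norm v)\<^sup>2 / R * (R - V (x i))))"
    proof -
      have "(\<Sum>i<m. \<delta> * (c * (R - V (x i)))) = (\<Sum>i<m. c * (R * \<delta> - \<delta> * V (x i)))" for c
        by (intro sum.cong refl) (simp add: algebra_simps)
      also have "(\<Sum>i<m. c * (R * \<delta> - \<delta> * V (x i))) = c * (\<Sum>i<m. R * \<delta> - \<delta> * V (x i))" for c
        by (rule sum_distrib_left[symmetric])
      also have "(\<Sum>i<m. R * \<delta> - \<delta> * V (x i)) = R * (real m * \<delta>) - (\<Sum>i<m. \<delta> * V (x i))"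
        unfolding sum_subtractf by (simp add: mult_ac)
      finally show ?thesis by (rule sym)
    qed
    \<comment> \<open>Instead of counting points, an affine function of \<open>V\<close> is placed
      below the form: where \<open>V\<close> is at most \<open>R\<close> it is at most
      \<open>l * (norm v)\<^sup>2\<close>, elsewhere it is at most 0 while the form is
      non-negative.\<close>
    also have "\<dots> \<le> (\<Sum>i<m. \<delta> * (v \<bullet> (F (x i) *v v)))"
    proof (intro sum_mono mult_left_mono)
      fix i
      show "l * (norm v)\<^sup>2 / R * (R - V (x i)) \<le> v \<bullet> (F (x i) *v v)"
      proof (cases "V (x i) \<le> R")
        case True
        have "l * (norm v)\<^sup>2 / R * (R - V (x i)) \<le> l * (norm v)\<^sup>2 / R * R"
          using l(1) R V_pos[of "x i"] by (intro mult_left_mono) auto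
        also have "\<dots> \<le> v \<bullet> (F (x i) *v v)" using l(2)[of "x i" v] True R by simp
        finally show ?thesis .
      next
        case False
        then have "l * (norm v)\<^sup>2 / R * (R - V (x i)) \<le> 0" using l(1) R by (intro mult_nonneg_nonpos) auto
        then show ?thesis using F0[of "x i"] by linarith
      qed
    qed (use \<delta> in simp)
    finally show "l / 2 * (real m * \<delta>) * (norm v)\<^sup>2 \<le> v \<bullet> ((\<Sum>i<m. \<delta> *\<^sub>R F (x i)) *v v)"
      unfolding scaled_sum_quadratic_form .
  qed
qed

end

section \<open>Consistency in terms of step length and number of observations\<close>

context lyapunov_diffusion
begin

lemma Markov_norm:
  fixes f :: "'w \<Rightarrow> 'b::euclidean_space"
  assumes [measurable]: "f \<in> borel_measurable M" and f: "(\<integral>\<^sup>+ w. ennreal (norm (f w)) \<partial>M) \<le> ennreal K" and c: "0 < c" and K: "0 \<le> K"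
  shows "prob {w \<in> space M. c < norm (f w)} \<le> K / c"
proof -
  have "emeasure M {w \<in> space M. c < norm (f w)} \<le> emeasure M {w \<in> space M. 1 \<le> ennreal (1 / c) * ennreal (norm (f w))}"
  proof (intro emeasure_mono subsetI)
    fix w assume "w \<in> {w \<in> space M. c < norm (f w)}"
    moreover then have "ennreal 1 \<le> ennreal (1 / c * norm (f w))" using c by (intro ennreal_leI) simp
    ultimately show "w \<in> {w \<in> space M. 1 \<le> ennreal (1 / c) * ennreal (norm (f w))}"
      using c by (simp flip: ennreal_mult)
  qed measurable
  also have "\<dots> \<le> ennreal (1 / c) * (\<integral>\<^sup>+ w. ennreal (norm (f w)) * indicator (space M) w \<partial>M)"
    by (rule nn_integral_Markov_inequality) measurable
  also have "(\<integral>\<^sup>+ w. ennreal (norm (f w)) * indicator (space M) w \<partial>M) = (\<integral>\<^sup>+ w. ennreal (norm (f w)) \<partial>M)"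
    by (intro nn_integral_cong) simp
  also have "ennreal (1 / c) * \<dots> \<le> ennreal (1 / c) * ennreal K" by (intro mult_left_mono f) simp
  also have "\<dots> = ennreal (K / c)" using c K by (simp flip: ennreal_mult)
  finally show ?thesis using c K by (simp add: emeasure_eq_measure)
qed

text \<open>Step and number of observations are independent parameters here, the observation length
  \<open>real m * \<delta>\<close> being at least 1, and the bound is uniform in that length. The
  link to \<epsilon> is made only at the end.\<close>

definition consistent :: "(real \<Rightarrow> nat \<Rightarrow> 'w \<Rightarrow> 'b::metric_space) \<Rightarrow> 'b \<Rightarrow> bool" where
  "consistent E e \<longleftrightarrow> (\<forall>\<delta> m. 0 < \<delta> \<longrightarrow> 0 < m \<longrightarrow> E \<delta> m \<in> borel_measurable M) \<and>
    (\<forall>\<eta>>0. \<forall>\<rho>>0. \<exists>\<delta>\<^sub>0>0. \<forall>\<delta> m. 0 < \<delta> \<longrightarrow> \<delta> \<le> \<delta>\<^sub>0 \<longrightarrow> 1 \<le> real m * \<delta> \<longrightarrow>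
      prob {w \<in> space M. \<eta> < dist (E \<delta> m w) e} \<le> \<rho>)"

text \<open>The common core of both forms: \<open>F\<close> is the matrix field whose sampled sum
  gets inverted, and the last premise says that the estimator misses the parameter only by
  \<open>quad_error\<close> divided by the coercivity constant. Two bad events, a large average of
  \<open>V\<close> and a large \<open>quad_error\<close>, receive half of \<open>\<rho>\<close>
  each.\<close>

lemma consistentI:
  fixes F :: "real ^ 'd \<Rightarrow> real ^ 'k ^ 'k" and E :: "real \<Rightarrow> nat \<Rightarrow> 'w \<Rightarrow> 'b::euclidean_space"
  assumes F: "continuous_on UNIV F" "\<And>x v. v \<noteq> 0 \<Longrightarrow> 0 < v \<bullet> (F x *v v)"
    and m: "\<And>\<delta> m. 0 < \<delta> \<Longrightarrow> 0 < m \<Longrightarrow>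
      (\<And>w. invertible (\<Sum>i<m. \<delta> *\<^sub>R F (path (real i * \<delta>) w))) \<Longrightarrow> E \<delta> m \<in> borel_measurable M"
    and E: "\<And>l \<delta> m w. 0 < l \<Longrightarrow> 0 < \<delta> \<Longrightarrow> 0 < m \<Longrightarrow> w \<in> space M \<Longrightarrow>
      (\<And>v. l * (norm v)\<^sup>2 \<le> v \<bullet> ((\<Sum>i<m. \<delta> *\<^sub>R F (path (real i * \<delta>) w)) *v v)) \<Longrightarrow>
      dist (E \<delta> m w) e \<le> norm (quad_error \<delta> m w) / l"
  shows "consistent E e"
  unfolding consistent_def
proof (intro conjI allI impI)
  fix \<delta> :: real and m :: nat assume \<delta>: "0 < \<delta>" "0 < m"
  show "E \<delta> m \<in> borel_measurable M"
  proof (rule m[OF \<delta> posdef_invertible])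
    fix w and v :: "real ^ 'k" assume "v \<noteq> 0"
    then show "0 < v \<bullet> ((\<Sum>i<m. \<delta> *\<^sub>R F (path (real i * \<delta>) w)) *v v)"
      unfolding scaled_sum_quadratic_form using \<delta> F(2) by (intro sum_pos) (auto simp del: path_nonneg)
  qed
next
  fix \<eta> \<rho> :: real assume \<eta>: "0 < \<eta>" and \<rho>: "0 < \<rho>"
  obtain C where C: "0 \<le> C" "\<And>\<delta> m. 0 < \<delta> \<Longrightarrow> \<delta> \<le> 1 \<Longrightarrow>
    (\<Sum>i<m. ennreal \<delta> * (\<integral>\<^sup>+ w. ennreal (V (path (real i * \<delta>) w) ^ 1) \<partial>M)) \<le> ennreal (C * (1 + real m * \<delta>))"
    using grid_moment[of 1] by blast
  \<comment> \<open>Markov's inequality for the average of \<open>V\<close> exceeding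
    \<open>R / 2\<close> gives \<open>4 * C / R\<close> once 1 + T is replaced by 2 T; this
    \<open>R\<close> makes it at most \<open>\<rho> / 2\<close>.\<close>
  define R where "R = 8 * (C + 1) / \<rho>"
  have R: "0 < R" using C \<rho> by (simp add: R_def)
  obtain l where l: "0 < l" "\<And>\<delta> m (x :: nat \<Rightarrow> real ^ 'd) v. 0 < \<delta> \<Longrightarrow> (\<Sum>i<m. \<delta> * V (x i)) \<le> R * (real m * \<delta>) / 2 \<Longrightarrow>
    l * (real m * \<delta>) * (norm v)\<^sup>2 \<le> v \<bullet> ((\<Sum>i<m. \<delta> *\<^sub>R F (x i)) *v v)"
    using sampled_sum_coercive[OF F R] by blast
  \<comment> \<open>The mean of the norm of \<open>quad_error\<close> is at most 2 \<epsilon> T, so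
    the probability that it exceeds \<eta> l T is at most \<open>\<rho> / 2\<close>.\<close>
  define \<epsilon> where "\<epsilon> = \<eta> * l * \<rho> / 4"
  have \<epsilon>: "0 < \<epsilon>" using \<eta> l \<rho> by (simp add: \<epsilon>_def)
  obtain \<delta>\<^sub>0 where \<delta>\<^sub>0: "0 < \<delta>\<^sub>0" "\<delta>\<^sub>0 \<le> 1" "\<And>\<delta> m. 0 < \<delta> \<Longrightarrow> \<delta> \<le> \<delta>\<^sub>0 \<Longrightarrow>
    (\<integral>\<^sup>+ w. ennreal (norm (quad_error \<delta> m w)) \<partial>M)
    \<le> ennreal (\<epsilon> * (1 + real m * \<delta>))"
    using quadratic_variation[OF \<epsilon>] by blast
  show "\<exists>\<delta>\<^sub>0>0. \<forall>\<delta> m. 0 < \<delta> \<longrightarrow> \<delta> \<le> \<delta>\<^sub>0 \<longrightarrow> 1 \<le> real m * \<delta> \<longrightarrow>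
      prob {w \<in> space M. \<eta> < dist (E \<delta> m w) e} \<le> \<rho>"
  proof (intro exI[of _ \<delta>\<^sub>0] conjI allI impI \<delta>\<^sub>0(1))
    fix \<delta> :: real and m :: nat assume \<delta>: "0 < \<delta>" "\<delta> \<le> \<delta>\<^sub>0" and T: "1 \<le> real m * \<delta>"
    let ?T = "real m * \<delta>"
    have \<delta>1: "\<delta> \<le> 1" using \<delta> \<delta>\<^sub>0 by simp
    have m: "0 < m" using T by (cases m) auto
    define U where "U w = (\<Sum>i<m. \<delta> * V (path (real i * \<delta>) w))" for w
    let ?Err = "quad_error \<delta> m"
    have Err_eq: "?Err = (\<lambda>w. (\<Sum>i<m. outer_square (path (real (Suc i) * \<delta>) w - path (real i * \<delta>) w))
      - spot_sum \<delta> m w)"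
      using \<delta> by (simp add: fun_eq_iff quad_error_def quad_stat_def)
    have [measurable]: "U \<in> borel_measurable M" unfolding U_def by measurable
    have [measurable]: "?Err \<in> borel_measurable M" unfolding Err_eq spot_sum_def by measurable
    have "(\<integral>\<^sup>+ w. ennreal (norm (U w)) \<partial>M) = (\<integral>\<^sup>+ w. (\<Sum>i<m. ennreal \<delta> * ennreal (V (path (real i * \<delta>) w) ^ 1)) \<partial>M)"
    proof (intro nn_integral_cong)
      fix w
      have "norm (U w) = (\<Sum>i<m. \<delta> * V (path (real i * \<delta>) w))"
        unfolding U_def using \<delta> V_pos by (auto simp: less_imp_le intro!: abs_of_nonneg sum_nonneg mult_nonneg_nonneg simp del: path_nonneg)
      then show "ennreal (norm (U w)) = (\<Sum>i<m. ennreal \<delta> * ennreal (V (path (real i * \<delta>) w) ^ 1))"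
        using \<delta> V_pos by (simp add: less_imp_le flip: ennreal_mult del: path_nonneg)
    qed
    also have "\<dots> = (\<Sum>i<m. ennreal \<delta> * (\<integral>\<^sup>+ w. ennreal (V (path (real i * \<delta>) w) ^ 1) \<partial>M))"
      by (simp add: nn_integral_sum nn_integral_cmult del: path_nonneg)
    also have "\<dots> \<le> ennreal (C * (1 + ?T))" by (rule C(2)[OF \<delta>(1) \<delta>1])
    finally have "prob {w \<in> space M. R * ?T / 2 < norm (U w)} \<le> C * (1 + ?T) / (R * ?T / 2)"
      using R T C(1) by (intro Markov_norm) auto
    also have "\<dots> \<le> C * (?T + ?T) / (R * ?T / 2)" using R T C(1) by (intro divide_right_mono mult_left_mono add_right_mono) auto
    also have "\<dots> = 4 * C / R" using T m R \<delta>(1) by (simp add: field_simps)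
    also have "\<dots> \<le> 4 * (C + 1) / R" using R by (intro divide_right_mono) auto
    also have "\<dots> = \<rho> / 2" using \<rho> C(1) by (simp add: R_def field_simps)
    finally have 1: "prob {w \<in> space M. R * ?T / 2 < norm (U w)} \<le> \<rho> / 2" .
    have "prob {w \<in> space M. \<eta> * (l * ?T) < norm (?Err w)} \<le> \<epsilon> * (1 + ?T) / (\<eta> * (l * ?T))"
      using \<eta> l(1) \<epsilon> T m \<delta>(1) by (intro Markov_norm \<delta>\<^sub>0(3)[OF \<delta>, of m]) auto
    also have "\<dots> \<le> \<epsilon> * (?T + ?T) / (\<eta> * (l * ?T))" using \<eta> l T \<epsilon> by (intro divide_right_mono mult_left_mono add_right_mono) auto
    also have "\<dots> = \<rho> / 2" using \<eta> l(1) m \<delta>(1) by (simp add: \<epsilon>_def field_simps)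
    finally have 2: "prob {w \<in> space M. \<eta> * (l * ?T) < norm (?Err w)} \<le> \<rho> / 2" .
    have lT: "0 < l * ?T" using l T by simp
    have "{w \<in> space M. \<eta> < dist (E \<delta> m w) e} \<subseteq> {w \<in> space M. R * ?T / 2 < norm (U w)} \<union> {w \<in> space M. \<eta> * (l * ?T) < norm (?Err w)}"
    proof (rule subsetI, rule ccontr)
      fix w assume "w \<in> {w \<in> space M. \<eta> < dist (E \<delta> m w) e}"
        "w \<notin> {w \<in> space M. R * ?T / 2 < norm (U w)} \<union> {w \<in> space M. \<eta> * (l * ?T) < norm (?Err w)}"
      then have w: "w \<in> space M" "\<eta> < dist (E \<delta> m w) e" "norm (U w) \<le> R * ?T / 2" "norm (?Err w) \<le> \<eta> * (l * ?T)"
        by (simp_all only: mem_Collect_eq Un_iff de_Morgan_disj de_Morgan_conj not_less) auto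
      have "(\<Sum>i<m. \<delta> * V (path (real i * \<delta>) w)) \<le> R * ?T / 2" using w(3) by (auto simp: U_def)
      from E[OF lT \<delta>(1) m w(1) l(2)[OF \<delta>(1) this]] have "dist (E \<delta> m w) e \<le> norm (?Err w) / (l * ?T)" .
      also have "\<dots> \<le> \<eta> * (l * ?T) / (l * ?T)" using lT w(4) by (intro divide_right_mono) auto
      also have "\<dots> = \<eta>" by (rule nonzero_mult_div_cancel_right[OF less_imp_neq[OF lT, symmetric]])
      finally show False using w(2) by simp
    qed
    then have "prob {w \<in> space M. \<eta> < dist (E \<delta> m w) e} \<le> prob ({w \<in> space M. R * ?T / 2 < norm (U w)} \<union> {w \<in> space M. \<eta> * (l * ?T) < norm (?Err w)})"
      by (rule finite_measure_mono) measurable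
    also have "\<dots> \<le> prob {w \<in> space M. R * ?T / 2 < norm (U w)} + prob {w \<in> space M. \<eta> * (l * ?T) < norm (?Err w)}"
      by (rule measure_Un_le) measurable
    also have "\<dots> \<le> \<rho>" using 1 2 by linarith
    finally show "prob {w \<in> space M. \<eta> < dist (E \<delta> m w) e} \<le> \<rho>" .
  qed
qed

lemma quad_stat_path: "0 \<le> \<delta> \<Longrightarrow> quad_stat X \<delta> m w = quad_stat path \<delta> m w"
  by (simp add: quad_stat_def)

lemma quad_stat_measurable [measurable]: "quad_stat path \<delta> m \<in> borel_measurable M"
  unfolding quad_stat_def[abs_def] by measurable

text \<open>Continuity of \<open>a\<^sub>0\<close> is recovered from that of \<open>S\<close>,
  because right multiplication by the inverse of \<open>\<zeta>\<close> undoes the form of the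
  coefficient. The sampled sum times \<open>\<zeta>\<close> is \<open>spot_sum\<close>, so the
  estimator is exact up to \<open>quad_error\<close>.\<close>

lemma estimator1_consistent:
  assumes a\<^sub>0: "\<And>x. a\<^sub>0 x \<in> spd" "\<And>x. a\<^sub>0 x ** \<zeta> = S x ** transpose (S x)" and \<zeta>: "\<zeta> \<in> spd"
  shows "consistent (\<lambda>\<delta> m. estimator1 a\<^sub>0 X \<delta> m (real m * \<delta>)) \<zeta>"
proof -
  have \<zeta>_inv: "invertible \<zeta>" using \<zeta> by (intro posdef_invertible) (auto simp: spd_def)
  have "a\<^sub>0 x = S x ** transpose (S x) ** matrix_inv \<zeta>" for x
    unfolding a\<^sub>0(2)[symmetric] by (simp add: matrix_mul_assoc[symmetric] matrix_inv_mult[OF \<zeta>_inv])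
  then have "a\<^sub>0 = (\<lambda>x. S x ** transpose (S x) ** matrix_inv \<zeta>)" by (rule ext)
  then have cont: "continuous_on UNIV a\<^sub>0"
    by (simp only:) (intro continuous_on_matrix_mult continuous_on_transpose S_continuous continuous_on_const)
  have [measurable]: "a\<^sub>0 \<in> borel_measurable borel" by (rule borel_measurable_continuous_onI[OF cont])
  define D where "D \<delta> m w = (\<Sum>i<m. \<delta> *\<^sub>R a\<^sub>0 (path (real i * \<delta>) w))" for \<delta> m w
  have est: "estimator1 a\<^sub>0 X \<delta> m (real m * \<delta>) = (\<lambda>w. matrix_inv (D \<delta> m w) ** quad_stat path \<delta> m w)" if "0 < \<delta>" for \<delta> m
    using that integral_grid_floor[OF that, of m "\<lambda>u. a\<^sub>0 (X u _)"] by (simp add: estimator1_def D_def fun_eq_iff quad_stat_path)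
  show ?thesis
  proof (rule consistentI[OF cont])
    show "0 < v \<bullet> (a\<^sub>0 x *v v)" if "v \<noteq> 0" for x v using a\<^sub>0(1)[of x] that by (simp add: spd_def)
    show "estimator1 a\<^sub>0 X \<delta> m (real m * \<delta>) \<in> borel_measurable M"
      if "0 < \<delta>" "\<And>w. invertible (\<Sum>i<m. \<delta> *\<^sub>R a\<^sub>0 (path (real i * \<delta>) w))" for \<delta> m
      unfolding est[OF that(1)] using that(2)
      by (intro borel_measurable_matrix_matrix_mult borel_measurable_matrix_inv quad_stat_measurable) (auto simp: D_def simp del: path_nonneg)
    fix l \<delta> :: real and m :: nat and w
    assume *: "0 < l" "0 < \<delta>" "\<And>v. l * (norm v)\<^sup>2 \<le> v \<bullet> ((\<Sum>i<m. \<delta> *\<^sub>R a\<^sub>0 (path (real i * \<delta>) w)) *v v)"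
    have D: "l * (norm v)\<^sup>2 \<le> v \<bullet> (D \<delta> m w *v v)" for v unfolding D_def by (rule *(3))
    let ?A = "spot_sum \<delta> m w"
    have A: "?A = D \<delta> m w ** \<zeta>"
      unfolding spot_sum_def D_def matrix_mult_sum_left a\<^sub>0(2)[symmetric] by (simp add: matrix_mult_scaleR[of _ _ 1, simplified] del: path_nonneg)
    have "matrix_inv (D \<delta> m w) ** ?A = \<zeta>"
      unfolding A by (simp add: matrix_mul_assoc matrix_inv_mult[OF coercive_matrix_inv(1)[OF *(1) D]])
    then have "estimator1 a\<^sub>0 X \<delta> m (real m * \<delta>) w - \<zeta> = matrix_inv (D \<delta> m w) ** (quad_error \<delta> m w)"
      using *(2) by (simp add: est quad_error_def quad_stat_path matrix_diff_ldistrib)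
    then show "dist (estimator1 a\<^sub>0 X \<delta> m (real m * \<delta>) w) \<zeta>
      \<le> norm (quad_error \<delta> m w) / l"
      unfolding dist_norm using coercive_matrix_inv_mult[OF *(1) D] by simp
  qed
qed

text \<open>Here \<open>\<sigma>\<^sub>0\<close> is recovered from \<open>S\<close> by the inverse
  of \<open>\<kappa>\<close>, which exists because \<open>\<kappa> ** transpose \<kappa>\<close> is
  invertible. The Kronecker sum applied to \<open>vec_mat \<zeta>\<close> is the vectorized
  \<open>spot_sum\<close>, and vectorization preserves the norm.\<close>

lemma estimator2_consistent:
  assumes \<sigma>\<^sub>0: "\<And>x. \<sigma>\<^sub>0 x \<in> spd" "\<And>x. S x = \<sigma>\<^sub>0 x ** \<kappa>" and \<zeta>: "\<zeta> \<in> spd" and \<kappa>: "\<kappa> ** transpose \<kappa> = \<zeta>"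
  shows "consistent (\<lambda>\<delta> m. estimator2 \<sigma>\<^sub>0 X \<delta> m (real m * \<delta>)) \<zeta>"
proof -
  have \<zeta>_inv: "invertible \<zeta>" using \<zeta> by (intro posdef_invertible) (auto simp: spd_def)
  have "\<kappa> ** (transpose \<kappa> ** matrix_inv \<zeta>) = mat 1"
    unfolding matrix_mul_assoc \<kappa> by (rule matrix_inv_mult[OF \<zeta>_inv])
  then have \<kappa>_inv: "invertible \<kappa>" using invertible_right_inverse by blast
  have "\<sigma>\<^sub>0 x = S x ** matrix_inv \<kappa>" for x
    unfolding \<sigma>\<^sub>0(2) by (simp add: matrix_mul_assoc[symmetric] matrix_inv_mult[OF \<kappa>_inv])
  then have "\<sigma>\<^sub>0 = (\<lambda>x. S x ** matrix_inv \<kappa>)" by (rule ext)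
  then have "continuous_on UNIV \<sigma>\<^sub>0"
    by (simp only:) (intro continuous_on_matrix_mult S_continuous continuous_on_const)
  then have cont: "continuous_on UNIV (\<lambda>x. kronecker (\<sigma>\<^sub>0 x) (\<sigma>\<^sub>0 x))" by (rule continuous_on_kronecker)
  have [measurable]: "(\<lambda>x. kronecker (\<sigma>\<^sub>0 x) (\<sigma>\<^sub>0 x)) \<in> borel_measurable borel" by (rule borel_measurable_continuous_onI[OF cont])
  have kron_meas [measurable]: "(\<lambda>w. kronecker (\<sigma>\<^sub>0 (path u w)) (\<sigma>\<^sub>0 (path u w))) \<in> borel_measurable M" for u
    by (rule measurable_compose[OF path_measurable_M]) measurable
  have [measurable]: "(\<lambda>A :: real ^ 'd ^ 'd. vec_mat A) \<in> borel_measurable borel" "(\<lambda>v. unvec_mat v :: real ^ 'd ^ 'd) \<in> borel_measurable borel"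
    unfolding vec_mat_def unvec_mat_def by (intro borel_measurable_vecI borel_measurable_matrixI; simp)+
  define D where "D \<delta> m w = (\<Sum>i<m. \<delta> *\<^sub>R kronecker (\<sigma>\<^sub>0 (path (real i * \<delta>) w)) (\<sigma>\<^sub>0 (path (real i * \<delta>) w)))" for \<delta> m w
  have est: "estimator2 \<sigma>\<^sub>0 X \<delta> m (real m * \<delta>) = (\<lambda>w. unvec_mat (matrix_inv (D \<delta> m w) *v vec_mat (quad_stat path \<delta> m w)))" if "0 < \<delta>" for \<delta> m
    using that integral_grid_floor[OF that, of m "\<lambda>u. kronecker (\<sigma>\<^sub>0 (X u _)) (\<sigma>\<^sub>0 (X u _))"]
    by (simp add: estimator2_def D_def fun_eq_iff quad_stat_path)
  show ?thesis
  proof (rule consistentI[OF cont])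
    show "0 < v \<bullet> (kronecker (\<sigma>\<^sub>0 x) (\<sigma>\<^sub>0 x) *v v)" if "v \<noteq> 0" for x v by (rule kronecker_posdef[OF \<sigma>\<^sub>0(1) that])
    show "estimator2 \<sigma>\<^sub>0 X \<delta> m (real m * \<delta>) \<in> borel_measurable M"
      if "0 < \<delta>" and inv: "\<And>w. invertible (\<Sum>i<m. \<delta> *\<^sub>R kronecker (\<sigma>\<^sub>0 (path (real i * \<delta>) w)) (\<sigma>\<^sub>0 (path (real i * \<delta>) w)))" for \<delta> m
    proof -
      have "D \<delta> m \<in> borel_measurable M" unfolding D_def[abs_def] by (intro borel_measurable_sum borel_measurable_scaleR borel_measurable_const kron_meas)
      then have [measurable]: "(\<lambda>w. matrix_inv (D \<delta> m w)) \<in> borel_measurable M"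
        using inv by (intro borel_measurable_matrix_inv) (auto simp: D_def simp del: path_nonneg)
      show ?thesis unfolding est[OF that(1)] by measurable
    qed
    fix l \<delta> :: real and m :: nat and w
    assume *: "0 < l" "0 < \<delta>"
      "\<And>v. l * (norm v)\<^sup>2 \<le> v \<bullet> ((\<Sum>i<m. \<delta> *\<^sub>R kronecker (\<sigma>\<^sub>0 (path (real i * \<delta>) w)) (\<sigma>\<^sub>0 (path (real i * \<delta>) w))) *v v)"
    have D: "l * (norm v)\<^sup>2 \<le> v \<bullet> (D \<delta> m w *v v)" for v unfolding D_def by (rule *(3))
    let ?A = "spot_sum \<delta> m w"
    have sq: "S x ** transpose (S x) = \<sigma>\<^sub>0 x ** \<zeta> ** transpose (\<sigma>\<^sub>0 x)" for x
      unfolding \<sigma>\<^sub>0(2) \<kappa>[symmetric] by (simp add: matrix_transpose_mul matrix_mul_assoc)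
    have A: "vec_mat ?A = D \<delta> m w *v vec_mat \<zeta>"
      unfolding spot_sum_def D_def matrix_vector_mult_sum_left sq linear_sum[OF vec_mat_linear]
      by (simp add: linear_cmul[OF vec_mat_linear] kronecker_mult_vec_mat scaleR_matrix_vector_assoc[symmetric] del: path_nonneg)
    have "matrix_inv (D \<delta> m w) *v vec_mat ?A = vec_mat \<zeta>"
      unfolding A by (simp add: matrix_vector_mul_assoc matrix_inv_mult[OF coercive_matrix_inv(1)[OF *(1) D]])
    then have "matrix_inv (D \<delta> m w) *v vec_mat (quad_error \<delta> m w) = matrix_inv (D \<delta> m w) *v vec_mat (quad_stat X \<delta> m w) - vec_mat \<zeta>"
      by (simp add: quad_error_def linear_diff[OF vec_mat_linear] matrix_vector_mult_diff_distrib)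
    then have "estimator2 \<sigma>\<^sub>0 X \<delta> m (real m * \<delta>) w - \<zeta> = unvec_mat (matrix_inv (D \<delta> m w) *v vec_mat (quad_error \<delta> m w))"
      using *(2) by (simp add: est quad_stat_path unvec_mat_diff)
    then show "dist (estimator2 \<sigma>\<^sub>0 X \<delta> m (real m * \<delta>) w) \<zeta>
      \<le> norm (quad_error \<delta> m w) / l"
      unfolding dist_norm using coercive_matrix_inv(2)[OF *(1) D, of "vec_mat (quad_error \<delta> m w)"]
      by (simp add: norm_unvec_mat norm_vec_mat)
  qed
qed

text \<open>For \<epsilon> below 1 the observation length 1/\<epsilon> is at least 1, so the uniform
  statement applies along \<open>\<Delta> \<epsilon>\<close> and
  \<open>m \<epsilon>\<close>.\<close>

lemma consistent_tendsto:
  assumes E: "consistent E e" and \<Delta>: "(\<Delta> \<longlongrightarrow> 0) (at_right 0)"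
    and m: "\<forall>\<^sub>F \<epsilon> in at_right 0. \<Delta> \<epsilon> > 0 \<and> real (m \<epsilon>) = inverse (\<epsilon> * \<Delta> \<epsilon>)"
    and est: "\<And>\<epsilon> w. 0 < \<epsilon> \<Longrightarrow> w \<in> space M \<Longrightarrow> real (m \<epsilon>) * \<Delta> \<epsilon> = inverse \<epsilon> \<Longrightarrow> est \<epsilon> w = E (\<Delta> \<epsilon>) (m \<epsilon>) w"
  shows "tendsto_in_prob M est (\<lambda>_. e) (at_right (0 :: real))"
proof -
  have id: "((\<lambda>\<epsilon> :: real. \<epsilon>) \<longlongrightarrow> 0) (at_right 0)" by (rule tendsto_ident_at)
  have regime: "\<forall>\<^sub>F \<epsilon> in at_right 0. 0 < \<epsilon> \<and> 0 < \<Delta> \<epsilon> \<and> real (m \<epsilon>) * \<Delta> \<epsilon> = inverse \<epsilon> \<and> 1 \<le> real (m \<epsilon>) * \<Delta> \<epsilon> \<and> 0 < m \<epsilon>"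
    using m eventually_at_right_less[of "0 :: real"] order_tendstoD(2)[OF id, of 1, OF zero_less_one]
  proof eventually_elim
    case (elim \<epsilon>)
    then have "real (m \<epsilon>) * \<Delta> \<epsilon> = inverse \<epsilon>" by (simp add: field_simps)
    moreover have "1 \<le> inverse \<epsilon>" using elim by (simp add: one_le_inverse)
    moreover have "0 < m \<epsilon>" using calculation by (cases "m \<epsilon>") auto
    ultimately show ?case using elim by metis
  qed
  show ?thesis
    unfolding tendsto_in_prob_def
  proof (intro conjI allI impI)
    show "\<forall>\<^sub>F \<epsilon> in at_right 0. est \<epsilon> \<in> borel_measurable M"
      using regime
    proof eventually_elim
      case (elim \<epsilon>)
      then have "E (\<Delta> \<epsilon>) (m \<epsilon>) \<in> borel_measurable M" using E unfolding consistent_def by blast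
      then show ?case by (rule measurable_cong[THEN iffD2, rotated]) (use elim in \<open>auto intro: est\<close>)
    qed
    fix \<eta> :: real assume \<eta>: "0 < \<eta>"
    show "((\<lambda>\<epsilon>. prob {w \<in> space M. \<eta> < dist (est \<epsilon> w) e}) \<longlongrightarrow> 0) (at_right 0)"
    proof (rule tendstoI)
      fix r :: real assume r: "0 < r"
      then obtain \<delta>\<^sub>0 where \<delta>\<^sub>0: "0 < \<delta>\<^sub>0" "\<And>\<delta> m. 0 < \<delta> \<Longrightarrow> \<delta> \<le> \<delta>\<^sub>0 \<Longrightarrow> 1 \<le> real m * \<delta> \<Longrightarrow>
        prob {w \<in> space M. \<eta> < dist (E \<delta> m w) e} \<le> r / 2"
        using conjunct2[OF E[unfolded consistent_def], rule_format, OF \<eta> half_gt_zero[OF r]] by blast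
      show "\<forall>\<^sub>F \<epsilon> in at_right 0. dist (prob {w \<in> space M. \<eta> < dist (est \<epsilon> w) e}) 0 < r"
        using regime order_tendstoD(2)[OF \<Delta> \<delta>\<^sub>0(1)]
      proof eventually_elim
        case (elim \<epsilon>)
        have "{w \<in> space M. \<eta> < dist (est \<epsilon> w) e} = {w \<in> space M. \<eta> < dist (E (\<Delta> \<epsilon>) (m \<epsilon>) w) e}"
          using elim est by auto
        then have "prob {w \<in> space M. \<eta> < dist (est \<epsilon> w) e} \<le> r / 2" using \<delta>\<^sub>0(2)[of "\<Delta> \<epsilon>" "m \<epsilon>"] elim by simp
        then show ?case using r by simp
      qed
    qed
  qed simp
qed

end

section \<open>From the hypotheses of the theorem to the moment framework\<close>

lemma lyapunov_function_data:
  assumes "lyapunov_function V"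
  shows "lyapunov_function_data V (grad V) (hessian V)"
proof
  note C2 = assms[unfolded lyapunov_function_def C2_def]
  fix x
  have d: "(V has_derivative frechet_derivative V (at x)) (at x)" using C2 frechet_derivative_works by blast
  then have lin: "linear (frechet_derivative V (at x))" by (rule has_derivative_linear)
  have "frechet_derivative V (at x) v = grad V x \<bullet> v" for v
  proof -
    have "frechet_derivative V (at x) v = frechet_derivative V (at x) (\<Sum>i\<in>UNIV. v $ i *\<^sub>R axis i 1)"
      using basis_expansion[of v] by (simp add: scalar_mult_eq_scaleR)
    also have "\<dots> = grad V x \<bullet> v"
      unfolding linear_sum[OF lin] linear_cmul[OF lin] by (simp add: grad_def inner_vec_def mult.commute)
    finally show ?thesis .
  qed
  then have "frechet_derivative V (at x) = (\<lambda>v. grad V x \<bullet> v)" by (rule ext)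
  with d show "(V has_derivative (\<lambda>v. grad V x \<bullet> v)) (at x)" by (simp only:)
  show "(grad V has_derivative (\<lambda>v. hessian V x *v v)) (at x)"
    using C2 jacobian_works[of "grad V" "at x"] by (simp add: hessian_def)
qed (use assms in \<open>auto simp: lyapunov_function_def C2_def\<close>)

lemma generator_eq:
  "generator b \<sigma> \<mu> \<zeta> V x = grad V x \<bullet> b \<mu> x + 1 / 2 * trace (transpose (\<sigma> \<zeta> x) ** hessian V x ** \<sigma> \<zeta> x)"
  using trace_mul_sym[of "transpose (\<sigma> \<zeta> x) ** hessian V x" "\<sigma> \<zeta> x"]
  by (simp add: generator_def diffusion_matrix_def inner_commute matrix_mul_assoc)

lemma diffusion_matrix_form:
  "v \<bullet> (diffusion_matrix \<sigma> \<zeta> x *v v) = (norm (transpose (\<sigma> \<zeta> x) *v v))\<^sup>2"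
  using dot_lmul_matrix[of v "\<sigma> \<zeta> x" "transpose (\<sigma> \<zeta> x) *v v"]
  by (simp add: diffusion_matrix_def matrix_vector_mul_assoc[symmetric] transpose_matrix_vector power2_norm_eq_inner)

lemma powr_le_power:
  assumes "1 \<le> (v :: real)" "q \<le> real p" "0 \<le> c" "c \<le> J"
  shows "c * v powr q \<le> J * v ^ p"
proof -
  have "v powr q \<le> v powr real p" by (rule powr_mono) (use assms in auto)
  also have "\<dots> = v ^ p" using assms by (intro powr_realpow) simp
  finally show ?thesis using assms by (intro mult_mono) auto
qed

text \<open>One constant and one natural exponent replace the separate real ones, which is possible
  because \<open>V\<close> is at least 1; products of growth bounds are then again powers of
  \<open>V\<close>.\<close>

lemma lyapunov_diffusion_of_powr_growth:
  fixes V :: "real ^ 'd \<Rightarrow> real" and M :: "'w measure"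
  assumes sde: "prob_space M" "filtration_of M G" "brownian_motion M G W" "continuous_adapted M G X"
      "has_ito_integral M G W (\<lambda>s w. \<sigma> \<zeta> (X s w)) I"
      "AE w in M. \<forall>t\<ge>0. set_integrable lborel {0..t} (\<lambda>s. b \<mu> (X s w)) \<and>
        X t w = X 0 w + (LINT s:{0..t}|lborel. b \<mu> (X s w)) + I t w"
    and initial: "AE w in M. X 0 w = x\<^sub>0"
    and meas: "b \<mu> \<in> borel_measurable borel" "\<sigma> \<zeta> \<in> borel_measurable borel"
    and V: "lyapunov_function V"
    and drift: "- Limsup at_infinity (\<lambda>x. ereal (generator b \<sigma> \<mu> \<zeta> V x)) > 0"
    and ratio: "((\<lambda>x. (grad V x \<bullet> (diffusion_matrix \<sigma> \<zeta> x *v grad V x)) / (V x * \<bar>generator b \<sigma> \<mu> \<zeta> V x\<bar>)) \<longlongrightarrow> 0) at_infinity"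
    and V_growth: "\<And>x. max (norm (grad V x)) (norm (hessian V x)) \<le> c1 * V x powr q1"
    and b_growth: "\<And>x. norm (b \<mu> x) \<le> c2 * V x powr q2"
    and \<sigma>_growth: "\<And>x. norm (\<sigma> \<zeta> x) \<le> c3 * V x powr q3"
    and \<sigma>_hoelder: "\<And>x x'. norm (\<sigma> \<zeta> x - \<sigma> \<zeta> x') \<le> c4 * (V x powr q4 + V x' powr q4) * norm (x - x') powr \<alpha>"
    and pos: "0 \<le> c1" "0 \<le> c2" "0 \<le> c3" "0 \<le> c4" "0 < \<alpha>"
  obtains J p where "lyapunov_diffusion M G W X (b \<mu>) (\<sigma> \<zeta>) I V (grad V) (hessian V) J \<alpha> p x\<^sub>0"
proof -
  interpret lyapunov_function_data V "grad V" "hessian V" by (rule lyapunov_function_data[OF V])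
  define J where "J = c1 + c2 + c3 + c4"
  define p where "p = nat \<lceil>max (max q1 q2) (max q3 q4)\<rceil>"
  have q: "q1 \<le> real p" "q2 \<le> real p" "q3 \<le> real p" "q4 \<le> real p" unfolding p_def by linarith+
  have c: "c1 \<le> J" "c2 \<le> J" "c3 \<le> J" "c4 \<le> J" using pos by (auto simp: J_def)
  note le = powr_le_power[OF V_ge_1 q(1) pos(1) c(1)] powr_le_power[OF V_ge_1 q(2) pos(2) c(2)]
    powr_le_power[OF V_ge_1 q(3) pos(3) c(3)] powr_le_power[OF V_ge_1 q(4) pos(4) c(4)]
  have "Limsup at_infinity (\<lambda>x. ereal (generator b \<sigma> \<mu> \<zeta> V x)) < 0"
    using drift by (simp add: ereal_uminus_less_reorder)
  \<comment> \<open>\<open>z\<close> separates the limit superior, which may be infinite, from 0;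
    its negative is the constant of the drift condition.\<close>
  then obtain z where z: "Limsup at_infinity (\<lambda>x. ereal (generator b \<sigma> \<mu> \<zeta> V x)) < ereal z" "ereal z < 0"
    using ereal_dense2 by blast
  obtain R where R: "\<And>x. R \<le> norm x \<Longrightarrow> generator b \<sigma> \<mu> \<zeta> V x < z"
    using Limsup_lessD[OF z(1)] unfolding eventually_at_infinity by auto
  interpret prob_space M by (rule sde(1))
  have "lyapunov_diffusion M G W X (b \<mu>) (\<sigma> \<zeta>) I V (grad V) (hessian V) J \<alpha> p x\<^sub>0"
  proof
    show "\<exists>c>0. \<exists>R. \<forall>x. R \<le> norm x \<longrightarrow>
      grad V x \<bullet> b \<mu> x + 1 / 2 * trace (transpose (\<sigma> \<zeta> x) ** hessian V x ** \<sigma> \<zeta> x) \<le> - c"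
      unfolding generator_eq[symmetric] using R z(2) by (intro exI[of _ "- z"] conjI exI[of _ R]) (auto intro: less_imp_le)
    fix \<eta> :: real assume "0 < \<eta>"
    from order_tendstoD(2)[OF ratio this] obtain R' where
      R': "\<And>x. R' \<le> norm x \<Longrightarrow> (norm (transpose (\<sigma> \<zeta> x) *v grad V x))\<^sup>2 / (V x * \<bar>generator b \<sigma> \<mu> \<zeta> V x\<bar>) < \<eta>"
      unfolding eventually_at_infinity diffusion_matrix_form by auto
    show "\<exists>R. \<forall>x. R \<le> norm x \<longrightarrow> (norm (transpose (\<sigma> \<zeta> x) *v grad V x))\<^sup>2
      \<le> \<eta> * (V x * \<bar>grad V x \<bullet> b \<mu> x + 1 / 2 * trace (transpose (\<sigma> \<zeta> x) ** hessian V x ** \<sigma> \<zeta> x)\<bar>)"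
      unfolding generator_eq[symmetric]
    \<comment> \<open>The radius \<open>R\<close> is included because the quotient is 0 by
      convention where the generator vanishes and then says nothing; beyond \<open>R\<close> the
      denominator is positive.\<close>
    proof (intro exI[of _ "max R R'"] allI impI)
      fix x :: "real ^ 'd" assume x: "max R R' \<le> norm x"
      then have "generator b \<sigma> \<mu> \<zeta> V x < 0" using R[of x] z(2) by simp
      then have "0 < V x * \<bar>generator b \<sigma> \<mu> \<zeta> V x\<bar>" using V_pos[of x] by (simp add: mult_pos_neg)
      then show "(norm (transpose (\<sigma> \<zeta> x) *v grad V x))\<^sup>2 \<le> \<eta> * (V x * \<bar>generator b \<sigma> \<mu> \<zeta> V x\<bar>)"
        using R'[of x] x by (simp add: pos_divide_less_eq)
    qed
  next
    show "0 \<le> J" using pos by (simp add: J_def)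
  next
    fix x show "norm (grad V x) \<le> J * V x ^ p" using V_growth[of x] le(1)[of x] by simp
  next
    fix x show "norm (hessian V x) \<le> J * V x ^ p" using V_growth[of x] le(1)[of x] by simp
  next
    fix x show "norm (b \<mu> x) \<le> J * V x ^ p" using b_growth[of x] le(2)[of x] by simp
  next
    fix x show "norm (\<sigma> \<zeta> x) \<le> J * V x ^ p" using \<sigma>_growth[of x] le(3)[of x] by simp
  next
    fix x y
    have "c4 * (V x powr q4 + V y powr q4) \<le> J * (V x ^ p + V y ^ p)" using le(4)[of x] le(4)[of y] by (simp add: distrib_left)
    then show "norm (\<sigma> \<zeta> x - \<sigma> \<zeta> y) \<le> J * (V x ^ p + V y ^ p) * norm (x - y) powr \<alpha>"
      using \<sigma>_hoelder[of x y] by (meson mult_right_mono order_trans powr_ge_zero)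
  qed (use sde initial meas pos in auto)
  then show thesis by (rule that)
qed

theorem theorem3p6:
  fixes \<F> :: "'w measure"
    and MM :: "(real ^ 'n) set"
    and P :: "real ^ 'n \<Rightarrow> real ^ 'd ^ 'd \<Rightarrow> 'w measure"
    and X :: "real \<Rightarrow> 'w \<Rightarrow> real ^ 'd"
    and x\<^sub>0 :: "real ^ 'd"
    and b :: "real ^ 'n \<Rightarrow> real ^ 'd \<Rightarrow> real ^ 'd"
    and \<sigma> :: "real ^ 'd ^ 'd \<Rightarrow> real ^ 'd \<Rightarrow> real ^ 'd ^ 'd"
    and \<pi>st :: "real ^ 'n \<Rightarrow> real ^ 'd ^ 'd \<Rightarrow> (real ^ 'd) measure"
    and V :: "real ^ 'd \<Rightarrow> real"
    and J\<^sub>b\<^sub>0 :: "real ^ 'n \<Rightarrow> real"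
    and J\<^sub>\<sigma>\<^sub>0 J\<^sub>\<sigma>\<^sub>1 :: "real ^ 'd ^ 'd \<Rightarrow> real"
    and J\<^sub>V\<^sub>0 q\<^sub>V\<^sub>0 q\<^sub>b\<^sub>0 q\<^sub>\<sigma>\<^sub>0 q\<^sub>\<sigma>\<^sub>1 \<alpha>\<^sub>\<sigma> :: real
    and \<Delta> :: "real \<Rightarrow> real"
    and m :: "real \<Rightarrow> nat"
    and a\<^sub>0 \<sigma>\<^sub>0 :: "real ^ 'd \<Rightarrow> real ^ 'd ^ 'd"
    and \<kappa> :: "real ^ 'd ^ 'd \<Rightarrow> real ^ 'd ^ 'd"
    and est :: "real \<Rightarrow> 'w \<Rightarrow> real ^ 'd ^ 'd"
  assumes b_measurable: "\<And>\<mu>. \<mu> \<in> MM \<Longrightarrow> b \<mu> \<in> borel_measurable borel"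
    and \<sigma>_measurable: "\<And>\<zeta>. \<zeta> \<in> spd \<Longrightarrow> \<sigma> \<zeta> \<in> borel_measurable borel"
    and a_spd: "\<And>\<zeta> x. \<zeta> \<in> spd \<Longrightarrow> diffusion_matrix \<sigma> \<zeta> x \<in> spd"
    and P_sets: "\<And>\<mu> \<zeta>. \<mu> \<in> MM \<Longrightarrow> \<zeta> \<in> spd \<Longrightarrow> prob_space (P \<mu> \<zeta>) \<and> sets (P \<mu> \<zeta>) = sets \<F>"
    and X_sde: "\<And>\<mu> \<zeta>. \<mu> \<in> MM \<Longrightarrow> \<zeta> \<in> spd \<Longrightarrow>
      (\<exists>G W. sde_solution (P \<mu> \<zeta>) G W (b \<mu>) (\<sigma> \<zeta>) X) \<and> (AE \<omega> in P \<mu> \<zeta>. X 0 \<omega> = x\<^sub>0)"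
    and X_stationary: "\<And>\<mu> \<zeta>. \<mu> \<in> MM \<Longrightarrow> \<zeta> \<in> spd \<Longrightarrow>
      stationary_distribution (b \<mu>) (\<sigma> \<zeta>) (\<pi>st \<mu> \<zeta>) \<and>
      (\<forall>\<nu>. stationary_distribution (b \<mu>) (\<sigma> \<zeta>) \<nu> \<longrightarrow> \<nu> = \<pi>st \<mu> \<zeta>)"
    and X_ergodic: "\<And>\<mu> \<zeta>. \<mu> \<in> MM \<Longrightarrow> \<zeta> \<in> spd \<Longrightarrow> ergodic_process (P \<mu> \<zeta>) X (\<pi>st \<mu> \<zeta>)"
    and observations: "\<forall>\<^sub>F \<epsilon> in at_right 0. \<Delta> \<epsilon> > 0 \<and> real (m \<epsilon>) = inverse (\<epsilon> * \<Delta> \<epsilon>)"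
    and form_est:
      "sigma_form1 \<sigma> a\<^sub>0 \<and> (\<forall>\<epsilon>>0. \<forall>\<omega>\<in>space \<F>. est \<epsilon> \<omega> = estimator1 a\<^sub>0 X (\<Delta> \<epsilon>) (m \<epsilon>) (inverse \<epsilon>) \<omega>) \<or>
       sigma_form2 \<sigma> \<sigma>\<^sub>0 \<kappa> \<and> (\<forall>\<epsilon>>0. \<forall>\<omega>\<in>space \<F>. est \<epsilon> \<omega> = estimator2 \<sigma>\<^sub>0 X (\<Delta> \<epsilon>) (m \<epsilon>) (inverse \<epsilon>) \<omega>)"
    and V_lyapunov: "lyapunov_function V"
    and V_drift: "\<And>\<mu> \<zeta>. \<mu> \<in> MM \<Longrightarrow> \<zeta> \<in> spd \<Longrightarrow>
      - Limsup at_infinity (\<lambda>x. ereal (generator b \<sigma> \<mu> \<zeta> V x)) > 0"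
    and V_ratio: "\<And>\<mu> \<zeta>. \<mu> \<in> MM \<Longrightarrow> \<zeta> \<in> spd \<Longrightarrow>
      ((\<lambda>x. (grad V x \<bullet> (diffusion_matrix \<sigma> \<zeta> x *v grad V x)) / (V x * \<bar>generator b \<sigma> \<mu> \<zeta> V x\<bar>))
        \<longlongrightarrow> 0) at_infinity"
    and V_growth: "q\<^sub>V\<^sub>0 \<ge> 0" "J\<^sub>V\<^sub>0 > 0"
      "\<And>x. max (norm (grad V x)) (norm (hessian V x)) \<le> J\<^sub>V\<^sub>0 * V x powr q\<^sub>V\<^sub>0"
    and J_bounded: "locally_bounded_on MM J\<^sub>b\<^sub>0" "locally_bounded_on spd J\<^sub>\<sigma>\<^sub>0" "locally_bounded_on spd J\<^sub>\<sigma>\<^sub>1"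
    and J_nonneg: "\<And>\<mu>. \<mu> \<in> MM \<Longrightarrow> J\<^sub>b\<^sub>0 \<mu> \<ge> 0" "\<And>\<zeta>. \<zeta> \<in> spd \<Longrightarrow> J\<^sub>\<sigma>\<^sub>0 \<zeta> \<ge> 0" "\<And>\<zeta>. \<zeta> \<in> spd \<Longrightarrow> J\<^sub>\<sigma>\<^sub>1 \<zeta> \<ge> 0"
    and exponents: "q\<^sub>b\<^sub>0 \<ge> 0" "q\<^sub>\<sigma>\<^sub>0 \<ge> 0" "q\<^sub>\<sigma>\<^sub>1 \<ge> 0" "0 < \<alpha>\<^sub>\<sigma>" "\<alpha>\<^sub>\<sigma> \<le> 1"
    and b_growth: "\<And>\<mu> x. \<mu> \<in> MM \<Longrightarrow> norm (b \<mu> x) \<le> J\<^sub>b\<^sub>0 \<mu> * V x powr q\<^sub>b\<^sub>0"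
    and \<sigma>_growth: "\<And>\<zeta> x. \<zeta> \<in> spd \<Longrightarrow> norm (\<sigma> \<zeta> x) \<le> J\<^sub>\<sigma>\<^sub>0 \<zeta> * V x powr q\<^sub>\<sigma>\<^sub>0"
    and \<sigma>_hoelder: "\<And>\<zeta> x x'. \<zeta> \<in> spd \<Longrightarrow>
      norm (\<sigma> \<zeta> x - \<sigma> \<zeta> x') \<le> J\<^sub>\<sigma>\<^sub>1 \<zeta> * (V x powr q\<^sub>\<sigma>\<^sub>1 + V x' powr q\<^sub>\<sigma>\<^sub>1) * norm (x - x') powr \<alpha>\<^sub>\<sigma>"
    and \<Delta>_tendsto: "(\<Delta> \<longlongrightarrow> 0) (at_right 0)"
  shows "\<forall>\<mu>\<^sub>0\<in>MM. \<forall>\<zeta>\<^sub>0\<in>spd. tendsto_in_prob (P \<mu>\<^sub>0 \<zeta>\<^sub>0) est (\<lambda>_. \<zeta>\<^sub>0) (at_right 0)"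
proof (intro ballI)
  fix \<mu> and \<zeta> :: "real ^ 'd ^ 'd" assume \<mu>: "\<mu> \<in> MM" and \<zeta>: "\<zeta> \<in> spd"
  obtain G W where sol: "sde_solution (P \<mu> \<zeta>) G W (b \<mu>) (\<sigma> \<zeta>) X" and initial: "AE \<omega> in P \<mu> \<zeta>. X 0 \<omega> = x\<^sub>0"
    using X_sde[OF \<mu> \<zeta>] by blast
  obtain I where sde: "prob_space (P \<mu> \<zeta>)" "filtration_of (P \<mu> \<zeta>) G" "brownian_motion (P \<mu> \<zeta>) G W" "continuous_adapted (P \<mu> \<zeta>) G X"
    "has_ito_integral (P \<mu> \<zeta>) G W (\<lambda>s \<omega>. \<sigma> \<zeta> (X s \<omega>)) I"
    "AE \<omega> in P \<mu> \<zeta>. \<forall>t\<ge>0. set_integrable lborel {0..t} (\<lambda>s. b \<mu> (X s \<omega>)) \<and>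
      X t \<omega> = X 0 \<omega> + (LINT s:{0..t}|lborel. b \<mu> (X s \<omega>)) + I t \<omega>"
    using sol unfolding sde_solution_def by blast
  obtain J p where "lyapunov_diffusion (P \<mu> \<zeta>) G W X (b \<mu>) (\<sigma> \<zeta>) I V (grad V) (hessian V) J \<alpha>\<^sub>\<sigma> p x\<^sub>0"
    by (rule lyapunov_diffusion_of_powr_growth[OF sde initial b_measurable[OF \<mu>] \<sigma>_measurable[OF \<zeta>] V_lyapunov V_drift[OF \<mu> \<zeta>]
        V_ratio[OF \<mu> \<zeta>] V_growth(3) b_growth[OF \<mu>] \<sigma>_growth[OF \<zeta>] \<sigma>_hoelder[OF \<zeta>] less_imp_le[OF V_growth(2)]
        J_nonneg(1)[OF \<mu>] J_nonneg(2,3)[OF \<zeta>] exponents(4)])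
  then interpret lyapunov_diffusion "P \<mu> \<zeta>" G W X "b \<mu>" "\<sigma> \<zeta>" I V "grad V" "hessian V" J \<alpha>\<^sub>\<sigma> p x\<^sub>0 .
  \<comment> \<open>\<open>est\<close> is prescribed on the space of \<open>\<F>\<close>, which all
    the measures share.\<close>
  have space: "space (P \<mu> \<zeta>) = space \<F>" using P_sets[OF \<mu> \<zeta>] by (intro sets_eq_imp_space_eq) simp
  from form_est show "tendsto_in_prob (P \<mu> \<zeta>) est (\<lambda>_. \<zeta>) (at_right 0)"
  proof (elim disjE conjE)
    assume form: "sigma_form1 \<sigma> a\<^sub>0" and est: "\<forall>\<epsilon>>0. \<forall>\<omega>\<in>space \<F>. est \<epsilon> \<omega> = estimator1 a\<^sub>0 X (\<Delta> \<epsilon>) (m \<epsilon>) (inverse \<epsilon>) \<omega>"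
    \<comment> \<open>The root is symmetric, so the coefficient times its transpose is the square of
      the root.\<close>
    have a\<^sub>0: "a\<^sub>0 x \<in> spd" "a\<^sub>0 x ** \<zeta> = \<sigma> \<zeta> x ** transpose (\<sigma> \<zeta> x)" for x
      using form \<zeta> spd_sqrt[of "a\<^sub>0 x ** \<zeta>"] by (auto simp: sigma_form1_def spd_def)
    show ?thesis
      by (rule consistent_tendsto[OF estimator1_consistent[OF a\<^sub>0 \<zeta>] \<Delta>_tendsto observations]) (simp add: est space)
  next
    assume form: "sigma_form2 \<sigma> \<sigma>\<^sub>0 \<kappa>" and est: "\<forall>\<epsilon>>0. \<forall>\<omega>\<in>space \<F>. est \<epsilon> \<omega> = estimator2 \<sigma>\<^sub>0 X (\<Delta> \<epsilon>) (m \<epsilon>) (inverse \<epsilon>) \<omega>"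
    have \<sigma>\<^sub>0: "\<sigma>\<^sub>0 x \<in> spd" "\<sigma> \<zeta> x = \<sigma>\<^sub>0 x ** \<kappa> \<zeta>" "\<kappa> \<zeta> ** transpose (\<kappa> \<zeta>) = \<zeta>" for x
      using form \<zeta> by (auto simp: sigma_form2_def)
    show ?thesis
      by (rule consistent_tendsto[OF estimator2_consistent[OF \<sigma>\<^sub>0(1,2) \<zeta> \<sigma>\<^sub>0(3)] \<Delta>_tendsto observations]) (simp add: est space)
  qed
qed

end
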